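(* As $n\to\infty$, $$n^{-1/3}\bigl(X_n^{(1)*}-X^{(1)}_{n,\lfloor n/3\rfloor}\bigr)\overset{\mathrm d}{\longrightarrow}\beta V,$$ where $V=\max_{t\in\mathbb R}\bigl(B(t)-t^2/2\bigr)$ and $\beta=2^{7/3}3^{-8/3}5^{2/3}=\frac4{27}(150)^{1/3}$. Furthermore, $$\mathbb E X_n^{(1)*}=\mathbb E X^{(1)}_{n,\lfloor n/3\rfloor}+\beta\,\mathbb E V\,n^{1/3}+o(n^{1/3})=\tfrac4{27}n+\beta\,\mathbb E V\,n^{1/3}+o(n^{1/3}).$$
   Context: For $n\ge 2$ let $\sigma$ be a uniformly random permutation of $\{1,\dots,n\}$. For $0\le m\le n$ and $1\le k\le n$ let $I_{n,m}(k)=1$ if $\sigma^{-1}(k)\le m$ and $I_{n,m}(k)=0$ otherwise, with indices $k$ interpreted modulo $n$ (cyclic convention, $I_{n,m}(k+n)=I_{n,m}(k)$). The number of runs of ones of length exactly $1$ after $m$ steps is $$X_{n,m}^{(1)}=\sum_{k=1}^n\bigl(1-I_{n,m}(k)\bigr)I_{n,m}(k+1)\bigl(1-I_{n,m}(k+2)\bigr),$$ and $X_n^{(1)*}=\max_{0\le m\le n}X_{n,m}^{(1)}$. $B(t)$, $-\infty<t<\infty$, is a standard two-sided Brownian motion: $B(0)=0$ and $(B(t))_{t\ge0}$, $(B(-t))_{t\ge0}$ are two independent standard Brownian motions. $\overset{\mathrm d}{\longrightarrow}$ denotes convergence in distribution. *)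

theory Defs
  imports
    "HOL-Probability.Probability"
    "HOL-Combinatorics.Combinatorics"
    "HOL-Library.Landau_Symbols"
begin

definition uniform_perm :: "nat \<Rightarrow> (nat \<Rightarrow> nat) pmf" where
  "uniform_perm n = pmf_of_set {\<sigma>. \<sigma> permutes {1..n}}"

text \<open>The representative of \<open>k\<close> modulo \<open>n\<close> in \<open>{1..n}\<close>; adding \<open>n\<close> before
  subtracting 1 avoids truncated subtraction at \<open>k = 0\<close>.\<close>

definition cyc :: "nat \<Rightarrow> nat \<Rightarrow> nat" where
  "cyc n k = (k + n - 1) mod n + 1"

definition I :: "nat \<Rightarrow> (nat \<Rightarrow> nat) \<Rightarrow> nat \<Rightarrow> nat \<Rightarrow> int" where
  "I n \<sigma> m k = (if inv \<sigma> (cyc n k) \<le> m then 1 else 0)"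

definition X1 :: "nat \<Rightarrow> (nat \<Rightarrow> nat) \<Rightarrow> nat \<Rightarrow> int" where
  "X1 n \<sigma> m = (\<Sum>k=1..n. (1 - I n \<sigma> m k) * I n \<sigma> m (k + 1) * (1 - I n \<sigma> m (k + 2)))"

definition X1_max :: "nat \<Rightarrow> (nat \<Rightarrow> nat) \<Rightarrow> int" where
  "X1_max n \<sigma> = Max ((\<lambda>m. X1 n \<sigma> m) ` {0..n})"

text \<open>Only the values \<open>W t\<close> with \<open>t \<ge> 0\<close> matter. Paths are continuous everywhere on the
  sample space, not just almost surely. The second argument of \<^const>\<open>normal_density\<close>
  is the standard deviation.\<close>

definition standard_BM :: "'a measure \<Rightarrow> (real \<Rightarrow> 'a \<Rightarrow> real) \<Rightarrow> bool" where
  "standard_BM M W \<longleftrightarrow>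
     prob_space M \<and>
     (\<forall>t\<ge>0. W t \<in> borel_measurable M) \<and>
     (\<forall>\<omega>\<in>space M. W 0 \<omega> = 0) \<and>
     (\<forall>\<omega>\<in>space M. continuous_on {0..} (\<lambda>t. W t \<omega>)) \<and>
     (\<forall>s t. 0 \<le> s \<and> s < t \<longrightarrow>
        distributed M lborel (\<lambda>\<omega>. W t \<omega> - W s \<omega>) (normal_density 0 (sqrt (t - s)))) \<and>
     (\<forall>(N::nat) (u::nat \<Rightarrow> real). 0 \<le> u 0 \<and> (\<forall>i<N. u i \<le> u (Suc i)) \<longrightarrow>
        prob_space.indep_vars M (\<lambda>_. borel) (\<lambda>i \<omega>. W (u (Suc i)) \<omega> - W (u i) \<omega>) {..<N})"

text \<open>Independence of the two halves is independence as random elements of the product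
  space over the index set \<open>{0..}\<close>.\<close>

definition two_sided_BM :: "'a measure \<Rightarrow> (real \<Rightarrow> 'a \<Rightarrow> real) \<Rightarrow> bool" where
  "two_sided_BM M B \<longleftrightarrow>
     standard_BM M B \<and>
     standard_BM M (\<lambda>t. B (- t)) \<and>
     prob_space.indep_var M
       (Pi\<^sub>M {0..} (\<lambda>_. borel)) (\<lambda>\<omega>. \<lambda>t\<in>{0..}. B t \<omega>)
       (Pi\<^sub>M {0..} (\<lambda>_. borel)) (\<lambda>\<omega>. \<lambda>t\<in>{0..}. B (- t) \<omega>)"

text \<open>As a supremum in \<^typ>\<open>real\<close> this is meaningful only where the path is bounded above;
  it is the maximum in the text when the supremum is attained.\<close>

definition V :: "(real \<Rightarrow> 'a \<Rightarrow> real) \<Rightarrow> 'a \<Rightarrow> real" where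
  "V B \<omega> = (SUP t. B t \<omega> - t\<^sup>2 / 2)"

definition \<beta> :: real where
  "\<beta> = 2 powr (7/3) * 3 powr (- 8/3) * 5 powr (2/3)"

end

theory Submission
  imports Defs
begin

text \<open>
  Let \<open>Z\<close> be the set of zeros after \<open>m\<close> steps. The number of runs of length 1 is \<open>T - U\<close>, where \<open>T\<close> counts
  the \<open>k\<close> with \<open>k, k + 2 \<in> Z\<close> and \<open>U\<close> the \<open>k\<close> with \<open>k, k + 1, k + 2 \<in> Z\<close>. The next step removes a uniform
  element of \<open>Z\<close>, hence multiplies the conditional mean of the count of a pattern with \<open>q\<close> points by
  \<open>1 - q / \<bar>Z\<bar>\<close>. Every pattern count therefore has an explicit mean and variance \<open>O(n)\<close>. It follows that
  the run count is, up to errors \<open>O(len / \<surd>n)\<close> over \<open>len\<close> steps, its mean plus a martingale with bounded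
  increments, whose conditional variance near \<open>m = n / 3\<close> tends to \<open>80/81\<close>. The mean is
  \<open>4n/27 - e\<^sup>2/n + e\<^sup>3/n\<^sup>2 + O(1)\<close> with \<open>e = m - n/3\<close>, so fluctuations and parabola balance at
  \<open>e \<approx> n powr (2/3)\<close>.

  On a finite grid of that scale the increments converge jointly to Gaussian ones by Lindeberg's replacement
  argument, one block at a time. A fourth moment maximal inequality controls the oscillation between grid points,
  and a second moment one on dyadic blocks shows that the maximum outside a window of width \<open>A n powr (2/3)\<close>
  contributes \<open>O(n powr (1/3) / A)\<close> in expectation. All errors are bounded in expectation, which gives
  convergence in distribution and of means at once. The same bounds with part of the parabola removed
  pass to the limit and show that \<open>B t - c t\<^sup>2\<close> is bounded above also for some \<open>c < 1/2\<close>, so that the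
  maximum defining \<open>V\<close> is attained and integrable.
\<close>

section \<open>Averages over Gaussian increments\<close>

text \<open>The test functions are all Lipschitz functions, bounded or not: ramps detect convergence
  in distribution, the identity the means. The replacement argument wants a cubic Taylor remainder,
  so a Lipschitz function is first smoothed at a scale \<open>e\<close> that tends to 0 after
  \<open>n\<close> has tended to infinity. No tightness in path space is used, since only maxima
  over finitely many times are passed to the limit. An obstacle is that the estimates for the drift
  degenerate when few zeros remain; there the count, at most the number of zeros, is compared with
  its value near 4n/27 at a third. The constants come from the density 2/3 of zeros at a third. A
  pattern of q points occurs about (2/3)^(q-1) times per zero; hence the drift 3(4/9) - 2(2/3)
  vanishes, and the expanded square of an increment averages to 80/81. What the maximum needs to
  know about Brownian motion beyond its increments and continuity, in particular integrability, is
  taken from the permutations: a bound that is uniform over all grids is passed to the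
  limit.\<close>

definition gauss_avg :: "(real \<Rightarrow> real) \<Rightarrow> real \<Rightarrow> real \<Rightarrow> real" where
  "gauss_avg f s x = (\<integral>y. f (x + s * y) \<partial>std_normal_distribution)"

lemma prob_space_std_normal: "prob_space std_normal_distribution"
  by (rule prob_space_normal_density) simp

lemma integrable_std_normal_abs_power: "integrable std_normal_distribution (\<lambda>y. \<bar>y\<bar> ^ k)"
  using integrable_std_normal_moment_abs[of k]
  by (subst integrable_density) auto

lemma integrable_std_normal_affine:
  fixes f :: "real \<Rightarrow> real"
  assumes "L-lipschitz_on UNIV f"
  shows "integrable std_normal_distribution (\<lambda>y. f (x + s * y))"
proof (rule Bochner_Integration.integrable_bound)
  interpret prob_space std_normal_distribution by (rule prob_space_std_normal)
  show "integrable std_normal_distribution (\<lambda>y. \<bar>f x\<bar> + L * \<bar>s\<bar> * \<bar>y\<bar>)"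
    using integrable_std_normal_abs_power[of 1] by simp
  have [measurable]: "f \<in> borel_measurable borel"
    by (intro borel_measurable_continuous_onI lipschitz_on_continuous_on[OF assms])
  show "(\<lambda>y. f (x + s * y)) \<in> borel_measurable std_normal_distribution"
    by measurable
  have "norm (f (x + s * y)) \<le> norm (\<bar>f x\<bar> + L * \<bar>s\<bar> * \<bar>y\<bar>)" for y
  proof -
    have "\<bar>f (x + s * y) - f x\<bar> \<le> L * \<bar>s * y\<bar>"
      using lipschitz_onD[OF assms, of "x + s * y" x] by (simp add: dist_real_def)
    moreover have "L * \<bar>s * y\<bar> = L * \<bar>s\<bar> * \<bar>y\<bar>" by (simp add: abs_mult)
    moreover have "0 \<le> L * \<bar>s\<bar> * \<bar>y\<bar>" using lipschitz_on_nonneg[OF assms] by simp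
    ultimately have "\<bar>f (x + s * y)\<bar> \<le> \<bar>f x\<bar> + L * \<bar>s\<bar> * \<bar>y\<bar>" by linarith
    then show ?thesis by simp
  qed
  then show "AE y in std_normal_distribution. norm (f (x + s * y)) \<le> norm (\<bar>f x\<bar> + L * \<bar>s\<bar> * \<bar>y\<bar>)"
    by simp
qed

text \<open>Scaling a fixed standard normal variable, instead of using the density of deviation
  \<open>s\<close>, keeps the degenerate case \<open>s = 0\<close> meaningful. The replacement
  argument ends there, when no normal increment is left.\<close>

lemma gauss_avg_0 [simp]: "gauss_avg f 0 x = f x"
proof -
  interpret prob_space std_normal_distribution by (rule prob_space_std_normal)
  show ?thesis by (simp add: gauss_avg_def prob_space[simplified])
qed

lemma gauss_avg_lipschitz:
  fixes f :: "real \<Rightarrow> real"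
  assumes "L-lipschitz_on UNIV f"
  shows "L-lipschitz_on UNIV (gauss_avg f s)"
proof (rule lipschitz_onI)
  interpret prob_space std_normal_distribution by (rule prob_space_std_normal)
  fix x y :: real
  have "dist (gauss_avg f s x) (gauss_avg f s y)
     = \<bar>\<integral>z. f (x + s * z) - f (y + s * z) \<partial>std_normal_distribution\<bar>"
    unfolding gauss_avg_def dist_real_def
    by (subst Bochner_Integration.integral_diff) (auto intro: integrable_std_normal_affine[OF assms])
  also have "\<dots> \<le> (\<integral>z. \<bar>f (x + s * z) - f (y + s * z)\<bar> \<partial>std_normal_distribution)"
    by (rule integral_abs_bound)
  also have "\<dots> \<le> (\<integral>z. L * dist x y \<partial>std_normal_distribution)"
  proof (rule integral_mono)
    show "integrable std_normal_distribution (\<lambda>z. \<bar>f (x + s * z) - f (y + s * z)\<bar>)"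
      by (intro integrable_abs Bochner_Integration.integrable_diff integrable_std_normal_affine[OF assms])
    fix z show "\<bar>f (x + s * z) - f (y + s * z)\<bar> \<le> L * dist x y"
      using lipschitz_onD[OF assms, of "x + s * z" "y + s * z"] by (simp add: dist_real_def)
  qed simp
  also have "\<dots> = L * dist x y" using prob_space by simp
  finally show "dist (gauss_avg f s x) (gauss_avg f s y) \<le> L * dist x y" .
qed (rule lipschitz_on_nonneg[OF assms])

lemma distr_scale_std_normal:
  assumes "0 < s"
  shows "distr std_normal_distribution borel (\<lambda>y. s * y) = density lborel (normal_density 0 s)"
proof -
  interpret prob_space std_normal_distribution by (rule prob_space_std_normal)
  have "distributed std_normal_distribution lborel (\<lambda>x. x) (normal_density 0 1)"
    unfolding distributed_def by (auto simp: distr_id2)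
  from normal_density_affine[OF this, of s 0] assms
  have "distributed std_normal_distribution lborel (\<lambda>x. s * x) (normal_density 0 s)"
    by simp
  then have "distr std_normal_distribution lborel (\<lambda>y. s * y) = density lborel (normal_density 0 s)"
    by (simp add: distributed_def)
  then show ?thesis by (metis distr_cong sets_lborel)
qed

lemma gauss_avg_eq:
  assumes "0 < s" "f \<in> borel_measurable borel"
  shows "gauss_avg f s x = (\<integral>u. f (x + u) \<partial>density lborel (normal_density 0 s))"
  unfolding distr_scale_std_normal[OF assms(1), symmetric] gauss_avg_def
  by (subst integral_distr) (use assms(2) in auto)

text \<open>The sum of independent centred normal variables is normal with added variances. The
  convolution formula speaks of densities, so a vanishing deviation is treated separately.\<close>

lemma gauss_avg_gauss_avg:
  fixes f :: "real \<Rightarrow> real"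
  assumes L: "L-lipschitz_on UNIV f" and s: "0 \<le> s" "0 \<le> t"
  shows "gauss_avg (gauss_avg f s) t x = gauss_avg f (sqrt (s\<^sup>2 + t\<^sup>2)) x"
proof (cases "s = 0 \<or> t = 0")
  case True
  then show ?thesis
  proof
    assume "s = 0"
    then have "gauss_avg f s = f" by auto
    then show ?thesis using s \<open>s = 0\<close> by simp
  qed (use s in simp)
next
  case False
  then have s0: "0 < s" "0 < t" using s by auto
  define r where "r = sqrt (s\<^sup>2 + t\<^sup>2)"
  have r0: "0 < r" using s0 by (simp add: r_def add_pos_pos)
  have fm[measurable]: "f \<in> borel_measurable borel"
    by (intro borel_measurable_continuous_onI lipschitz_on_continuous_on[OF L])
  have gm: "gauss_avg f s \<in> borel_measurable borel"
    by (intro borel_measurable_continuous_onI lipschitz_on_continuous_on[OF gauss_avg_lipschitz[OF L]])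
  let ?N = "\<lambda>s. density lborel (normal_density 0 s)"
  have ps: "prob_space (?N s)" "prob_space (?N t)" "prob_space (?N r)"
    using s0 r0 by (auto intro: prob_space_normal_density)
  interpret S: prob_space "?N s" by fact
  interpret T: prob_space "?N t" by fact
  interpret P: pair_sigma_finite "?N t" "?N s" ..
  have conv: "?N r = distr (?N t \<Otimes>\<^sub>M ?N s) borel (\<lambda>(a, b). a + b)"
  proof -
    have "convolution (?N t) (?N s)
        = density lborel (\<lambda>x. \<integral>\<^sup>+y. ennreal (normal_density 0 t (x - y)) * ennreal (normal_density 0 s y) \<partial>lborel)"
      by (rule convolution_density) (auto intro: S.finite_measure_axioms T.finite_measure_axioms)
    also have "(\<lambda>x. \<integral>\<^sup>+y. ennreal (normal_density 0 t (x - y)) * ennreal (normal_density 0 s y) \<partial>lborel)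
       = (\<lambda>x. \<integral>\<^sup>+y. ennreal (normal_density 0 t (x - y) * normal_density 0 s y) \<partial>lborel)"
      by (intro ext nn_integral_cong) (simp add: ennreal_mult')
    also have "\<dots> = normal_density 0 (sqrt (t\<^sup>2 + s\<^sup>2))"
      by (rule conv_normal_density_zero_mean[OF s0(2,1)])
    finally show ?thesis by (simp add: convolution_def r_def add.commute)
  qed
  have int: "integrable (?N t \<Otimes>\<^sub>M ?N s) (\<lambda>(a, b). f (x + (a + b)))"
  proof -
    have "integrable (?N r) (\<lambda>u. f (x + u))"
      unfolding distr_scale_std_normal[OF r0, symmetric]
      by (subst integrable_distr_eq) (auto intro: integrable_std_normal_affine[OF L])
    then show ?thesis
      unfolding conv by (subst (asm) integrable_distr_eq) (auto simp: case_prod_unfold)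
  qed
  have "gauss_avg f r x = (\<integral>u. f (x + u) \<partial>?N r)"
    by (rule gauss_avg_eq[OF r0 fm])
  also have "\<dots> = (\<integral>p. (case p of (a, b) \<Rightarrow> f (x + (a + b))) \<partial>(?N t \<Otimes>\<^sub>M ?N s))"
    unfolding conv by (subst integral_distr) (auto simp: case_prod_unfold)
  also have "\<dots> = (\<integral>a. (\<integral>b. f (x + (a + b)) \<partial>?N s) \<partial>?N t)"
    using P.integral_fst'[OF int] by simp
  also have "\<dots> = (\<integral>a. gauss_avg f s (x + a) \<partial>?N t)"
    by (simp add: gauss_avg_eq[OF s0(1) fm] add.assoc)
  also have "\<dots> = gauss_avg (gauss_avg f s) t x"
    by (rule gauss_avg_eq[OF s0(2) gm, symmetric])
  finally show ?thesis by (simp add: r_def)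
qed

section \<open>Taylor bounds with cubic error and smoothing of Lipschitz functions\<close>

definition taylor3 :: "(real \<Rightarrow> real) \<Rightarrow> (real \<Rightarrow> real) \<Rightarrow> (real \<Rightarrow> real) \<Rightarrow> real \<Rightarrow> bool" where
  "taylor3 f f1 f2 K \<longleftrightarrow> (\<forall>x h. \<bar>f (x + h) - f x - f1 x * h - f2 x * h\<^sup>2 / 2\<bar> \<le> K * \<bar>h\<bar>^3)"

lemma lipschitz_bounded_derivative:
  fixes g g' :: "real \<Rightarrow> real"
  assumes "\<And>x. (g has_real_derivative g' x) (at x)" "\<And>x. \<bar>g' x\<bar> \<le> M"
  shows "\<bar>g x - g y\<bar> \<le> M * \<bar>x - y\<bar>"
  using field_differentiable_bound[of UNIV g g' M x y] assms by auto

text \<open>Two applications of the mean value inequality to the remainder, on the symmetric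
  interval of radius |h|, which covers both signs of \<open>h\<close>. The crude constant
  \<open>K\<close> in place of \<open>K / 6\<close> is enough.\<close>

lemma taylor3_derivatives:
  fixes f f1 f2 :: "real \<Rightarrow> real"
  assumes 1: "\<And>x. (f has_real_derivative f1 x) (at x)"
    and 2: "\<And>x. (f1 has_real_derivative f2 x) (at x)"
    and L: "\<And>x y. \<bar>f2 x - f2 y\<bar> \<le> K * \<bar>x - y\<bar>"
  shows "taylor3 f f1 f2 K"
  unfolding taylor3_def
proof (intro allI)
  fix x h :: real
  have K: "0 \<le> K" using L[of 1 0] by simp
  let ?S = "{-\<bar>h\<bar>..\<bar>h\<bar>}"
  have b1: "\<bar>f1 (x + t) - f1 x - f2 x * t\<bar> \<le> K * \<bar>h\<bar> * \<bar>h\<bar>" if t: "t \<in> ?S" for t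
  proof -
    have "norm ((f1 (x + t) - f1 x - f2 x * t) - (f1 (x + 0) - f1 x - f2 x * 0)) \<le> K * \<bar>h\<bar> * norm (t - 0)"
    proof (rule field_differentiable_bound[where S="?S" and f'="\<lambda>t. f2 (x + t) - f2 x"])
      fix z assume z: "z \<in> ?S"
      have "((\<lambda>t. f1 (x + t)) has_real_derivative f2 (x + z) * (0 + 1)) (at z)"
        by (rule DERIV_chain2[OF 2]) (intro derivative_intros)
      then have d: "((\<lambda>t. f1 (x + t)) has_real_derivative f2 (x + z)) (at z)" by simp
      have "((\<lambda>t. f1 (x + t) - f1 x - f2 x * t) has_real_derivative f2 (x + z) - 0 - f2 x * 1) (at z)"
        by (intro DERIV_diff d DERIV_const DERIV_cmult DERIV_ident)
      then show "((\<lambda>t. f1 (x + t) - f1 x - f2 x * t) has_real_derivative f2 (x + z) - f2 x) (at z within ?S)"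
        by (simp add: has_field_derivative_at_within)
      have "\<bar>f2 (x + z) - f2 x\<bar> \<le> K * \<bar>z\<bar>" using L[of "x + z" x] by simp
      also have "\<dots> \<le> K * \<bar>h\<bar>" using z K by (intro mult_left_mono) auto
      finally show "norm (f2 (x + z) - f2 x) \<le> K * \<bar>h\<bar>" by simp
    qed (use t in auto)
    also have "\<dots> \<le> K * \<bar>h\<bar> * \<bar>h\<bar>" using t K by (intro mult_left_mono) auto
    finally show ?thesis by simp
  qed
  have "norm ((f (x + h) - f x - f1 x * h - f2 x * h\<^sup>2 / 2) - (f (x + 0) - f x - f1 x * 0 - f2 x * 0\<^sup>2 / 2))
      \<le> K * \<bar>h\<bar> * \<bar>h\<bar> * norm (h - 0)"
  proof (rule field_differentiable_bound[where S="?S" and f'="\<lambda>t. f1 (x + t) - f1 x - f2 x * t"])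
    fix z assume z: "z \<in> ?S"
    have "((\<lambda>t. f (x + t)) has_real_derivative f1 (x + z) * (0 + 1)) (at z)"
      by (rule DERIV_chain2[OF 1]) (intro derivative_intros)
    then have d: "((\<lambda>t. f (x + t)) has_real_derivative f1 (x + z)) (at z)" by simp
    have sq: "((\<lambda>t. f2 x * t\<^sup>2 / 2) has_real_derivative f2 x * z) (at z)"
      by (auto intro!: derivative_eq_intros)
    have "((\<lambda>t. f (x + t) - f x - f1 x * t - f2 x * t\<^sup>2 / 2) has_real_derivative f1 (x + z) - 0 - f1 x * 1 - f2 x * z) (at z)"
      by (intro DERIV_diff d DERIV_const DERIV_cmult DERIV_ident sq)
    then show "((\<lambda>t. f (x + t) - f x - f1 x * t - f2 x * t\<^sup>2 / 2) has_real_derivative f1 (x + z) - f1 x - f2 x * z) (at z within ?S)"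
      by (simp add: has_field_derivative_at_within)
    show "norm (f1 (x + z) - f1 x - f2 x * z) \<le> K * \<bar>h\<bar> * \<bar>h\<bar>" using b1[OF z] by simp
  qed auto
  then show "\<bar>f (x + h) - f x - f1 x * h - f2 x * h\<^sup>2 / 2\<bar> \<le> K * \<bar>h\<bar>^3"
    by (simp add: power3_eq_cube mult.assoc)
qed

lemma antiderivative_UNIV:
  fixes F :: "real \<Rightarrow> real"
  assumes "continuous_on UNIV F"
  obtains P where "\<And>x. (P has_real_derivative F x) (at x)"
proof -
  have "\<exists>P. \<forall>x::real. -\<infinity> < ereal x \<longrightarrow> ereal x < \<infinity> \<longrightarrow> (P has_vector_derivative F x) (at x)"
    by (rule einterval_antiderivative) (use assms in \<open>auto simp: continuous_on_eq_continuous_at\<close>)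
  then show ?thesis using that by (auto simp: has_real_derivative_iff_has_vector_derivative)
qed

text \<open>The witness is the second difference quotient, with step \<open>e\<close>, of a function \<open>Q\<close> with \<open>Q'' = F\<close>.\<close>

lemma lipschitz_smoothing:
  fixes F :: "real \<Rightarrow> real"
  assumes L: "L-lipschitz_on UNIV F" and e: "0 < e"
  shows "\<exists>f f1 f2. taylor3 f f1 f2 (4 * L / e\<^sup>2) \<and> L-lipschitz_on UNIV f \<and>
    (\<forall>x. \<bar>f1 x\<bar> \<le> L) \<and> continuous_on UNIV f1 \<and> (\<forall>x. \<bar>f2 x\<bar> \<le> 2 * L / e) \<and> continuous_on UNIV f2 \<and>
    (\<forall>x. \<bar>f x - F x\<bar> \<le> 10 * L * e)"
proof -
  have L0: "0 \<le> L" by (rule lipschitz_on_nonneg[OF L])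
  have FL: "\<bar>F x - F y\<bar> \<le> L * \<bar>x - y\<bar>" for x y
    using lipschitz_onD[OF L, of x y] by (simp add: dist_real_def)
  have Fc: "continuous_on UNIV F" by (rule lipschitz_on_continuous_on[OF L])
  obtain P where P: "\<And>x. (P has_real_derivative F x) (at x)" using antiderivative_UNIV[OF Fc] by blast
  have Pc: "continuous_on UNIV P"
    using P by (meson DERIV_isCont continuous_at_imp_continuous_on)
  obtain Q where Q: "\<And>x. (Q has_real_derivative P x) (at x)" using antiderivative_UNIV[OF Pc] by blast
  have Qc: "continuous_on UNIV Q"
    using Q by (meson DERIV_isCont continuous_at_imp_continuous_on)
  define \<Delta> where "\<Delta> = (\<lambda>(g::real\<Rightarrow>real) x. (g (x + 2 * e) - 2 * g (x + e) + g x) / e\<^sup>2)"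
  \<comment> \<open>\<open>\<Delta>\<close> is linear and commutes with translations, hence with
    differentiation: \<open>\<Delta> Q\<close>, \<open>\<Delta> P\<close>, \<open>\<Delta> F\<close>
    are the function sought and its first two derivatives.\<close>
  have D\<Delta>: "(\<Delta> g has_real_derivative \<Delta> g' x) (at x)"
    if g: "\<And>x. (g has_real_derivative g' x) (at x)" for g g' x
  proof -
    have sh: "((\<lambda>x. g (x + c)) has_real_derivative g' (x + c)) (at x)" for c
    proof -
      have "((\<lambda>x. g (x + c)) has_real_derivative g' (x + c) * (1 + 0)) (at x)"
        by (rule DERIV_chain2[OF g]) (intro derivative_intros)
      then show ?thesis by simp
    qed
    have "((\<lambda>x. g (x + 2 * e) - 2 * g (x + e) + g x) has_real_derivative
        g' (x + 2 * e) - 2 * g' (x + e) + g' x) (at x)"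
      by (auto intro!: derivative_eq_intros sh g)
    then show ?thesis unfolding \<Delta>_def by (rule DERIV_cdivide)
  qed
  have c\<Delta>: "continuous_on UNIV (\<Delta> g)" if "continuous_on UNIV g" for g
    unfolding \<Delta>_def using e
    by (intro continuous_intros continuous_on_compose2[OF that]) auto
  have f2b: "\<bar>\<Delta> F x\<bar> \<le> 2 * L / e" for x
  proof -
    have "\<bar>F (x + 2 * e) - F (x + e)\<bar> \<le> L * e" "\<bar>F (x + e) - F x\<bar> \<le> L * e"
      using FL[of "x + 2 * e" "x + e"] FL[of "x + e" x] e by simp_all
    then have "\<bar>F (x + 2 * e) - 2 * F (x + e) + F x\<bar> \<le> 2 * L * e" by (simp add: abs_le_iff)
    then have "\<bar>\<Delta> F x\<bar> \<le> 2 * L * e / e\<^sup>2" unfolding \<Delta>_def by (simp add: abs_divide divide_right_mono)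
    then show ?thesis using e by (simp add: power2_eq_square)
  qed
  have f2L: "\<bar>\<Delta> F x - \<Delta> F y\<bar> \<le> 4 * L / e\<^sup>2 * \<bar>x - y\<bar>" for x y
  proof -
    have "\<bar>(F (x + 2 * e) - 2 * F (x + e) + F x) - (F (y + 2 * e) - 2 * F (y + e) + F y)\<bar> \<le> 4 * (L * \<bar>x - y\<bar>)"
      using FL[of "x + 2 * e" "y + 2 * e"] FL[of "x + e" "y + e"] FL[of x y] by (simp add: abs_le_iff)
    then have "\<bar>(F (x + 2 * e) - 2 * F (x + e) + F x) - (F (y + 2 * e) - 2 * F (y + e) + F y)\<bar> / e\<^sup>2 \<le> 4 * (L * \<bar>x - y\<bar>) / e\<^sup>2"
      by (rule divide_right_mono) simp
    then show ?thesis unfolding \<Delta>_def by (simp add: diff_divide_distrib[symmetric] abs_divide)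
  qed
  \<comment> \<open>The second difference of \<open>P\<close> is a first difference of the function
    \<open>P (x + e) - P x\<close>, whose derivative \<open>F (x + e) - F x\<close> is at most
    \<open>L * e\<close>.\<close>
  have f1b: "\<bar>\<Delta> P x\<bar> \<le> L" for x
  proof -
    have "\<bar>(P (x + e + e) - P (x + e)) - (P (x + e) - P x)\<bar> \<le> L * e * \<bar>(x + e) - x\<bar>"
    proof (rule lipschitz_bounded_derivative[where g="\<lambda>x. P (x + e) - P x" and g'="\<lambda>x. F (x + e) - F x"])
      fix y
      have "((\<lambda>x. P (x + e)) has_real_derivative F (y + e) * (1 + 0)) (at y)"
        by (rule DERIV_chain2[OF P]) (intro derivative_intros)
      then show "((\<lambda>x. P (x + e) - P x) has_real_derivative F (y + e) - F y) (at y)"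
        by (intro derivative_intros P) simp
      show "\<bar>F (y + e) - F y\<bar> \<le> L * e" using FL[of "y + e" y] e by simp
    qed
    then have "\<bar>P (x + 2 * e) - 2 * P (x + e) + P x\<bar> \<le> L * e\<^sup>2"
      using e by (simp add: power2_eq_square algebra_simps)
    then show ?thesis unfolding \<Delta>_def using e by (simp add: abs_divide pos_divide_le_eq)
  qed
  \<comment> \<open>\<open>Q\<close> is expanded at \<open>x\<close> with steps \<open>e\<close> and
    \<open>2 * e\<close>. In the second difference the constant and linear terms cancel and the
    quadratic ones give \<open>F x * e^2\<close>; the remainders contribute 8 + 2 = 10 times
    \<open>L * e^3\<close>.\<close>
  have close: "\<bar>\<Delta> Q x - F x\<bar> \<le> 10 * L * e" for x
  proof -
    have "taylor3 Q P F L" by (rule taylor3_derivatives[OF Q P FL])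
    then have T: "\<bar>Q (x + h) - Q x - P x * h - F x * h\<^sup>2 / 2\<bar> \<le> L * \<bar>h\<bar>^3" for h
      by (auto simp: taylor3_def)
    define r1 r2 where "r1 = Q (x + e) - Q x - P x * e - F x * e\<^sup>2 / 2"
      and "r2 = Q (x + 2 * e) - Q x - P x * (2 * e) - F x * (2 * e)\<^sup>2 / 2"
    have "\<bar>r1\<bar> \<le> L * e^3" "\<bar>r2\<bar> \<le> 8 * (L * e^3)"
      using T[of e] T[of "2 * e"] e by (auto simp: r1_def r2_def power_mult_distrib)
    then have "\<bar>r2 - 2 * r1\<bar> \<le> 10 * L * e * e\<^sup>2" 
      by (simp add: abs_le_iff power3_eq_cube power2_eq_square mult.assoc)
    then have "\<bar>r2 - 2 * r1\<bar> / e\<^sup>2 \<le> 10 * L * e" using e by (simp add: pos_divide_le_eq)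
    moreover have "\<Delta> Q x - F x = (r2 - 2 * r1) / e\<^sup>2"
      unfolding \<Delta>_def r1_def r2_def using e by (simp add: field_simps power2_eq_square)
    ultimately show ?thesis by (simp add: abs_divide)
  qed
  have "L-lipschitz_on UNIV (\<Delta> Q)"
    using lipschitz_bounded_derivative[OF D\<Delta>[OF Q] f1b] L0
    by (intro lipschitz_onI) (auto simp: dist_real_def)
  moreover have "taylor3 (\<Delta> Q) (\<Delta> P) (\<Delta> F) (4 * L / e\<^sup>2)"
    by (rule taylor3_derivatives[OF D\<Delta>[OF Q] D\<Delta>[OF P] f2L])
  ultimately show ?thesis
    using f1b f2b close c\<Delta>[OF Pc] c\<Delta>[OF Fc] by blast
qed

lemma integrable_std_normal_bounded:
  fixes f :: "real \<Rightarrow> real"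
  assumes "continuous_on UNIV f" "\<And>x. \<bar>f x\<bar> \<le> B"
  shows "integrable std_normal_distribution (\<lambda>y. f (x + s * y))"
proof -
  interpret prob_space std_normal_distribution by (rule prob_space_std_normal)
  have [measurable]: "f \<in> borel_measurable borel" using assms(1) by (rule borel_measurable_continuous_onI)
  show ?thesis by (rule integrable_const_bound[of _ B]) (use assms in auto)
qed

lemma abs_gauss_avg_le:
  assumes "continuous_on UNIV f" "\<And>x. \<bar>f x\<bar> \<le> B"
  shows "\<bar>gauss_avg f s x\<bar> \<le> B"
proof -
  interpret prob_space std_normal_distribution by (rule prob_space_std_normal)
  have "\<bar>gauss_avg f s x\<bar> \<le> (\<integral>y. \<bar>f (x + s * y)\<bar> \<partial>std_normal_distribution)"
    unfolding gauss_avg_def by (rule integral_abs_bound)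
  also have "\<dots> \<le> (\<integral>y. B \<partial>std_normal_distribution)"
    using assms integrable_std_normal_bounded[OF assms, of x s] by (intro integral_mono) auto
  finally show ?thesis using prob_space by simp
qed

text \<open>The inequality defining \<open>taylor3\<close> is linear in the three functions and
  invariant under translation, so it may be integrated as it stands, with the same constant. No
  differentiation under the integral sign is involved, which is why expansions are recorded as
  inequalities.\<close>

lemma taylor3_gauss_avg:
  assumes t: "taylor3 f f1 f2 K" and L: "L-lipschitz_on UNIV f"
    and f1: "continuous_on UNIV f1" "\<And>x. \<bar>f1 x\<bar> \<le> B1"
    and f2: "continuous_on UNIV f2" "\<And>x. \<bar>f2 x\<bar> \<le> B2"
  shows "taylor3 (gauss_avg f s) (gauss_avg f1 s) (gauss_avg f2 s) K"
  unfolding taylor3_def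
proof (intro allI)
  interpret prob_space std_normal_distribution by (rule prob_space_std_normal)
  fix x h :: real
  note [simp] = integrable_std_normal_affine[OF L] integrable_std_normal_bounded[OF f1] integrable_std_normal_bounded[OF f2]
  let ?R = "\<lambda>y. f ((x + h) + s * y) - f (x + s * y) - f1 (x + s * y) * h - f2 (x + s * y) * h\<^sup>2 / 2"
  have b: "\<bar>?R y\<bar> \<le> K * \<bar>h\<bar>^3" for y
    using t[unfolded taylor3_def, rule_format, of "x + s * y" h] by (simp add: add_ac)
  have i: "integrable std_normal_distribution ?R" by simp
  have eq: "gauss_avg f s (x + h) - gauss_avg f s x - gauss_avg f1 s x * h - gauss_avg f2 s x * h\<^sup>2 / 2
     = (\<integral>y. ?R y \<partial>std_normal_distribution)"
    unfolding gauss_avg_def by simp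
  have "\<bar>\<integral>y. ?R y \<partial>std_normal_distribution\<bar> \<le> (\<integral>y. \<bar>?R y\<bar> \<partial>std_normal_distribution)" by (rule integral_abs_bound)
  also have "\<dots> \<le> (\<integral>y. K * \<bar>h\<bar>^3 \<partial>std_normal_distribution)"
    by (rule integral_mono[OF integrable_abs[OF i] integrable_const b])
  finally show "\<bar>gauss_avg f s (x + h) - gauss_avg f s x - gauss_avg f1 s x * h - gauss_avg f2 s x * h\<^sup>2 / 2\<bar>
      \<le> K * \<bar>h\<bar>^3"
    unfolding eq using prob_space by simp
qed

text \<open>The first moment of the standard normal law vanishes and the second is one, so only the
  second order term survives. A step of the martingale has an expansion of the same form, and the
  two are compared.\<close>

lemma gauss_avg_taylor3:
  assumes t: "taylor3 f f1 f2 K" and L: "L-lipschitz_on UNIV f"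
  shows "\<bar>gauss_avg f s x - f x - f2 x * s\<^sup>2 / 2\<bar> \<le> K * \<bar>s\<bar>^3 * (\<integral>y. \<bar>y\<bar>^3 \<partial>std_normal_distribution)"
proof -
  interpret prob_space std_normal_distribution by (rule prob_space_std_normal)
  have m1: "integrable std_normal_distribution (\<lambda>y. y)" "(\<integral>y. y \<partial>std_normal_distribution) = 0"
    using integrable_std_normal_distribution_moment[of 1] integral_std_normal_distribution_moment_odd[of 1] by simp_all
  have m2: "integrable std_normal_distribution (\<lambda>y. y\<^sup>2)" "(\<integral>y. y\<^sup>2 \<partial>std_normal_distribution) = 1"
    using integrable_std_normal_distribution_moment[of 2] std_normal_distribution_even_moments(1)[of 1] by simp_all
  note [simp] = integrable_std_normal_affine[OF L] m1 m2
  let ?R = "\<lambda>y. f (x + s * y) - f x - (f1 x * s) * y - (f2 x * s\<^sup>2 / 2) * y\<^sup>2"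
  have b: "\<bar>?R y\<bar> \<le> K * \<bar>s\<bar>^3 * \<bar>y\<bar>^3" for y
    using t[unfolded taylor3_def, rule_format, of x "s * y"] by (simp add: power_mult_distrib abs_mult mult_ac)
  have eq: "gauss_avg f s x - f x - f2 x * s\<^sup>2 / 2 = (\<integral>y. ?R y \<partial>std_normal_distribution)"
    unfolding gauss_avg_def using prob_space by simp
  have "\<bar>\<integral>y. ?R y \<partial>std_normal_distribution\<bar> \<le> (\<integral>y. \<bar>?R y\<bar> \<partial>std_normal_distribution)" by (rule integral_abs_bound)
  also have "\<dots> \<le> (\<integral>y. K * \<bar>s\<bar>^3 * \<bar>y\<bar>^3 \<partial>std_normal_distribution)"
  proof (rule integral_mono[OF integrable_abs _ b])
    show "integrable std_normal_distribution ?R" by simp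
    show "integrable std_normal_distribution (\<lambda>y. K * \<bar>s\<bar>^3 * \<bar>y\<bar>^3)"
      by (intro Bochner_Integration.integrable_mult_right integrable_std_normal_abs_power)
  qed
  also have "\<dots> = K * \<bar>s\<bar>^3 * (\<integral>y. \<bar>y\<bar>^3 \<partial>std_normal_distribution)" by simp
  finally show ?thesis unfolding eq .
qed

lemma standard_BM_increment_inner:
  assumes "standard_BM M W" "0 \<le> s" "s < t"
  shows "distributed M lborel (\<lambda>\<omega>. W t \<omega> - W s \<omega>) (normal_density 0 (sqrt (t - s)))"
  using assms unfolding standard_BM_def by blast

section \<open>Brownian increments on a grid\<close>

text \<open>The indices 0 to \<open>2 * K\<close> cover a symmetric interval and index
  \<open>K\<close> is time 0, so that both halves of the Brownian motion are indexed by one range of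
  natural numbers.\<close>

definition grid_pt :: "nat \<Rightarrow> real \<Rightarrow> nat \<Rightarrow> real" where
  "grid_pt K \<delta> j = (real j - real K) * \<delta>"

context
  fixes M :: "'a measure" and B :: "real \<Rightarrow> 'a \<Rightarrow> real"
  assumes BM: "two_sided_BM M B"
begin

lemma BM_prob_space: "prob_space M"
  using BM by (simp add: two_sided_BM_def standard_BM_def)

lemma BM_halves: "standard_BM M B" "standard_BM M (\<lambda>t. B (- t))"
  using BM by (simp_all add: two_sided_BM_def)

lemma BM_measurable: "B t \<in> borel_measurable M"
proof (cases "0 \<le> t")
  case True
  then show ?thesis using BM_halves(1) by (simp add: standard_BM_def)
next
  case False
  then have "B (- (- t)) \<in> borel_measurable M"
    using BM_halves(2) unfolding standard_BM_def by (metis less_eq_real_def linorder_not_le neg_0_le_iff_le)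
  then show ?thesis by simp
qed

lemma BM_0: "\<omega> \<in> space M \<Longrightarrow> B 0 \<omega> = 0"
  using BM_halves(1) by (simp add: standard_BM_def)

lemma BM_continuous: "\<omega> \<in> space M \<Longrightarrow> continuous_on UNIV (\<lambda>t. B t \<omega>)"
proof -
  assume w: "\<omega> \<in> space M"
  have 1: "continuous_on {0..} (\<lambda>t. B t \<omega>)"
    using BM_halves(1) w by (simp add: standard_BM_def)
  have "continuous_on {0..} (\<lambda>t. B (- t) \<omega>)"
    using BM_halves(2) w by (simp add: standard_BM_def)
  then have "continuous_on {..0} (\<lambda>t. (\<lambda>t. B (- t) \<omega>) (- t))"
    by (rule continuous_on_compose2) (auto intro!: continuous_intros)
  then have 2: "continuous_on {..0} (\<lambda>t. B t \<omega>)" by simp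
  have "continuous_on ({0..} \<union> {..0}) (\<lambda>t. B t \<omega>)"
    by (rule continuous_on_closed_Un[OF _ _ 1 2]) auto
  moreover have "{0..} \<union> {..0} = (UNIV :: real set)" by auto
  ultimately show ?thesis by simp
qed

text \<open>Left of 0 the increment is, up to sign, one of the reflected half, and the centred
  normal law is symmetric.\<close>

lemma grid_increment_normal:
  assumes "0 < \<delta>" "j < 2 * K"
  shows "distributed M lborel (\<lambda>\<omega>. B (grid_pt K \<delta> (Suc j)) \<omega> - B (grid_pt K \<delta> j) \<omega>) (normal_density 0 (sqrt \<delta>))"
proof -
  interpret prob_space M by (rule BM_prob_space)
  have d: "grid_pt K \<delta> (Suc j) - grid_pt K \<delta> j = \<delta>" by (simp add: grid_pt_def algebra_simps)
  show ?thesis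
  proof (cases "K \<le> j")
    case True
    then have "0 \<le> grid_pt K \<delta> j" using assms by (simp add: grid_pt_def)
    then show ?thesis
      using standard_BM_increment_inner[OF BM_halves(1), of "grid_pt K \<delta> j" "grid_pt K \<delta> (Suc j)"] assms d by auto
  next
    case False
    then have "real (Suc j) \<le> real K" by (simp only: of_nat_le_iff)
    then have "0 \<le> - grid_pt K \<delta> (Suc j)"
      using assms by (simp add: grid_pt_def mult_nonpos_nonneg)
    then have "distributed M lborel (\<lambda>\<omega>. B (grid_pt K \<delta> j) \<omega> - B (grid_pt K \<delta> (Suc j)) \<omega>) (normal_density 0 (sqrt \<delta>))"
      using standard_BM_increment_inner[OF BM_halves(2), of "- grid_pt K \<delta> (Suc j)" "- grid_pt K \<delta> j"] assms d by auto
    from normal_density_affine[OF this, of "-1" 0] assms(1) show ?thesis by simp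
  qed
qed

text \<open>Within each half the increments are independent by definition, and the two halves are
  independent as paths. The product formula for all \<open>2 * K\<close> increments follows by
  splitting a box of events into one event for each path.\<close>

lemma grid_increment_indep:
  assumes \<delta>: "0 < \<delta>" and K: "0 < K"
  shows "prob_space.indep_vars M (\<lambda>_. borel)
    (\<lambda>j \<omega>. B (grid_pt K \<delta> (Suc j)) \<omega> - B (grid_pt K \<delta> j) \<omega>) {..<2 * K}"
proof -
  interpret prob_space M by (rule BM_prob_space)
  define Z where "Z = (\<lambda>j \<omega>. B (grid_pt K \<delta> (Suc j)) \<omega> - B (grid_pt K \<delta> j) \<omega>)"
  define u where "u = (\<lambda>i. real i * \<delta>)"
  define R where "R = (\<lambda>i \<omega>. B (u (Suc i)) \<omega> - B (u i) \<omega>)"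
  define L where "L = (\<lambda>i \<omega>. B (- u (Suc i)) \<omega> - B (- u i) \<omega>)"
  have u0: "0 \<le> u 0 \<and> (\<forall>i<K. u i \<le> u (Suc i))" using \<delta> by (simp add: u_def)
  have R: "indep_vars (\<lambda>_. borel) R {..<K}"
    using BM_halves(1) u0 unfolding standard_BM_def R_def by blast
  have L: "indep_vars (\<lambda>_. borel) L {..<K}"
    using BM_halves(2) u0 unfolding standard_BM_def L_def by blast
  have [measurable]: "Z j \<in> borel_measurable M" "R j \<in> borel_measurable M" "L j \<in> borel_measurable M" for j
    unfolding Z_def R_def L_def using BM_measurable by simp_all
  have ZR: "Z (K + i) = R i" for i
    unfolding Z_def R_def grid_pt_def u_def by simp
  \<comment> \<open>Counted from 0 to the left, the increments appear in reverse order and with the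
    opposite sign.\<close>
  have ZL: "Z (K - Suc i) \<omega> = - L i \<omega>" if "i < K" for i \<omega>
  proof -
    have "Suc (K - Suc i) = K - i" using that by simp
    then show ?thesis
      unfolding Z_def L_def grid_pt_def u_def using that by (simp add: of_nat_diff algebra_simps)
  qed
  let ?P = "Pi\<^sub>M {0..} (\<lambda>_. borel) :: (real \<Rightarrow> real) measure"
  have ind: "indep_var ?P (\<lambda>\<omega>. \<lambda>t\<in>{0..}. B t \<omega>) ?P (\<lambda>\<omega>. \<lambda>t\<in>{0..}. B (- t) \<omega>)"
    using BM by (simp add: two_sided_BM_def)
  have main: "prob (\<Inter>j\<in>{..<2 * K}. Z j -` A j \<inter> space M) = (\<Prod>j\<in>{..<2 * K}. prob (Z j -` A j \<inter> space M))"
    if A: "\<And>j. j < 2 * K \<Longrightarrow> A j \<in> sets borel" for A :: "nat \<Rightarrow> real set"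
  proof -
    \<comment> \<open>\<open>ER\<close> and \<open>EL\<close> are events in the space of paths on
      \<open>{0..}\<close>. They involve finitely many coordinates and are therefore measurable for
      the product sigma-algebra with respect to which the halves are independent.\<close>
    define ER where "ER = {p \<in> space ?P. \<forall>i<K. p (u (Suc i)) - p (u i) \<in> A (K + i)}"
    define EL where "EL = {p \<in> space ?P. \<forall>i<K. - (p (u (Suc i)) - p (u i)) \<in> A (K - Suc i)}"
    have u_in: "u i \<in> {0..}" for i using \<delta> by (simp add: u_def)
    have comp[measurable]: "(\<lambda>p. p (u i)) \<in> borel_measurable ?P" for i
      using u_in by (rule measurable_component_singleton)
    have ERs: "ER \<in> sets ?P"
    proof -
      have "(\<lambda>p. p (u (Suc i)) - p (u i)) -` A (K + i) \<inter> space ?P \<in> sets ?P" if "i < K" for i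
        by (rule measurable_sets[OF _ A]) (use that in auto)
      then have "space ?P \<inter> (\<Inter>i\<in>{..<K}. (\<lambda>p. p (u (Suc i)) - p (u i)) -` A (K + i) \<inter> space ?P) \<in> sets ?P"
        by (intro sets.Int[OF sets.top sets.finite_INT]) (use K in auto)
      moreover have "ER = space ?P \<inter> (\<Inter>i\<in>{..<K}. (\<lambda>p. p (u (Suc i)) - p (u i)) -` A (K + i) \<inter> space ?P)"
        unfolding ER_def by auto
      ultimately show ?thesis by simp
    qed
    have ELs: "EL \<in> sets ?P"
    proof -
      have "(\<lambda>p. - (p (u (Suc i)) - p (u i))) -` A (K - Suc i) \<inter> space ?P \<in> sets ?P" if "i < K" for i
        by (rule measurable_sets[OF _ A]) (use that in auto)
      then have "space ?P \<inter> (\<Inter>i\<in>{..<K}. (\<lambda>p. - (p (u (Suc i)) - p (u i))) -` A (K - Suc i) \<inter> space ?P) \<in> sets ?P"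
        by (intro sets.Int[OF sets.top sets.finite_INT]) (use K in auto)
      moreover have "EL = space ?P \<inter> (\<Inter>i\<in>{..<K}. (\<lambda>p. - (p (u (Suc i)) - p (u i))) -` A (K - Suc i) \<inter> space ?P)"
        unfolding EL_def by auto
      ultimately show ?thesis by simp
    qed
    have pathR: "(\<lambda>\<omega>. \<lambda>t\<in>{0..}. B t \<omega>) -` ER \<inter> space M = (\<Inter>i\<in>{..<K}. R i -` A (K + i) \<inter> space M)"
      using u_in K unfolding ER_def R_def by (auto simp: space_PiM PiE_def)
    have Lneg: "L i -` (uminus ` S) = (\<lambda>\<omega>. - L i \<omega>) -` S" for i S
      by (auto simp: image_iff) (metis minus_minus)
    have pathL: "(\<lambda>\<omega>. \<lambda>t\<in>{0..}. B (- t) \<omega>) -` EL \<inter> space M = (\<Inter>i\<in>{..<K}. L i -` (uminus ` A (K - Suc i)) \<inter> space M)"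
      unfolding Lneg using u_in K unfolding EL_def L_def by (auto simp: space_PiM PiE_def)
    have split: "{..<2 * K} = (\<lambda>i. K + i) ` {..<K} \<union> (\<lambda>i. K - Suc i) ` {..<K}"
    proof (intro set_eqI iffI)
      fix j assume j: "j \<in> {..<2 * K}"
      show "j \<in> (\<lambda>i. K + i) ` {..<K} \<union> (\<lambda>i. K - Suc i) ` {..<K}"
      proof (cases "K \<le> j")
        case True
        then have "j = K + (j - K)" "j - K < K" using j by auto
        then show ?thesis by blast
      next
        case False
        then have "j = K - Suc (K - Suc j)" "K - Suc j < K" by auto
        then show ?thesis by blast
      qed
    qed auto
    have disj: "(\<lambda>i. K + i) ` {..<K} \<inter> (\<lambda>i. K - Suc i) ` {..<K} = {}" by auto
    have inj2: "inj_on (\<lambda>i. K - Suc i) {..<K}" by (auto simp: inj_on_def)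
    have neg: "A j \<in> sets borel \<Longrightarrow> uminus ` A j \<in> sets borel" for j
    proof -
      assume a: "A j \<in> sets borel"
      have "uminus ` A j = uminus -` A j \<inter> space borel" by (auto simp: image_iff) (metis minus_minus)
      also have "\<dots> \<in> sets borel" using a by (intro measurable_sets[OF _ a]) auto
      finally show ?thesis .
    qed
    have "(\<Inter>j\<in>{..<2 * K}. Z j -` A j \<inter> space M)
      = (\<Inter>i\<in>{..<K}. Z (K + i) -` A (K + i) \<inter> space M) \<inter> (\<Inter>i\<in>{..<K}. Z (K - Suc i) -` A (K - Suc i) \<inter> space M)"
      unfolding split INT_Un by simp
    also have "(\<Inter>i\<in>{..<K}. Z (K + i) -` A (K + i) \<inter> space M) = (\<Inter>i\<in>{..<K}. R i -` A (K + i) \<inter> space M)"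
      by (simp add: ZR)
    also have "(\<Inter>i\<in>{..<K}. Z (K - Suc i) -` A (K - Suc i) \<inter> space M)
       = (\<Inter>i\<in>{..<K}. L i -` (uminus ` A (K - Suc i)) \<inter> space M)"
      unfolding Lneg using ZL by (intro INF_cong refl) auto
    also have "(\<Inter>i\<in>{..<K}. R i -` A (K + i) \<inter> space M) \<inter> (\<Inter>i\<in>{..<K}. L i -` (uminus ` A (K - Suc i)) \<inter> space M)
       = (\<lambda>x. (\<lambda>t\<in>{0..}. B t x, \<lambda>t\<in>{0..}. B (- t) x)) -` (ER \<times> EL) \<inter> space M"
      unfolding pathR[symmetric] pathL[symmetric] by auto
    finally have "prob (\<Inter>j\<in>{..<2 * K}. Z j -` A j \<inter> space M)
      = prob (\<Inter>i\<in>{..<K}. R i -` A (K + i) \<inter> space M) * prob (\<Inter>i\<in>{..<K}. L i -` (uminus ` A (K - Suc i)) \<inter> space M)"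
      using indep_varD[OF ind ERs ELs] unfolding pathR pathL by simp
    also have "prob (\<Inter>i\<in>{..<K}. R i -` A (K + i) \<inter> space M) = (\<Prod>i\<in>{..<K}. prob (R i -` A (K + i) \<inter> space M))"
      using K A by (intro indep_varsD_finite[OF R]) auto
    also have "prob (\<Inter>i\<in>{..<K}. L i -` (uminus ` A (K - Suc i)) \<inter> space M)
        = (\<Prod>i\<in>{..<K}. prob (L i -` (uminus ` A (K - Suc i)) \<inter> space M))"
      using K A by (intro indep_varsD_finite[OF L] neg) auto
    also have "(\<Prod>i\<in>{..<K}. prob (L i -` (uminus ` A (K - Suc i)) \<inter> space M))
        = (\<Prod>i\<in>{..<K}. prob (Z (K - Suc i) -` A (K - Suc i) \<inter> space M))"
      unfolding Lneg using ZL by (intro prod.cong refl arg_cong[where f=prob]) auto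
    also have "(\<Prod>i\<in>{..<K}. prob (R i -` A (K + i) \<inter> space M)) * (\<Prod>i\<in>{..<K}. prob (Z (K - Suc i) -` A (K - Suc i) \<inter> space M))
      = (\<Prod>j\<in>{..<2 * K}. prob (Z j -` A j \<inter> space M))"
      unfolding split using disj inj2
      by (subst prod.union_disjoint) (auto simp: prod.reindex ZR)
    finally show ?thesis .
  qed
  have "indep_vars (\<lambda>_. borel) Z {..<2 * K}"
  proof (subst indep_vars_finite[where E="\<lambda>_. sets borel"])
    show "\<forall>A\<in>{..<2 * K} \<rightarrow> sets borel. prob (\<Inter>j\<in>{..<2 * K}. Z j -` A j \<inter> space M)
        = (\<Prod>j\<in>{..<2 * K}. prob (Z j -` A j \<inter> space M))"
      by (intro ballI main) auto
    show "sets borel = sigma_sets (space borel) (sets (borel :: real measure))"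
      by (rule sets.sigma_sets_eq[symmetric])
    show "Int_stable (sets (borel :: real measure))" by (rule sets.Int_stable)
    show "sets borel \<subseteq> Pow (space (borel :: real measure))" by (rule sets.space_closed)
  qed (use K in \<open>auto simp: lessThan_empty_iff\<close>)
  then show ?thesis by (simp add: Z_def)
qed

end

section \<open>Lipschitz functions of finitely many normal increments\<close>

definition coord_lipschitz :: "nat \<Rightarrow> real \<Rightarrow> ((nat \<Rightarrow> real) \<Rightarrow> real) \<Rightarrow> bool" where
  "coord_lipschitz N L F \<longleftrightarrow> 0 \<le> L \<and> (\<forall>x y. \<bar>F x - F y\<bar> \<le> L * (\<Sum>i<N. \<bar>x i - y i\<bar>))"

lemma coord_lipschitzD: "coord_lipschitz N L F \<Longrightarrow> \<bar>F x - F y\<bar> \<le> L * (\<Sum>i<N. \<bar>x i - y i\<bar>)"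
  by (simp add: coord_lipschitz_def)

text \<open>The Lipschitz bound sums over the first \<open>N\<close> coordinates only, so
  \<open>F\<close> ignores all others. Functions of different numbers of increments thus share one
  type, and an induction can shorten the vector.\<close>

lemma coord_lipschitz_cong: "coord_lipschitz N L F \<Longrightarrow> (\<And>i. i < N \<Longrightarrow> x i = y i) \<Longrightarrow> F x = F y"
  using coord_lipschitzD[of N L F x y] by simp

lemma coord_lipschitz_coordinate:
  assumes "coord_lipschitz (Suc N) L F"
  shows "L-lipschitz_on UNIV (\<lambda>y. F (x(N := y)))"
proof (rule lipschitz_onI)
  show "0 \<le> L" using assms by (simp add: coord_lipschitz_def)
  fix y z :: real
  have "(\<Sum>i<Suc N. \<bar>(x(N := y)) i - (x(N := z)) i\<bar>) = \<bar>y - z\<bar>" by simp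
  then show "dist (F (x(N := y))) (F (x(N := z))) \<le> L * dist y z"
    using coord_lipschitzD[OF assms, of "x(N := y)" "x(N := z)"] by (simp add: dist_real_def)
qed

definition integrate_last :: "nat \<Rightarrow> real \<Rightarrow> ((nat \<Rightarrow> real) \<Rightarrow> real) \<Rightarrow> (nat \<Rightarrow> real) \<Rightarrow> real" where
  "integrate_last N s F x = gauss_avg (\<lambda>y. F (x(N := y))) s 0"

text \<open>For two arguments that agree in coordinate \<open>N\<close> the bound does not involve
  this coordinate, so it passes through the average. The constant stays the same however many
  coordinates are integrated out.\<close>

lemma coord_lipschitz_integrate_last:
  assumes F: "coord_lipschitz (Suc N) L F"
  shows "coord_lipschitz N L (integrate_last N s F)"
  unfolding coord_lipschitz_def
proof (intro conjI allI)
  interpret prob_space std_normal_distribution by (rule prob_space_std_normal)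
  show "0 \<le> L" using F by (simp add: coord_lipschitz_def)
  fix x y :: "nat \<Rightarrow> real"
  note i = integrable_std_normal_affine[OF coord_lipschitz_coordinate[OF F, of x], of 0 s]
    integrable_std_normal_affine[OF coord_lipschitz_coordinate[OF F, of y], of 0 s]
  have eq: "integrate_last N s F x - integrate_last N s F y
    = (\<integral>z. F (x(N := 0 + s * z)) - F (y(N := 0 + s * z)) \<partial>std_normal_distribution)"
    unfolding integrate_last_def gauss_avg_def by (rule Bochner_Integration.integral_diff[OF i, symmetric])
  have b: "\<bar>F (x(N := 0 + s * z)) - F (y(N := 0 + s * z))\<bar> \<le> L * (\<Sum>i<N. \<bar>x i - y i\<bar>)" for z
    using coord_lipschitzD[OF F, of "x(N := 0 + s * z)" "y(N := 0 + s * z)"] by simp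
  have "\<bar>\<integral>z. F (x(N := 0 + s * z)) - F (y(N := 0 + s * z)) \<partial>std_normal_distribution\<bar>
      \<le> (\<integral>z. \<bar>F (x(N := 0 + s * z)) - F (y(N := 0 + s * z))\<bar> \<partial>std_normal_distribution)"
    by (rule integral_abs_bound)
  also have "\<dots> \<le> (\<integral>z. L * (\<Sum>i<N. \<bar>x i - y i\<bar>) \<partial>std_normal_distribution)"
    by (rule integral_mono[OF integrable_abs[OF Bochner_Integration.integrable_diff[OF i]] integrable_const b])
  finally show "\<bar>integrate_last N s F x - integrate_last N s F y\<bar> \<le> L * (\<Sum>i<N. \<bar>x i - y i\<bar>)"
    unfolding eq using prob_space by simp
qed

text \<open>Continuity refers to the product topology, in which finitely many coordinates control
  the bound. It yields measurability for the Borel sets of that topology, where measurability of a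
  vector can be checked coordinatewise.\<close>

lemma coord_lipschitz_continuous:
  fixes F :: "(nat \<Rightarrow> real) \<Rightarrow> real"
  assumes "coord_lipschitz N L F" shows "continuous_on UNIV F"
  unfolding continuous_on_def
proof
  fix x :: "nat \<Rightarrow> real"
  have c: "((\<lambda>y :: nat \<Rightarrow> real. y i) \<longlongrightarrow> x i) (at x)" for i
    using continuous_on_product_coordinates[of i] unfolding continuous_on_def by blast
  have "((\<lambda>y. L * (\<Sum>i<N. \<bar>y i - x i\<bar>)) \<longlongrightarrow> L * (\<Sum>i<N. \<bar>x i - x i\<bar>)) (at x)"
    by (intro tendsto_intros c)
  then have "((\<lambda>y. L * (\<Sum>i<N. \<bar>y i - x i\<bar>)) \<longlongrightarrow> 0) (at x)" by simp
  then have "((\<lambda>y. F y - F x) \<longlongrightarrow> 0) (at x)"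
    by (rule Lim_null_comparison[rotated]) (simp add: coord_lipschitzD[OF assms])
  then show "(F \<longlongrightarrow> F x) (at x)" by (simp add: LIM_zero_iff)
qed

lemma coord_lipschitz_measurable:
  fixes F :: "(nat \<Rightarrow> real) \<Rightarrow> real"
  shows "coord_lipschitz N L F \<Longrightarrow> F \<in> borel_measurable borel"
  by (rule borel_measurable_continuous_onI) (rule coord_lipschitz_continuous)

definition gauss_incr :: "'a measure \<Rightarrow> (nat \<Rightarrow> 'a \<Rightarrow> real) \<Rightarrow> nat \<Rightarrow> real \<Rightarrow> bool" where
  "gauss_incr M Z N s \<longleftrightarrow> prob_space M \<and> 0 < s \<and> prob_space.indep_vars M (\<lambda>_. borel) Z {..<N} \<and>
     (\<forall>i<N. distributed M lborel (Z i) (normal_density 0 s))"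

lemma gauss_incr_integrable:
  assumes "gauss_incr M Z N s" "i < N"
  shows "integrable M (Z i)" "Z i \<in> borel_measurable M"
proof -
  have d: "distributed M lborel (Z i) (normal_density 0 s)" and s: "0 < s"
    using assms by (auto simp: gauss_incr_def)
  show "integrable M (Z i)"
    using distributed_integrable[OF d, of "\<lambda>x. x"] integrable_normal_moment_nz_1[OF s, of 0] by simp
  show "Z i \<in> borel_measurable M"
    using distributed_measurable[OF d] by simp
qed

lemma coord_lipschitz_integrable:
  assumes G: "gauss_incr M Z N s" and F: "coord_lipschitz N L F"
  shows "integrable M (\<lambda>\<omega>. F (\<lambda>i. if i < N then Z i \<omega> else 0))"
proof (rule Bochner_Integration.integrable_bound)
  interpret prob_space M using G by (simp add: gauss_incr_def)
  show "integrable M (\<lambda>\<omega>. \<bar>F (\<lambda>_. 0)\<bar> + L * (\<Sum>i<N. \<bar>Z i \<omega>\<bar>))"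
    by (intro Bochner_Integration.integrable_add integrable_const Bochner_Integration.integrable_mult_right
        Bochner_Integration.integrable_sum integrable_abs gauss_incr_integrable(1)[OF G]) auto
  have Zm: "(\<lambda>\<omega>. (\<lambda>i. if i < N then Z i \<omega> else 0)) \<in> borel_measurable M"
  proof (rule measurable_coordinatewise_then_product)
    fix i show "(\<lambda>\<omega>. if i < N then Z i \<omega> else 0) \<in> borel_measurable M"
      using gauss_incr_integrable(2)[OF G, of i] by (cases "i < N") auto
  qed
  show "(\<lambda>\<omega>. F (\<lambda>i. if i < N then Z i \<omega> else 0)) \<in> borel_measurable M"
    by (rule measurable_compose[OF Zm coord_lipschitz_measurable[OF F]])
  have "\<bar>F (\<lambda>i. if i < N then Z i \<omega> else 0)\<bar> \<le> \<bar>F (\<lambda>_. 0)\<bar> + L * (\<Sum>i<N. \<bar>Z i \<omega>\<bar>)" for \<omega>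
    using coord_lipschitzD[OF F, of "\<lambda>i. if i < N then Z i \<omega> else 0" "\<lambda>_. 0"] by simp
  then show "AE \<omega> in M. norm (F (\<lambda>i. if i < N then Z i \<omega> else 0)) \<le> norm (\<bar>F (\<lambda>_. 0)\<bar> + L * (\<Sum>i<N. \<bar>Z i \<omega>\<bar>))"
    by (auto intro: order_trans[OF _ abs_ge_self])
qed

lemma gauss_incr_mono: "gauss_incr M Z (Suc N) s \<Longrightarrow> gauss_incr M Z N s"
  unfolding gauss_incr_def using prob_space.indep_vars_subset[of M _ Z "{..<Suc N}" "{..<N}"] by auto

text \<open>Fubini for the law of the first \<open>N\<close> increments and the independent law of
  the last one.\<close>

lemma expectation_integrate_last:
  fixes F :: "(nat \<Rightarrow> real) \<Rightarrow> real"
  assumes G: "gauss_incr M Z (Suc N) s" and F: "coord_lipschitz (Suc N) L F"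
  shows "(\<integral>\<omega>. F (\<lambda>i. if i < Suc N then Z i \<omega> else 0) \<partial>M)
    = (\<integral>\<omega>. integrate_last N s F (\<lambda>i. if i < N then Z i \<omega> else 0) \<partial>M)"
proof -
  interpret prob_space M using G by (simp add: gauss_incr_def)
  have s: "0 < s" and d: "distributed M lborel (Z N) (normal_density 0 s)"
    and ind: "indep_vars (\<lambda>_. borel) Z {..<Suc N}"
    using G by (auto simp: gauss_incr_def)
  define X where "X = (\<lambda>\<omega> i. if i < N then Z i \<omega> else 0)"
  have Xm[measurable]: "X \<in> borel_measurable M"
    unfolding X_def
  proof (rule measurable_coordinatewise_then_product)
    fix i show "(\<lambda>\<omega>. if i < N then Z i \<omega> else 0) \<in> borel_measurable M"
      using gauss_incr_integrable(2)[OF G, of i] by (cases "i < N") auto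
  qed
  have Zm[measurable]: "Z N \<in> borel_measurable M" using gauss_incr_integrable(2)[OF G] by simp
  \<comment> \<open>\<open>indep_var\<close> relates two variables with values in the same type, so
    \<open>Z N\<close> is carried by a vector supported at coordinate \<open>N\<close>.\<close>
  define Y where "Y = (\<lambda>\<omega> i. if i = N then Z N \<omega> else 0)"
  have Ym[measurable]: "Y \<in> borel_measurable M"
    unfolding Y_def by (rule measurable_coordinatewise_then_product) simp
  define G' where "G' = (\<lambda>p :: (nat \<Rightarrow> real) \<times> (nat \<Rightarrow> real). F ((fst p)(N := snd p N)))"
  have upd: "(\<lambda>p :: (nat \<Rightarrow> real) \<times> (nat \<Rightarrow> real). (fst p)(N := snd p N)) \<in> borel \<Otimes>\<^sub>M borel \<rightarrow>\<^sub>M borel"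
  proof (rule measurable_coordinatewise_then_product)
    fix i show "(\<lambda>p :: (nat \<Rightarrow> real) \<times> (nat \<Rightarrow> real). ((fst p)(N := snd p N)) i) \<in> borel_measurable (borel \<Otimes>\<^sub>M borel)"
    proof (cases "i = N")
      case True
      have "(\<lambda>p :: (nat \<Rightarrow> real) \<times> (nat \<Rightarrow> real). snd p i) \<in> borel_measurable (borel \<Otimes>\<^sub>M borel)"
        by (rule measurable_compose[OF measurable_snd measurable_product_coordinates])
      then show ?thesis using True by simp
    next
      case False
      have "(\<lambda>p :: (nat \<Rightarrow> real) \<times> (nat \<Rightarrow> real). fst p i) \<in> borel_measurable (borel \<Otimes>\<^sub>M borel)"
        by (rule measurable_compose[OF measurable_fst measurable_product_coordinates])
      then show ?thesis using False by simp
    qed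
  qed
  have Gm: "G' \<in> borel_measurable (borel \<Otimes>\<^sub>M borel)"
    unfolding G'_def by (rule measurable_compose[OF upd coord_lipschitz_measurable[OF F]])
  have iv: "indep_var borel X borel Y"
  proof -
    have 1: "indep_var (PiM {..<N} (\<lambda>_. borel)) (\<lambda>\<omega>. restrict (\<lambda>i. Z i \<omega>) {..<N})
        (PiM {N} (\<lambda>_. borel)) (\<lambda>\<omega>. restrict (\<lambda>i. Z i \<omega>) {N})"
      by (rule indep_var_restrict[OF ind]) auto
    have m1: "(\<lambda>x i. if i < N then x i else 0) \<in> measurable (PiM {..<N} (\<lambda>_. borel)) (borel :: (nat \<Rightarrow> real) measure)"
    proof (rule measurable_coordinatewise_then_product)
      fix i show "(\<lambda>x. if i < N then x i else 0) \<in> measurable (PiM {..<N} (\<lambda>_. borel)) (borel :: real measure)"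
        by (cases "i < N") auto
    qed
    have m2: "(\<lambda>x i. if i = N then x N else 0) \<in> measurable (PiM {N} (\<lambda>_. borel)) (borel :: (nat \<Rightarrow> real) measure)"
    proof (rule measurable_coordinatewise_then_product)
      fix i show "(\<lambda>x. if i = N then x N else 0) \<in> measurable (PiM {N} (\<lambda>_. borel)) (borel :: real measure)"
        by (cases "i = N") auto
    qed
    have "indep_var borel ((\<lambda>x i. if i < N then x i else 0) \<circ> (\<lambda>\<omega>. restrict (\<lambda>i. Z i \<omega>) {..<N}))
      borel ((\<lambda>x i. if i = N then x N else 0) \<circ> (\<lambda>\<omega>. restrict (\<lambda>i. Z i \<omega>) {N}))"
      by (rule indep_var_compose[OF 1 m1 m2])
    moreover have "(\<lambda>x i. if i < N then x i else 0) \<circ> (\<lambda>\<omega>. restrict (\<lambda>i. Z i \<omega>) {..<N}) = X"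
      by (auto simp: X_def fun_eq_iff)
    moreover have "(\<lambda>x i. if i = N then x N else 0) \<circ> (\<lambda>\<omega>. restrict (\<lambda>i. Z i \<omega>) {N}) = Y"
      by (auto simp: Y_def fun_eq_iff)
    ultimately show ?thesis by simp
  qed
  then have dist: "distr M borel X \<Otimes>\<^sub>M distr M borel Y = distr M (borel \<Otimes>\<^sub>M borel) (\<lambda>\<omega>. (X \<omega>, Y \<omega>))"
    by (simp add: indep_var_distribution_eq)
  interpret X: prob_space "distr M borel X" by (rule prob_space_distr) (rule Xm)
  interpret Y: prob_space "distr M borel Y" by (rule prob_space_distr) (rule Ym)
  interpret P: pair_sigma_finite "distr M borel X" "distr M borel Y" ..
  have FG: "F (\<lambda>i. if i < Suc N then Z i \<omega> else 0) = G' (X \<omega>, Y \<omega>)" for \<omega>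
    unfolding G'_def X_def Y_def by (rule arg_cong[where f=F]) (auto simp: fun_eq_iff less_Suc_eq)
  have int: "integrable (distr M borel X \<Otimes>\<^sub>M distr M borel Y) G'"
    unfolding dist using coord_lipschitz_integrable[OF G F] Gm
    by (subst integrable_distr_eq) (auto simp: FG)
  have inner: "(\<integral>y. G' (x, y) \<partial>distr M borel Y) = integrate_last N s F x" for x
  proof -
    have cm: "(\<lambda>z. F (x(N := z))) \<in> borel_measurable borel"
      by (rule borel_measurable_continuous_onI, rule lipschitz_on_continuous_on[OF coord_lipschitz_coordinate[OF F]])
    have m: "(\<lambda>y. G' (x, y)) \<in> borel_measurable borel"
      by (rule measurable_compose[OF measurable_Pair1' Gm]) simp
    have "distr M borel (Z N) = density lborel (normal_density 0 s)"
      using distributed_distr_eq_density[OF d] by (metis distr_cong sets_lborel)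
    then have dens: "(\<integral>z. F (x(N := z)) \<partial>distr M borel (Z N)) = (\<integral>z. F (x(N := 0 + z)) \<partial>density lborel (normal_density 0 s))"
      by simp
    have "(\<integral>y. G' (x, y) \<partial>distr M borel Y) = (\<integral>\<omega>. G' (x, Y \<omega>) \<partial>M)"
      by (rule integral_distr[OF Ym m])
    also have "\<dots> = (\<integral>\<omega>. F (x(N := Z N \<omega>)) \<partial>M)" by (simp add: G'_def Y_def)
    also have "\<dots> = (\<integral>z. F (x(N := z)) \<partial>distr M borel (Z N))"
      by (rule integral_distr[OF Zm cm, symmetric])
    also have "\<dots> = integrate_last N s F x"
      unfolding integrate_last_def dens
      by (rule gauss_avg_eq[OF s cm, symmetric])
    finally show ?thesis .
  qed
  have "(\<integral>\<omega>. F (\<lambda>i. if i < Suc N then Z i \<omega> else 0) \<partial>M)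
      = (\<integral>p. G' p \<partial>(distr M borel X \<Otimes>\<^sub>M distr M borel Y))"
    unfolding FG dist using Gm by (subst integral_distr) auto
  also have "\<dots> = (\<integral>x. (\<integral>y. G' (x, y) \<partial>distr M borel Y) \<partial>distr M borel X)"
    by (rule P.integral_fst'[OF int, symmetric])
  also have "\<dots> = (\<integral>x. integrate_last N s F x \<partial>distr M borel X)" by (simp only: inner)
  also have "\<dots> = (\<integral>\<omega>. integrate_last N s F (X \<omega>) \<partial>M)"
    by (rule integral_distr[OF Xm coord_lipschitz_measurable[OF coord_lipschitz_integrate_last[OF F]]])
  finally show ?thesis by (simp add: X_def)
qed


text \<open>Keeps sets \<open>{1..n}\<close> and cyclic offsets in numeral form.\<close>

declare One_nat_def [simp del] add_2_eq_Suc [simp del] add_2_eq_Suc' [simp del]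

section \<open>Uniform permutations and cyclic patterns\<close>

text \<open>A finite average, so that linearity and monotonicity come without integrability
  conditions.\<close>

definition EE :: "nat \<Rightarrow> ((nat \<Rightarrow> nat) \<Rightarrow> real) \<Rightarrow> real" where
  "EE n g = (\<Sum>\<sigma> | \<sigma> permutes {1..n}. g \<sigma>) / fact n"

lemma finite_perms: "finite {\<sigma>. \<sigma> permutes {1..n::nat}}"
  by (simp add: finite_permutations)

lemma card_perms: "card {\<sigma>. \<sigma> permutes {1..n::nat}} = fact n"
  by (simp add: card_permutations)

lemma expectation_uniform_perm: "measure_pmf.expectation (uniform_perm n) g = EE n g"
proof -
  have "{\<sigma>. \<sigma> permutes {1..n}} \<noteq> {}"
    using permutes_id by blast
  then show ?thesis
    unfolding uniform_perm_def EE_def by (simp add: integral_pmf_of_set finite_perms card_perms)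
qed

lemma EE_cong: "(\<And>\<sigma>. \<sigma> permutes {1..n} \<Longrightarrow> f \<sigma> = g \<sigma>) \<Longrightarrow> EE n f = EE n g"
  unfolding EE_def by (auto intro!: arg_cong2[where f="(/)"] sum.cong)

lemma EE_mono: "(\<And>\<sigma>. \<sigma> permutes {1..n} \<Longrightarrow> f \<sigma> \<le> g \<sigma>) \<Longrightarrow> EE n f \<le> EE n g"
  unfolding EE_def by (auto intro!: divide_right_mono sum_mono)

lemma EE_add: "EE n (\<lambda>\<sigma>. f \<sigma> + g \<sigma>) = EE n f + EE n g"
  unfolding EE_def by (simp add: sum.distrib add_divide_distrib)

lemma EE_diff: "EE n (\<lambda>\<sigma>. f \<sigma> - g \<sigma>) = EE n f - EE n g"
  unfolding EE_def by (simp add: sum_subtractf diff_divide_distrib)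

lemma EE_cmult: "EE n (\<lambda>\<sigma>. c * f \<sigma>) = c * EE n f"
  unfolding EE_def by (simp add: sum_distrib_left)

lemma EE_multc: "EE n (\<lambda>\<sigma>. f \<sigma> * c) = EE n f * c"
  unfolding EE_def by (simp add: sum_distrib_right)

lemma EE_divide: "EE n (\<lambda>\<sigma>. f \<sigma> / c) = EE n f / c"
  using EE_multc[of n f "1/c"] by simp

lemma EE_const [simp]: "EE n (\<lambda>\<sigma>. c) = c"
  unfolding EE_def by (simp add: card_perms)

lemma EE_sum: "EE n (\<lambda>\<sigma>. \<Sum>i\<in>J. f i \<sigma>) = (\<Sum>i\<in>J. EE n (f i))"
  unfolding EE_def by (subst sum.swap) (simp add: sum_divide_distrib)

lemma EE_nonneg: "(\<And>\<sigma>. \<sigma> permutes {1..n} \<Longrightarrow> 0 \<le> f \<sigma>) \<Longrightarrow> 0 \<le> EE n f"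
  using EE_mono[of n "\<lambda>_. 0" f] by simp

lemma EE_abs: "\<bar>EE n f\<bar> \<le> EE n (\<lambda>\<sigma>. \<bar>f \<sigma>\<bar>)"
  unfolding EE_def by (simp add: divide_right_mono sum_abs)

lemma EE_square: "(EE n f)\<^sup>2 \<le> EE n (\<lambda>\<sigma>. (f \<sigma>)\<^sup>2)"
proof -
  let ?m = "EE n f"
  have "0 \<le> EE n (\<lambda>\<sigma>. (f \<sigma> - ?m)\<^sup>2)"
    by (rule EE_nonneg) simp
  also have "EE n (\<lambda>\<sigma>. (f \<sigma> - ?m)\<^sup>2) = EE n (\<lambda>\<sigma>. (f \<sigma>)\<^sup>2 - 2 * ?m * f \<sigma> + ?m\<^sup>2)"
    by (simp add: power2_diff algebra_simps)
  also have "\<dots> = EE n (\<lambda>\<sigma>. (f \<sigma>)\<^sup>2) - ?m\<^sup>2"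
    by (simp add: EE_add EE_diff EE_cmult power2_eq_square)
  finally show ?thesis by simp
qed

lemma EE_le_sqrt: "EE n f \<le> sqrt (EE n (\<lambda>\<sigma>. (f \<sigma>)\<^sup>2))"
  using EE_square[of n f] by (simp add: real_le_rsqrt)

text \<open>\<open>\<sigma> i\<close> is the position that becomes one at step \<open>i\<close>. The
  information of the first \<open>m\<close> steps is encoded without a sigma-algebra: a quantity is
  known after step \<open>m\<close> if reordering the later entries does not change it.\<close>

definition adapted :: "nat \<Rightarrow> nat \<Rightarrow> ((nat \<Rightarrow> nat) \<Rightarrow> 'b) \<Rightarrow> bool" where
  "adapted n m g \<longleftrightarrow> (\<forall>\<sigma> \<tau>. \<sigma> permutes {1..n} \<longrightarrow> \<tau> permutes {Suc m..n} \<longrightarrow> g (\<sigma> \<circ> \<tau>) = g \<sigma>)"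

definition zeros :: "nat \<Rightarrow> (nat \<Rightarrow> nat) \<Rightarrow> nat \<Rightarrow> nat set" where
  "zeros n \<sigma> m = \<sigma> ` {Suc m..n}"

lemma adaptedD:
  "adapted n m g \<Longrightarrow> \<sigma> permutes {1..n} \<Longrightarrow> \<tau> permutes {Suc m..n} \<Longrightarrow> g (\<sigma> \<circ> \<tau>) = g \<sigma>"
  by (auto simp: adapted_def)

lemma adapted_mono: "adapted n i g \<Longrightarrow> i \<le> m \<Longrightarrow> adapted n m g"
  unfolding adapted_def by (meson atLeastatMost_subset_iff Suc_le_mono order_refl permutes_subset)

lemma adapted_zeros: "i \<le> m \<Longrightarrow> adapted n m (\<lambda>\<sigma>. zeros n \<sigma> i)"
  by (rule adapted_mono[of n i]) (simp add: adapted_def zeros_def image_comp[symmetric] permutes_image del: image_comp comp_apply o_apply image_image)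

lemma adapted_apply: "i \<le> m \<Longrightarrow> adapted n m (\<lambda>\<sigma>. \<sigma> i)"
  unfolding adapted_def by (auto simp: permutes_def)

lemma adapted_const: "adapted n m (\<lambda>\<sigma>. c)"
  by (simp add: adapted_def)

lemma adapted_comp: "adapted n m g \<Longrightarrow> adapted n m (\<lambda>\<sigma>. h (g \<sigma>))"
  by (simp add: adapted_def)

lemma adapted_comp2: "adapted n m g \<Longrightarrow> adapted n m g' \<Longrightarrow> adapted n m (\<lambda>\<sigma>. h (g \<sigma>) (g' \<sigma>))"
  by (simp add: adapted_def)

lemma adapted_sum: "(\<And>i. i \<in> J \<Longrightarrow> adapted n m (f i)) \<Longrightarrow> adapted n m (\<lambda>\<sigma>. \<Sum>i\<in>J. f i \<sigma>)"
  by (simp add: adapted_def)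

lemma zeros_subset: "\<sigma> permutes {1..n} \<Longrightarrow> zeros n \<sigma> m \<subseteq> {1..n}"
  unfolding zeros_def using permutes_image[of \<sigma> "{1..n}"] by auto

lemma card_zeros: "\<sigma> permutes {1..n} \<Longrightarrow> card (zeros n \<sigma> m) = n - m"
  unfolding zeros_def by (subst card_image) (auto dest: permutes_inj simp: inj_on_def)

lemma finite_zeros [simp]: "finite (zeros n \<sigma> m)"
  by (simp add: zeros_def)

lemma zeros_0: "\<sigma> permutes {1..n} \<Longrightarrow> zeros n \<sigma> 0 = {1..n}"
  unfolding zeros_def using permutes_image[of \<sigma> "{1..n}"] by (simp add: One_nat_def)

lemma zeros_Suc:
  assumes "\<sigma> permutes {1..n}" "m < n"
  shows "zeros n \<sigma> (Suc m) = zeros n \<sigma> m - {\<sigma> (Suc m)}"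
proof -
  have "{Suc m..n} = insert (Suc m) {Suc (Suc m)..n}"
    using assms by auto
  then show ?thesis
    unfolding zeros_def using permutes_inj[OF assms(1)] by (auto simp: inj_def) (metis Suc_n_not_le_n)
qed

lemma in_zeros: "\<sigma> permutes {1..n} \<Longrightarrow> m < n \<Longrightarrow> \<sigma> (Suc m) \<in> zeros n \<sigma> m"
  by (auto simp: zeros_def)

text \<open>Composing with a transposition of later indices preserves both the uniform distribution and the past.\<close>

lemma EE_one_step:
  fixes \<Phi> :: "(nat \<Rightarrow> nat) \<Rightarrow> nat \<Rightarrow> real"
  assumes ad: "adapted n m \<Phi>" and m: "m < n"
  shows "EE n (\<lambda>\<sigma>. \<Phi> \<sigma> (\<sigma> (Suc m))) = EE n (\<lambda>\<sigma>. (\<Sum>x\<in>zeros n \<sigma> m. \<Phi> \<sigma> x) / real (n - m))"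
proof -
  have eq: "EE n (\<lambda>\<sigma>. \<Phi> \<sigma> (\<sigma> j)) = EE n (\<lambda>\<sigma>. \<Phi> \<sigma> (\<sigma> (Suc m)))" if j: "j \<in> {Suc m..n}" for j
  proof -
    let ?t = "Transposition.transpose (Suc m) j"
    have t: "?t permutes {Suc m..n}"
      using j m by (intro permutes_swap_id) auto
    have t': "?t permutes {1..n}"
      using j m by (intro permutes_swap_id) auto
    have "EE n (\<lambda>\<sigma>. \<Phi> \<sigma> (\<sigma> j)) = EE n (\<lambda>\<sigma>. \<Phi> (\<sigma> \<circ> ?t) ((\<sigma> \<circ> ?t) j))"
      unfolding EE_def by (subst sum_permutations_compose_right[OF t']) simp
    also have "\<dots> = EE n (\<lambda>\<sigma>. \<Phi> \<sigma> (\<sigma> (Suc m)))"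
      by (rule EE_cong) (simp add: adaptedD[OF ad _ t])
    finally show ?thesis .
  qed
  have "EE n (\<lambda>\<sigma>. (\<Sum>x\<in>zeros n \<sigma> m. \<Phi> \<sigma> x) / real (n - m))
      = EE n (\<lambda>\<sigma>. (\<Sum>j\<in>{Suc m..n}. \<Phi> \<sigma> (\<sigma> j)) / real (n - m))"
    unfolding zeros_def
    by (rule EE_cong, subst sum.reindex) (auto dest: permutes_inj simp: inj_on_def inj_def)
  also have "\<dots> = (\<Sum>j\<in>{Suc m..n}. EE n (\<lambda>\<sigma>. \<Phi> \<sigma> (\<sigma> j))) / real (n - m)"
    by (simp add: EE_divide EE_sum)
  also have "\<dots> = EE n (\<lambda>\<sigma>. \<Phi> \<sigma> (\<sigma> (Suc m)))"
    using m by (subst sum.cong[OF refl eq]) auto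
  finally show ?thesis by simp
qed

section \<open>Cyclic positions and pattern counts\<close>

lemma cyc_in: "n \<ge> 1 \<Longrightarrow> cyc n k \<in> {1..n}"
  unfolding cyc_def using mod_less_divisor[of n "k + n - 1"] by (auto simp: Suc_le_eq simp del: mod_less_divisor)

lemma cyc_cyc_add: "n \<ge> 1 \<Longrightarrow> cyc n (cyc n k + a) = cyc n (k + a)"
proof -
  assume n: "n \<ge> 1"
  have "cyc n (cyc n k + a) = ((k + n - 1) mod n + (a + n)) mod n + 1"
    unfolding cyc_def using n by (simp add: algebra_simps)
  also have "\<dots> = ((k + n - 1) + (a + n)) mod n + 1"
    by (simp add: mod_add_left_eq)
  also have "(k + n - 1) + (a + n) = (k + a + n - 1) + n"
    using n by simp
  finally show ?thesis unfolding cyc_def by simp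
qed

lemma cyc_eq_iff:
  assumes "n \<ge> 1" "k \<ge> 1" "a < n" "b < n"
  shows "cyc n (k + a) = cyc n (k + b) \<longleftrightarrow> a = b"
proof
  assume "cyc n (k + a) = cyc n (k + b)"
  then have h: "(a + (k + n - 1)) mod n = (b + (k + n - 1)) mod n"
    using assms by (simp add: cyc_def algebra_simps)
  have "a mod n = b mod n"
    using h unfolding nat_mod_eq_iff by auto
  then show "a = b" using assms by simp
qed simp

lemma inj_on_cyc_offset: "n \<ge> 1 \<Longrightarrow> k \<ge> 1 \<Longrightarrow> A \<subseteq> {..<n} \<Longrightarrow> inj_on (\<lambda>a. cyc n (k + a)) A"
  by (auto simp: inj_on_def cyc_eq_iff subset_eq)

lemma inj_on_cyc_base: "n \<ge> 1 \<Longrightarrow> inj_on (\<lambda>k. cyc n (k + a)) {1..n}"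
proof (rule inj_onI)
  fix k l assume n: "n \<ge> 1" and k: "k \<in> {1..n}" and l: "l \<in> {1..n}" and eq: "cyc n (k + a) = cyc n (l + a)"
  have "cyc n ((a + 1) + (k - 1)) = cyc n ((a + 1) + (l - 1))"
    using eq k l by (simp add: algebra_simps)
  then have "k - 1 = l - 1"
    using k l n by (subst (asm) cyc_eq_iff) auto
  then show "k = l" using k l by (auto simp: eq_diff_iff)
qed

lemma bij_betw_cyc_base: "n \<ge> 1 \<Longrightarrow> bij_betw (\<lambda>k. cyc n (k + a)) {1..n} {1..n}"
  unfolding bij_betw_def using cyc_in
  by (intro conjI inj_on_cyc_base endo_inj_surj) auto

text \<open>A pattern is a set \<open>A\<close> of offsets, placed at the cyclic position \<open>k\<close>.\<close>

definition pos :: "nat \<Rightarrow> nat set \<Rightarrow> nat \<Rightarrow> nat set" where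
  "pos n A k = (\<lambda>a. cyc n (k + a)) ` A"

definition cnt :: "nat \<Rightarrow> nat set \<Rightarrow> nat set \<Rightarrow> real" where
  "cnt n A Z = real (card {k \<in> {1..n}. pos n A k \<subseteq> Z})"

lemma card_pos: "n \<ge> 1 \<Longrightarrow> k \<ge> 1 \<Longrightarrow> A \<subseteq> {..<n} \<Longrightarrow> card (pos n A k) = card A"
  unfolding pos_def by (rule card_image) (rule inj_on_cyc_offset)

lemma cnt_diff:
  "cnt n A Z - cnt n A (Z - {x}) = (\<Sum>k | k \<in> {1..n} \<and> pos n A k \<subseteq> Z. of_bool (x \<in> pos n A k))"
proof -
  let ?K = "{k. k \<in> {1..n} \<and> pos n A k \<subseteq> Z}"
  have K: "{k \<in> {1..n}. pos n A k \<subseteq> Z - {x}} = ?K - {k \<in> ?K. x \<in> pos n A k}"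
    by auto
  have "card (?K - {k \<in> ?K. x \<in> pos n A k}) = card ?K - card {k \<in> ?K. x \<in> pos n A k}"
    by (rule card_Diff_subset) auto
  moreover have "card {k \<in> ?K. x \<in> pos n A k} \<le> card ?K"
    by (rule card_mono) auto
  moreover have "(\<Sum>k\<in>?K. of_bool (x \<in> pos n A k)) = real (card {k \<in> ?K. x \<in> pos n A k})"
    by (subst sum_of_bool_eq) (auto intro!: arg_cong[where f=card])
  ultimately show ?thesis
    unfolding cnt_def K by (simp add: of_nat_diff)
qed

text \<open>Double counting: a placement contained in \<open>Z\<close> is destroyed by the removal
  of any of its \<open>card A\<close> points. These are distinct, since offsets below
  \<open>n\<close> do not collide modulo \<open>n\<close>. Dividing by \<open>card Z\<close> gives
  the conditional mean loss in one step.\<close>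

lemma sum_cnt_diff:
  assumes "n \<ge> 1" "A \<subseteq> {..<n}" "Z \<subseteq> {1..n}"
  shows "(\<Sum>x\<in>Z. cnt n A Z - cnt n A (Z - {x})) = real (card A) * cnt n A Z"
proof -
  let ?K = "{k. k \<in> {1..n} \<and> pos n A k \<subseteq> Z}"
  have fZ: "finite Z" using assms(3) finite_subset by blast
  have "(\<Sum>x\<in>Z. cnt n A Z - cnt n A (Z - {x})) = (\<Sum>k\<in>?K. \<Sum>x\<in>Z. of_bool (x \<in> pos n A k))"
    unfolding cnt_diff by (rule sum.swap)
  also have "\<dots> = (\<Sum>k\<in>?K. real (card A))"
  proof (rule sum.cong[OF refl])
    fix k assume k: "k \<in> ?K"
    then have "Z \<inter> pos n A k = pos n A k" by auto
    then show "(\<Sum>x\<in>Z. of_bool (x \<in> pos n A k)) = real (card A)"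
      using fZ k assms by (simp add: sum_of_bool_eq card_pos)
  qed
  finally show ?thesis by (simp add: cnt_def mult.commute)
qed

lemma cnt_diff_nonneg: "0 \<le> cnt n A Z - cnt n A (Z - {x})"
  unfolding cnt_diff by (rule sum_nonneg) simp

text \<open>For each offset at most one base point moves it onto \<open>x\<close>.\<close>

lemma cnt_diff_le:
  assumes "n \<ge> 1" "finite A"
  shows "cnt n A Z - cnt n A (Z - {x}) \<le> real (card A)"
proof -
  let ?K = "{k. k \<in> {1..n} \<and> pos n A k \<subseteq> Z}"
  have "cnt n A Z - cnt n A (Z - {x}) = real (card {k \<in> ?K. x \<in> pos n A k})"
    unfolding cnt_diff by (subst sum_of_bool_eq) (auto intro!: arg_cong[where f=card])
  also have "card {k \<in> ?K. x \<in> pos n A k} \<le> card (\<Union>a\<in>A. {k \<in> {1..n}. cyc n (k + a) = x})"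
    using assms by (intro card_mono) (auto simp: pos_def)
  also have "\<dots> \<le> (\<Sum>a\<in>A. card {k \<in> {1..n}. cyc n (k + a) = x})"
    by (rule card_UN_le[OF assms(2)])
  also have "\<dots> \<le> (\<Sum>a\<in>A. 1)"
  proof (rule sum_mono)
    fix a assume "a \<in> A"
    show "card {k \<in> {1..n}. cyc n (k + a) = x} \<le> 1"
      using inj_onD[OF inj_on_cyc_base[OF assms(1), of a]]
      by (subst One_nat_def, subst card_le_Suc0_iff_eq) (simp, blast)
  qed
  finally show ?thesis by simp
qed

lemma cnt_nonneg: "0 \<le> cnt n A Z"
  by (simp add: cnt_def)

lemma cnt_le_card:
  assumes "n \<ge> 1" "A \<noteq> {}" "finite Z"
  shows "cnt n A Z \<le> real (card Z)"
proof -
  obtain a where "a \<in> A" using assms by auto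
  have "inj_on (\<lambda>k. cyc n (k + a)) {k \<in> {1..n}. pos n A k \<subseteq> Z}"
    by (rule inj_on_subset[OF inj_on_cyc_base[OF assms(1)]]) auto
  then have "card {k \<in> {1..n}. pos n A k \<subseteq> Z} \<le> card Z"
    using assms \<open>a \<in> A\<close>
    by (intro card_inj_on_le[where f="\<lambda>k. cyc n (k + a)"]) (auto simp: pos_def)
  then show ?thesis by (simp add: cnt_def)
qed

section \<open>Martingale inequalities\<close>

text \<open>\<open>\<xi> i \<sigma> x\<close> is the increment of step \<open>i\<close> if the next entry is \<open>x\<close>; the dependence on \<open>\<sigma>\<close> is only through
  the first \<open>i\<close> entries.\<close>

definition martingale_increments :: "nat \<Rightarrow> nat \<Rightarrow> nat \<Rightarrow> (nat \<Rightarrow> (nat \<Rightarrow> nat) \<Rightarrow> nat \<Rightarrow> real) \<Rightarrow> real \<Rightarrow> bool" where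
  "martingale_increments n a b \<xi> c \<longleftrightarrow> a \<le> b \<and> b \<le> n \<and> (\<forall>i. a \<le> i \<and> i < b \<longrightarrow>
     adapted n i (\<xi> i) \<and>
     (\<forall>\<sigma>. \<sigma> permutes {1..n} \<longrightarrow> (\<forall>x\<in>zeros n \<sigma> i. \<bar>\<xi> i \<sigma> x\<bar> \<le> c) \<and> (\<Sum>x\<in>zeros n \<sigma> i. \<xi> i \<sigma> x) = 0))"

definition mart :: "(nat \<Rightarrow> (nat \<Rightarrow> nat) \<Rightarrow> nat \<Rightarrow> real) \<Rightarrow> nat \<Rightarrow> nat \<Rightarrow> (nat \<Rightarrow> nat) \<Rightarrow> real" where
  "mart \<xi> a m \<sigma> = (\<Sum>i=a..<m. \<xi> i \<sigma> (\<sigma> (Suc i)))"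

lemma martingale_incrementsD:
  assumes "martingale_increments n a b \<xi> c" "a \<le> i" "i < b"
  shows "adapted n i (\<xi> i)"
    "\<And>\<sigma> x. \<sigma> permutes {1..n} \<Longrightarrow> x \<in> zeros n \<sigma> i \<Longrightarrow> \<bar>\<xi> i \<sigma> x\<bar> \<le> c"
    "\<And>\<sigma>. \<sigma> permutes {1..n} \<Longrightarrow> (\<Sum>x\<in>zeros n \<sigma> i. \<xi> i \<sigma> x) = 0"
    "i < n"
  using assms unfolding martingale_increments_def by auto

lemma martingale_increments_bound:
  assumes "martingale_increments n a b \<xi> c" "a \<le> i" "i < b" "\<sigma> permutes {1..n}"
  shows "\<bar>\<xi> i \<sigma> (\<sigma> (Suc i))\<bar> \<le> c"
  using martingale_incrementsD[OF assms(1-3)] assms(4) in_zeros[OF assms(4)] by blast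

lemma mart_same [simp]: "mart \<xi> a a \<sigma> = 0"
  by (simp add: mart_def)

lemma mart_Suc: "a \<le> m \<Longrightarrow> mart \<xi> a (Suc m) \<sigma> = mart \<xi> a m \<sigma> + \<xi> m \<sigma> (\<sigma> (Suc m))"
  by (simp add: mart_def)

lemma adapted_mart:
  assumes "martingale_increments n a b \<xi> c" "a \<le> m" "m \<le> b"
  shows "adapted n m (mart \<xi> a m)"
  unfolding mart_def
proof (rule adapted_sum)
  fix i assume i: "i \<in> {a..<m}"
  have "adapted n m (\<xi> i)"
    using i assms by (intro adapted_mono[OF martingale_incrementsD(1)[OF assms(1)]]) auto
  moreover have "adapted n m (\<lambda>\<sigma>. \<sigma> (Suc i))"
    using i by (intro adapted_apply) auto
  ultimately show "adapted n m (\<lambda>\<sigma>. \<xi> i \<sigma> (\<sigma> (Suc i)))"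
    by (rule adapted_comp2)
qed

text \<open>Given the past, \<open>h\<close> is constant and the increments sum to zero over the
  possible next entries.\<close>

lemma EE_orthogonal:
  assumes "martingale_increments n a b \<xi> c" "a \<le> i" "i < b" "adapted n i h"
  shows "EE n (\<lambda>\<sigma>. h \<sigma> * \<xi> i \<sigma> (\<sigma> (Suc i))) = 0"
proof -
  note mi = martingale_incrementsD[OF assms(1-3)]
  have "adapted n i (\<lambda>\<sigma> x. h \<sigma> * \<xi> i \<sigma> x)"
    using assms(4) mi(1) by (simp add: adapted_def)
  from EE_one_step[OF this mi(4)]
  have "EE n (\<lambda>\<sigma>. h \<sigma> * \<xi> i \<sigma> (\<sigma> (Suc i)))
      = EE n (\<lambda>\<sigma>. (\<Sum>x\<in>zeros n \<sigma> i. h \<sigma> * \<xi> i \<sigma> x) / real (n - i))" .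
  also have "\<dots> = EE n (\<lambda>\<sigma>. 0)"
    by (rule EE_cong) (simp add: sum_distrib_left[symmetric] mi(3))
  finally show ?thesis by simp
qed

lemma EE_mart_square:
  assumes "martingale_increments n a b \<xi> c" "a \<le> m" "m \<le> b"
  shows "EE n (\<lambda>\<sigma>. (mart \<xi> a m \<sigma>)\<^sup>2) \<le> c\<^sup>2 * real (m - a)"
  using assms(2,3)
proof (induction m rule: dec_induct)
  case base
  then show ?case by simp
next
  case (step m)
  have "EE n (\<lambda>\<sigma>. (mart \<xi> a (Suc m) \<sigma>)\<^sup>2)
      \<le> EE n (\<lambda>\<sigma>. (mart \<xi> a m \<sigma>)\<^sup>2 + (2 * mart \<xi> a m \<sigma>) * \<xi> m \<sigma> (\<sigma> (Suc m)) + c\<^sup>2)"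
  proof (rule EE_mono)
    fix \<sigma> assume "\<sigma> permutes {1..n}"
    then have "\<bar>\<xi> m \<sigma> (\<sigma> (Suc m))\<bar> \<le> c"
      using step.prems by (intro martingale_increments_bound[OF assms(1) step.hyps(1)]) auto
    then have "(\<xi> m \<sigma> (\<sigma> (Suc m)))\<^sup>2 \<le> c\<^sup>2"
      by (metis abs_ge_zero power2_abs power_mono)
    then show "(mart \<xi> a (Suc m) \<sigma>)\<^sup>2
       \<le> (mart \<xi> a m \<sigma>)\<^sup>2 + (2 * mart \<xi> a m \<sigma>) * \<xi> m \<sigma> (\<sigma> (Suc m)) + c\<^sup>2"
      by (simp add: mart_Suc[OF step.hyps(1)] power2_sum)
  qed
  also have "\<dots> = EE n (\<lambda>\<sigma>. (mart \<xi> a m \<sigma>)\<^sup>2) + c\<^sup>2"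
  proof -
    have "adapted n m (\<lambda>\<sigma>. 2 * mart \<xi> a m \<sigma>)"
      using step.prems by (intro adapted_comp[OF adapted_mart[OF assms(1) step.hyps(1)], where h="\<lambda>x. 2 * x"]) auto
    then have "EE n (\<lambda>\<sigma>. (2 * mart \<xi> a m \<sigma>) * \<xi> m \<sigma> (\<sigma> (Suc m))) = 0"
      using step.prems by (intro EE_orthogonal[OF assms(1) step.hyps(1)]) auto
    then show ?thesis by (simp only: EE_add EE_const)
  qed
  also have "\<dots> \<le> c\<^sup>2 * real (Suc m - a)"
    using step by (simp add: Suc_diff_le algebra_simps)
  finally show ?case .
qed

text \<open>The term linear in \<open>x\<close> is kept intact because it has mean zero along a
  martingale. The quadratic and quartic terms use the bound on \<open>x\<close>, and the cubic one
  is split by \<open>2 * M * x \<le> M^2 + x^2\<close>.\<close>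

lemma power4_sum_le:
  fixes M x c :: real
  assumes "\<bar>x\<bar> \<le> c"
  shows "(M + x)^4 \<le> M^4 + (4 * M^3) * x + 8 * c\<^sup>2 * M\<^sup>2 + 3 * c^4"
proof -
  have c: "0 \<le> c" using assms by simp
  have x2: "x\<^sup>2 \<le> c\<^sup>2" using assms by (metis abs_ge_zero power2_abs power_mono)
  have a: "6 * M\<^sup>2 * x\<^sup>2 \<le> 6 * M\<^sup>2 * c\<^sup>2"
    using x2 by (simp add: mult_left_mono)
  have x4: "x^4 \<le> c^4"
    using power_mono[OF x2, of 2] by simp
  have "4 * M * x^3 = 2 * x\<^sup>2 * (2 * (M * x))"
    by (simp add: power2_eq_square power3_eq_cube)
  also have "\<dots> \<le> 2 * x\<^sup>2 * (M\<^sup>2 + x\<^sup>2)"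
    using sum_squares_bound[of M x] by (intro mult_left_mono) auto
  also have "\<dots> \<le> 2 * c\<^sup>2 * M\<^sup>2 + 2 * c^4"
    using x4 mult_right_mono[OF x2, of "M\<^sup>2"] by (simp add: algebra_simps power2_eq_square power4_eq_xxxx)
  finally have b: "4 * M * x^3 \<le> 2 * c\<^sup>2 * M\<^sup>2 + 2 * c^4" .
  have "(M + x)^4 = M^4 + (4 * M^3) * x + 6 * M\<^sup>2 * x\<^sup>2 + 4 * M * x^3 + x^4"
    by (simp add: power4_eq_xxxx power2_eq_square power3_eq_cube algebra_simps)
  then show ?thesis using a b x4 by (simp add: algebra_simps)
qed

lemma EE_mart_power4:
  assumes "martingale_increments n a b \<xi> c" "a \<le> m" "m \<le> b"
  shows "EE n (\<lambda>\<sigma>. (mart \<xi> a m \<sigma>)^4) \<le> 7 * c^4 * (real (m - a))\<^sup>2"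
  using assms(2,3)
proof (induction m rule: dec_induct)
  case base
  then show ?case by simp
next
  case (step m)
  let ?l = "real (m - a)"
  have "EE n (\<lambda>\<sigma>. (mart \<xi> a (Suc m) \<sigma>)^4)
      \<le> EE n (\<lambda>\<sigma>. (mart \<xi> a m \<sigma>)^4 + (4 * (mart \<xi> a m \<sigma>)^3) * \<xi> m \<sigma> (\<sigma> (Suc m))
          + 8 * c\<^sup>2 * (mart \<xi> a m \<sigma>)\<^sup>2 + 3 * c^4)"
  proof (rule EE_mono)
    fix \<sigma> assume "\<sigma> permutes {1..n}"
    then have "\<bar>\<xi> m \<sigma> (\<sigma> (Suc m))\<bar> \<le> c"
      using step.prems by (intro martingale_increments_bound[OF assms(1) step.hyps(1)]) auto
    then show "(mart \<xi> a (Suc m) \<sigma>)^4 \<le> (mart \<xi> a m \<sigma>)^4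
         + (4 * (mart \<xi> a m \<sigma>)^3) * \<xi> m \<sigma> (\<sigma> (Suc m)) + 8 * c\<^sup>2 * (mart \<xi> a m \<sigma>)\<^sup>2 + 3 * c^4"
      unfolding mart_Suc[OF step(1)] by (rule power4_sum_le)
  qed
  also have "\<dots> = EE n (\<lambda>\<sigma>. (mart \<xi> a m \<sigma>)^4)
      + EE n (\<lambda>\<sigma>. (4 * (mart \<xi> a m \<sigma>)^3) * \<xi> m \<sigma> (\<sigma> (Suc m)))
      + 8 * c\<^sup>2 * EE n (\<lambda>\<sigma>. (mart \<xi> a m \<sigma>)\<^sup>2) + 3 * c^4"
    by (simp only: EE_add EE_cmult EE_const)
  also have "EE n (\<lambda>\<sigma>. (4 * (mart \<xi> a m \<sigma>)^3) * \<xi> m \<sigma> (\<sigma> (Suc m))) = 0"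
  proof -
    have "adapted n m (\<lambda>\<sigma>. 4 * (mart \<xi> a m \<sigma>)^3)"
      using step.prems by (intro adapted_comp[OF adapted_mart[OF assms(1) step.hyps(1)], where h="\<lambda>x. 4 * x^3"]) auto
    then show ?thesis
      using step.prems by (intro EE_orthogonal[OF assms(1) step.hyps(1)]) auto
  qed
  also have "EE n (\<lambda>\<sigma>. (mart \<xi> a m \<sigma>)^4) + 0 + 8 * c\<^sup>2 * EE n (\<lambda>\<sigma>. (mart \<xi> a m \<sigma>)\<^sup>2) + 3 * c^4
     \<le> 7 * c^4 * ?l\<^sup>2 + 0 + 8 * c\<^sup>2 * (c\<^sup>2 * ?l) + 3 * c^4"
    using step.prems step.IH EE_mart_square[OF assms(1) step.hyps(1)] by (intro add_mono mult_left_mono) auto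
  \<comment> \<open>With \<open>l = m - a\<close>, one step adds at most
    \<open>8 * c^4 * l + 3 * c^4\<close>, which is below \<open>7 * c^4 * (2 * l + 1)\<close>, the
    increment of the bound.\<close>
  also have "\<dots> \<le> 7 * c^4 * (?l + 1)\<^sup>2"
  proof -
    have "0 \<le> c^4 * (6 * ?l + 4)" by simp
    then show ?thesis by (simp add: power2_eq_square power4_eq_xxxx algebra_simps)
  qed
  finally show ?case using step.hyps(1) by (simp add: Suc_diff_le add.commute)
qed

text \<open>The sum is a martingale transform, so that it drops out in expectation.\<close>

lemma pathwise_doob4:
  fixes h :: "nat \<Rightarrow> real"
  assumes "h a = 0" "a \<le> b"
  defines "M \<equiv> \<lambda>i. Max (h ` {a..i})"
  shows "(M b)^4 / 2 \<le> (M b)^3 * h b - (\<Sum>i=a..<b. (M i)^3 * (h (Suc i) - h i))"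
  using assms(2)
proof (induction b rule: dec_induct)
  case base
  then show ?case using assms(1) by (simp add: M_def)
next
  case (step m)
  have "{a..Suc m} = insert (Suc m) {a..m}" using step by auto
  then have M: "M (Suc m) = max (h (Suc m)) (M m)"
    using step unfolding M_def by (simp add: Max_insert)
  have M0: "0 \<le> M m"
    unfolding M_def using step assms(1) by (intro Max_ge_iff[THEN iffD2]) (auto intro!: bexI[of _ a])
  show ?case
  proof (cases "h (Suc m) \<le> M m")
    case True
    then show ?thesis using step M by (simp add: algebra_simps)
  next
    case False
    \<comment> \<open>The maximum is renewed, from \<open>p\<close> to \<open>q\<close>. By the
      induction hypothesis it suffices that \<open>p^3 * q \<le> p^4 / 2 + q^4 / 2\<close>. When the
      maximum is not renewed, both sides of the claim are unchanged.\<close>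
    define p q where "p = M m" and "q = h (Suc m)"
    have pq: "0 \<le> p" "p < q" using False M0 by (auto simp: p_def q_def)
    have "p^3 * q = p\<^sup>2 * (p * q)" by (simp add: power2_eq_square power3_eq_cube)
    also have "\<dots> \<le> p\<^sup>2 * ((p\<^sup>2 + q\<^sup>2) / 2)"
      using sum_squares_bound[of p q] by (intro mult_left_mono) auto
    also have "\<dots> \<le> p^4 / 2 + q^4 / 2"
    proof -
      have "p\<^sup>2 * q\<^sup>2 \<le> q\<^sup>2 * q\<^sup>2"
        using pq by (intro mult_right_mono power_mono) auto
      then show ?thesis by (simp add: field_simps power2_eq_square power4_eq_xxxx)
    qed
    finally have "p^3 * q \<le> p^4 / 2 + q^4 / 2" .
    moreover have "M (Suc m) = q" using M False by (simp add: q_def)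
    ultimately show ?thesis
      using step by (simp add: p_def[symmetric] q_def[symmetric] algebra_simps power4_eq_xxxx power3_eq_cube)
  qed
qed

text \<open>Young's inequality with weight 1/4 on the maximum, small enough to be absorbed by the
  factor 1/2 in \<open>pathwise_doob4\<close>. The cut is at \<open>m = M / 4\<close>, and 64 is the
  cube of 4.\<close>

lemma cube_mult_le: 
  fixes M m :: real assumes "0 \<le> M" shows "M^3 * m \<le> M^4 / 4 + 64 * m^4"
proof (cases "m \<le> M / 4")
  case True
  have "M^3 * m \<le> M^3 * (M / 4)" using assms True by (intro mult_left_mono) auto
  also have "\<dots> = M^4 / 4" by (simp add: power4_eq_xxxx power3_eq_cube)
  finally show ?thesis by (simp add: add_increasing2)
next
  case False
  then have "M \<le> 4 * m" by simp
  then have "M^3 * m \<le> (4 * m)^3 * m" using assms False by (intro mult_right_mono power_mono) auto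
  also have "\<dots> = 64 * m^4" by (simp add: power4_eq_xxxx power3_eq_cube)
  finally show ?thesis by (simp add: add_increasing)
qed

text \<open>Expectation of \<open>pathwise_doob4\<close>: the transform has mean zero, and after
  absorption a quarter of the fourth moment of the maximum is at most 64 times that of the end
  value. The constant is 256 * 7.\<close>

lemma EE_Max_mart_power4:
  assumes mi: "martingale_increments n a b \<xi> c"
  shows "EE n (\<lambda>\<sigma>. (Max ((\<lambda>m. mart \<xi> a m \<sigma>) ` {a..b}))^4) \<le> 1792 * c^4 * (real (b - a))\<^sup>2"
proof -
  have ab: "a \<le> b" using mi by (simp add: martingale_increments_def)
  define M where "M = (\<lambda>i \<sigma>. Max ((\<lambda>m. mart \<xi> a m \<sigma>) ` {a..i}))"
  have M0: "0 \<le> M i \<sigma>" if "a \<le> i" for i \<sigma>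
    unfolding M_def using that by (intro Max_ge_iff[THEN iffD2]) (auto intro!: bexI[of _ a])
  have adM: "adapted n i (\<lambda>\<sigma>. (M i \<sigma>)^3)" if "a \<le> i" "i < b" for i
  proof -
    have "adapted n i (\<lambda>\<sigma>. mart \<xi> a m \<sigma>)" if "m \<in> {a..i}" for m
      using that \<open>i < b\<close> by (intro adapted_mono[OF adapted_mart[OF mi]]) auto
    then show ?thesis
      unfolding M_def adapted_def by (auto intro!: arg_cong[where f="\<lambda>x. Max x ^ 3"] image_cong)
  qed
  have "EE n (\<lambda>\<sigma>. (M b \<sigma>)^4 / 2)
     \<le> EE n (\<lambda>\<sigma>. (M b \<sigma>)^3 * mart \<xi> a b \<sigma> - (\<Sum>i=a..<b. (M i \<sigma>)^3 * \<xi> i \<sigma> (\<sigma> (Suc i))))"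
  proof (rule EE_mono)
    fix \<sigma> :: "nat \<Rightarrow> nat"
    have "(\<Sum>i=a..<b. (M i \<sigma>)^3 * (mart \<xi> a (Suc i) \<sigma> - mart \<xi> a i \<sigma>))
        = (\<Sum>i=a..<b. (M i \<sigma>)^3 * \<xi> i \<sigma> (\<sigma> (Suc i)))"
      by (intro sum.cong) (auto simp: mart_Suc)
    then show "(M b \<sigma>)^4 / 2
       \<le> (M b \<sigma>)^3 * mart \<xi> a b \<sigma> - (\<Sum>i=a..<b. (M i \<sigma>)^3 * \<xi> i \<sigma> (\<sigma> (Suc i)))"
      using pathwise_doob4[of "\<lambda>m. mart \<xi> a m \<sigma>" a b] ab by (simp add: M_def)
  qed
  also have "\<dots> = EE n (\<lambda>\<sigma>. (M b \<sigma>)^3 * mart \<xi> a b \<sigma>) - (\<Sum>i=a..<b. EE n (\<lambda>\<sigma>. (M i \<sigma>)^3 * \<xi> i \<sigma> (\<sigma> (Suc i))))"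
    by (simp add: EE_diff EE_sum)
  also have "(\<Sum>i=a..<b. EE n (\<lambda>\<sigma>. (M i \<sigma>)^3 * \<xi> i \<sigma> (\<sigma> (Suc i)))) = 0"
    by (rule sum.neutral) (auto intro!: EE_orthogonal[OF mi] adM)
  also have "EE n (\<lambda>\<sigma>. (M b \<sigma>)^3 * mart \<xi> a b \<sigma>) - 0
     \<le> EE n (\<lambda>\<sigma>. (M b \<sigma>)^4 / 4 + 64 * (mart \<xi> a b \<sigma>)^4)"
    using M0[OF ab] by (simp add: EE_mono cube_mult_le)
  also have "\<dots> = EE n (\<lambda>\<sigma>. (M b \<sigma>)^4) / 4 + 64 * EE n (\<lambda>\<sigma>. (mart \<xi> a b \<sigma>)^4)"
    by (simp add: EE_add EE_divide EE_cmult)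
  finally have "EE n (\<lambda>\<sigma>. (M b \<sigma>)^4) \<le> 256 * EE n (\<lambda>\<sigma>. (mart \<xi> a b \<sigma>)^4)"
    by (simp add: EE_divide)
  also have "\<dots> \<le> 256 * (7 * c^4 * (real (b - a))\<^sup>2)"
    using EE_mart_power4[OF mi ab] by simp
  finally show ?thesis by (simp add: M_def)
qed

lemma martingale_increments_uminus:
  "martingale_increments n a b \<xi> c \<Longrightarrow> martingale_increments n a b (\<lambda>i \<sigma> x. - \<xi> i \<sigma> x) c"
  unfolding martingale_increments_def adapted_def by (auto simp: sum_negf fun_eq_iff)

text \<open>The largest modulus is attained by the martingale or by its negative, hence twice the
  constant.\<close>

lemma EE_Max_abs_mart_power4:
  assumes mi: "martingale_increments n a b \<xi> c"
  shows "EE n (\<lambda>\<sigma>. (Max ((\<lambda>m. \<bar>mart \<xi> a m \<sigma>\<bar>) ` {a..b}))^4) \<le> 3584 * c^4 * (real (b - a))\<^sup>2"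
proof -
  have ab: "a \<le> b" using mi by (simp add: martingale_increments_def)
  let ?P = "\<lambda>\<sigma>. Max ((\<lambda>m. mart \<xi> a m \<sigma>) ` {a..b})"
  let ?Q = "\<lambda>\<sigma>. Max ((\<lambda>m. mart (\<lambda>i \<sigma> x. - \<xi> i \<sigma> x) a m \<sigma>) ` {a..b})"
  have m: "mart (\<lambda>i \<sigma> x. - \<xi> i \<sigma> x) a m \<sigma> = - mart \<xi> a m \<sigma>" for m \<sigma>
    by (simp add: mart_def sum_negf)
  have "EE n (\<lambda>\<sigma>. (Max ((\<lambda>m. \<bar>mart \<xi> a m \<sigma>\<bar>) ` {a..b}))^4) \<le> EE n (\<lambda>\<sigma>. (?P \<sigma>)^4 + (?Q \<sigma>)^4)"
  proof (rule EE_mono)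
    fix \<sigma> :: "nat \<Rightarrow> nat"
    have "Max ((\<lambda>m. \<bar>mart \<xi> a m \<sigma>\<bar>) ` {a..b}) \<in> (\<lambda>m. \<bar>mart \<xi> a m \<sigma>\<bar>) ` {a..b}"
      using ab by (intro Max_in) auto
    then obtain m where m': "m \<in> {a..b}" "Max ((\<lambda>m. \<bar>mart \<xi> a m \<sigma>\<bar>) ` {a..b}) = \<bar>mart \<xi> a m \<sigma>\<bar>"
      by auto
    have P: "mart \<xi> a m \<sigma> \<le> ?P \<sigma>" using m' by (intro Max_ge) auto
    have Q: "- mart \<xi> a m \<sigma> \<le> ?Q \<sigma>" using m' by (intro Max_ge) (auto simp: m)
    show "(Max ((\<lambda>m. \<bar>mart \<xi> a m \<sigma>\<bar>) ` {a..b}))^4 \<le> (?P \<sigma>)^4 + (?Q \<sigma>)^4"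
    proof (cases "0 \<le> mart \<xi> a m \<sigma>")
      case True
      then have "\<bar>mart \<xi> a m \<sigma>\<bar>^4 \<le> (?P \<sigma>)^4" using P by (intro power_mono) auto
      then show ?thesis using m' by (simp add: add_increasing2)
    next
      case False
      then have "\<bar>mart \<xi> a m \<sigma>\<bar>^4 \<le> (?Q \<sigma>)^4" using Q by (intro power_mono) auto
      then show ?thesis using m' by (simp add: add_increasing)
    qed
  qed
  also have "\<dots> \<le> 1792 * c^4 * (real (b - a))\<^sup>2 + 1792 * c^4 * (real (b - a))\<^sup>2"
    unfolding EE_add
    by (intro add_mono EE_Max_mart_power4 mi martingale_increments_uminus)
  finally show ?thesis by simp
qed

section \<open>Run counts\<close>

lemma sum_cyc_shift: "n \<ge> 1 \<Longrightarrow> (\<Sum>k=1..n. \<phi> (cyc n (k + a))) = (\<Sum>k=1..n. \<phi> k)"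
  using sum.reindex_bij_betw[OF bij_betw_cyc_base, of n \<phi> a] by simp

lemma pos_cyc: "n \<ge> 1 \<Longrightarrow> pos n A (cyc n k) = pos n A k"
  by (simp add: pos_def cyc_cyc_add)

text \<open>A placement that contains the position \<open>k + 2\<close> at offset \<open>a\<close>
  starts at \<open>k + 2 - a\<close>. The shift by 2, with \<open>a \<le> 2\<close>, keeps the
  subtraction exact.\<close>

lemma cnt_diff_local:
  assumes n: "n \<ge> 3" and A: "A \<subseteq> {..2}" and k: "k \<in> {1..n}"
  shows "cnt n A Z - cnt n A (Z - {cyc n (k + 2)}) = (\<Sum>a\<in>A. of_bool (pos n A (k + 2 - a) \<subseteq> Z))"
proof -
  let ?x = "cyc n (k + 2)"
  have fA: "finite A" using A finite_subset by blast
  have n1: "n \<ge> 1" using n by simp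
  have "cnt n A Z - cnt n A (Z - {?x}) = (\<Sum>l=1..n. of_bool (pos n A l \<subseteq> Z) * of_bool (?x \<in> pos n A l))"
    unfolding cnt_diff by (intro sum.mono_neutral_cong_left) auto
  also have "\<dots> = (\<Sum>l=1..n. \<Sum>a\<in>A. of_bool (pos n A l \<subseteq> Z) * of_bool (cyc n (l + a) = ?x))"
  proof (rule sum.cong[OF refl])
    fix l assume l: "l \<in> {1..n}"
    have inj: "inj_on (\<lambda>a. cyc n (l + a)) A"
      using l n A by (intro inj_on_cyc_offset) (auto simp: subset_eq)
    have "(\<Sum>a\<in>A. of_bool (cyc n (l + a) = ?x)) = (\<Sum>y\<in>pos n A l. of_bool (y = ?x) :: real)"
      unfolding pos_def by (subst sum.reindex[OF inj]) simp
    also have "\<dots> = of_bool (?x \<in> pos n A l)"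
      using fA by (simp add: pos_def of_bool_def)
    finally show "of_bool (pos n A l \<subseteq> Z) * of_bool (?x \<in> pos n A l)
        = (\<Sum>a\<in>A. of_bool (pos n A l \<subseteq> Z) * of_bool (cyc n (l + a) = ?x) :: real)"
      by (simp only: sum_distrib_left[symmetric])
  qed
  also have "\<dots> = (\<Sum>a\<in>A. \<Sum>l=1..n. of_bool (pos n A l \<subseteq> Z) * of_bool (cyc n (l + a) = ?x))"
    by (rule sum.swap)
  also have "\<dots> = (\<Sum>a\<in>A. of_bool (pos n A (k + 2 - a) \<subseteq> Z))"
  proof (rule sum.cong[OF refl])
    fix a assume "a \<in> A"
    then have a: "a \<le> 2" using A by auto
    let ?l = "cyc n (k + 2 - a)"
    have l: "?l \<in> {1..n}" using n by (intro cyc_in) auto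
    have "cyc n (?l + a) = ?x"
      using a n1 by (simp add: cyc_cyc_add)
    then have iff: "cyc n (l + a) = ?x \<longleftrightarrow> l = ?l" if "l \<in> {1..n}" for l
      using inj_onD[OF inj_on_cyc_base[OF n1, of a] _ that l] by auto
    have "(\<Sum>l=1..n. of_bool (pos n A l \<subseteq> Z) * of_bool (cyc n (l + a) = ?x))
        = (\<Sum>l=1..n. if l = ?l then of_bool (pos n A l \<subseteq> Z) else (0::real))"
      by (intro sum.cong refl) (simp add: iff of_bool_def)
    also have "\<dots> = of_bool (pos n A ?l \<subseteq> Z)"
      using l by simp
    finally show "(\<Sum>l=1..n. of_bool (pos n A l \<subseteq> Z) * of_bool (cyc n (l + a) = ?x))
        = (of_bool (pos n A (k + 2 - a) \<subseteq> Z) :: real)"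
      by (simp add: pos_cyc[OF n1])
  qed
  finally show ?thesis .
qed

definition zi :: "nat \<Rightarrow> nat set \<Rightarrow> nat \<Rightarrow> real" where
  "zi n Z k = of_bool (cyc n k \<in> Z)"

lemma cnt_eq_sum: "finite A \<Longrightarrow> cnt n A Z = (\<Sum>k=1..n. \<Prod>a\<in>A. zi n Z (k + a))"
proof -
  assume A: "finite A"
  have "(\<Prod>a\<in>A. zi n Z (k + a)) = of_bool (pos n A k \<subseteq> Z)" for k
    unfolding zi_def pos_def using A by (auto simp: of_bool_def prod_zero_iff intro!: prod.neutral)
  then have "(\<Sum>k=1..n. \<Prod>a\<in>A. zi n Z (k + a)) = (\<Sum>k=1..n. of_bool (pos n A k \<subseteq> Z))"
    by simp
  also have "\<dots> = real (card ({1..n} \<inter> {k. pos n A k \<subseteq> Z}))"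
    by (subst sum_of_bool_eq) auto
  also have "{1..n} \<inter> {k. pos n A k \<subseteq> Z} = {k \<in> {1..n}. pos n A k \<subseteq> Z}" by auto
  finally show ?thesis by (simp add: cnt_def)
qed

definition runs :: "nat \<Rightarrow> nat set \<Rightarrow> real" where
  "runs n Z = cnt n {0,2} Z - cnt n {0,1,2} Z"

text \<open>\<open>1 - I\<close> is the indicator \<open>z\<close> of a remaining zero, and
  \<open>z * (1 - z') * z'' = z * z'' - z * z' * z''\<close> for three neighbours.\<close>

lemma X1_eq_runs:
  assumes "\<sigma> permutes {1..n}" "n \<ge> 1"
  shows "real_of_int (X1 n \<sigma> m) = runs n (zeros n \<sigma> m)"
proof -
  have I: "real_of_int (I n \<sigma> m k) = 1 - zi n (zeros n \<sigma> m) k" for k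
  proof -
    let ?y = "cyc n k"
    have y: "?y \<in> {1..n}" using cyc_in assms(2) by blast
    have "?y \<in> zeros n \<sigma> m \<longleftrightarrow> \<not> inv \<sigma> ?y \<le> m"
    proof
      assume "?y \<in> zeros n \<sigma> m"
      then obtain j where "j \<in> {Suc m..n}" "?y = \<sigma> j" by (auto simp: zeros_def)
      then show "\<not> inv \<sigma> ?y \<le> m" using permutes_inverses(2)[OF assms(1)] by simp
    next
      assume "\<not> inv \<sigma> ?y \<le> m"
      moreover have "inv \<sigma> ?y \<in> {1..n}"
        using y permutes_in_image[OF permutes_inv[OF assms(1)]] by blast
      moreover have "?y = \<sigma> (inv \<sigma> ?y)"
        using permutes_inverses(1)[OF assms(1)] by simp
      ultimately show "?y \<in> zeros n \<sigma> m"
        unfolding zeros_def by (intro image_eqI[of _ _ "inv \<sigma> ?y"]) auto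
    qed
    then show ?thesis by (simp add: I_def zi_def)
  qed
  show ?thesis
    unfolding X1_def runs_def
    by (simp add: I cnt_eq_sum sum_subtractf[symmetric] algebra_simps)
qed

text \<open>The loss when the zero at \<open>k + 2\<close> is removed, in terms of its four neighbours.\<close>

definition local_drop :: "nat \<Rightarrow> nat set \<Rightarrow> nat \<Rightarrow> real" where
  "local_drop n Z k = zi n Z k + zi n Z (k + 4) - zi n Z k * zi n Z (k + 1)
     - zi n Z (k + 1) * zi n Z (k + 3) - zi n Z (k + 3) * zi n Z (k + 4)"

lemma runs_remove:
  assumes n: "n \<ge> 3" and k: "k \<in> {1..n}" and x: "cyc n (k + 2) \<in> Z"
  shows "runs n (Z - {cyc n (k + 2)}) - runs n Z = - local_drop n Z k"
proof -
  have two: "(\<Sum>a\<in>{0,2}. g a) = g 0 + g 2" for g :: "nat \<Rightarrow> real" by simp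
  have three: "(\<Sum>a\<in>{0,1,2}. g a) = g 0 + (g 1 + g 2)" for g :: "nat \<Rightarrow> real" by simp
  have "cnt n {0,2} Z - cnt n {0,2} (Z - {cyc n (k + 2)}) = zi n Z (k + 4) + zi n Z k"
    using x by (subst cnt_diff_local[OF n _ k], simp, subst two) (simp add: pos_def zi_def add.commute)
  moreover have "cnt n {0,1,2} Z - cnt n {0,1,2} (Z - {cyc n (k + 2)})
     = zi n Z (k + 3) * zi n Z (k + 4) + zi n Z (k + 1) * zi n Z (k + 3) + zi n Z k * zi n Z (k + 1)"
  proof -
    have e: "k + 2 - 0 = k + 2" "k + 2 - 1 = k + 1" "k + 2 - 2 = k" by simp_all
    have p: "pos n {0,1,2} (k + 2) = {cyc n (k + 2), cyc n (k + 3), cyc n (k + 4)}"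
      "pos n {0,1,2} (k + 1) = {cyc n (k + 1), cyc n (k + 2), cyc n (k + 3)}"
      "pos n {0,1,2} k = {cyc n k, cyc n (k + 1), cyc n (k + 2)}"
      by (simp_all add: pos_def One_nat_def numeral_eq_Suc)
    show ?thesis
      using x by (subst cnt_diff_local[OF n _ k], simp, subst three) (simp only: e p, simp add: zi_def)
  qed
  ultimately show ?thesis
    unfolding runs_def local_drop_def by simp
qed

text \<open>This makes the conditional second moment of an increment a combination of pattern counts
  with offsets at most 4, to which the formulas for means and variances apply.\<close>

lemma sum_runs_remove_square:
  assumes n: "n \<ge> 3" and Z: "Z \<subseteq> {1..n}"
  shows "(\<Sum>x\<in>Z. (runs n (Z - {x}) - runs n Z)\<^sup>2)
    = cnt n {0,2} Z + cnt n {2,4} Z - cnt n {0,1,2} Z - cnt n {2,3,4} Z + cnt n {1,2,3} Z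
      + 2 * cnt n {0,2,4} Z - 2 * cnt n {0,2,3,4} Z - 2 * cnt n {0,1,2,4} Z + 2 * cnt n {0,1,2,3,4} Z"
proof -
  let ?\<phi> = "\<lambda>x. (runs n (Z - {x}) - runs n Z)\<^sup>2"
  have n1: "n \<ge> 1" using n by simp
  have "(\<Sum>x\<in>Z. ?\<phi> x) = (\<Sum>x=1..n. of_bool (x \<in> Z) * ?\<phi> x)"
    using Z by (intro sum.mono_neutral_cong_left) auto
  also have "\<dots> = (\<Sum>k=1..n. of_bool (cyc n (k + 2) \<in> Z) * ?\<phi> (cyc n (k + 2)))"
    using sum_cyc_shift[OF n1, of "\<lambda>x. of_bool (x \<in> Z) * ?\<phi> x" 2] by simp
  also have "\<dots> = (\<Sum>k=1..n. zi n Z (k + 2) * (local_drop n Z k)\<^sup>2)"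
  proof (rule sum.cong[OF refl])
    fix k assume k: "k \<in> {1..n}"
    show "of_bool (cyc n (k + 2) \<in> Z) * ?\<phi> (cyc n (k + 2)) = zi n Z (k + 2) * (local_drop n Z k)\<^sup>2"
    proof (cases "cyc n (k + 2) \<in> Z")
      case True
      show ?thesis unfolding runs_remove[OF n k True] by (simp add: zi_def)
    qed (simp add: zi_def)
  qed
  \<comment> \<open>Indicators equal their squares, so the square of \<open>local_drop\<close>
    collapses to a sum of products of indicators. The identity is checked on all values of the five
    indicators.\<close>
  also have "\<dots> = (\<Sum>k=1..n.
       zi n Z k * zi n Z (k+2) + zi n Z (k+2) * zi n Z (k+4) - zi n Z k * (zi n Z (k+1) * zi n Z (k+2))
     - zi n Z (k+2) * (zi n Z (k+3) * zi n Z (k+4)) + zi n Z (k+1) * (zi n Z (k+2) * zi n Z (k+3))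
     + 2 * (zi n Z k * (zi n Z (k+2) * zi n Z (k+4)))
     - 2 * (zi n Z k * (zi n Z (k+2) * (zi n Z (k+3) * zi n Z (k+4))))
     - 2 * (zi n Z k * (zi n Z (k+1) * (zi n Z (k+2) * zi n Z (k+4))))
     + 2 * (zi n Z k * (zi n Z (k+1) * (zi n Z (k+2) * (zi n Z (k+3) * zi n Z (k+4))))))"
    unfolding local_drop_def zi_def
    by (intro sum.cong refl) (auto simp: of_bool_def)
  finally show ?thesis
    by (simp add: cnt_eq_sum sum.distrib sum_subtractf sum_distrib_left)
qed

section \<open>Means and variances of pattern counts\<close>

lemma EE_cnt_Suc:
  assumes "n \<ge> 1" "A \<subseteq> {..<n}" "m < n"
  shows "EE n (\<lambda>\<sigma>. cnt n A (zeros n \<sigma> (Suc m)))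
    = (1 - real (card A) / real (n - m)) * EE n (\<lambda>\<sigma>. cnt n A (zeros n \<sigma> m))"
proof -
  have ad: "adapted n m (\<lambda>\<sigma> x. cnt n A (zeros n \<sigma> m - {x}))"
    by (rule adapted_comp[OF adapted_zeros[OF order_refl], where h="\<lambda>Z x. cnt n A (Z - {x})"])
  have "EE n (\<lambda>\<sigma>. cnt n A (zeros n \<sigma> (Suc m))) = EE n (\<lambda>\<sigma>. cnt n A (zeros n \<sigma> m - {\<sigma> (Suc m)}))"
    by (rule EE_cong) (simp add: zeros_Suc assms)
  also have "\<dots> = EE n (\<lambda>\<sigma>. (\<Sum>x\<in>zeros n \<sigma> m. cnt n A (zeros n \<sigma> m - {x})) / real (n - m))"
    by (rule EE_one_step[OF ad assms(3)])
  also have "\<dots> = EE n (\<lambda>\<sigma>. (1 - real (card A) / real (n - m)) * cnt n A (zeros n \<sigma> m))"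
  proof (rule EE_cong)
    fix \<sigma> assume s: "\<sigma> permutes {1..n}"
    let ?Z = "zeros n \<sigma> m"
    have "(\<Sum>x\<in>?Z. cnt n A (?Z - {x})) = (\<Sum>x\<in>?Z. cnt n A ?Z) - (\<Sum>x\<in>?Z. cnt n A ?Z - cnt n A (?Z - {x}))"
      by (simp only: sum_subtractf[symmetric]) simp
    also have "\<dots> = real (n - m) * cnt n A ?Z - real (card A) * cnt n A ?Z"
      using sum_cnt_diff[OF assms(1,2) zeros_subset[OF s]] by (simp add: card_zeros[OF s])
    finally have "(\<Sum>x\<in>?Z. cnt n A (?Z - {x})) / real (n - m)
        = (real (n - m) * cnt n A ?Z - real (card A) * cnt n A ?Z) / real (n - m)" by simp
    also have "\<dots> = (1 - real (card A) / real (n - m)) * cnt n A ?Z"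
      using assms(3) by (simp add: field_simps del: of_nat_diff)
    finally show "(\<Sum>x\<in>?Z. cnt n A (?Z - {x})) / real (n - m)
        = (1 - real (card A) / real (n - m)) * cnt n A ?Z" .
  qed
  finally show ?thesis by (simp add: EE_cmult)
qed

text \<open>Passing from \<open>w\<close> to \<open>w - 1\<close> zeros exchanges an end factor of
  the falling factorial; this matches the factor \<open>1 - q / w\<close> in the recursion for the
  mean.\<close>

lemma falling_step: "(w - real q) * (\<Prod>i<q. w - real i) = w * (\<Prod>i<q. w - 1 - real i)"
proof (induction q)
  case (Suc q)
  have "(w - real (Suc q)) * (\<Prod>i<Suc q. w - real i) = (w - real (Suc q)) * ((w - real q) * (\<Prod>i<q. w - real i))"
    by simp
  also have "\<dots> = (w - real (Suc q)) * (w * (\<Prod>i<q. w - 1 - real i))"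
    by (simp only: Suc)
  finally show ?case by (simp add: algebra_simps)
qed simp

text \<open>A placement occupies \<open>card A\<close> distinct positions, and the product is the
  probability that all of them are among the \<open>n - m\<close> zeros.\<close>

lemma EE_cnt:
  assumes "n \<ge> 1" "A \<subseteq> {..<n}" "m \<le> n"
  shows "EE n (\<lambda>\<sigma>. cnt n A (zeros n \<sigma> m))
    = real n * (\<Prod>i<card A. (real (n - m) - real i) / (real n - real i))"
  using assms(3)
proof (induction m)
  case 0
  have q: "card A \<le> n" using card_mono[of "{..<n}" A] assms(2) by simp
  have "cnt n A {1..n} = real n"
  proof -
    have "{k \<in> {1..n}. pos n A k \<subseteq> {1..n}} = {1..n}"
      using cyc_in[OF assms(1)] by (auto simp: pos_def)
    then show ?thesis by (simp add: cnt_def)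
  qed
  then have "EE n (\<lambda>\<sigma>. cnt n A (zeros n \<sigma> 0)) = EE n (\<lambda>\<sigma>. real n)"
    by (intro EE_cong) (simp add: zeros_0)
  moreover have "(\<Prod>i<card A. (real (n - 0) - real i) / (real n - real i)) = 1"
    using q by (intro prod.neutral) auto
  ultimately show ?case by simp
next
  case (Suc m)
  let ?w = "real (n - m)"
  have w: "?w \<noteq> 0" "real (n - Suc m) = ?w - 1" using Suc.prems by (auto simp: of_nat_diff)
  have "EE n (\<lambda>\<sigma>. cnt n A (zeros n \<sigma> (Suc m)))
     = (1 - real (card A) / ?w) * (real n * (\<Prod>i<card A. (?w - real i) / (real n - real i)))"
    using Suc by (subst EE_cnt_Suc[OF assms(1,2)]) auto
  also have "\<dots> = real n * (((?w - real (card A)) * (\<Prod>i<card A. (?w - real i))) / ?w / (\<Prod>i<card A. (real n - real i)))"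
    using w by (simp add: prod_dividef field_simps del: of_nat_diff)
  also have "\<dots> = real n * ((\<Prod>i<card A. ?w - 1 - real i) / (\<Prod>i<card A. (real n - real i)))"
    unfolding falling_step using w by simp
  finally show ?case by (simp add: w(2) prod_dividef)
qed

lemma sum_cnt_centered:
  assumes "n \<ge> 1" "A \<subseteq> {..<n}" "Z \<subseteq> {1..n}" "Z \<noteq> {}"
  shows "(\<Sum>x\<in>Z. cnt n A (Z - {x}) - (1 - real (card A) / real (card Z)) * cnt n A Z) = 0"
proof -
  have fZ: "finite Z" using assms(3) finite_subset by blast
  then have c: "real (card Z) \<noteq> 0" using assms(4) by simp
  have "(\<Sum>x\<in>Z. cnt n A (Z - {x}) - (1 - real (card A) / real (card Z)) * cnt n A Z)
    = (\<Sum>x\<in>Z. real (card A) / real (card Z) * cnt n A Z - (cnt n A Z - cnt n A (Z - {x})))"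
    by (intro sum.cong) (auto simp: algebra_simps)
  also have "\<dots> = real (card Z) * (real (card A) / real (card Z) * cnt n A Z) - real (card A) * cnt n A Z"
    using sum_cnt_diff[OF assms(1-3)] by (subst sum_subtractf) simp
  finally show ?thesis using c by simp
qed

text \<open>In one step the deviation from the mean is multiplied by
  \<open>\<alpha> = 1 - q / w\<close> and receives a conditionally centred perturbation of size at
  most \<open>q\<close>. While at least \<open>q\<close> zeros remain, \<open>\<alpha>\<close> lies
  between 0 and 1, so each step adds at most \<open>q^2\<close> to the variance.\<close>

lemma EE_cnt_variance:
  assumes "n \<ge> 1" "A \<subseteq> {..<n}" "A \<noteq> {}" "m + card A \<le> n"
  shows "EE n (\<lambda>\<sigma>. (cnt n A (zeros n \<sigma> m) - EE n (\<lambda>\<sigma>. cnt n A (zeros n \<sigma> m)))\<^sup>2) \<le> (real (card A))\<^sup>2 * real m"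
  using assms(4)
proof (induction m)
  case 0
  have "EE n (\<lambda>\<sigma>. cnt n A (zeros n \<sigma> 0)) = EE n (\<lambda>\<sigma>. cnt n A {1..n})"
    by (rule EE_cong) (simp add: zeros_0)
  then have "EE n (\<lambda>\<sigma>. (cnt n A (zeros n \<sigma> 0) - EE n (\<lambda>\<sigma>. cnt n A (zeros n \<sigma> 0)))\<^sup>2) = EE n (\<lambda>\<sigma>. 0)"
    by (intro EE_cong) (simp add: zeros_0)
  then show ?case by simp
next
  case (Suc m)
  define q where "q = real (card A)"
  define w where "w = real (n - m)"
  define \<mu> where "\<mu> = EE n (\<lambda>\<sigma>. cnt n A (zeros n \<sigma> m))"
  define \<alpha> where "\<alpha> = 1 - q / w"
  have fA: "finite A" using assms(2) finite_subset by blast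
  have mn: "m < n" and qw: "q \<le> w" using Suc.prems by (auto simp: q_def w_def)
  have w0: "w > 0" using mn by (simp add: w_def)
  have \<alpha>: "0 \<le> \<alpha>" "\<alpha> \<le> 1" using qw w0 by (auto simp: \<alpha>_def q_def)
  have \<mu>': "EE n (\<lambda>\<sigma>. cnt n A (zeros n \<sigma> (Suc m))) = \<alpha> * \<mu>"
    unfolding \<alpha>_def q_def w_def \<mu>_def by (rule EE_cnt_Suc[OF assms(1,2) mn])
  have ad: "adapted n m (\<lambda>\<sigma> x. (cnt n A (zeros n \<sigma> m - {x}) - \<alpha> * \<mu>)\<^sup>2)"
    by (rule adapted_comp[OF adapted_zeros[OF order_refl], where h="\<lambda>Z x. (cnt n A (Z - {x}) - \<alpha> * \<mu>)\<^sup>2"])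
  have "EE n (\<lambda>\<sigma>. (cnt n A (zeros n \<sigma> (Suc m)) - \<alpha> * \<mu>)\<^sup>2)
      = EE n (\<lambda>\<sigma>. (cnt n A (zeros n \<sigma> m - {\<sigma> (Suc m)}) - \<alpha> * \<mu>)\<^sup>2)"
    by (rule EE_cong) (simp add: zeros_Suc mn)
  also have "\<dots> = EE n (\<lambda>\<sigma>. (\<Sum>x\<in>zeros n \<sigma> m. (cnt n A (zeros n \<sigma> m - {x}) - \<alpha> * \<mu>)\<^sup>2) / w)"
    unfolding w_def by (rule EE_one_step[OF ad mn])
  also have "\<dots> \<le> EE n (\<lambda>\<sigma>. (cnt n A (zeros n \<sigma> m) - \<mu>)\<^sup>2 + q\<^sup>2)"
  proof (rule EE_mono)
    fix \<sigma> assume s: "\<sigma> permutes {1..n}"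
    define Z where "Z = zeros n \<sigma> m"
    define \<xi> where "\<xi> = (\<lambda>x. cnt n A (Z - {x}) - \<alpha> * cnt n A Z)"
    define D where "D = cnt n A Z - \<mu>"
    have cZ: "real (card Z) = w" unfolding Z_def w_def by (simp add: card_zeros[OF s])
    have zeros: "Z \<subseteq> {1..n}" "Z \<noteq> {}" using zeros_subset[OF s] cZ w0 unfolding Z_def by auto
    have s0: "(\<Sum>x\<in>Z. \<xi> x) = 0"
      using sum_cnt_centered[OF assms(1,2) zeros] by (simp add: \<xi>_def \<alpha>_def q_def cZ)
    \<comment> \<open>Both the actual loss and its conditional mean \<open>q / w * cnt n A Z\<close>
      lie between 0 and \<open>q\<close>.\<close>
    have b: "(\<xi> x)\<^sup>2 \<le> q\<^sup>2" for x
    proof -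
      have "cnt n A Z \<le> w" using cnt_le_card[OF assms(1,3), of Z] cZ by (simp add: Z_def)
      then have "0 \<le> q / w * cnt n A Z" "q / w * cnt n A Z \<le> q / w * w"
        using w0 by (simp add: cnt_nonneg q_def, intro mult_left_mono) (auto simp: q_def)
      moreover have "\<xi> x = q / w * cnt n A Z - (cnt n A Z - cnt n A (Z - {x}))"
        by (simp add: \<xi>_def \<alpha>_def algebra_simps)
      moreover have "0 \<le> cnt n A Z - cnt n A (Z - {x})" "cnt n A Z - cnt n A (Z - {x}) \<le> q"
        unfolding q_def by (rule cnt_diff_nonneg, rule cnt_diff_le[OF assms(1) fA])
      ultimately have "\<bar>\<xi> x\<bar> \<le> q" using w0 by simp
      then show ?thesis by (metis abs_ge_zero power2_abs power_mono)
    qed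
    have "(\<Sum>x\<in>Z. (cnt n A (Z - {x}) - \<alpha> * \<mu>)\<^sup>2) = (\<Sum>x\<in>Z. \<alpha>\<^sup>2 * D\<^sup>2 + 2 * \<alpha> * D * \<xi> x + (\<xi> x)\<^sup>2)"
      by (intro sum.cong) (auto simp: D_def \<xi>_def power2_eq_square algebra_simps)
    also have "\<dots> = w * (\<alpha>\<^sup>2 * D\<^sup>2) + (\<Sum>x\<in>Z. (\<xi> x)\<^sup>2)"
      using s0 by (simp add: sum.distrib cZ sum_distrib_left[symmetric])
    also have "\<dots> \<le> w * (1 * D\<^sup>2) + (\<Sum>x\<in>Z. q\<^sup>2)"
      using b w0 \<alpha> by (intro add_mono mult_left_mono mult_right_mono sum_mono power_le_one) auto
    also have "\<dots> = w * (D\<^sup>2 + q\<^sup>2)" using cZ by (simp add: algebra_simps)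
    finally have "(\<Sum>x\<in>Z. (cnt n A (Z - {x}) - \<alpha> * \<mu>)\<^sup>2) / w \<le> D\<^sup>2 + q\<^sup>2"
      using w0 by (simp add: pos_divide_le_eq mult.commute)
    then show "(\<Sum>x\<in>zeros n \<sigma> m. (cnt n A (zeros n \<sigma> m - {x}) - \<alpha> * \<mu>)\<^sup>2) / w \<le> (cnt n A (zeros n \<sigma> m) - \<mu>)\<^sup>2 + q\<^sup>2"
      by (simp add: D_def Z_def)
  qed
  also have "\<dots> \<le> q\<^sup>2 * real m + q\<^sup>2"
    using Suc by (simp add: EE_add \<mu>_def q_def)
  finally show ?case by (simp add: \<mu>' q_def algebra_simps)
qed

text \<open>The conditional mean of the next increment of the run count.\<close>

definition drift :: "nat \<Rightarrow> nat set \<Rightarrow> real" where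
  "drift n Z = (3 * cnt n {0,1,2} Z - 2 * cnt n {0,2} Z) / real (card Z)"

definition innovation :: "nat \<Rightarrow> nat \<Rightarrow> (nat \<Rightarrow> nat) \<Rightarrow> nat \<Rightarrow> real" where
  "innovation n i \<sigma> x = runs n (zeros n \<sigma> i - {x}) - runs n (zeros n \<sigma> i) - drift n (zeros n \<sigma> i)"

lemma sum_runs_remove:
  assumes "n \<ge> 3" "Z \<subseteq> {1..n}"
  shows "(\<Sum>x\<in>Z. runs n (Z - {x}) - runs n Z) = 3 * cnt n {0,1,2} Z - 2 * cnt n {0,2} Z"
proof -
  have "(\<Sum>x\<in>Z. runs n (Z - {x}) - runs n Z)
    = (\<Sum>x\<in>Z. cnt n {0,1,2} Z - cnt n {0,1,2} (Z - {x})) - (\<Sum>x\<in>Z. cnt n {0,2} Z - cnt n {0,2} (Z - {x}))"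
    unfolding runs_def sum_subtractf[symmetric] by (intro sum.cong) auto
  then show ?thesis
    using sum_cnt_diff[of n "{0,1,2}" Z] sum_cnt_diff[of n "{0,2}" Z] assms by simp
qed

lemma abs_drift_le:
  assumes "n \<ge> 1" "finite Z" shows "\<bar>drift n Z\<bar> \<le> 3"
proof (cases "card Z = 0")
  case False
  have "cnt n {0,1,2} Z \<le> real (card Z)" "cnt n {0,2} Z \<le> real (card Z)"
    using assms by (auto intro!: cnt_le_card)
  moreover have "0 \<le> cnt n {0,1,2} Z" "0 \<le> cnt n {0,2} Z" by (rule cnt_nonneg)+
  ultimately have "\<bar>3 * cnt n {0,1,2} Z - 2 * cnt n {0,2} Z\<bar> \<le> 3 * real (card Z)" by linarith
  then show ?thesis using False by (simp add: drift_def abs_divide pos_divide_le_eq)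
qed (simp add: drift_def)

lemma abs_runs_remove_le:
  assumes "n \<ge> 1" shows "\<bar>runs n (Z - {x}) - runs n Z\<bar> \<le> 3"
proof -
  have "cnt n {0,1,2} Z - cnt n {0,1,2} (Z - {x}) \<le> 3"
    using cnt_diff_le[OF assms, of "{0,1,2}" Z x] by simp
  moreover have "cnt n {0,2} Z - cnt n {0,2} (Z - {x}) \<le> 2"
    using cnt_diff_le[OF assms, of "{0,2}" Z x] by simp
  ultimately show ?thesis
    using cnt_diff_nonneg[of n "{0,1,2}" Z x] cnt_diff_nonneg[of n "{0,2}" Z x] unfolding runs_def by linarith
qed

text \<open>An increment of the run count and its conditional mean are each at most 3 in absolute
  value, hence the constant 6.\<close>

lemma martingale_increments_innovation:
  assumes "n \<ge> 3" "a \<le> b" "b \<le> n"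
  shows "martingale_increments n a b (innovation n) 6"
  unfolding martingale_increments_def
proof (intro conjI allI impI ballI)
  fix i assume i: "a \<le> i \<and> i < b"
  show "adapted n i (innovation n i)"
    unfolding innovation_def
    by (rule adapted_comp[OF adapted_zeros[OF order_refl], where h="\<lambda>Z x. runs n (Z - {x}) - runs n Z - drift n Z"])
  fix \<sigma> assume s: "\<sigma> permutes {1..n}"
  show "\<bar>innovation n i \<sigma> x\<bar> \<le> 6" for x
    using abs_runs_remove_le[of n "zeros n \<sigma> i" x] abs_drift_le[of n "zeros n \<sigma> i"] assms unfolding innovation_def by auto
  have "card (zeros n \<sigma> i) \<noteq> 0" using i assms by (simp add: card_zeros[OF s])
  then show "(\<Sum>x\<in>zeros n \<sigma> i. innovation n i \<sigma> x) = 0"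
    unfolding innovation_def using sum_runs_remove[OF assms(1) zeros_subset[OF s], of i]
    by (simp add: sum_subtractf drift_def)
qed (use assms in auto)

definition run_count :: "nat \<Rightarrow> (nat \<Rightarrow> nat) \<Rightarrow> nat \<Rightarrow> real" where
  "run_count n \<sigma> m = runs n (zeros n \<sigma> m)"

lemma run_count_diff:
  assumes "\<sigma> permutes {1..n}" "a \<le> b" "b \<le> n"
  shows "run_count n \<sigma> b - run_count n \<sigma> a = mart (innovation n) a b \<sigma> + (\<Sum>i=a..<b. drift n (zeros n \<sigma> i))"
  using assms(2,3)
proof (induction b rule: dec_induct)
  case (step m)
  have "zeros n \<sigma> (Suc m) = zeros n \<sigma> m - {\<sigma> (Suc m)}"
    using step.prems assms(1) by (intro zeros_Suc) auto
  then show ?case using step by (simp add: run_count_def mart_Suc innovation_def)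
qed simp

text \<open>This is \<open>n\<close> times the probability that a given position is a one between
  two zeros.\<close>

definition run_mean :: "nat \<Rightarrow> nat \<Rightarrow> real" where
  "run_mean n m = real m * real (n - m) * (real (n - m) - 1) / ((real n - 1) * (real n - 2))"

lemma EE_cnt2:
  assumes "n \<ge> 3" "m \<le> n"
  shows "EE n (\<lambda>\<sigma>. cnt n {0,2} (zeros n \<sigma> m)) = real (n - m) * (real (n - m) - 1) / (real n - 1)"
  using assms by (subst EE_cnt) (auto simp: numeral_2_eq_2 lessThan_Suc)

lemma EE_cnt3:
  assumes "n \<ge> 3" "m \<le> n"
  shows "EE n (\<lambda>\<sigma>. cnt n {0,1,2} (zeros n \<sigma> m))
    = real (n - m) * (real (n - m) - 1) * (real (n - m) - 2) / ((real n - 1) * (real n - 2))"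
proof -
  have "card {0,1,2::nat} = Suc (Suc (Suc 0))" by simp
  then show ?thesis
    using assms by (subst EE_cnt) (auto simp: lessThan_Suc mult_ac)
qed

lemma EE_run_count:
  assumes "n \<ge> 3" "m \<le> n"
  shows "EE n (\<lambda>\<sigma>. run_count n \<sigma> m) = run_mean n m"
proof -
  have "EE n (\<lambda>\<sigma>. run_count n \<sigma> m) = EE n (\<lambda>\<sigma>. cnt n {0,2} (zeros n \<sigma> m)) - EE n (\<lambda>\<sigma>. cnt n {0,1,2} (zeros n \<sigma> m))"
    unfolding run_count_def runs_def by (rule EE_diff)
  also have "\<dots> = run_mean n m"
    unfolding EE_cnt2[OF assms] EE_cnt3[OF assms] run_mean_def
  proof -
    define N w where "N = real n" and "w = real (n - m)"
    have m: "real m = N - w" using assms(2) by (simp add: N_def w_def of_nat_diff)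
    have "N - 1 \<noteq> 0" "N - 2 \<noteq> 0" using assms(1) by (auto simp: N_def)
    then have "w * (w - 1) / (N - 1) - w * (w - 1) * (w - 2) / ((N - 1) * (N - 2))
        = (N - w) * w * (w - 1) / ((N - 1) * (N - 2))"
      by (simp add: divide_simps) (simp add: algebra_simps)
    then show "real (n - m) * (real (n - m) - 1) / (real n - 1)
        - real (n - m) * (real (n - m) - 1) * (real (n - m) - 2) / ((real n - 1) * (real n - 2))
        = real m * real (n - m) * (real (n - m) - 1) / ((real n - 1) * (real n - 2))"
      by (simp only: m N_def[symmetric] w_def[symmetric])
  qed
  finally show ?thesis .
qed

section \<open>Deviation of the drift from its mean\<close>

definition drift_dev :: "nat \<Rightarrow> nat \<Rightarrow> (nat \<Rightarrow> nat) \<Rightarrow> real" where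
  "drift_dev n i \<sigma> = drift n (zeros n \<sigma> i) - EE n (\<lambda>\<sigma>. drift n (zeros n \<sigma> i))"

text \<open>Taking expectations in \<open>run_count_diff\<close> removes the martingale and
  identifies the increment of \<open>run_mean\<close> with the sum of the mean drifts.\<close>

lemma run_count_decomp:
  assumes "\<sigma> permutes {1..n}" "n \<ge> 3" "a \<le> b" "b \<le> n"
  shows "run_count n \<sigma> b - run_count n \<sigma> a - (run_mean n b - run_mean n a) = mart (innovation n) a b \<sigma> + (\<Sum>i=a..<b. drift_dev n i \<sigma>)"
proof -
  have m0: "EE n (mart (innovation n) a b) = 0"
  proof -
    have "EE n (\<lambda>\<sigma>. 1 * innovation n i \<sigma> (\<sigma> (Suc i))) = 0" if "i \<in> {a..<b}" for i
      using that by (intro EE_orthogonal[OF martingale_increments_innovation[OF assms(2-4)]] adapted_const) auto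
    then show ?thesis unfolding mart_def EE_sum by simp
  qed
  have "run_mean n b - run_mean n a = EE n (\<lambda>\<sigma>. run_count n \<sigma> b - run_count n \<sigma> a)"
    using assms by (simp add: EE_diff EE_run_count)
  also have "\<dots> = EE n (\<lambda>\<sigma>. mart (innovation n) a b \<sigma> + (\<Sum>i=a..<b. drift n (zeros n \<sigma> i)))"
    by (rule EE_cong) (rule run_count_diff[OF _ assms(3,4)])
  also have "\<dots> = (\<Sum>i=a..<b. EE n (\<lambda>\<sigma>. drift n (zeros n \<sigma> i)))"
    using m0 by (simp add: EE_add EE_sum)
  finally show ?thesis
    unfolding drift_dev_def sum_subtractf using run_count_diff[OF assms(1,3,4)] by simp
qed

text \<open>The drift is a combination of two counts of variance O(n), divided by the number of
  zeros, which the second hypothesis keeps of order \<open>n\<close>. The constant is 100 times 18 *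
  9 + 8 * 4 = 194.\<close>

lemma EE_drift_dev_square:
  assumes n: "n \<ge> 30" and i: "real n / 10 \<le> real (n - i)"
  shows "EE n (\<lambda>\<sigma>. (drift_dev n i \<sigma>)\<^sup>2) \<le> 19400 / real n"
proof -
  define w where "w = real (n - i)"
  have w: "w > 0" "real n \<le> 10 * w" "w \<ge> 3" using n i by (auto simp: w_def)
  have i3: "i + 3 \<le> n" using w(3) by (simp add: w_def)
  let ?c3 = "\<lambda>\<sigma>. cnt n {0,1,2} (zeros n \<sigma> i)" and ?c2 = "\<lambda>\<sigma>. cnt n {0,2} (zeros n \<sigma> i)"
  let ?D3 = "\<lambda>\<sigma>. ?c3 \<sigma> - EE n ?c3" and ?D2 = "\<lambda>\<sigma>. ?c2 \<sigma> - EE n ?c2"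
  have dr: "drift n (zeros n \<sigma> i) = (3 * ?c3 \<sigma> - 2 * ?c2 \<sigma>) / w" if "\<sigma> permutes {1..n}" for \<sigma>
    using that by (simp add: drift_def card_zeros w_def)
  have "EE n (\<lambda>\<sigma>. drift n (zeros n \<sigma> i)) = EE n (\<lambda>\<sigma>. (3 * ?c3 \<sigma> - 2 * ?c2 \<sigma>) / w)"
    by (rule EE_cong) (rule dr)
  also have "\<dots> = (3 * EE n ?c3 - 2 * EE n ?c2) / w"
    by (simp add: EE_divide EE_diff EE_cmult)
  finally have m: "EE n (\<lambda>\<sigma>. drift n (zeros n \<sigma> i)) = (3 * EE n ?c3 - 2 * EE n ?c2) / w" .
  have "EE n (\<lambda>\<sigma>. (drift_dev n i \<sigma>)\<^sup>2) \<le> EE n (\<lambda>\<sigma>. (18 * (?D3 \<sigma>)\<^sup>2 + 8 * (?D2 \<sigma>)\<^sup>2) / w\<^sup>2)"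
  proof (rule EE_mono)
    fix \<sigma> assume s: "\<sigma> permutes {1..n}"
    have "drift_dev n i \<sigma> = (3 * ?D3 \<sigma> - 2 * ?D2 \<sigma>) / w"
      unfolding drift_dev_def m dr[OF s] using w by (simp add: field_simps)
    moreover have "(3 * ?D3 \<sigma> - 2 * ?D2 \<sigma>)\<^sup>2 \<le> 18 * (?D3 \<sigma>)\<^sup>2 + 8 * (?D2 \<sigma>)\<^sup>2"
      using zero_le_power2[of "3 * ?D3 \<sigma> + 2 * ?D2 \<sigma>"] by (simp add: power2_eq_square algebra_simps)
    ultimately show "(drift_dev n i \<sigma>)\<^sup>2 \<le> (18 * (?D3 \<sigma>)\<^sup>2 + 8 * (?D2 \<sigma>)\<^sup>2) / w\<^sup>2"
      by (simp add: power_divide divide_right_mono)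
  qed
  also have "\<dots> = (18 * EE n (\<lambda>\<sigma>. (?D3 \<sigma>)\<^sup>2) + 8 * EE n (\<lambda>\<sigma>. (?D2 \<sigma>)\<^sup>2)) / w\<^sup>2"
    by (simp only: EE_divide EE_add EE_cmult)
  also have "\<dots> \<le> (18 * (9 * real i) + 8 * (4 * real i)) / w\<^sup>2"
    using EE_cnt_variance[of n "{0,1,2}" i] EE_cnt_variance[of n "{0,2}" i] n i3
    by (intro divide_right_mono add_mono mult_left_mono) auto
  also have "\<dots> \<le> (194 * real n) / w\<^sup>2"
    using i3 by (intro divide_right_mono) auto
  also have "\<dots> \<le> 194 * real n / (real n / 10)\<^sup>2"
    using w n by (intro divide_left_mono power_mono) auto
  also have "\<dots> = 19400 / real n"
    using n by (simp add: power2_eq_square field_simps)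
  finally show ?thesis .
qed

lemma EE_square_sum_drift_dev:
  assumes n: "n \<ge> 30" and ab: "a \<le> b" "b \<le> n" and b: "real n / 10 \<le> real (n - b)"
  shows "EE n (\<lambda>\<sigma>. (\<Sum>i=a..<b. \<bar>drift_dev n i \<sigma>\<bar>)\<^sup>2) \<le> 19400 / real n * (real (b - a))\<^sup>2"
proof -
  have "EE n (\<lambda>\<sigma>. (\<Sum>i=a..<b. \<bar>drift_dev n i \<sigma>\<bar>)\<^sup>2) \<le> EE n (\<lambda>\<sigma>. real (b - a) * (\<Sum>i=a..<b. (drift_dev n i \<sigma>)\<^sup>2))"
  proof (rule EE_mono)
    fix \<sigma> :: "nat \<Rightarrow> nat"
    have "(\<Sum>i=a..<b. \<bar>drift_dev n i \<sigma>\<bar> * 1)\<^sup>2 \<le> (\<Sum>i=a..<b. \<bar>drift_dev n i \<sigma>\<bar>\<^sup>2) * (\<Sum>i=a..<b. 1\<^sup>2)"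
      by (rule Cauchy_Schwarz_ineq_sum)
    then show "(\<Sum>i=a..<b. \<bar>drift_dev n i \<sigma>\<bar>)\<^sup>2 \<le> real (b - a) * (\<Sum>i=a..<b. (drift_dev n i \<sigma>)\<^sup>2)"
      by (simp add: mult.commute)
  qed
  also have "\<dots> = real (b - a) * (\<Sum>i=a..<b. EE n (\<lambda>\<sigma>. (drift_dev n i \<sigma>)\<^sup>2))"
    by (simp only: EE_cmult EE_sum)
  also have "\<dots> \<le> real (b - a) * (\<Sum>i=a..<b. 19400 / real n)"
    using n b by (intro mult_left_mono sum_mono EE_drift_dev_square) (auto intro: order_trans)
  also have "\<dots> = 19400 / real n * (real (b - a))\<^sup>2"
    using ab by (simp add: power2_eq_square)
  finally show ?thesis .
qed

definition centered_runs :: "nat \<Rightarrow> (nat \<Rightarrow> nat) \<Rightarrow> nat \<Rightarrow> real" where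
  "centered_runs n \<sigma> m = run_count n \<sigma> m - run_mean n m"

lemma centered_runs_diff:
  assumes "\<sigma> permutes {1..n}" "n \<ge> 3" "a \<le> b" "b \<le> n"
  shows "centered_runs n \<sigma> b - centered_runs n \<sigma> a = mart (innovation n) a b \<sigma> + (\<Sum>i=a..<b. drift_dev n i \<sigma>)"
  using run_count_decomp[OF assms] by (simp add: centered_runs_def)

text \<open>The martingale part is bounded through its fourth moment, the drift part by
  Cauchy-Schwarz. The latter is quadratic in the length but has a factor \<open>1 / n\<close>, so
  \<open>b - a \<le> n\<close> makes it linear as well.\<close>

lemma EE_Max_centered_runs_square:
  assumes n: "n \<ge> 30" and ab: "a \<le> b" "b \<le> n" and b: "real n / 10 \<le> real (n - b)"
  shows "EE n (\<lambda>\<sigma>. (Max ((\<lambda>m. \<bar>centered_runs n \<sigma> m - centered_runs n \<sigma> a\<bar>) ` {a..b}))\<^sup>2) \<le> 43120 * real (b - a)"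
proof -
  have n3: "n \<ge> 3" using n by simp
  let ?S = "\<lambda>\<sigma>. \<Sum>i=a..<b. \<bar>drift_dev n i \<sigma>\<bar>"
  let ?M = "\<lambda>\<sigma>. Max ((\<lambda>m. \<bar>mart (innovation n) a m \<sigma>\<bar>) ` {a..b})"
  have "EE n (\<lambda>\<sigma>. (Max ((\<lambda>m. \<bar>centered_runs n \<sigma> m - centered_runs n \<sigma> a\<bar>) ` {a..b}))\<^sup>2)
     \<le> EE n (\<lambda>\<sigma>. 2 * (?M \<sigma>)\<^sup>2 + 2 * (?S \<sigma>)\<^sup>2)"
  proof (rule EE_mono)
    fix \<sigma> assume s: "\<sigma> permutes {1..n}"
    have "Max ((\<lambda>m. \<bar>centered_runs n \<sigma> m - centered_runs n \<sigma> a\<bar>) ` {a..b}) \<in> (\<lambda>m. \<bar>centered_runs n \<sigma> m - centered_runs n \<sigma> a\<bar>) ` {a..b}"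
      using ab by (intro Max_in) auto
    then obtain m where m: "m \<in> {a..b}"
      "Max ((\<lambda>m. \<bar>centered_runs n \<sigma> m - centered_runs n \<sigma> a\<bar>) ` {a..b}) = \<bar>centered_runs n \<sigma> m - centered_runs n \<sigma> a\<bar>"
      by auto
    have "\<bar>centered_runs n \<sigma> m - centered_runs n \<sigma> a\<bar> \<le> \<bar>mart (innovation n) a m \<sigma>\<bar> + \<bar>\<Sum>i=a..<m. drift_dev n i \<sigma>\<bar>"
      using m ab by (subst centered_runs_diff[OF s n3]) auto
    also have "\<dots> \<le> ?M \<sigma> + ?S \<sigma>"
    proof (rule add_mono)
      show "\<bar>mart (innovation n) a m \<sigma>\<bar> \<le> ?M \<sigma>" using m by (intro Max_ge) auto
      have "\<bar>\<Sum>i=a..<m. drift_dev n i \<sigma>\<bar> \<le> (\<Sum>i=a..<m. \<bar>drift_dev n i \<sigma>\<bar>)" by (rule sum_abs)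
      also have "\<dots> \<le> ?S \<sigma>" using m by (intro sum_mono2) auto
      finally show "\<bar>\<Sum>i=a..<m. drift_dev n i \<sigma>\<bar> \<le> ?S \<sigma>" .
    qed
    finally have "\<bar>centered_runs n \<sigma> m - centered_runs n \<sigma> a\<bar>\<^sup>2 \<le> (?M \<sigma> + ?S \<sigma>)\<^sup>2"
      by (intro power_mono) auto
    also have "\<dots> \<le> 2 * (?M \<sigma>)\<^sup>2 + 2 * (?S \<sigma>)\<^sup>2"
      using sum_squares_bound[of "?M \<sigma>" "?S \<sigma>"] by (simp add: power2_sum)
    finally show "(Max ((\<lambda>m. \<bar>centered_runs n \<sigma> m - centered_runs n \<sigma> a\<bar>) ` {a..b}))\<^sup>2 \<le> 2 * (?M \<sigma>)\<^sup>2 + 2 * (?S \<sigma>)\<^sup>2"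
      using m(2) by simp
  qed
  also have "\<dots> = 2 * EE n (\<lambda>\<sigma>. (?M \<sigma>)\<^sup>2) + 2 * EE n (\<lambda>\<sigma>. (?S \<sigma>)\<^sup>2)"
    by (simp only: EE_add EE_cmult)
  also have "\<dots> \<le> 2 * (2160 * real (b - a)) + 2 * (19400 * real (b - a))"
  proof (intro add_mono mult_left_mono)
    have "(EE n (\<lambda>\<sigma>. (?M \<sigma>)\<^sup>2))\<^sup>2 \<le> EE n (\<lambda>\<sigma>. ((?M \<sigma>)\<^sup>2)\<^sup>2)"
      by (rule EE_square)
    also have "\<dots> = EE n (\<lambda>\<sigma>. (?M \<sigma>)^4)" by simp
    also have "\<dots> \<le> 3584 * 6^4 * (real (b - a))\<^sup>2"
      by (rule EE_Max_abs_mart_power4) (rule martingale_increments_innovation[OF n3 ab])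
    \<comment> \<open>3584 * 6^4 = 4644864 is just below the square of 2160.\<close>
    also have "\<dots> \<le> (2160 * real (b - a))\<^sup>2"
      by (simp add: power_mult_distrib mult_right_mono)
    finally show "EE n (\<lambda>\<sigma>. (?M \<sigma>)\<^sup>2) \<le> 2160 * real (b - a)"
      by (rule power2_le_imp_le) simp
    have "EE n (\<lambda>\<sigma>. (?S \<sigma>)\<^sup>2) \<le> 19400 / real n * (real (b - a))\<^sup>2"
      by (rule EE_square_sum_drift_dev[OF n ab b])
    also have "\<dots> \<le> 19400 / real n * (real n * real (b - a))"
      unfolding power2_eq_square using ab by (intro mult_left_mono mult_right_mono) auto
    also have "\<dots> = 19400 * real (b - a)" using n by simp
    finally show "EE n (\<lambda>\<sigma>. (?S \<sigma>)\<^sup>2) \<le> 19400 * real (b - a)" .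
  qed auto
  finally show ?thesis by simp
qed

text \<open>The maximal inequality runs forward from the left end of a window, while the reference
  point \<open>n div 3\<close> will lie inside it. Changing the reference at most doubles the
  maximum.\<close>

lemma EE_Max_centered_runs_window:
  assumes n: "n \<ge> 30" and ab: "a \<le> c" "c \<le> b" "b \<le> n" and b: "real n / 10 \<le> real (n - b)"
  shows "EE n (\<lambda>\<sigma>. (Max ((\<lambda>m. \<bar>centered_runs n \<sigma> m - centered_runs n \<sigma> c\<bar>) ` {a..b}))\<^sup>2) \<le> 172480 * real (b - a)"
proof -
  let ?M = "\<lambda>\<sigma>. Max ((\<lambda>m. \<bar>centered_runs n \<sigma> m - centered_runs n \<sigma> a\<bar>) ` {a..b})"
  have "EE n (\<lambda>\<sigma>. (Max ((\<lambda>m. \<bar>centered_runs n \<sigma> m - centered_runs n \<sigma> c\<bar>) ` {a..b}))\<^sup>2) \<le> EE n (\<lambda>\<sigma>. 4 * (?M \<sigma>)\<^sup>2)"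
  proof (rule EE_mono)
    fix \<sigma> :: "nat \<Rightarrow> nat"
    have c: "\<bar>centered_runs n \<sigma> m - centered_runs n \<sigma> a\<bar> \<le> ?M \<sigma>" if "m \<in> {a..b}" for m
      using that by (intro Max_ge) auto
    have "Max ((\<lambda>m. \<bar>centered_runs n \<sigma> m - centered_runs n \<sigma> c\<bar>) ` {a..b}) \<le> 2 * ?M \<sigma>"
    proof (rule Max.boundedI)
      show "(\<lambda>m. \<bar>centered_runs n \<sigma> m - centered_runs n \<sigma> c\<bar>) ` {a..b} \<noteq> {}" using ab by auto
      fix y assume "y \<in> (\<lambda>m. \<bar>centered_runs n \<sigma> m - centered_runs n \<sigma> c\<bar>) ` {a..b}"
      then obtain m where "m \<in> {a..b}" "y = \<bar>centered_runs n \<sigma> m - centered_runs n \<sigma> c\<bar>" by auto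
      moreover have "c \<in> {a..b}" using ab by simp
      ultimately show "y \<le> 2 * ?M \<sigma>" using c[of m] c[of c] by linarith
    qed simp
    moreover have "0 \<le> Max ((\<lambda>m. \<bar>centered_runs n \<sigma> m - centered_runs n \<sigma> c\<bar>) ` {a..b})"
      using ab by (intro Max_ge_iff[THEN iffD2]) (auto intro!: bexI[of _ c])
    ultimately have "(Max ((\<lambda>m. \<bar>centered_runs n \<sigma> m - centered_runs n \<sigma> c\<bar>) ` {a..b}))\<^sup>2 \<le> (2 * ?M \<sigma>)\<^sup>2"
      by (intro power_mono)
    then show "(Max ((\<lambda>m. \<bar>centered_runs n \<sigma> m - centered_runs n \<sigma> c\<bar>) ` {a..b}))\<^sup>2 \<le> 4 * (?M \<sigma>)\<^sup>2"
      by (simp only: power_mult_distrib) simp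
  qed
  also have "\<dots> \<le> 4 * (43120 * real (b - a))"
    using EE_Max_centered_runs_square[OF n _ ab(3) b, of a] ab by (simp add: EE_cmult)
  finally show ?thesis by simp
qed

section \<open>The mean run count near a third\<close>

lemma run_mean_expansion:
  fixes n m :: nat
  assumes n: "n \<ge> 30" and m: "m \<le> n"
  defines "e \<equiv> real m - real n / 3"
  shows "\<bar>run_mean n m - (4 / 27 * real n - e\<^sup>2 / real n + e^3 / (real n)\<^sup>2)\<bar> \<le> 5"
proof -
  define N M where "N = real n" and "M = real m"
  have N: "N \<ge> 30" and M: "0 \<le> M" "M \<le> N" using n m by (auto simp: N_def M_def)
  define W where "W = N - M"
  have W: "0 \<le> W" "W \<le> N" using M by (auto simp: W_def)
  have w: "real (n - m) = W" using m by (simp add: W_def N_def M_def of_nat_diff)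
  \<comment> \<open>With \<open>M = N / 3 + e\<close> and \<open>W = 2 * N / 3 - e\<close> the cubic
    polynomial is exact. Only the passage from \<open>W - 1\<close> to \<open>W\<close> and from
    \<open>(N - 1) * (N - 2)\<close> to \<open>N^2\<close> costs O(1).\<close>
  have "4 / 27 * N - e\<^sup>2 / N + e^3 / N\<^sup>2 = M * W\<^sup>2 / N\<^sup>2"
    using N unfolding e_def N_def[symmetric] M_def[symmetric] W_def
    by (simp add: field_simps power2_eq_square power3_eq_cube)
  moreover have "run_mean n m = M * W * (W - 1) / ((N - 1) * (N - 2))"
    unfolding run_mean_def w by (simp add: N_def M_def)
  moreover have "M * W * (W - 1) / ((N - 1) * (N - 2)) - M * W\<^sup>2 / N\<^sup>2
      = M * W * (W * (3 * N - 2) - N\<^sup>2) / ((N - 1) * (N - 2) * N\<^sup>2)"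
    using N by (simp add: divide_simps) (simp add: algebra_simps power2_eq_square)
  moreover have "\<bar>M * W * (W * (3 * N - 2) - N\<^sup>2) / ((N - 1) * (N - 2) * N\<^sup>2)\<bar> \<le> 5"
  proof -
    have "W * (3 * N - 2) \<le> N * (3 * N)" using W N by (intro mult_mono) auto
    moreover have "0 \<le> W * (3 * N - 2)" using W N by auto
    ultimately have "\<bar>W * (3 * N - 2) - N\<^sup>2\<bar> \<le> 4 * N\<^sup>2"
      by (auto simp: power2_eq_square abs_le_iff)
    moreover have "M * W \<le> N * N" "0 \<le> M * W" using M W by (auto intro!: mult_mono)
    ultimately have "(M * W) * \<bar>W * (3 * N - 2) - N\<^sup>2\<bar> \<le> (N * N) * (4 * N\<^sup>2)"
      by (rule_tac mult_mono) auto
    also have "\<dots> \<le> 5 * ((N - 1) * (N - 2)) * N\<^sup>2"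
    proof -
      have "30 * N \<le> N * N" using N by (intro mult_right_mono) auto
      moreover have "5 * ((N - 1) * (N - 2)) = 5 * (N * N) - 15 * N + 10" by (simp add: algebra_simps)
      ultimately have "4 * (N * N) \<le> 5 * ((N - 1) * (N - 2))"
        using N by linarith
      then have "4 * (N * N) * N\<^sup>2 \<le> 5 * ((N - 1) * (N - 2)) * N\<^sup>2"
        by (intro mult_right_mono) auto
      then show ?thesis by (simp add: algebra_simps)
    qed
    finally have "\<bar>M * W * (W * (3 * N - 2) - N\<^sup>2)\<bar> \<le> 5 * ((N - 1) * (N - 2) * N\<^sup>2)"
      using M W by (simp add: abs_mult mult.assoc)
    moreover have "0 < (N - 1) * (N - 2) * N\<^sup>2" using N by simp
    ultimately show ?thesis by (simp add: abs_divide pos_divide_le_eq abs_of_pos)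
  qed
  ultimately show ?thesis by (simp add: N_def[symmetric])
qed

lemma abs_div3: "\<bar>real (n div 3) - real n / 3\<bar> \<le> 1"
proof -
  have "n = 3 * (n div 3) + n mod 3" "n mod 3 < 3" by auto
  then have "real n = 3 * real (n div 3) + real (n mod 3)" "real (n mod 3) < 3"
    by (metis of_nat_add of_nat_mult of_nat_numeral, simp)
  moreover have "0 \<le> real (n mod 3)" by simp
  ultimately show ?thesis by linarith
qed

text \<open>Rounding a third of \<open>n\<close> down changes each term by O(1). The first bound
  serves at distances of order \<open>n powr (2/3)\<close>, where the cubic term is O(1). The second
  serves for all \<open>m\<close>: as \<open>e \<le> 2 * n / 3\<close>, the cubic term cancels at
  most two thirds of the parabola.\<close>

lemma run_mean_diff:
  fixes n m :: nat
  assumes n: "n \<ge> 30" and m: "m \<le> n"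
  defines "D \<equiv> real m - real (n div 3)"
  shows "\<bar>run_mean n m - run_mean n (n div 3) + D\<^sup>2 / real n\<bar> \<le> \<bar>D\<bar>^3 / (real n)\<^sup>2 + 25"
    and "run_mean n m - run_mean n (n div 3) \<le> - D\<^sup>2 / (3 * real n) + 15"
    and "\<bar>run_mean n (n div 3) - 4 / 27 * real n\<bar> \<le> 7"
proof -
  define N where "N = real n"
  have N: "N \<ge> 30" using n by (simp add: N_def)
  define d where "d = real (n div 3) - N / 3"
  define e where "e = real m - N / 3"
  have d: "\<bar>d\<bar> \<le> 1" using abs_div3[of n] by (simp add: d_def N_def)
  have e: "e = D + d" by (simp add: e_def D_def d_def)
  have D: "\<bar>D\<bar> \<le> N" using m by (auto simp: D_def N_def abs_le_iff intro: order_trans[of _ "real n"])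
  have x1: "\<bar>run_mean n m - (4 / 27 * N - e\<^sup>2 / N + e^3 / N\<^sup>2)\<bar> \<le> 5"
    using run_mean_expansion[OF n m] by (simp add: e_def N_def)
  have x2: "\<bar>run_mean n (n div 3) - (4 / 27 * N - d\<^sup>2 / N + d^3 / N\<^sup>2)\<bar> \<le> 5"
    using run_mean_expansion[OF n, of "n div 3"] by (simp add: d_def N_def)
  have "\<bar>d\<bar>\<^sup>2 \<le> 1" "\<bar>d\<bar>^3 \<le> 1" using d by (intro power_le_one; simp)+
  then have d2: "\<bar>d\<^sup>2 / N\<bar> \<le> 1" "\<bar>d^3 / N\<^sup>2\<bar> \<le> 1"
  proof -
    assume a: "\<bar>d\<bar>\<^sup>2 \<le> 1" "\<bar>d\<bar>^3 \<le> 1"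
    have "1 \<le> N\<^sup>2" using N by (simp add: one_le_power)
    then have "\<bar>d\<bar>^3 \<le> N\<^sup>2" using a by linarith
    then show "\<bar>d^3 / N\<^sup>2\<bar> \<le> 1" using N by (simp add: abs_divide power_abs pos_divide_le_eq)
    have "\<bar>d\<bar>\<^sup>2 \<le> N" using a N by linarith
    then show "\<bar>d\<^sup>2 / N\<bar> \<le> 1" using N by (simp add: abs_divide pos_divide_le_eq)
  qed
  show "\<bar>run_mean n (n div 3) - 4 / 27 * real n\<bar> \<le> 7"
    using x2 d2 unfolding N_def abs_le_iff by linarith
  have "\<bar>e\<^sup>2 - D\<^sup>2\<bar> = \<bar>d\<bar> * \<bar>2 * D + d\<bar>"
    unfolding e abs_mult[symmetric] by (simp add: power2_eq_square algebra_simps)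
  also have "\<dots> \<le> 1 * (2 * N + 1)" using d D by (intro mult_mono) auto
  also have "\<dots> \<le> 3 * N" using N by simp
  finally have "\<bar>e\<^sup>2 - D\<^sup>2\<bar> \<le> 3 * N" .
  then have e2: "\<bar>e\<^sup>2 / N - D\<^sup>2 / N\<bar> \<le> 3"
    using N by (simp add: diff_divide_distrib[symmetric] abs_divide pos_divide_le_eq)
  have "\<bar>e\<bar>^3 \<le> (\<bar>D\<bar> + 1)^3" using e d by (intro power_mono) auto
  also have "\<dots> = \<bar>D\<bar>^3 + (3 * (\<bar>D\<bar> * \<bar>D\<bar>) + 3 * \<bar>D\<bar> + 1)"
    by (simp add: power3_eq_cube algebra_simps)
  also have "\<dots> \<le> \<bar>D\<bar>^3 + 7 * N\<^sup>2"
  proof -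
    have "\<bar>D\<bar> * \<bar>D\<bar> \<le> N * N" using D by (intro mult_mono) auto
    moreover have "N \<le> N * N" using N mult_right_mono[of 1 N N] by simp
    ultimately have "3 * (\<bar>D\<bar> * \<bar>D\<bar>) + 3 * \<bar>D\<bar> + 1 \<le> 7 * (N * N)" using D N by linarith
    then show ?thesis by (simp add: power2_eq_square)
  qed
  finally have "\<bar>e\<bar>^3 / N\<^sup>2 \<le> (\<bar>D\<bar>^3 + 7 * N\<^sup>2) / N\<^sup>2" by (rule divide_right_mono) simp
  then have e3: "\<bar>e^3 / N\<^sup>2\<bar> \<le> \<bar>D\<bar>^3 / N\<^sup>2 + 7"
    using N by (simp add: abs_divide power_abs add_divide_distrib)
  show "\<bar>run_mean n m - run_mean n (n div 3) + D\<^sup>2 / real n\<bar> \<le> \<bar>D\<bar>^3 / (real n)\<^sup>2 + 25"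
    using x1 x2 d2 e2 e3 unfolding N_def[symmetric] abs_le_iff by linarith
  have "- e\<^sup>2 / N + e^3 / N\<^sup>2 \<le> - e\<^sup>2 / (3 * N)"
  proof -
    have "e \<le> 2 / 3 * N" using m by (simp add: e_def N_def)
    then have "e\<^sup>2 * e \<le> e\<^sup>2 * (2 / 3 * N)" by (intro mult_left_mono) auto
    then have "e^3 / N\<^sup>2 \<le> e\<^sup>2 * (2 / 3 * N) / N\<^sup>2" by (intro divide_right_mono) (auto simp: power2_eq_square power3_eq_cube)
    also have "\<dots> = 2 / 3 * (e\<^sup>2 / N)" using N by (simp add: power2_eq_square)
    finally show ?thesis by simp
  qed
  moreover have "D\<^sup>2 / (3 * N) \<le> e\<^sup>2 / (3 * N) + 1" using e2 by simp
  ultimately show "run_mean n m - run_mean n (n div 3) \<le> - D\<^sup>2 / (3 * real n) + 15"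
    using x1 x2 d2 unfolding N_def[symmetric] abs_le_iff by simp
qed

section \<open>The conditional variance near a third\<close>

definition condvar :: "nat \<Rightarrow> nat \<Rightarrow> (nat \<Rightarrow> nat) \<Rightarrow> real" where
  "condvar n i \<sigma> = (\<Sum>x\<in>zeros n \<sigma> i. (innovation n i \<sigma> x)\<^sup>2) / real (n - i)"

lemma tendsto_remaining:
  assumes "(\<lambda>n. real (m n) / real n) \<longlonglongrightarrow> 1 / 3"
  shows "eventually (\<lambda>n. m n + 5 \<le> n) sequentially"
    and "(\<lambda>n. real (n - m n) / real n) \<longlonglongrightarrow> 2 / 3"
proof -
  have "eventually (\<lambda>n. real (m n) / real n < 1 / 2) sequentially"
    using assms by (rule order_tendstoD) simp
  then show ev: "eventually (\<lambda>n. m n + 5 \<le> n) sequentially"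
    using eventually_ge_at_top[of 10]
  proof eventually_elim
    case (elim n)
    then have "real (m n) < real n / 2" by (simp add: field_simps)
    moreover have "5 \<le> real n / 2" using elim by simp
    ultimately have "real (m n + 5) \<le> real n" by simp
    then show ?case by (simp only: of_nat_le_iff)
  qed
  have "(\<lambda>n. 1 - real (m n) / real n) \<longlonglongrightarrow> 1 - 1 / 3"
    by (intro tendsto_intros assms)
  then have "(\<lambda>n. 1 - real (m n) / real n) \<longlonglongrightarrow> 2 / 3" by simp
  then show "(\<lambda>n. real (n - m n) / real n) \<longlonglongrightarrow> 2 / 3"
  proof (rule Lim_transform_eventually)
    show "eventually (\<lambda>n. 1 - real (m n) / real n = real (n - m n) / real n) sequentially"
      using ev eventually_gt_at_top[of 0]
      by eventually_elim (auto simp: of_nat_diff diff_divide_distrib)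
  qed
qed

text \<open>The mean count is about \<open>n * (2/3)^q\<close>, which per zero is
  \<open>(2/3)^(q - 1)\<close>; the fluctuations are of order sqrt n and vanish after division by
  the number of zeros. The step may vary with \<open>n\<close>, which later gives uniformity over a
  window.\<close>

lemma EE_cnt_ratio:
  assumes m: "(\<lambda>n. real (m n) / real n) \<longlonglongrightarrow> 1 / 3" and A: "A \<subseteq> {..4}" "A \<noteq> {}"
  shows "(\<lambda>n. EE n (\<lambda>\<sigma>. \<bar>cnt n A (zeros n \<sigma> (m n)) / real (n - m n) - (2/3)^(card A - 1)\<bar>)) \<longlonglongrightarrow> 0"
proof -
  define q where "q = card A"
  define w where "w = (\<lambda>n. real (n - m n))"
  define \<mu> where "\<mu> = (\<lambda>n. EE n (\<lambda>\<sigma>. cnt n A (zeros n \<sigma> (m n))))"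
  have fA: "finite A" using A(1) finite_subset by blast
  have q: "q \<ge> 1" "q \<le> 5" using card_mono[OF _ A(1)] A(2) fA by (auto simp: q_def Suc_le_eq card_gt_0_iff One_nat_def)
  note rem = tendsto_remaining[OF m]
  have inv: "(\<lambda>n. c / real n) \<longlonglongrightarrow> 0" for c
    by (rule lim_const_over_n)
  have l1: "(\<lambda>n. (\<Prod>i<q. (w n / real n - real i / real n) / (1 - real i / real n)) / (w n / real n))
      \<longlonglongrightarrow> (\<Prod>i<q. (2/3 - 0) / (1 - 0)) / (2/3)"
    unfolding w_def by (intro tendsto_intros rem inv) auto
  have l2: "(\<Prod>i<q. (2/3 - 0) / (1 - 0)) / (2/3) = (2/3::real)^(q - 1)"
    using q by (cases q) auto
  have l3: "eventually (\<lambda>n. (\<Prod>i<q. (w n / real n - real i / real n) / (1 - real i / real n)) / (w n / real n) = \<mu> n / w n) sequentially"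
    using rem(1) eventually_ge_at_top[of 5]
  proof eventually_elim
    case (elim n)
    have "A \<subseteq> {..<n}" using A(1) elim by auto
    then have "\<mu> n = real n * (\<Prod>i<q. (w n - real i) / (real n - real i))"
      unfolding \<mu>_def w_def q_def using elim by (intro EE_cnt) auto
    moreover have "(w n / real n - real i / real n) / (1 - real i / real n) = (w n - real i) / (real n - real i)" for i
      using elim by (simp add: diff_divide_distrib[symmetric] divide_simps)
    ultimately show ?case by simp
  qed
  have \<mu>lim: "(\<lambda>n. \<mu> n / w n) \<longlonglongrightarrow> (2/3)^(q - 1)"
    using Lim_transform_eventually[OF l1 l3] unfolding l2 .
  \<comment> \<open>\<open>5 * sqrt n\<close> will bound the standard deviation, as a pattern with
    offsets up to 4 has at most five points.\<close>
  have sq: "(\<lambda>n. 5 / sqrt (real n) / (w n / real n)) \<longlonglongrightarrow> 0 / (2/3)"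
    unfolding w_def
    by (intro tendsto_divide rem tendsto_divide_0[OF tendsto_const] filterlim_at_top_imp_at_infinity
        filterlim_compose[OF sqrt_at_top] filterlim_real_sequentially) simp
  have lim: "(\<lambda>n. 5 / sqrt (real n) / (w n / real n) + \<bar>\<mu> n / w n - (2/3)^(q - 1)\<bar>) \<longlonglongrightarrow> 0"
    using tendsto_add[OF sq tendsto_rabs_zero[OF LIM_zero[OF \<mu>lim]]] by simp
  show ?thesis
  proof (rule tendsto_sandwich[OF _ _ tendsto_const lim])
    show "eventually (\<lambda>n. 0 \<le> EE n (\<lambda>\<sigma>. \<bar>cnt n A (zeros n \<sigma> (m n)) / real (n - m n) - (2/3)^(card A - 1)\<bar>)) sequentially"
      by (intro always_eventually allI EE_nonneg) simp
    show "eventually (\<lambda>n. EE n (\<lambda>\<sigma>. \<bar>cnt n A (zeros n \<sigma> (m n)) / real (n - m n) - (2/3)^(card A - 1)\<bar>)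
        \<le> 5 / sqrt (real n) / (w n / real n) + \<bar>\<mu> n / w n - (2/3)^(q - 1)\<bar>) sequentially"
      using rem(1) eventually_ge_at_top[of 5]
    proof eventually_elim
      case (elim n)
      let ?C = "\<lambda>\<sigma>. cnt n A (zeros n \<sigma> (m n))"
      have w0: "w n > 0" using elim by (simp add: w_def)
      have An: "A \<subseteq> {..<n}" using A(1) elim by auto
      have "EE n (\<lambda>\<sigma>. \<bar>?C \<sigma> / w n - (2/3)^(q - 1)\<bar>)
          \<le> EE n (\<lambda>\<sigma>. \<bar>?C \<sigma> - \<mu> n\<bar> / w n + \<bar>\<mu> n / w n - (2/3)^(q - 1)\<bar>)"
      proof (rule EE_mono)
        fix \<sigma> :: "nat \<Rightarrow> nat"
        have "\<bar>?C \<sigma> - \<mu> n\<bar> / w n = \<bar>?C \<sigma> / w n - \<mu> n / w n\<bar>"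
          using w0 by (simp add: diff_divide_distrib[symmetric] abs_divide)
        then show "\<bar>?C \<sigma> / w n - (2/3)^(q - 1)\<bar> \<le> \<bar>?C \<sigma> - \<mu> n\<bar> / w n + \<bar>\<mu> n / w n - (2/3)^(q - 1)\<bar>"
          by linarith
      qed
      also have "\<dots> = EE n (\<lambda>\<sigma>. \<bar>?C \<sigma> - \<mu> n\<bar>) / w n + \<bar>\<mu> n / w n - (2/3)^(q - 1)\<bar>"
        by (simp only: EE_add EE_divide EE_const)
      also have "EE n (\<lambda>\<sigma>. \<bar>?C \<sigma> - \<mu> n\<bar>) \<le> 5 * sqrt (real n)"
      proof -
        have "EE n (\<lambda>\<sigma>. \<bar>?C \<sigma> - \<mu> n\<bar>) \<le> sqrt (EE n (\<lambda>\<sigma>. \<bar>?C \<sigma> - \<mu> n\<bar>\<^sup>2))"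
          by (rule EE_le_sqrt)
        also have "EE n (\<lambda>\<sigma>. \<bar>?C \<sigma> - \<mu> n\<bar>\<^sup>2) \<le> (real q)\<^sup>2 * real (m n)"
          using EE_cnt_variance[OF _ An A(2), of "m n"] elim q unfolding \<mu>_def q_def by simp
        also have "\<dots> \<le> 5\<^sup>2 * real n"
          using q elim by (intro mult_mono power_mono) auto
        also have "sqrt (5\<^sup>2 * real n) = 5 * sqrt (real n)"
          by (simp add: real_sqrt_mult)
        finally show ?thesis by simp
      qed
      also have "5 * sqrt (real n) / w n = 5 / sqrt (real n) / (w n / real n)"
        using w0 elim by (simp add: field_simps)
      finally show ?case using w0 by (simp add: divide_right_mono w_def q_def)
    qed
  qed
qed

text \<open>The limit \<open>3 * 4/9 - 2 * 2/3\<close> of the drift is zero, since a third is the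
  stationary point of the mean. As the drift is bounded by 3, its square is at most three times its
  modulus, so convergence of first absolute moments suffices.\<close>

lemma EE_drift_square_lim:
  assumes m: "(\<lambda>n. real (m n) / real n) \<longlonglongrightarrow> 1 / 3"
  shows "(\<lambda>n. EE n (\<lambda>\<sigma>. (drift n (zeros n \<sigma> (m n)))\<^sup>2)) \<longlonglongrightarrow> 0"
proof -
  let ?r = "\<lambda>A n \<sigma>. \<bar>cnt n A (zeros n \<sigma> (m n)) / real (n - m n) - (2/3)^(card A - 1)\<bar>"
  have lim: "(\<lambda>n. 9 * EE n (?r {0,1,2} n) + 6 * EE n (?r {0,2} n)) \<longlonglongrightarrow> 9 * 0 + 6 * 0"
    by (intro tendsto_intros EE_cnt_ratio m) auto
  show ?thesis
  proof (rule tendsto_sandwich[OF _ _ tendsto_const])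
    show "(\<lambda>n. 9 * EE n (?r {0,1,2} n) + 6 * EE n (?r {0,2} n)) \<longlonglongrightarrow> 0" using lim by simp
    show "eventually (\<lambda>n. 0 \<le> EE n (\<lambda>\<sigma>. (drift n (zeros n \<sigma> (m n)))\<^sup>2)) sequentially"
      by (intro always_eventually allI EE_nonneg) simp
    show "eventually (\<lambda>n. EE n (\<lambda>\<sigma>. (drift n (zeros n \<sigma> (m n)))\<^sup>2)
        \<le> 9 * EE n (?r {0,1,2} n) + 6 * EE n (?r {0,2} n)) sequentially"
      using tendsto_remaining(1)[OF m] eventually_ge_at_top[of 5]
    proof eventually_elim
      case (elim n)
      have "EE n (\<lambda>\<sigma>. (drift n (zeros n \<sigma> (m n)))\<^sup>2) \<le> EE n (\<lambda>\<sigma>. 9 * ?r {0,1,2} n \<sigma> + 6 * ?r {0,2} n \<sigma>)"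
      proof (rule EE_mono)
        fix \<sigma> assume s: "\<sigma> permutes {1..n}"
        let ?d = "drift n (zeros n \<sigma> (m n))"
        define w where "w = real (n - m n)"
        define c3 where "c3 = cnt n {0,1,2} (zeros n \<sigma> (m n)) / w"
        define c2 where "c2 = cnt n {0,2} (zeros n \<sigma> (m n)) / w"
        have "?d = 3 * c3 - 2 * c2"
          unfolding drift_def card_zeros[OF s] w_def[symmetric] c3_def c2_def by (simp add: diff_divide_distrib)
        then have "?d = 3 * (c3 - 4/9) - 2 * (c2 - 2/3)" by simp
        then have "\<bar>?d\<bar> \<le> \<bar>3 * (c3 - 4/9)\<bar> + \<bar>2 * (c2 - 2/3)\<bar>" by (simp only: abs_triangle_ineq4)
        then have d: "\<bar>?d\<bar> \<le> 3 * \<bar>c3 - 4/9\<bar> + 2 * \<bar>c2 - 2/3\<bar>" by (simp only: abs_mult abs_numeral)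
        have r: "?r {0,1,2} n \<sigma> = \<bar>c3 - 4/9\<bar>" "?r {0,2} n \<sigma> = \<bar>c2 - 2/3\<bar>"
          unfolding c3_def c2_def w_def by (simp_all add: power2_eq_square numeral_2_eq_2 One_nat_def)
        have "?d\<^sup>2 = \<bar>?d\<bar> * \<bar>?d\<bar>" by (simp add: power2_eq_square)
        also have "\<dots> \<le> 3 * (3 * \<bar>c3 - 4/9\<bar> + 2 * \<bar>c2 - 2/3\<bar>)"
          using d abs_drift_le[of n "zeros n \<sigma> (m n)"] elim by (intro mult_mono) auto
        finally show "?d\<^sup>2 \<le> 9 * ?r {0,1,2} n \<sigma> + 6 * ?r {0,2} n \<sigma>" unfolding r by simp
      qed
      then show ?case by (simp only: EE_add EE_cmult)
    qed
  qed
qed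

lemma abs_nine:
  fixes d :: real
  assumes "0 \<le> d"
  shows "\<bar>x1 + x2 - x3 - x4 + x5 + 2 * x6 - 2 * x7 - 2 * x8 + 2 * x9 - d\<bar>
    \<le> \<bar>x1\<bar> + \<bar>x2\<bar> + \<bar>x3\<bar> + \<bar>x4\<bar> + \<bar>x5\<bar> + 2 * \<bar>x6\<bar> + 2 * \<bar>x7\<bar> + 2 * \<bar>x8\<bar> + 2 * \<bar>x9\<bar> + d"
proof -
  \<comment> \<open>Under the opaque name the absolute values are not split into cases; only the two
    linear bounds in \<open>ge\<close> are used.\<close>
  obtain f :: "real \<Rightarrow> real" where f: "f = abs" by blast
  have ge: "x \<le> f x" "- x \<le> f x" for x unfolding f by simp_all
  have "\<bar>x1 + x2 - x3 - x4 + x5 + 2 * x6 - 2 * x7 - 2 * x8 + 2 * x9 - d\<bar>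
    \<le> f x1 + f x2 + f x3 + f x4 + f x5 + 2 * f x6 + 2 * f x7 + 2 * f x8 + 2 * f x9 + d"
    using ge[of x1] ge[of x2] ge[of x3] ge[of x4] ge[of x5] ge[of x6] ge[of x7] ge[of x8] ge[of x9] assms
    by linarith
  then show ?thesis unfolding f .
qed

lemma condvar_eq:
  assumes "\<sigma> permutes {1..n}" "n \<ge> 3" "i < n"
  shows "condvar n i \<sigma> = (\<Sum>x\<in>zeros n \<sigma> i. (runs n (zeros n \<sigma> i - {x}) - runs n (zeros n \<sigma> i))\<^sup>2) / real (n - i)
     - (drift n (zeros n \<sigma> i))\<^sup>2"
proof -
  let ?Z = "zeros n \<sigma> i"
  let ?D = "\<lambda>x. runs n (?Z - {x}) - runs n ?Z"
  let ?d = "drift n ?Z"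
  define w where "w = real (n - i)"
  have w: "w \<noteq> 0" "real (card ?Z) = w" using assms by (auto simp: w_def card_zeros[OF assms(1)])
  have s: "(\<Sum>x\<in>?Z. ?D x) = w * ?d"
    using w sum_runs_remove[OF assms(2) zeros_subset[OF assms(1)], of i] by (simp add: drift_def)
  have "(\<Sum>x\<in>?Z. (innovation n i \<sigma> x)\<^sup>2) = (\<Sum>x\<in>?Z. (?D x)\<^sup>2 - 2 * ?d * ?D x + ?d\<^sup>2)"
    unfolding innovation_def by (intro sum.cong) (auto simp: power2_eq_square algebra_simps)
  also have "\<dots> = (\<Sum>x\<in>?Z. (?D x)\<^sup>2) - 2 * ?d * (\<Sum>x\<in>?Z. ?D x) + w * ?d\<^sup>2"
    by (simp add: sum.distrib sum_subtractf sum_distrib_left[symmetric] w(2) del: sum_subtractf[of "\<lambda>x. runs n (?Z - {x})"])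
  also have "\<dots> = (\<Sum>x\<in>?Z. (?D x)\<^sup>2) - w * ?d\<^sup>2"
    unfolding s by (simp add: power2_eq_square)
  finally show ?thesis
    unfolding condvar_def w_def[symmetric] using w by (simp add: diff_divide_distrib)
qed

text \<open>Inserting the limit \<open>(2/3)^(q - 1)\<close> for each count in
  \<open>sum_runs_remove_square\<close> gives
  \<open>2 * 2/3 + 4/9 - 4 * 8/27 + 2 * 16/81 = 80/81\<close>; the squared drift tends to
  zero.\<close>

lemma EE_condvar_lim:
  assumes m: "(\<lambda>n. real (m n) / real n) \<longlonglongrightarrow> 1 / 3"
  shows "(\<lambda>n. EE n (\<lambda>\<sigma>. \<bar>condvar n (m n) \<sigma> - 80/81\<bar>)) \<longlonglongrightarrow> 0"
proof -
  let ?r = "\<lambda>A n \<sigma>. \<bar>cnt n A (zeros n \<sigma> (m n)) / real (n - m n) - (2/3)^(card A - 1)\<bar>"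
  let ?R = "\<lambda>n \<sigma>. ?r {0,2} n \<sigma> + ?r {2,4} n \<sigma> + ?r {0,1,2} n \<sigma> + ?r {2,3,4} n \<sigma> + ?r {1,2,3} n \<sigma>
     + 2 * ?r {0,2,4} n \<sigma> + 2 * ?r {0,2,3,4} n \<sigma> + 2 * ?r {0,1,2,4} n \<sigma> + 2 * ?r {0,1,2,3,4} n \<sigma>
     + (drift n (zeros n \<sigma> (m n)))\<^sup>2"
  have "(\<lambda>n. EE n (?R n)) \<longlonglongrightarrow> 0 + 0 + 0 + 0 + 0 + 2 * 0 + 2 * 0 + 2 * 0 + 2 * 0 + 0"
    unfolding EE_add EE_cmult by (intro tendsto_intros EE_cnt_ratio EE_drift_square_lim m) auto
  then have lim: "(\<lambda>n. EE n (?R n)) \<longlonglongrightarrow> 0" by simp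
  show ?thesis
  proof (rule tendsto_sandwich[OF _ _ tendsto_const lim])
    show "eventually (\<lambda>n. 0 \<le> EE n (\<lambda>\<sigma>. \<bar>condvar n (m n) \<sigma> - 80/81\<bar>)) sequentially"
      by (intro always_eventually allI EE_nonneg) simp
    show "eventually (\<lambda>n. EE n (\<lambda>\<sigma>. \<bar>condvar n (m n) \<sigma> - 80/81\<bar>) \<le> EE n (?R n)) sequentially"
      using tendsto_remaining(1)[OF m] eventually_ge_at_top[of 5]
    proof eventually_elim
      case (elim n)
      show ?case
      proof (rule EE_mono)
        fix \<sigma> assume s: "\<sigma> permutes {1..n}"
        define c where "c = (\<lambda>A. cnt n A (zeros n \<sigma> (m n)) / real (n - m n))"
        have cv: "condvar n (m n) \<sigma> = c {0,2} + c {2,4} - c {0,1,2} - c {2,3,4} + c {1,2,3}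
            + 2 * c {0,2,4} - 2 * c {0,2,3,4} - 2 * c {0,1,2,4} + 2 * c {0,1,2,3,4} - (drift n (zeros n \<sigma> (m n)))\<^sup>2"
          using elim unfolding c_def
          by (subst condvar_eq[OF s]) (simp_all add: sum_runs_remove_square zeros_subset[OF s] add_divide_distrib diff_divide_distrib)
        have r: "(2/3::real)^(card {0,2::nat} - 1) = 2/3" "(2/3::real)^(card {2,4::nat} - 1) = 2/3"
           "(2/3::real)^(card {0,1,2::nat} - 1) = 4/9" "(2/3::real)^(card {2,3,4::nat} - 1) = 4/9"
           "(2/3::real)^(card {1,2,3::nat} - 1) = 4/9" "(2/3::real)^(card {0,2,4::nat} - 1) = 4/9"
           "(2/3::real)^(card {0,2,3,4::nat} - 1) = 8/27" "(2/3::real)^(card {0,1,2,4::nat} - 1) = 8/27"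
           "(2/3::real)^(card {0,1,2,3,4::nat} - 1) = 16/81"
          by (simp_all add: One_nat_def)
        show "\<bar>condvar n (m n) \<sigma> - 80/81\<bar> \<le> ?R n \<sigma>"
        proof -
          let ?d = "drift n (zeros n \<sigma> (m n))"
          have e: "condvar n (m n) \<sigma> - 80/81 = (c {0,2} - 2/3) + (c {2,4} - 2/3) - (c {0,1,2} - 4/9) - (c {2,3,4} - 4/9)
            + (c {1,2,3} - 4/9) + 2 * (c {0,2,4} - 4/9) - 2 * (c {0,2,3,4} - 8/27) - 2 * (c {0,1,2,4} - 8/27)
            + 2 * (c {0,1,2,3,4} - 16/81) - ?d\<^sup>2"
            unfolding cv by (simp add: algebra_simps)
          have cA: "cnt n A (zeros n \<sigma> (m n)) / real (n - m n) = c A" for A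
            by (simp add: c_def)
          show ?thesis unfolding e r cA
            by (rule abs_nine) simp
        qed
      qed
    qed
  qed
qed

section \<open>The maximum far from a third\<close>

text \<open>Expanding \<open>(u - 2 * q)^2 \<ge> 0\<close>. It turns a second moment into a bound
  for the expected excess over a level \<open>q\<close> that the parabola supplies.\<close>

lemma pos_part_le: "0 < q \<Longrightarrow> max 0 (u - q) \<le> u\<^sup>2 / (4 * q)" for u q :: real
proof -
  assume q: "0 < q"
  have "0 \<le> (u - 2 * q)\<^sup>2" by simp
  then have "(u - q) * (4 * q) \<le> u\<^sup>2" by (simp add: power2_eq_square algebra_simps)
  then show ?thesis using q by (simp add: pos_le_divide_eq)
qed

text \<open>A deterministic bound for the last steps, where too few zeros remain for the estimates
  of the drift.\<close>

lemma run_count_le: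
  assumes "\<sigma> permutes {1..n}" "n \<ge> 1"
  shows "run_count n \<sigma> m \<le> real (n - m)"
proof -
  have "cnt n {0,2} (zeros n \<sigma> m) \<le> real (card (zeros n \<sigma> m))"
    using assms by (intro cnt_le_card) auto
  then show ?thesis
    using cnt_nonneg[of n "{0,1,2}" "zeros n \<sigma> m"] by (simp add: run_count_def runs_def card_zeros[OF assms(1)])
qed

lemma centered_runs_0: "\<sigma> permutes {1..n} \<Longrightarrow> n \<ge> 1 \<Longrightarrow> centered_runs n \<sigma> 0 = 0"
proof -
  assume s: "\<sigma> permutes {1..n}" and n: "n \<ge> 1"
  have "cnt n A {1..n} = real n" for A
  proof -
    have "{k \<in> {1..n}. pos n A k \<subseteq> {1..n}} = {1..n}"
      using cyc_in[OF n] by (auto simp: pos_def)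
    then show ?thesis by (simp add: cnt_def)
  qed
  then show ?thesis
    by (simp add: centered_runs_def run_count_def runs_def run_mean_def zeros_0[OF s])
qed

lemma EE_centered_runs_third_square:
  assumes n: "n \<ge> 30"
  shows "EE n (\<lambda>\<sigma>. (centered_runs n \<sigma> (n div 3))\<^sup>2) \<le> 43120 * real n"
proof -
  let ?M = "\<lambda>\<sigma>. Max ((\<lambda>m. \<bar>centered_runs n \<sigma> m - centered_runs n \<sigma> 0\<bar>) ` {0..n div 3})"
  have "EE n (\<lambda>\<sigma>. (centered_runs n \<sigma> (n div 3))\<^sup>2) \<le> EE n (\<lambda>\<sigma>. (?M \<sigma>)\<^sup>2)"
  proof (rule EE_mono)
    fix \<sigma> assume s: "\<sigma> permutes {1..n}"
    have "\<bar>centered_runs n \<sigma> (n div 3) - centered_runs n \<sigma> 0\<bar> \<le> ?M \<sigma>" by (rule Max_ge) auto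
    then have "\<bar>centered_runs n \<sigma> (n div 3)\<bar> \<le> ?M \<sigma>" using centered_runs_0[OF s] n by simp
    then have "\<bar>centered_runs n \<sigma> (n div 3)\<bar>\<^sup>2 \<le> (?M \<sigma>)\<^sup>2" by (intro power_mono) auto
    then show "(centered_runs n \<sigma> (n div 3))\<^sup>2 \<le> (?M \<sigma>)\<^sup>2" by simp
  qed
  also have "\<dots> \<le> 43120 * real (n div 3 - 0)"
  proof (rule EE_Max_centered_runs_square[OF n])
    have "n \<le> 10 * (n - n div 3)" by linarith
    then have "real n \<le> real (10 * (n - n div 3))" by (simp only: of_nat_le_iff)
    then show "real n / 10 \<le> real (n - n div 3)" by (simp del: of_nat_diff)
  qed auto
  also have "\<dots> \<le> 43120 * real n" by simp
  finally show ?thesis .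
qed

lemma sum_half_powers_le: "(\<Sum>j<k. 1 / 2 ^ j) \<le> (2::real)"
proof -
  have "(\<Sum>j<k. (1/2) ^ j) = (1 - (1/2)^k) / (1 - 1/2 :: real)"
    by (subst sum_gp_strict) auto
  then show ?thesis by (simp add: power_one_over)
qed

text \<open>The bound \<open>j < d\<close> limits the number of scales, so that a finite sum over
  \<open>j < n\<close> covers all distances.\<close>

lemma dyadic_scale:
  fixes d R :: nat assumes "1 \<le> R" "R \<le> d"
  obtains j where "2 ^ j * R \<le> d" "d < 2 ^ (j + 1) * R" "j < d"
proof -
  have ex: "\<exists>j. d < 2 ^ (j + 1) * R"
  proof
    have "d < 2 ^ d" by (rule less_exp)
    also have "\<dots> = 2 ^ d * 1" by simp
    also have "\<dots> \<le> 2 ^ (d + 1) * R" using assms(1) by (intro mult_le_mono power_increasing) auto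
    finally show "d < 2 ^ (d + 1) * R" .
  qed
  define j where "j = (LEAST j. d < 2 ^ (j + 1) * R)"
  have 1: "d < 2 ^ (j + 1) * R" unfolding j_def by (rule LeastI_ex[OF ex])
  have 2: "2 ^ j * R \<le> d"
  proof (cases j)
    case (Suc k)
    then have "\<not> d < 2 ^ (k + 1) * R" using not_less_Least[of k "\<lambda>j. d < 2 ^ (j + 1) * R"] by (simp add: j_def)
    then show ?thesis unfolding Suc not_less by (simp only: Suc_eq_plus1)
  qed (use assms in simp)
  have "j < 2 ^ j" by (rule less_exp)
  also have "\<dots> \<le> d" using 2 assms by (metis le_trans mult_le_mono2 mult.right_neutral)
  finally show ?thesis using 1 2 that by blast
qed

text \<open>The term with denominator \<open>20 n\<close> is a part of the parabola that the bound does not need. It is kept in order to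
  bound \<open>B t - c t\<^sup>2\<close> for some \<open>c < 1/2\<close> later.\<close>

lemma tail_bound:
  fixes n R :: nat
  assumes n: "n \<ge> 30" and R: "R \<ge> 1"
  shows "\<exists>T. (\<forall>\<sigma>. 0 \<le> T \<sigma>) \<and> EE n T \<le> 1724800 * (real n / real R) + 431223 \<and>
    (\<forall>\<sigma> m. \<sigma> permutes {1..n} \<longrightarrow> m \<le> n \<longrightarrow> real R \<le> \<bar>real m - real (n div 3)\<bar> \<longrightarrow>
      run_count n \<sigma> m - run_count n \<sigma> (n div 3) + (real m - real (n div 3))\<^sup>2 / (20 * real n) \<le> T \<sigma>)"
proof -
  \<comment> \<open>Up to \<open>m9\<close> at least \<open>n / 10\<close> zeros remain, as the
    second moment bounds require. Later steps are treated through
    \<open>run_count_le\<close>.\<close>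
  define m0 m9 where "m0 = n div 3" and "m9 = 9 * n div 10"
  define a b where "a = (\<lambda>j::nat. m0 - 2 ^ (j + 1) * R)" and "b = (\<lambda>j::nat. min (m0 + 2 ^ (j + 1) * R) m9)"
  define U where "U = (\<lambda>j \<sigma>. Max ((\<lambda>m. \<bar>centered_runs n \<sigma> m - centered_runs n \<sigma> m0\<bar>) ` {a j..b j}))"
  \<comment> \<open>At distance \<open>D\<close> the mean has dropped by at least a third of
    \<open>D^2 / n\<close>, up to O(1). One fifth pays for the level \<open>q j\<close> and one
    twentieth for the additional term; 1/5 + 1/20 is below 1/3.\<close>
  define q where "q = (\<lambda>j::nat. (2 ^ j * real R)\<^sup>2 / (5 * real n))"
  define T where "T = (\<lambda>\<sigma>. (\<Sum>j<n. max 0 (U j \<sigma> - q j)) + max 0 (\<bar>centered_runs n \<sigma> m0\<bar> - real n / 40) + 23)"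
  have n0: "real n > 0" using n by simp
  have m09: "m0 \<le> m9" "m9 \<le> n" using n by (auto simp: m0_def m9_def)
  have m9: "real n / 10 \<le> real (n - m9)"
  proof -
    have "n \<le> 10 * (n - m9)" unfolding m9_def by linarith
    then have "real n \<le> real (10 * (n - m9))" by (simp only: of_nat_le_iff)
    then show ?thesis by (simp del: of_nat_diff)
  qed
  have q0: "0 < q j" for j using n0 R by (simp add: q_def)
  \<comment> \<open>The window of scale \<open>j\<close> has length of order \<open>2^j * R\<close>
    and the level is of order \<open>(2^j * R)^2 / n\<close>, so the expected excess halves from
    scale to scale and sums to O(n / R).\<close>
  have EU: "EE n (\<lambda>\<sigma>. max 0 (U j \<sigma> - q j)) \<le> 862400 * (real n / real R) * (1 / 2 ^ j)" for j
  proof -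
    have "EE n (\<lambda>\<sigma>. max 0 (U j \<sigma> - q j)) \<le> EE n (\<lambda>\<sigma>. (U j \<sigma>)\<^sup>2 / (4 * q j))"
      by (intro EE_mono pos_part_le q0)
    also have "\<dots> = EE n (\<lambda>\<sigma>. (U j \<sigma>)\<^sup>2) / (4 * q j)" by (rule EE_divide)
    also have "\<dots> \<le> (172480 * real (b j - a j)) / (4 * q j)"
    proof (rule divide_right_mono)
      have "real (n - m9) \<le> real (n - b j)" by (simp add: b_def del: of_nat_diff)
      then have "real n / 10 \<le> real (n - b j)" using m9 by linarith
      then show "EE n (\<lambda>\<sigma>. (U j \<sigma>)\<^sup>2) \<le> 172480 * real (b j - a j)"
        unfolding U_def using n m09 by (intro EE_Max_centered_runs_window) (auto simp: a_def b_def)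
    qed (use q0[of j] in simp)
    also have "\<dots> \<le> (172480 * (4 * (2 ^ j * real R))) / (4 * q j)"
    proof (intro divide_right_mono mult_left_mono)
      have "(2::nat) ^ (j + 1) * R = 2 * (2 ^ j * R)" by (simp add: power_add)
      then have "b j - a j \<le> 4 * (2 ^ j * R)" unfolding a_def b_def by linarith
      then have "real (b j - a j) \<le> real (4 * (2 ^ j * R))" by (simp only: of_nat_le_iff)
      then show "real (b j - a j) \<le> 4 * (2 ^ j * real R)" by simp
    qed (use q0[of j] in auto)
    also have "\<dots> = 862400 * (real n / real R) * (1 / 2 ^ j)"
      unfolding q_def using n0 R by (simp add: power2_eq_square field_simps)
    finally show ?thesis .
  qed
  have "EE n T = (\<Sum>j<n. EE n (\<lambda>\<sigma>. max 0 (U j \<sigma> - q j))) + EE n (\<lambda>\<sigma>. max 0 (\<bar>centered_runs n \<sigma> m0\<bar> - real n / 40)) + 23"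
    unfolding T_def by (simp add: EE_add EE_sum)
  also have "(\<Sum>j<n. EE n (\<lambda>\<sigma>. max 0 (U j \<sigma> - q j))) \<le> (\<Sum>j<n. 862400 * (real n / real R) * (1 / 2 ^ j))"
    by (intro sum_mono EU)
  also have "\<dots> = 862400 * (real n / real R) * (\<Sum>j<n. 1 / 2 ^ j)"
    by (simp only: sum_distrib_left)
  also have "\<dots> \<le> 862400 * (real n / real R) * 2"
    by (intro mult_left_mono sum_half_powers_le) simp
  also have "EE n (\<lambda>\<sigma>. max 0 (\<bar>centered_runs n \<sigma> m0\<bar> - real n / 40)) \<le> 431200"
  proof -
    have "EE n (\<lambda>\<sigma>. max 0 (\<bar>centered_runs n \<sigma> m0\<bar> - real n / 40)) \<le> EE n (\<lambda>\<sigma>. \<bar>centered_runs n \<sigma> m0\<bar>\<^sup>2 / (4 * (real n / 40)))"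
      using n0 by (intro EE_mono pos_part_le) simp
    also have "\<dots> = EE n (\<lambda>\<sigma>. (centered_runs n \<sigma> m0)\<^sup>2) / (real n / 10)" by (simp add: EE_divide EE_multc)
    also have "\<dots> \<le> 43120 * real n / (real n / 10)"
      unfolding m0_def by (intro divide_right_mono EE_centered_runs_third_square n) simp
    also have "\<dots> = 431200" using n0 by simp
    finally show ?thesis .
  qed
  finally have ET: "EE n T \<le> 1724800 * (real n / real R) + 431223" by simp
  have U0: "0 \<le> (\<Sum>j<n. max 0 (U j \<sigma> - q j))" for \<sigma> by (intro sum_nonneg) simp
  have T0: "0 \<le> T \<sigma>" for \<sigma> unfolding T_def using U0[of \<sigma>] by simp
  have "run_count n \<sigma> m - run_count n \<sigma> m0 + (real m - real m0)\<^sup>2 / (20 * real n) \<le> T \<sigma>"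
    if s: "\<sigma> permutes {1..n}" and m: "m \<le> n" and d: "real R \<le> \<bar>real m - real m0\<bar>" for \<sigma> m
  proof -
    define D where "D = real m - real m0"
    have D20: "D\<^sup>2 / (20 * real n) = 1 / 20 * (D\<^sup>2 / real n)" "D\<^sup>2 / (3 * real n) = 1 / 3 * (D\<^sup>2 / real n)"
      by simp_all
    have D0: "0 \<le> D\<^sup>2 / real n" by simp
    show ?thesis
    proof (cases "m \<le> m9")
      case True
      define dd where "dd = (if m \<le> m0 then m0 - m else m - m0)"
      have dd: "real dd = \<bar>D\<bar>" unfolding dd_def D_def by auto
      have "R \<le> dd" using d dd unfolding D_def by simp
      then obtain j where j: "2 ^ j * R \<le> dd" "dd < 2 ^ (j + 1) * R" "j < dd"
        using dyadic_scale R by blast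
      have jn: "j < n" using j(3) m m09 by (auto simp: dd_def split: if_splits)
      have "m \<in> {a j..b j}" using j(2) True by (auto simp: a_def b_def dd_def split: if_splits)
      then have "\<bar>centered_runs n \<sigma> m - centered_runs n \<sigma> m0\<bar> \<le> U j \<sigma>" unfolding U_def by (intro Max_ge) auto
      moreover have "run_count n \<sigma> m - run_count n \<sigma> m0 = (centered_runs n \<sigma> m - centered_runs n \<sigma> m0) + (run_mean n m - run_mean n m0)"
        by (simp add: centered_runs_def)
      moreover have "run_mean n m - run_mean n m0 \<le> 15 - 1 / 3 * (D\<^sup>2 / real n)"
        using run_mean_diff(2)[OF n m] unfolding m0_def D_def by simp
      moreover have "q j \<le> 1 / 5 * (D\<^sup>2 / real n)"
      proof -
        have "real (2 ^ j * R) \<le> \<bar>D\<bar>" unfolding dd[symmetric] using j(1) by (simp only: of_nat_le_iff)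
        then have "(2 ^ j * real R)\<^sup>2 \<le> \<bar>D\<bar>\<^sup>2" by (intro power_mono) auto
        then show ?thesis unfolding q_def using n0 by (simp add: divide_right_mono)
      qed
      ultimately have "run_count n \<sigma> m - run_count n \<sigma> m0 + D\<^sup>2 / (20 * real n) \<le> max 0 (U j \<sigma> - q j) + 15"
        unfolding D20 using D0 by linarith
      also have "max 0 (U j \<sigma> - q j) \<le> (\<Sum>j<n. max 0 (U j \<sigma> - q j))"
        using jn by (intro member_le_sum) auto
      finally show ?thesis unfolding T_def D_def by simp
    next
      case False
      have "real (n - m) \<le> real n / 10"
      proof -
        have "10 * (n - m) \<le> n" using False m unfolding m9_def by linarith
        then have "real (10 * (n - m)) \<le> real n" by (simp only: of_nat_le_iff)
        then show ?thesis by simp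
      qed
      then have 1: "run_count n \<sigma> m \<le> real n / 10" using run_count_le[OF s, of m] n by simp
      have 2: "run_count n \<sigma> m0 \<ge> - \<bar>centered_runs n \<sigma> m0\<bar> + 4 / 27 * real n - 7"
        using run_mean_diff(3)[OF n m] abs_ge_minus_self[of "centered_runs n \<sigma> m0"] unfolding m0_def centered_runs_def abs_le_iff by simp
      have D: "0 \<le> D" "D \<le> 2 / 3 * real n + 1"
        using m False m09 abs_div3[of n] unfolding D_def m0_def abs_le_iff by (auto simp: not_le)
      then have "D\<^sup>2 \<le> (2 / 3 * real n + 1)\<^sup>2" by (intro power_mono) auto
      also have "\<dots> \<le> (4 / 9 * real n + 2) * real n"
        using n by (simp add: power2_eq_square algebra_simps)
      finally have "D\<^sup>2 / real n \<le> 4 / 9 * real n + 2" using n0 by (simp add: pos_divide_le_eq)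
      then have 3: "D\<^sup>2 / (20 * real n) \<le> real n / 45 + 1" unfolding D20 by simp
      \<comment> \<open>The threshold \<open>n / 40\<close> in \<open>T\<close> is chosen such that
        1/10 + 1/45 + 1/40 stays below 4/27.\<close>
      have "run_count n \<sigma> m - run_count n \<sigma> m0 + D\<^sup>2 / (20 * real n) \<le> \<bar>centered_runs n \<sigma> m0\<bar> - real n / 40 + 8"
        using 1 2 3 n0 by simp
      then show ?thesis using U0[of \<sigma>] unfolding T_def D_def by simp
    qed
  qed
  then show ?thesis using T0 ET unfolding m0_def by blast
qed

section \<open>Lindeberg replacement\<close>

text \<open>\<open>\<phi>\<close> may depend on the steps before \<open>a\<close>, so that earlier
  blocks enter as frozen parameters. Exchanging one step for a normal variable of variance
  \<open>v\<close> leaves the difference of the second order terms and two third order remainders;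
  of the conditional variance only the mean distance from \<open>v\<close> matters.\<close>

lemma lindeberg_block:
  fixes \<phi> \<phi>1 \<phi>2 :: "(nat \<Rightarrow> nat) \<Rightarrow> real \<Rightarrow> real"
  assumes mi: "martingale_increments n a b \<xi> c" and s: "0 \<le> s" and v: "0 \<le> v" and K: "0 \<le> K"
    and ad: "adapted n a \<phi>"
    and t: "\<And>\<sigma>. taylor3 (\<phi> \<sigma>) (\<phi>1 \<sigma>) (\<phi>2 \<sigma>) K" and L: "\<And>\<sigma>. L-lipschitz_on UNIV (\<phi> \<sigma>)"
    and f1: "\<And>\<sigma>. continuous_on UNIV (\<phi>1 \<sigma>)" "\<And>\<sigma> x. \<bar>\<phi>1 \<sigma> x\<bar> \<le> B1"
    and f2: "\<And>\<sigma>. continuous_on UNIV (\<phi>2 \<sigma>)" "\<And>\<sigma> x. \<bar>\<phi>2 \<sigma> x\<bar> \<le> B2"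
  defines "cv \<equiv> \<lambda>i \<sigma>. (\<Sum>x\<in>zeros n \<sigma> i. (\<xi> i \<sigma> x)\<^sup>2) / real (n - i)"
  shows "\<bar>EE n (\<lambda>\<sigma>. \<phi> \<sigma> (s * mart \<xi> a b \<sigma>)) - EE n (\<lambda>\<sigma>. gauss_avg (\<phi> \<sigma>) (sqrt (real (b - a) * v)) 0)\<bar>
    \<le> (\<Sum>i=a..<b. B2 / 2 * EE n (\<lambda>\<sigma>. \<bar>s\<^sup>2 * cv i \<sigma> - v\<bar>)
        + K * (s^3 * c^3 + sqrt v^3 * (\<integral>y. \<bar>y\<bar>^3 \<partial>std_normal_distribution)))"
proof -
  have ab: "a \<le> b" "b \<le> n" using mi by (auto simp: martingale_increments_def)
  define m3 where "m3 = (\<integral>y. \<bar>y\<bar>^3 \<partial>std_normal_distribution)"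
  \<comment> \<open>In \<open>H i\<close> the steps up to \<open>i\<close> come from the martingale
    and the remaining \<open>b - i\<close> are normal, already averaged out. At \<open>i = b\<close>
    the normal part has deviation 0.\<close>
  define H where "H = (\<lambda>i. EE n (\<lambda>\<sigma>. gauss_avg (\<phi> \<sigma>) (sqrt (real (b - i) * v)) (s * mart \<xi> a i \<sigma>)))"
  have step: "\<bar>H (Suc i) - H i\<bar> \<le> B2 / 2 * EE n (\<lambda>\<sigma>. \<bar>s\<^sup>2 * cv i \<sigma> - v\<bar>) + K * (s^3 * c^3 + sqrt v^3 * m3)"
    if i: "a \<le> i" "i < b" for i
  proof -
    note mii = martingale_incrementsD[OF mi i]
    define r where "r = sqrt (real (b - Suc i) * v)"
    define g where "g = (\<lambda>\<sigma>. gauss_avg (\<phi> \<sigma>) r)"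
    define g2 where "g2 = (\<lambda>\<sigma>. gauss_avg (\<phi>2 \<sigma>) r)"
    have gt: "taylor3 (g \<sigma>) (gauss_avg (\<phi>1 \<sigma>) r) (g2 \<sigma>) K" for \<sigma>
      unfolding g_def g2_def by (rule taylor3_gauss_avg[OF t L f1 f2])
    have gL: "L-lipschitz_on UNIV (g \<sigma>)" for \<sigma>
      unfolding g_def by (rule gauss_avg_lipschitz[OF L])
    have g2b: "\<bar>g2 \<sigma> x\<bar> \<le> B2" for \<sigma> x
      unfolding g2_def by (rule abs_gauss_avg_le[OF f2])
    let ?S = "\<lambda>\<sigma>. s * mart \<xi> a i \<sigma>"
    have adS: "adapted n i (mart \<xi> a i)" using i by (intro adapted_mart[OF mi]) auto
    have ad\<Phi>: "adapted n i (\<lambda>\<sigma> x. g \<sigma> (?S \<sigma> + s * \<xi> i \<sigma> x))"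
      using adS mii(1) adapted_mono[OF ad i(1)] by (simp add: adapted_def g_def)
    have "H (Suc i) = EE n (\<lambda>\<sigma>. g \<sigma> (?S \<sigma> + s * \<xi> i \<sigma> (\<sigma> (Suc i))))"
      unfolding H_def g_def r_def by (simp add: mart_Suc[OF i(1)] distrib_left)
    also have "\<dots> = EE n (\<lambda>\<sigma>. (\<Sum>x\<in>zeros n \<sigma> i. g \<sigma> (?S \<sigma> + s * \<xi> i \<sigma> x)) / real (n - i))"
      by (rule EE_one_step[OF ad\<Phi> mii(4)])
    finally have H1: "H (Suc i) = EE n (\<lambda>\<sigma>. (\<Sum>x\<in>zeros n \<sigma> i. g \<sigma> (?S \<sigma> + s * \<xi> i \<sigma> x)) / real (n - i))" .
    \<comment> \<open>The semigroup property splits one normal variable of variance \<open>v\<close>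
      off the remaining ones.\<close>
    have H2: "H i = EE n (\<lambda>\<sigma>. gauss_avg (g \<sigma>) (sqrt v) (?S \<sigma>))"
    proof -
      have "r\<^sup>2 + (sqrt v)\<^sup>2 = real (b - i) * v"
      proof -
        have "r\<^sup>2 + (sqrt v)\<^sup>2 = real (b - Suc i) * v + v" unfolding r_def using v by simp
        also have "\<dots> = real (Suc (b - Suc i)) * v" by (simp add: algebra_simps)
        also have "Suc (b - Suc i) = b - i" using i by simp
        finally show ?thesis .
      qed
      then show ?thesis
        unfolding H_def g_def using v by (subst gauss_avg_gauss_avg[OF L]) (auto simp: r_def)
    qed
    have pw: "\<bar>(\<Sum>x\<in>zeros n \<sigma> i. g \<sigma> (?S \<sigma> + s * \<xi> i \<sigma> x)) / real (n - i) - gauss_avg (g \<sigma>) (sqrt v) (?S \<sigma>)\<bar>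
        \<le> B2 / 2 * \<bar>s\<^sup>2 * cv i \<sigma> - v\<bar> + K * (s^3 * c^3 + sqrt v^3 * m3)" if \<sigma>: "\<sigma> permutes {1..n}" for \<sigma>
    proof -
      define w where "w = real (n - i)"
      have w: "w > 0" "real (card (zeros n \<sigma> i)) = w" using mii(4) by (auto simp: w_def card_zeros[OF \<sigma>])
      define X where "X = ?S \<sigma>"
      define A where "A = (\<Sum>x\<in>zeros n \<sigma> i. g \<sigma> (X + s * \<xi> i \<sigma> x)) / w"
      \<comment> \<open>Averaging over the next entry removes the first order term, as the
        increments sum to zero.\<close>
      have e1: "\<bar>A - g \<sigma> X - g2 \<sigma> X * (s\<^sup>2 * cv i \<sigma>) / 2\<bar> \<le> K * (s^3 * c^3)"
      proof -
        let ?R = "\<lambda>x. g \<sigma> (X + s * \<xi> i \<sigma> x) - g \<sigma> X - gauss_avg (\<phi>1 \<sigma>) r X * (s * \<xi> i \<sigma> x) - g2 \<sigma> X * (s * \<xi> i \<sigma> x)\<^sup>2 / 2"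
        have R: "\<bar>?R x\<bar> \<le> K * (s^3 * c^3)" if x: "x \<in> zeros n \<sigma> i" for x
        proof -
          have "\<bar>?R x\<bar> \<le> K * \<bar>s * \<xi> i \<sigma> x\<bar>^3" using gt[of \<sigma>] by (auto simp: taylor3_def)
          also have "\<dots> \<le> K * (s * c)^3"
            using mii(2)[OF \<sigma> x] s K by (intro mult_left_mono power_mono) (auto simp: abs_mult intro: mult_left_mono)
          finally show ?thesis by (simp add: power_mult_distrib)
        qed
        have "(\<Sum>x\<in>zeros n \<sigma> i. ?R x) = w * A - w * g \<sigma> X - gauss_avg (\<phi>1 \<sigma>) r X * s * (\<Sum>x\<in>zeros n \<sigma> i. \<xi> i \<sigma> x)
            - g2 \<sigma> X * s\<^sup>2 / 2 * (\<Sum>x\<in>zeros n \<sigma> i. (\<xi> i \<sigma> x)\<^sup>2)"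
          unfolding A_def using w
          by (simp add: sum_subtractf sum_distrib_left sum_divide_distrib power_mult_distrib mult_ac)
        also have "(\<Sum>x\<in>zeros n \<sigma> i. \<xi> i \<sigma> x) = 0" by (rule mii(3)[OF \<sigma>])
        also have "(\<Sum>x\<in>zeros n \<sigma> i. (\<xi> i \<sigma> x)\<^sup>2) = w * cv i \<sigma>" using w by (simp add: cv_def w_def)
        finally have eq: "w * (A - g \<sigma> X - g2 \<sigma> X * (s\<^sup>2 * cv i \<sigma>) / 2) = (\<Sum>x\<in>zeros n \<sigma> i. ?R x)"
          by (simp add: algebra_simps)
        have "\<bar>\<Sum>x\<in>zeros n \<sigma> i. ?R x\<bar> \<le> (\<Sum>x\<in>zeros n \<sigma> i. \<bar>?R x\<bar>)" by (rule sum_abs)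
        also have "\<dots> \<le> (\<Sum>x\<in>zeros n \<sigma> i. K * (s^3 * c^3))" by (rule sum_mono) (rule R)
        also have "\<dots> = w * (K * (s^3 * c^3))" using w by simp
        finally have "w * \<bar>A - g \<sigma> X - g2 \<sigma> X * (s\<^sup>2 * cv i \<sigma>) / 2\<bar> \<le> w * (K * (s^3 * c^3))"
          unfolding eq[symmetric] abs_mult using w by simp
        then show ?thesis using w by simp
      qed
      have e2: "\<bar>gauss_avg (g \<sigma>) (sqrt v) X - g \<sigma> X - g2 \<sigma> X * v / 2\<bar> \<le> K * (sqrt v^3 * m3)"
        using gauss_avg_taylor3[OF gt gL, of \<sigma> "sqrt v" X] v by (simp add: m3_def mult.assoc)
      have "\<bar>g2 \<sigma> X / 2 * (s\<^sup>2 * cv i \<sigma> - v)\<bar> \<le> B2 / 2 * \<bar>s\<^sup>2 * cv i \<sigma> - v\<bar>"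
        unfolding abs_mult using g2b[of \<sigma> X] by (intro mult_right_mono) auto
      moreover have "A - gauss_avg (g \<sigma>) (sqrt v) X
          = (A - g \<sigma> X - g2 \<sigma> X * (s\<^sup>2 * cv i \<sigma>) / 2) - (gauss_avg (g \<sigma>) (sqrt v) X - g \<sigma> X - g2 \<sigma> X * v / 2)
            + g2 \<sigma> X / 2 * (s\<^sup>2 * cv i \<sigma> - v)"
        by (simp add: algebra_simps)
      ultimately have "\<bar>A - gauss_avg (g \<sigma>) (sqrt v) X\<bar>
          \<le> B2 / 2 * \<bar>s\<^sup>2 * cv i \<sigma> - v\<bar> + (K * (s^3 * c^3) + K * (sqrt v^3 * m3))"
        using e1 e2 by linarith
      then show ?thesis unfolding A_def X_def w_def by (simp add: distrib_left)
    qed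
    have "\<bar>H (Suc i) - H i\<bar> = \<bar>EE n (\<lambda>\<sigma>. (\<Sum>x\<in>zeros n \<sigma> i. g \<sigma> (?S \<sigma> + s * \<xi> i \<sigma> x)) / real (n - i)
        - gauss_avg (g \<sigma>) (sqrt v) (?S \<sigma>))\<bar>"
      unfolding H1 H2 EE_diff ..
    also have "\<dots> \<le> EE n (\<lambda>\<sigma>. \<bar>(\<Sum>x\<in>zeros n \<sigma> i. g \<sigma> (?S \<sigma> + s * \<xi> i \<sigma> x)) / real (n - i)
        - gauss_avg (g \<sigma>) (sqrt v) (?S \<sigma>)\<bar>)"
      by (rule EE_abs)
    also have "\<dots> \<le> EE n (\<lambda>\<sigma>. B2 / 2 * \<bar>s\<^sup>2 * cv i \<sigma> - v\<bar> + K * (s^3 * c^3 + sqrt v^3 * m3))"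
      by (rule EE_mono) (rule pw)
    also have "\<dots> = B2 / 2 * EE n (\<lambda>\<sigma>. \<bar>s\<^sup>2 * cv i \<sigma> - v\<bar>) + K * (s^3 * c^3 + sqrt v^3 * m3)"
      by (simp only: EE_add EE_cmult EE_const)
    finally show ?thesis .
  qed
  have "H b - H a = (\<Sum>i=a..<b. H (Suc i) - H i)"
    using sum_Suc_diff'[OF ab(1), of H] by simp
  also have "\<bar>\<dots>\<bar> \<le> (\<Sum>i=a..<b. \<bar>H (Suc i) - H i\<bar>)" by (rule sum_abs)
  also have "\<dots> \<le> (\<Sum>i=a..<b. B2 / 2 * EE n (\<lambda>\<sigma>. \<bar>s\<^sup>2 * cv i \<sigma> - v\<bar>) + K * (s^3 * c^3 + sqrt v^3 * m3))"
    by (rule sum_mono, rule step) auto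
  finally show ?thesis by (simp add: H_def m3_def)
qed

lemma gauss_avg_close:
  assumes "L-lipschitz_on UNIV f" "L-lipschitz_on UNIV g" "\<And>x. \<bar>f x - g x\<bar> \<le> \<epsilon>"
  shows "\<bar>gauss_avg f s x - gauss_avg g s x\<bar> \<le> \<epsilon>"
proof -
  interpret prob_space std_normal_distribution by (rule prob_space_std_normal)
  note i = integrable_std_normal_affine[OF assms(1), of x s] integrable_std_normal_affine[OF assms(2), of x s]
  have eq: "gauss_avg f s x - gauss_avg g s x = (\<integral>y. f (x + s * y) - g (x + s * y) \<partial>std_normal_distribution)"
    unfolding gauss_avg_def by (rule Bochner_Integration.integral_diff[OF i, symmetric])
  have "\<bar>\<integral>y. f (x + s * y) - g (x + s * y) \<partial>std_normal_distribution\<bar>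
      \<le> (\<integral>y. \<bar>f (x + s * y) - g (x + s * y)\<bar> \<partial>std_normal_distribution)"
    by (rule integral_abs_bound)
  also have "\<dots> \<le> (\<integral>y. \<epsilon> \<partial>std_normal_distribution)"
    by (rule integral_mono[OF integrable_abs[OF Bochner_Integration.integrable_diff[OF i]] integrable_const assms(3)])
  finally show ?thesis unfolding eq using prob_space by simp
qed

lemma gauss_avg_scale:
  assumes "L-lipschitz_on UNIV f"
  shows "\<bar>gauss_avg f s x - gauss_avg f t x\<bar> \<le> L * \<bar>s - t\<bar> * (\<integral>y. \<bar>y\<bar> \<partial>std_normal_distribution)"
proof -
  interpret prob_space std_normal_distribution by (rule prob_space_std_normal)
  note i = integrable_std_normal_affine[OF assms, of x s] integrable_std_normal_affine[OF assms, of x t]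
  have m: "integrable std_normal_distribution (\<lambda>y. L * \<bar>s - t\<bar> * \<bar>y\<bar>)"
    using integrable_std_normal_abs_power[of 1] by simp
  have b: "\<bar>f (x + s * y) - f (x + t * y)\<bar> \<le> L * \<bar>s - t\<bar> * \<bar>y\<bar>" for y
    using lipschitz_onD[OF assms, of "x + s * y" "x + t * y"]
    by (simp add: dist_real_def left_diff_distrib[symmetric] abs_mult mult.assoc)
  have eq: "gauss_avg f s x - gauss_avg f t x = (\<integral>y. f (x + s * y) - f (x + t * y) \<partial>std_normal_distribution)"
    unfolding gauss_avg_def by (rule Bochner_Integration.integral_diff[OF i, symmetric])
  have "\<bar>\<integral>y. f (x + s * y) - f (x + t * y) \<partial>std_normal_distribution\<bar>
      \<le> (\<integral>y. \<bar>f (x + s * y) - f (x + t * y)\<bar> \<partial>std_normal_distribution)"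
    by (rule integral_abs_bound)
  also have "\<dots> \<le> (\<integral>y. L * \<bar>s - t\<bar> * \<bar>y\<bar> \<partial>std_normal_distribution)"
    by (rule integral_mono[OF integrable_abs[OF Bochner_Integration.integrable_diff[OF i]] m b])
  finally show ?thesis unfolding eq by simp
qed

text \<open>Smoothing moves each of the two averages by at most \<open>10 * L * e\<close> and costs
  a bound of order \<open>1 / e\<close> for the second derivative and a Taylor constant of order
  \<open>1 / e^2\<close>.\<close>

lemma lindeberg_block_lipschitz:
  fixes \<phi> :: "(nat \<Rightarrow> nat) \<Rightarrow> real \<Rightarrow> real"
  assumes mi: "martingale_increments n a b \<xi> c" and s: "0 \<le> s" and v: "0 \<le> v" and e: "0 < e"
    and ad: "adapted n a \<phi>" and L: "\<And>\<sigma>. L-lipschitz_on UNIV (\<phi> \<sigma>)"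
  defines "cv \<equiv> \<lambda>i \<sigma>. (\<Sum>x\<in>zeros n \<sigma> i. (\<xi> i \<sigma> x)\<^sup>2) / real (n - i)"
  shows "\<bar>EE n (\<lambda>\<sigma>. \<phi> \<sigma> (s * mart \<xi> a b \<sigma>)) - EE n (\<lambda>\<sigma>. gauss_avg (\<phi> \<sigma>) (sqrt (real (b - a) * v)) 0)\<bar>
    \<le> 20 * L * e + (\<Sum>i=a..<b. 2 * L / e / 2 * EE n (\<lambda>\<sigma>. \<bar>s\<^sup>2 * cv i \<sigma> - v\<bar>)
        + 4 * L / e\<^sup>2 * (s^3 * c^3 + sqrt v^3 * (\<integral>y. \<bar>y\<bar>^3 \<partial>std_normal_distribution)))"
proof -
  have L0: "0 \<le> L" by (rule lipschitz_on_nonneg[OF L])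
  \<comment> \<open>The smoothed function is chosen depending on \<open>F\<close> alone. Hence
    \<open>S (\<phi> \<sigma>)\<close> inherits adaptedness from \<open>\<phi>\<close>.\<close>
  have "\<forall>F. \<exists>f f1 f2. L-lipschitz_on UNIV F \<longrightarrow> taylor3 f f1 f2 (4 * L / e\<^sup>2) \<and> L-lipschitz_on UNIV f \<and>
    (\<forall>x. \<bar>f1 x\<bar> \<le> L) \<and> continuous_on UNIV f1 \<and> (\<forall>x. \<bar>f2 x\<bar> \<le> 2 * L / e) \<and> continuous_on UNIV f2 \<and>
    (\<forall>x. \<bar>f x - F x\<bar> \<le> 10 * L * e)"
    using lipschitz_smoothing[OF _ e] by blast
  then obtain S S1 S2 where S: "\<And>F. L-lipschitz_on UNIV F \<Longrightarrow> taylor3 (S F) (S1 F) (S2 F) (4 * L / e\<^sup>2) \<and> L-lipschitz_on UNIV (S F) \<and>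
    (\<forall>x. \<bar>S1 F x\<bar> \<le> L) \<and> continuous_on UNIV (S1 F) \<and> (\<forall>x. \<bar>S2 F x\<bar> \<le> 2 * L / e) \<and> continuous_on UNIV (S2 F) \<and>
    (\<forall>x. \<bar>S F x - F x\<bar> \<le> 10 * L * e)"
    by metis
  note S' = S[OF L]
  have adS: "adapted n a (\<lambda>\<sigma>. S (\<phi> \<sigma>))" by (rule adapted_comp[OF ad])
  have 1: "\<bar>EE n (\<lambda>\<sigma>. S (\<phi> \<sigma>) (s * mart \<xi> a b \<sigma>)) - EE n (\<lambda>\<sigma>. gauss_avg (S (\<phi> \<sigma>)) (sqrt (real (b - a) * v)) 0)\<bar>
    \<le> (\<Sum>i=a..<b. 2 * L / e / 2 * EE n (\<lambda>\<sigma>. \<bar>s\<^sup>2 * cv i \<sigma> - v\<bar>)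
        + 4 * L / e\<^sup>2 * (s^3 * c^3 + sqrt v^3 * (\<integral>y. \<bar>y\<bar>^3 \<partial>std_normal_distribution)))"
    unfolding cv_def
    by (rule lindeberg_block[OF mi s v _ adS, where ?\<phi>1.0="\<lambda>\<sigma>. S1 (\<phi> \<sigma>)" and ?\<phi>2.0="\<lambda>\<sigma>. S2 (\<phi> \<sigma>)" and ?B1.0=L and L=L])
      (use S' L0 e in auto)
  have close: "\<bar>EE n f - EE n g\<bar> \<le> 10 * L * e" if "\<And>\<sigma>. \<bar>f \<sigma> - g \<sigma>\<bar> \<le> 10 * L * e" for f g
  proof -
    have "\<bar>EE n f - EE n g\<bar> = \<bar>EE n (\<lambda>\<sigma>. f \<sigma> - g \<sigma>)\<bar>" by (simp add: EE_diff)
    also have "\<dots> \<le> EE n (\<lambda>\<sigma>. \<bar>f \<sigma> - g \<sigma>\<bar>)" by (rule EE_abs)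
    also have "\<dots> \<le> EE n (\<lambda>\<sigma>. 10 * L * e)" by (rule EE_mono) (rule that)
    finally show ?thesis by simp
  qed
  have 2: "\<bar>EE n (\<lambda>\<sigma>. S (\<phi> \<sigma>) (s * mart \<xi> a b \<sigma>)) - EE n (\<lambda>\<sigma>. \<phi> \<sigma> (s * mart \<xi> a b \<sigma>))\<bar> \<le> 10 * L * e"
    by (rule close) (use S' in blast)
  have 3: "\<bar>EE n (\<lambda>\<sigma>. gauss_avg (S (\<phi> \<sigma>)) (sqrt (real (b - a) * v)) 0) - EE n (\<lambda>\<sigma>. gauss_avg (\<phi> \<sigma>) (sqrt (real (b - a) * v)) 0)\<bar> \<le> 10 * L * e"
    by (rule close, rule gauss_avg_close[of L]) (use S' L in blast)+
  show ?thesis using 1 2 3 by linarith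
qed

lemma tendsto_zero_by_eps:
  fixes x :: "nat \<Rightarrow> real" and E :: "real \<Rightarrow> nat \<Rightarrow> real"
  assumes "0 \<le> C" "\<And>e. 0 < e \<Longrightarrow> eventually (\<lambda>n. \<bar>x n\<bar> \<le> C * e + E e n) sequentially"
    "\<And>e. 0 < e \<Longrightarrow> E e \<longlonglongrightarrow> 0"
  shows "x \<longlonglongrightarrow> 0"
proof (rule LIMSEQ_I)
  fix r :: real assume r: "0 < r"
  define e where "e = r / (2 * (C + 1))"
  have e: "0 < e" "C * e < r / 2 + r / 4"
  proof -
    show "0 < e" using r assms(1) by (simp add: e_def)
    have "C * e \<le> (C + 1) * e" using \<open>0 < e\<close> by (simp add: algebra_simps)
    also have "\<dots> = r / 2" using assms(1) by (simp add: e_def field_simps)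
    finally show "C * e < r / 2 + r / 4" using r by simp
  qed
  have "eventually (\<lambda>n. E e n < r / 4) sequentially"
    by (rule order_tendstoD(2)[OF assms(3)[OF e(1)]]) (use r in simp)
  with assms(2)[OF e(1)] have "eventually (\<lambda>n. norm (x n - 0) < r) sequentially"
    by eventually_elim (use e(2) in auto)
  then show "\<exists>no. \<forall>n\<ge>no. norm (x n - 0) < r" by (simp add: eventually_sequentially)
qed

lemma powr_third_tendsto_0: "(\<lambda>n. real n powr (- 1/3)) \<longlonglongrightarrow> 0"
  using tendsto_neg_powr[of "-1/3" "\<lambda>n. real n" sequentially] filterlim_real_sequentially by simp

text \<open>The maximum is attained at some index, and these indices form a sequence whose ratio to
  \<open>n\<close> again tends to 1/3. Convergence along arbitrary such sequences is therefore
  already uniform over the window.\<close>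

lemma sup_condvar_lim:
  assumes ab: "eventually (\<lambda>n. a n \<le> b n) sequentially"
    and a: "(\<lambda>n. real (a n) / real n) \<longlonglongrightarrow> 1 / 3" and b: "(\<lambda>n. real (b n) / real n) \<longlonglongrightarrow> 1 / 3"
  shows "(\<lambda>n. Max ((\<lambda>i. EE n (\<lambda>\<sigma>. \<bar>condvar n i \<sigma> - 80/81\<bar>)) ` {a n..b n})) \<longlonglongrightarrow> 0"
proof -
  let ?g = "\<lambda>n i. EE n (\<lambda>\<sigma>. \<bar>condvar n i \<sigma> - 80/81\<bar>)"
  have "\<exists>i\<in>{a n..b n}. Max (?g n ` {a n..b n}) = ?g n i" if "a n \<le> b n" for n
  proof -
    have "Max (?g n ` {a n..b n}) \<in> ?g n ` {a n..b n}" using that by (intro Max_in) auto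
    then show ?thesis by auto
  qed
  then obtain i where i: "\<And>n. a n \<le> b n \<Longrightarrow> i n \<in> {a n..b n} \<and> Max (?g n ` {a n..b n}) = ?g n (i n)"
    by metis
  have "(\<lambda>n. real (i n) / real n) \<longlonglongrightarrow> 1 / 3"
    by (rule tendsto_sandwich[OF _ _ a b]; rule eventually_mono[OF ab]) (use i in \<open>auto intro!: divide_right_mono\<close>)
  from EE_condvar_lim[OF this] show ?thesis
    by (rule Lim_transform_eventually) (rule eventually_mono[OF ab], use i in auto)
qed

text \<open>With \<open>s = n powr (- 1/3)\<close> the scaled length \<open>len\<close> converges.
  The second order errors sum to \<open>len\<close> times the worst mean deviation of the
  conditional variance from 80/81, the third order ones to \<open>len\<close> times O(s).\<close>

lemma block_clt:
  fixes \<phi> :: "nat \<Rightarrow> (nat \<Rightarrow> nat) \<Rightarrow> real \<Rightarrow> real"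
  assumes ev: "eventually (\<lambda>n. a n \<le> b n \<and> b n \<le> n \<and> adapted n (a n) (\<phi> n)) sequentially"
    and a: "(\<lambda>n. real (a n) / real n) \<longlonglongrightarrow> 1 / 3" and b: "(\<lambda>n. real (b n) / real n) \<longlonglongrightarrow> 1 / 3"
    and l: "(\<lambda>n. real (b n - a n) * (real n powr (- 1/3))\<^sup>2) \<longlonglongrightarrow> l"
    and L: "\<And>n \<sigma>. L-lipschitz_on UNIV (\<phi> n \<sigma>)"
  shows "(\<lambda>n. EE n (\<lambda>\<sigma>. \<phi> n \<sigma> (real n powr (- 1/3) * mart (innovation n) (a n) (b n) \<sigma>))
    - EE n (\<lambda>\<sigma>. gauss_avg (\<phi> n \<sigma>) (sqrt (80/81 * l)) 0)) \<longlonglongrightarrow> 0"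
proof -
  have L0: "0 \<le> L" by (rule lipschitz_on_nonneg[OF L])
  define s where "s = (\<lambda>n. real n powr (- 1/3))"
  define v where "v = (\<lambda>n. (s n)\<^sup>2 * (80/81))"
  define len where "len = (\<lambda>n. real (b n - a n) * (s n)\<^sup>2)"
  define m1 where "m1 = (\<integral>y. \<bar>y\<bar> \<partial>std_normal_distribution)"
  define m3 where "m3 = (\<integral>y. \<bar>y\<bar>^3 \<partial>std_normal_distribution)"
  define Mx where "Mx = (\<lambda>n. Max ((\<lambda>i. EE n (\<lambda>\<sigma>. \<bar>condvar n i \<sigma> - 80/81\<bar>)) ` {a n..b n}))"
  define E where "E = (\<lambda>e n. len n * (L / e * Mx n + 4 * L / e\<^sup>2 * (s n * (216 + m3)))
      + L * \<bar>sqrt (len n * (80/81)) - sqrt (80/81 * l)\<bar> * m1)"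
  have s0: "0 \<le> s n" for n by (simp add: s_def)
  have slim: "s \<longlonglongrightarrow> 0" unfolding s_def by (rule powr_third_tendsto_0)
  have llim: "len \<longlonglongrightarrow> l" unfolding len_def s_def by (rule l)
  have Mlim: "Mx \<longlonglongrightarrow> 0"
    unfolding Mx_def by (rule sup_condvar_lim[OF eventually_mono[OF ev] a b]) simp
  have m3: "0 \<le> m3" unfolding m3_def by (rule Bochner_Integration.integral_nonneg) simp
  have "(\<lambda>n. EE n (\<lambda>\<sigma>. \<phi> n \<sigma> (s n * mart (innovation n) (a n) (b n) \<sigma>))
    - EE n (\<lambda>\<sigma>. gauss_avg (\<phi> n \<sigma>) (sqrt (80/81 * l)) 0)) \<longlonglongrightarrow> 0"
  proof (rule tendsto_zero_by_eps[where C="20 * L" and E=E])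
    show "0 \<le> 20 * L" using L0 by simp
    fix e :: real assume e: "0 < e"
    have "E e \<longlonglongrightarrow> l * (L / e * 0 + 4 * L / e\<^sup>2 * (0 * (216 + m3)))
      + L * \<bar>sqrt (l * (80/81)) - sqrt (80/81 * l)\<bar> * m1"
      unfolding E_def by (intro tendsto_intros llim slim Mlim)
    then show "E e \<longlonglongrightarrow> 0" by (simp add: mult.commute)
    show "eventually (\<lambda>n. \<bar>EE n (\<lambda>\<sigma>. \<phi> n \<sigma> (s n * mart (innovation n) (a n) (b n) \<sigma>))
      - EE n (\<lambda>\<sigma>. gauss_avg (\<phi> n \<sigma>) (sqrt (80/81 * l)) 0)\<bar> \<le> 20 * L * e + E e n) sequentially"
      using ev eventually_ge_at_top[of 3]
    proof eventually_elim
      case (elim n)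
      then have ab: "a n \<le> b n" "b n \<le> n" and ad: "adapted n (a n) (\<phi> n)" and n: "n \<ge> 3" by auto
      have v0: "0 \<le> v n" by (simp add: v_def)
      have mi: "martingale_increments n (a n) (b n) (innovation n) 6"
        by (rule martingale_increments_innovation[OF n ab])
      let ?G = "EE n (\<lambda>\<sigma>. gauss_avg (\<phi> n \<sigma>) (sqrt (real (b n - a n) * v n)) 0)"
      have "\<bar>EE n (\<lambda>\<sigma>. \<phi> n \<sigma> (s n * mart (innovation n) (a n) (b n) \<sigma>)) - ?G\<bar>
        \<le> 20 * L * e + (\<Sum>i=a n..<b n. 2 * L / e / 2 * EE n (\<lambda>\<sigma>. \<bar>(s n)\<^sup>2 * condvar n i \<sigma> - v n\<bar>)
            + 4 * L / e\<^sup>2 * ((s n)^3 * 6^3 + sqrt (v n)^3 * m3))"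
        unfolding m3_def condvar_def
        by (rule lindeberg_block_lipschitz[OF mi s0 v0 e ad L])
      also have "(\<Sum>i=a n..<b n. 2 * L / e / 2 * EE n (\<lambda>\<sigma>. \<bar>(s n)\<^sup>2 * condvar n i \<sigma> - v n\<bar>)
            + 4 * L / e\<^sup>2 * ((s n)^3 * 6^3 + sqrt (v n)^3 * m3))
          \<le> (\<Sum>i=a n..<b n. (s n)\<^sup>2 * (L / e * Mx n + 4 * L / e\<^sup>2 * (s n * (216 + m3))))"
      proof (rule sum_mono)
        fix i assume i: "i \<in> {a n..<b n}"
        have "EE n (\<lambda>\<sigma>. \<bar>(s n)\<^sup>2 * condvar n i \<sigma> - v n\<bar>) = EE n (\<lambda>\<sigma>. (s n)\<^sup>2 * \<bar>condvar n i \<sigma> - 80/81\<bar>)"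
        proof (rule EE_cong)
          fix \<sigma>
          have "(s n)\<^sup>2 * condvar n i \<sigma> - v n = (s n)\<^sup>2 * (condvar n i \<sigma> - 80/81)"
            by (simp add: v_def algebra_simps)
          then show "\<bar>(s n)\<^sup>2 * condvar n i \<sigma> - v n\<bar> = (s n)\<^sup>2 * \<bar>condvar n i \<sigma> - 80/81\<bar>"
            by (simp add: abs_mult)
        qed
        also have "\<dots> = (s n)\<^sup>2 * EE n (\<lambda>\<sigma>. \<bar>condvar n i \<sigma> - 80/81\<bar>)" by (rule EE_cmult)
        also have "\<dots> \<le> (s n)\<^sup>2 * Mx n"
          unfolding Mx_def using i by (intro mult_left_mono Max_ge) auto
        finally have 1: "2 * L / e / 2 * EE n (\<lambda>\<sigma>. \<bar>(s n)\<^sup>2 * condvar n i \<sigma> - v n\<bar>) \<le> 2 * L / e / 2 * ((s n)\<^sup>2 * Mx n)"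
          using L0 e by (intro mult_left_mono) auto
        have "sqrt (v n) = s n * sqrt (80/81)" unfolding v_def real_sqrt_mult using s0 by simp
        also have "\<dots> \<le> s n * 1" by (intro mult_left_mono s0) simp
        finally have "sqrt (v n)^3 * m3 \<le> (s n)^3 * m3"
          using m3 v0 by (intro mult_right_mono power_mono) auto
        then have 2: "4 * L / e\<^sup>2 * ((s n)^3 * 6^3 + sqrt (v n)^3 * m3) \<le> 4 * L / e\<^sup>2 * ((s n)^3 * 6^3 + (s n)^3 * m3)"
          using L0 by (intro mult_left_mono) auto
        have "2 * L / e / 2 * ((s n)\<^sup>2 * Mx n) + 4 * L / e\<^sup>2 * ((s n)^3 * 6^3 + (s n)^3 * m3)
            = (s n)\<^sup>2 * (L / e * Mx n + 4 * L / e\<^sup>2 * (s n * (216 + m3)))"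
          by (simp add: power2_eq_square power3_eq_cube algebra_simps)
        then show "2 * L / e / 2 * EE n (\<lambda>\<sigma>. \<bar>(s n)\<^sup>2 * condvar n i \<sigma> - v n\<bar>)
            + 4 * L / e\<^sup>2 * ((s n)^3 * 6^3 + sqrt (v n)^3 * m3)
            \<le> (s n)\<^sup>2 * (L / e * Mx n + 4 * L / e\<^sup>2 * (s n * (216 + m3)))"
          using 1 2 by linarith
      qed
      also have "\<dots> = len n * (L / e * Mx n + 4 * L / e\<^sup>2 * (s n * (216 + m3)))"
        by (simp add: len_def)
      finally have B1: "\<bar>EE n (\<lambda>\<sigma>. \<phi> n \<sigma> (s n * mart (innovation n) (a n) (b n) \<sigma>)) - ?G\<bar>
          \<le> 20 * L * e + len n * (L / e * Mx n + 4 * L / e\<^sup>2 * (s n * (216 + m3)))"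
        by simp
      \<comment> \<open>The scaled length of the block equals \<open>l\<close> only in the limit, so
        the deviation of the normal variable is corrected afterwards by
        \<open>gauss_avg_scale\<close>.\<close>
      have lv: "real (b n - a n) * v n = len n * (80/81)" by (simp add: len_def v_def)
      have "\<bar>?G - EE n (\<lambda>\<sigma>. gauss_avg (\<phi> n \<sigma>) (sqrt (80/81 * l)) 0)\<bar>
          = \<bar>EE n (\<lambda>\<sigma>. gauss_avg (\<phi> n \<sigma>) (sqrt (real (b n - a n) * v n)) 0 - gauss_avg (\<phi> n \<sigma>) (sqrt (80/81 * l)) 0)\<bar>"
        by (simp add: EE_diff)
      also have "\<dots> \<le> EE n (\<lambda>\<sigma>. \<bar>gauss_avg (\<phi> n \<sigma>) (sqrt (real (b n - a n) * v n)) 0 - gauss_avg (\<phi> n \<sigma>) (sqrt (80/81 * l)) 0\<bar>)"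
        by (rule EE_abs)
      also have "\<dots> \<le> EE n (\<lambda>\<sigma>. L * \<bar>sqrt (len n * (80/81)) - sqrt (80/81 * l)\<bar> * m1)"
        unfolding lv m1_def by (intro EE_mono gauss_avg_scale L)
      finally have B2: "\<bar>?G - EE n (\<lambda>\<sigma>. gauss_avg (\<phi> n \<sigma>) (sqrt (80/81 * l)) 0)\<bar>
          \<le> L * \<bar>sqrt (len n * (80/81)) - sqrt (80/81 * l)\<bar> * m1"
        by simp
      show ?case unfolding E_def using B1 B2 by linarith
    qed
  qed
  then show ?thesis unfolding s_def .
qed

definition incr_vec :: "(nat \<Rightarrow> nat \<Rightarrow> nat) \<Rightarrow> nat \<Rightarrow> nat \<Rightarrow> (nat \<Rightarrow> nat) \<Rightarrow> nat \<Rightarrow> real" where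
  "incr_vec mm n N \<sigma> = (\<lambda>i. if i < N then real n powr (- 1/3) * mart (innovation n) (mm n i) (mm n (Suc i)) \<sigma> else 0)"

text \<open>Induction on the number of blocks: the last block is replaced by a normal variable and
  integrated out, which leaves a Lipschitz function of one coordinate less with the same constant.
  The limit is reduced in the same way by \<open>expectation_integrate_last\<close>.\<close>

lemma grid_clt:
  assumes G: "gauss_incr M Z N0 (sqrt (80/81 * l))"
    and mono: "eventually (\<lambda>n. \<forall>j<N0. mm n j \<le> mm n (Suc j)) sequentially"
    and le: "eventually (\<lambda>n. \<forall>j\<le>N0. mm n j \<le> n) sequentially"
    and third: "\<And>j. j \<le> N0 \<Longrightarrow> (\<lambda>n. real (mm n j) / real n) \<longlonglongrightarrow> 1 / 3"
    and len: "\<And>j. j < N0 \<Longrightarrow> (\<lambda>n. real (mm n (Suc j) - mm n j) * (real n powr (- 1/3))\<^sup>2) \<longlonglongrightarrow> l"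
    and F: "coord_lipschitz N0 L F"
  shows "(\<lambda>n. EE n (\<lambda>\<sigma>. F (incr_vec mm n N0 \<sigma>))) \<longlonglongrightarrow> (\<integral>\<omega>. F (\<lambda>i. if i < N0 then Z i \<omega> else 0) \<partial>M)"
proof -
  interpret prob_space M using G by (simp add: gauss_incr_def)
  have "(\<lambda>n. EE n (\<lambda>\<sigma>. F (incr_vec mm n N \<sigma>))) \<longlonglongrightarrow> (\<integral>\<omega>. F (\<lambda>i. if i < N then Z i \<omega> else 0) \<partial>M)"
    if "N \<le> N0" "coord_lipschitz N L F" "gauss_incr M Z N (sqrt (80/81 * l))" for N F
    using that
  proof (induction N arbitrary: F)
    case 0
    show ?case using prob_space by (simp add: incr_vec_def)
  next
    case (Suc N)
    let ?s = "sqrt (80/81 * l)"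
    have N: "N < N0" using Suc.prems(1) by simp
    define \<phi> where "\<phi> = (\<lambda>n \<sigma> y. F ((incr_vec mm n N \<sigma>)(N := y)))"
    have IH: "(\<lambda>n. EE n (\<lambda>\<sigma>. integrate_last N ?s F (incr_vec mm n N \<sigma>)))
        \<longlonglongrightarrow> (\<integral>\<omega>. integrate_last N ?s F (\<lambda>i. if i < N then Z i \<omega> else 0) \<partial>M)"
      using N by (intro Suc.IH coord_lipschitz_integrate_last Suc.prems gauss_incr_mono) auto
    have ev: "eventually (\<lambda>n. mm n N \<le> mm n (Suc N) \<and> mm n (Suc N) \<le> n \<and> adapted n (mm n N) (\<phi> n)) sequentially"
      using mono le eventually_ge_at_top[of 3]
    proof eventually_elim
      case (elim n)
      \<comment> \<open>Earlier blocks end before the last one starts, so their sums are known at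
        its start and \<open>\<phi>\<close> is adapted.\<close>
      have chain: "mm n (Suc i) \<le> mm n N" if "i < N" for i
      proof -
        have "Suc i \<le> N" using that by simp
        then show ?thesis
        proof (induction rule: inc_induct)
          case (step j)
          then show ?case using elim(1) N by (meson le_trans less_trans)
        qed simp
      qed
      have "adapted n (mm n N) (mart (innovation n) (mm n i) (mm n (Suc i)))" if i: "i < N" for i
      proof (rule adapted_mono[OF adapted_mart chain[OF i]])
        show "martingale_increments n (mm n i) (mm n (Suc i)) (innovation n) 6"
          using elim i N by (intro martingale_increments_innovation) auto
        show "mm n i \<le> mm n (Suc i)" using elim i N by auto
      qed simp
      then have "adapted n (mm n N) (\<phi> n)"
        unfolding \<phi>_def incr_vec_def adapted_def
        by (auto intro!: ext arg_cong[where f=F])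
      then show ?case using elim N by auto
    qed
    have clt: "(\<lambda>n. EE n (\<lambda>\<sigma>. \<phi> n \<sigma> (real n powr (- 1/3) * mart (innovation n) (mm n N) (mm n (Suc N)) \<sigma>))
        - EE n (\<lambda>\<sigma>. gauss_avg (\<phi> n \<sigma>) ?s 0)) \<longlonglongrightarrow> 0"
    proof (rule block_clt[OF ev third third len])
      show "L-lipschitz_on UNIV (\<phi> n \<sigma>)" for n \<sigma>
        unfolding \<phi>_def by (rule coord_lipschitz_coordinate[OF Suc.prems(2)])
    qed (use N in auto)
    have e1: "\<phi> n \<sigma> (real n powr (- 1/3) * mart (innovation n) (mm n N) (mm n (Suc N)) \<sigma>) = F (incr_vec mm n (Suc N) \<sigma>)" for n \<sigma>
      unfolding \<phi>_def by (rule coord_lipschitz_cong[OF Suc.prems(2)]) (auto simp: incr_vec_def)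
    have e2: "gauss_avg (\<phi> n \<sigma>) ?s 0 = integrate_last N ?s F (incr_vec mm n N \<sigma>)" for n \<sigma>
      by (simp add: \<phi>_def integrate_last_def)
    from tendsto_add[OF clt[unfolded e1 e2] IH] show ?case
      by (simp add: expectation_integrate_last[OF Suc.prems(3,2)])
  qed
  from this[OF order_refl F G] show ?thesis .
qed

section \<open>Convergence on a grid\<close>

lemma \<beta>_cube: "\<beta> ^ 3 = 3200 / 6561" and \<beta>_pos: "0 < \<beta>"
proof -
  show "0 < \<beta>" by (simp add: \<beta>_def)
  have p: "(x powr y) ^ 3 = x powr (3 * y)" if "0 < x" for x y :: real
    using that by (simp add: powr_power mult.commute)
  have "\<beta> ^ 3 = 2 powr 7 * 3 powr (- 8) * 5 powr 2"
    unfolding \<beta>_def power_mult_distrib by (simp add: p)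
  also have "\<dots> = 2 ^ 7 * inverse (3 ^ 8) * 5 ^ 2"
    by (simp add: powr_minus)
  finally show "\<beta> ^ 3 = 3200 / 6561" by simp
qed

text \<open>Both sides are positive and have cube 3200/6561.\<close>

lemma \<beta>_alt: "\<beta> = 4 / 27 * 150 powr (1/3)"
proof (rule power_eq_imp_eq_base)
  have "(150 powr (1/3)) ^ 3 = (150::real)" by (simp add: powr_power)
  then show "\<beta> ^ 3 = (4 / 27 * 150 powr (1/3)) ^ 3"
    unfolding \<beta>_cube by (simp add: power_mult_distrib power3_eq_cube)
qed (use \<beta>_pos in auto)

text \<open>Brownian time \<open>t\<close> corresponds to \<open>m = n/3 + \<alpha> t n powr (2/3)\<close>; the value of \<open>\<alpha>\<close> makes \<open>(\<alpha> t)\<^sup>2\<close> equal to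
  \<open>\<beta> t\<^sup>2 / 2\<close>, and then \<open>80/81 \<alpha> = \<beta>\<^sup>2\<close> matches the variances.\<close>

definition \<alpha> :: real where "\<alpha> = sqrt (\<beta> / 2)"

lemma \<alpha>_pos: "0 < \<alpha>" using \<beta>_pos by (simp add: \<alpha>_def)

lemma \<alpha>_square: "\<alpha>\<^sup>2 = \<beta> / 2" using \<beta>_pos by (simp add: \<alpha>_def)

lemma variance_scaling: "0 \<le> \<delta> \<Longrightarrow> sqrt (80/81 * (\<alpha> * \<delta>)) = \<beta> * sqrt \<delta>"
proof -
  assume \<delta>: "0 \<le> \<delta>"
  have "(80/81 * \<alpha>)\<^sup>2 = (80/81)\<^sup>2 * (\<beta> / 2)" by (simp only: power_mult_distrib \<alpha>_square)
  also have "\<dots> = 3200 / 6561 * \<beta>" by (simp add: power2_eq_square)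
  also have "\<dots> = (\<beta>\<^sup>2)\<^sup>2" unfolding \<beta>_cube[symmetric] by (simp add: power2_eq_square power3_eq_cube)
  finally have "80/81 * \<alpha> = \<beta>\<^sup>2" by (rule power2_eq_imp_eq) (use \<alpha>_pos in auto)
  then have e: "80/81 * (\<alpha> * \<delta>) = \<beta>\<^sup>2 * \<delta>" by simp
  show ?thesis unfolding e real_sqrt_mult using \<beta>_pos by simp
qed

text \<open>The floor is taken in the integers because grid times may be negative.
  \<open>nat\<close> cuts off only while \<open>n\<close> is small compared with the grid;
  monotonicity in \<open>j\<close> and the exact value at \<open>K\<close> hold for all
  \<open>n\<close>.\<close>

definition grid_index :: "nat \<Rightarrow> real \<Rightarrow> nat \<Rightarrow> nat \<Rightarrow> nat" where
  "grid_index K \<delta> n j = nat (int (n div 3) + \<lfloor>\<alpha> * grid_pt K \<delta> j * real n powr (2/3)\<rfloor>)"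

lemma grid_index_mid [simp]: "grid_index K \<delta> n K = n div 3"
  by (simp add: grid_index_def grid_pt_def)

lemma grid_index_mono: "0 < \<delta> \<Longrightarrow> i \<le> j \<Longrightarrow> grid_index K \<delta> n i \<le> grid_index K \<delta> n j"
  unfolding grid_index_def grid_pt_def using \<alpha>_pos
  by (intro nat_mono add_left_mono floor_mono mult_right_mono mult_left_mono) auto

lemma powr_two_thirds: "0 < n \<Longrightarrow> real n powr (2/3) * (real n powr (- 1/3))\<^sup>2 = 1"
  by (simp add: powr_power powr_add[symmetric])

lemma powr_inverse_third: "0 < n \<Longrightarrow> (real n powr (- 1/3))^3 = 1 / real n"
proof -
  assume n: "0 < n"
  have "(real n powr (- 1/3))^3 = real n powr (- 1)" using n by (simp add: powr_power)
  then show ?thesis using n by (simp add: powr_minus_divide)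
qed

lemma inverse_nat_tendsto_0: "(\<lambda>n. c / real n) \<longlonglongrightarrow> 0"
  by (rule lim_const_over_n)

text \<open>The window has width of order \<open>n powr (2/3)\<close> and is eventually small
  compared with \<open>n\<close>. So no index is cut off, rounding costs at most one step, and
  enough zeros remain.\<close>

lemma eventually_grid_index:
  assumes \<delta>: "0 < \<delta>"
  shows "eventually (\<lambda>n. \<forall>j\<le>2 * K. \<bar>(real (grid_index K \<delta> n j) - real (n div 3)) - \<alpha> * grid_pt K \<delta> j * real n powr (2/3)\<bar> \<le> 1
    \<and> real n / 10 \<le> real (n - grid_index K \<delta> n j) \<and> grid_index K \<delta> n j \<le> n) sequentially"
proof -
  define c where "c = \<alpha> * (real K * \<delta>)"
  have c0: "0 \<le> c" using \<delta> \<alpha>_pos by (simp add: c_def)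
  have "(\<lambda>n. 3 / real n + c * real n powr (- 1/3)) \<longlonglongrightarrow> 0 + c * 0"
    by (intro tendsto_intros powr_third_tendsto_0 inverse_nat_tendsto_0)
  then have "eventually (\<lambda>n. 3 / real n + c * real n powr (- 1/3) < 1 / 6) sequentially"
    by (rule order_tendstoD(2)) simp
  then show ?thesis using eventually_ge_at_top[of 3]
  proof eventually_elim
    case (elim n)
    then have n0: "0 < real n" by simp
    have "real n powr (2/3) = real n * real n powr (- 1/3)"
      using n0 powr_add[of "real n" 1 "- 1/3"] by simp
    moreover have "(3 / real n + c * real n powr (- 1/3)) * real n < 1 / 6 * real n"
      using elim n0 by (intro mult_strict_right_mono) auto
    moreover have "(3 / real n + c * real n powr (- 1/3)) * real n = 3 + c * (real n * real n powr (- 1/3))"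
      using n0 by (simp add: distrib_right)
    ultimately have small: "3 + c * real n powr (2/3) < real n / 6"
      by simp
    show ?case
    proof (intro allI impI)
      fix j assume j: "j \<le> 2 * K"
      let ?x = "\<alpha> * grid_pt K \<delta> j * real n powr (2/3)"
      have "\<bar>real j - real K\<bar> \<le> real K" using j by (auto simp: abs_le_iff)
      then have "\<bar>grid_pt K \<delta> j\<bar> \<le> real K * \<delta>"
        unfolding grid_pt_def abs_mult using \<delta> by (intro mult_mono) auto
      then have "\<bar>?x\<bar> \<le> c * real n powr (2/3)"
        unfolding c_def abs_mult using \<alpha>_pos by (intro mult_mono mult_left_mono) auto
      then have x: "\<bar>?x\<bar> < real n / 6 - 3" using small by linarith
      have fl: "\<bar>real_of_int \<lfloor>?x\<rfloor> - ?x\<bar> \<le> 1" by linarith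
      have t: "\<bar>real (n div 3) - real n / 3\<bar> \<le> 1" by (rule abs_div3)
      have "0 \<le> real_of_int (int (n div 3) + \<lfloor>?x\<rfloor>)"
        using x fl t unfolding abs_le_iff abs_less_iff by simp
      then have "0 \<le> int (n div 3) + \<lfloor>?x\<rfloor>" by (simp only: of_int_0_le_iff)
      then have r: "real (grid_index K \<delta> n j) = real (n div 3) + real_of_int \<lfloor>?x\<rfloor>"
        unfolding grid_index_def by simp
      have "real (grid_index K \<delta> n j) \<le> 9 / 10 * real n"
        unfolding r using x fl t n0 unfolding abs_le_iff abs_less_iff by linarith
      then have "grid_index K \<delta> n j \<le> n" "real n / 10 \<le> real (n - grid_index K \<delta> n j)"
        by (auto simp: of_nat_diff)
      then show "\<bar>(real (grid_index K \<delta> n j) - real (n div 3)) - ?x\<bar> \<le> 1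
        \<and> real n / 10 \<le> real (n - grid_index K \<delta> n j) \<and> grid_index K \<delta> n j \<le> n"
        unfolding r using fl by simp
    qed
  qed
qed

lemma grid_index_scaled:
  assumes \<delta>: "0 < \<delta>" and j: "j \<le> 2 * K"
  shows "(\<lambda>n. (real (grid_index K \<delta> n j) - real (n div 3)) * (real n powr (- 1/3))\<^sup>2) \<longlonglongrightarrow> \<alpha> * grid_pt K \<delta> j"
proof (rule LIM_zero_cancel, rule Lim_null_comparison)
  show "(\<lambda>n. (real n powr (- 1/3))\<^sup>2) \<longlonglongrightarrow> 0"
    using tendsto_power[OF powr_third_tendsto_0, of 2] by simp
  show "eventually (\<lambda>n. norm ((real (grid_index K \<delta> n j) - real (n div 3)) * (real n powr (- 1/3))\<^sup>2 - \<alpha> * grid_pt K \<delta> j)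
      \<le> (real n powr (- 1/3))\<^sup>2) sequentially"
    using eventually_grid_index[OF \<delta>, of K] eventually_gt_at_top[of 0]
  proof eventually_elim
    case (elim n)
    let ?D = "real (grid_index K \<delta> n j) - real (n div 3)" and ?s = "(real n powr (- 1/3))\<^sup>2"
    have "?D * ?s - \<alpha> * grid_pt K \<delta> j = (?D - \<alpha> * grid_pt K \<delta> j * real n powr (2/3)) * ?s"
      using powr_two_thirds[OF elim(2)] by (simp add: left_diff_distrib mult.assoc)
    also have "norm \<dots> \<le> 1 * ?s"
      unfolding real_norm_def abs_mult using elim(1) j by (intro mult_mono) auto
    finally show ?case by simp
  qed
qed

lemma grid_index_third:
  assumes \<delta>: "0 < \<delta>" and j: "j \<le> 2 * K"
  shows "(\<lambda>n. real (grid_index K \<delta> n j) / real n) \<longlonglongrightarrow> 1 / 3"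
proof -
  have "(\<lambda>n. (real (grid_index K \<delta> n j) - real (n div 3)) * (real n powr (- 1/3))\<^sup>2 * real n powr (- 1/3))
      \<longlonglongrightarrow> \<alpha> * grid_pt K \<delta> j * 0"
    by (intro tendsto_intros grid_index_scaled[OF assms] powr_third_tendsto_0)
  moreover have "eventually (\<lambda>n. (real (grid_index K \<delta> n j) - real (n div 3)) * (real n powr (- 1/3))\<^sup>2 * real n powr (- 1/3)
      = (real (grid_index K \<delta> n j) - real (n div 3)) / real n) sequentially"
    using eventually_gt_at_top[of 0]
  proof eventually_elim
    case (elim n)
    then show ?case using powr_inverse_third[OF elim] by (simp add: power2_eq_square power3_eq_cube mult.assoc)
  qed
  ultimately have 1: "(\<lambda>n. (real (grid_index K \<delta> n j) - real (n div 3)) / real n) \<longlonglongrightarrow> 0"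
    using Lim_transform_eventually by fastforce
  have 2: "(\<lambda>n. real (n div 3) / real n) \<longlonglongrightarrow> 1 / 3"
  proof (rule LIM_zero_cancel, rule Lim_null_comparison[OF _ inverse_nat_tendsto_0[of 1]])
    show "eventually (\<lambda>n. norm (real (n div 3) / real n - 1 / 3) \<le> 1 / real n) sequentially"
      using eventually_gt_at_top[of 0]
    proof eventually_elim
      case (elim n)
      then have "real (n div 3) / real n - 1 / 3 = (real (n div 3) - real n / 3) / real n"
        by (simp add: field_simps)
      then show ?case using abs_div3[of n] elim by (simp add: abs_divide divide_right_mono)
    qed
  qed
  from tendsto_add[OF 1 2] show ?thesis by (simp add: diff_divide_distrib)
qed

text \<open>For \<open>D\<close> of order \<open>n powr (2/3)\<close> the scaled parabola is
  \<open>(D * n powr (- 2/3))^2\<close>, with limit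
  \<open>\<alpha>^2 * t^2 = \<beta> * t^2 / 2\<close>, while the cubic term is O(1) and vanishes
  after scaling. \<open>\<kappa>\<close> is the fraction of the parabola that is taken away: 0 for
  the theorem, 1/20 for integrability.\<close>

lemma drift_scaled:
  assumes \<delta>: "0 < \<delta>" and j: "j \<le> 2 * K"
  shows "(\<lambda>n. real n powr (- 1/3) * (run_mean n (grid_index K \<delta> n j) - run_mean n (n div 3)
       + \<kappa> * (real (grid_index K \<delta> n j) - real (n div 3))\<^sup>2 / real n))
    \<longlonglongrightarrow> - (1 - \<kappa>) * (\<beta> / 2) * (grid_pt K \<delta> j)\<^sup>2"
proof -
  define s where "s = (\<lambda>n. real n powr (- 1/3))"
  define m where "m = (\<lambda>n. grid_index K \<delta> n j)"
  define D where "D = (\<lambda>n. real (m n) - real (n div 3))"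
  define y where "y = \<alpha> * grid_pt K \<delta> j"
  have s0: "s \<longlonglongrightarrow> 0" unfolding s_def by (rule powr_third_tendsto_0)
  have Ds: "(\<lambda>n. D n * (s n)\<^sup>2) \<longlonglongrightarrow> y"
    unfolding D_def s_def m_def y_def by (rule grid_index_scaled[OF assms])
  have 1: "(\<lambda>n. s n * (run_mean n (m n) - run_mean n (n div 3) + (D n)\<^sup>2 / real n)) \<longlonglongrightarrow> 0"
  proof (rule Lim_null_comparison)
    have "(\<lambda>n. \<bar>D n * (s n)\<^sup>2\<bar>^3 * s n + 25 * s n) \<longlonglongrightarrow> \<bar>y\<bar>^3 * 0 + 25 * 0"
      by (intro tendsto_intros Ds s0)
    then show "(\<lambda>n. \<bar>D n * (s n)\<^sup>2\<bar>^3 * s n + 25 * s n) \<longlonglongrightarrow> 0" by simp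
    show "eventually (\<lambda>n. norm (s n * (run_mean n (m n) - run_mean n (n div 3) + (D n)\<^sup>2 / real n))
        \<le> \<bar>D n * (s n)\<^sup>2\<bar>^3 * s n + 25 * s n) sequentially"
      using eventually_grid_index[OF \<delta>, of K] eventually_ge_at_top[of 30]
    proof eventually_elim
      case (elim n)
      then have n: "0 < n" by simp
      have b: "\<bar>run_mean n (m n) - run_mean n (n div 3) + (D n)\<^sup>2 / real n\<bar> \<le> \<bar>D n\<bar>^3 / (real n)\<^sup>2 + 25"
        unfolding D_def m_def using elim j by (intro run_mean_diff(1)) auto
      have s6: "((s n)\<^sup>2)^3 = 1 / (real n)\<^sup>2"
      proof -
        have e: "((s n)\<^sup>2)^3 = ((s n)^3)\<^sup>2" by (simp add: power_mult[symmetric] mult.commute)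
        have s3: "(s n)^3 = 1 / real n" using powr_inverse_third[OF n] by (simp only: s_def)
        show ?thesis unfolding e s3 by (simp add: power_divide)
      qed
      have "norm (s n * (run_mean n (m n) - run_mean n (n div 3) + (D n)\<^sup>2 / real n))
          = s n * \<bar>run_mean n (m n) - run_mean n (n div 3) + (D n)\<^sup>2 / real n\<bar>"
        by (simp add: abs_mult s_def)
      also have "\<dots> \<le> s n * (\<bar>D n\<bar>^3 / (real n)\<^sup>2 + 25)"
        using b by (intro mult_left_mono) (auto simp: s_def)
      also have "\<dots> = \<bar>D n * (s n)\<^sup>2\<bar>^3 * s n + 25 * s n"
      proof -
        have "\<bar>D n * (s n)\<^sup>2\<bar>^3 = \<bar>D n\<bar>^3 * ((s n)\<^sup>2)^3"
          by (simp only: abs_mult power_mult_distrib abs_power2)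
        then show ?thesis unfolding s6 by (simp add: algebra_simps)
      qed
      finally show ?case .
    qed
  qed
  have 2: "(\<lambda>n. (1 - \<kappa>) * (D n * (s n)\<^sup>2)\<^sup>2) \<longlonglongrightarrow> (1 - \<kappa>) * y\<^sup>2"
    by (intro tendsto_intros Ds)
  have e: "0 - (1 - \<kappa>) * y\<^sup>2 = - (1 - \<kappa>) * (\<beta> / 2) * (grid_pt K \<delta> j)\<^sup>2"
    unfolding y_def power_mult_distrib \<alpha>_square by (simp add: field_simps)
  have 3: "(\<lambda>n. s n * (run_mean n (m n) - run_mean n (n div 3) + (D n)\<^sup>2 / real n) - (1 - \<kappa>) * (D n * (s n)\<^sup>2)\<^sup>2)
      \<longlonglongrightarrow> - (1 - \<kappa>) * (\<beta> / 2) * (grid_pt K \<delta> j)\<^sup>2"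
    using tendsto_diff[OF 1 2] unfolding e .
  have "(\<lambda>n. s n * (run_mean n (m n) - run_mean n (n div 3) + \<kappa> * (D n)\<^sup>2 / real n))
      \<longlonglongrightarrow> - (1 - \<kappa>) * (\<beta> / 2) * (grid_pt K \<delta> j)\<^sup>2"
  proof (rule Lim_transform_eventually[OF 3])
    show "eventually (\<lambda>n. s n * (run_mean n (m n) - run_mean n (n div 3) + (D n)\<^sup>2 / real n) - (1 - \<kappa>) * (D n * (s n)\<^sup>2)\<^sup>2
       = s n * (run_mean n (m n) - run_mean n (n div 3) + \<kappa> * (D n)\<^sup>2 / real n)) sequentially"
      using eventually_gt_at_top[of 0]
    proof eventually_elim
      case (elim n)
      have "(s n)^3 = 1 / real n" using powr_inverse_third[OF elim] by (simp only: s_def)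
      moreover have "(D n * (s n)\<^sup>2)\<^sup>2 = s n * ((D n)\<^sup>2 * (s n)^3)"
        by (simp add: power2_eq_square power3_eq_cube)
      moreover define q where "q = (D n)\<^sup>2 / real n"
      ultimately have "(D n * (s n)\<^sup>2)\<^sup>2 = s n * q" by simp
      moreover have "\<kappa> * (D n)\<^sup>2 / real n = \<kappa> * q" by (simp add: q_def)
      ultimately show ?case unfolding q_def[symmetric] by (simp add: algebra_simps)
    qed
  qed
  then show ?thesis unfolding s_def D_def m_def .
qed

lemma Max_image_diff_le:
  fixes f g :: "'b \<Rightarrow> real"
  assumes S: "finite S" "S \<noteq> {}" and c: "\<And>j. j \<in> S \<Longrightarrow> \<bar>f j - g j\<bar> \<le> c"
  shows "\<bar>Max (f ` S) - Max (g ` S)\<bar> \<le> c"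
proof -
  have 1: "Max (f ` S) \<le> Max (g ` S) + c" if "\<And>j. j \<in> S \<Longrightarrow> \<bar>f j - g j\<bar> \<le> c" for f g :: "'b \<Rightarrow> real"
  proof (rule Max.boundedI)
    fix y assume "y \<in> f ` S"
    then obtain j where j: "j \<in> S" "y = f j" by auto
    moreover have "g j \<le> Max (g ` S)" using S j by (intro Max_ge) auto
    ultimately show "y \<le> Max (g ` S) + c" using that[of j] by (auto simp: abs_le_iff)
  qed (use S in auto)
  have "Max (f ` S) \<le> Max (g ` S) + c" by (rule 1) (rule c)
  moreover have "Max (g ` S) \<le> Max (f ` S) + c"
    by (rule 1) (use c in \<open>simp add: abs_minus_commute\<close>)
  ultimately show ?thesis by (simp add: abs_le_iff)
qed

text \<open>The argument lists increments. Subtracting the sum up to \<open>K\<close> makes the path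
  vanish at time 0, and \<open>d\<close> stands for the deterministic parabola.\<close>

definition gridmax :: "(nat \<Rightarrow> real) \<Rightarrow> nat \<Rightarrow> (nat \<Rightarrow> real) \<Rightarrow> real" where
  "gridmax d K x = Max ((\<lambda>j. (\<Sum>i<j. x i) - (\<Sum>i<K. x i) + d j) ` {..2 * K})"

lemma coord_lipschitz_gridmax: "coord_lipschitz (2 * K) 2 (gridmax d K)"
  unfolding coord_lipschitz_def
proof (intro conjI allI)
  fix x y :: "nat \<Rightarrow> real"
  let ?S = "\<Sum>i<2 * K. \<bar>x i - y i\<bar>"
  have b: "\<bar>(\<Sum>i<j. x i) - (\<Sum>i<j. y i)\<bar> \<le> ?S" if "j \<le> 2 * K" for j
  proof -
    have "\<bar>(\<Sum>i<j. x i) - (\<Sum>i<j. y i)\<bar> \<le> (\<Sum>i<j. \<bar>x i - y i\<bar>)"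
      unfolding sum_subtractf[symmetric] by (rule sum_abs)
    also have "\<dots> \<le> ?S" using that by (intro sum_mono2) auto
    finally show ?thesis .
  qed
  show "\<bar>gridmax d K x - gridmax d K y\<bar> \<le> 2 * ?S"
    unfolding gridmax_def
  proof (rule Max_image_diff_le)
    fix j assume "j \<in> {..2 * K}"
    then show "\<bar>(\<Sum>i<j. x i) - (\<Sum>i<K. x i) + d j - ((\<Sum>i<j. y i) - (\<Sum>i<K. y i) + d j)\<bar> \<le> 2 * ?S"
      using b[of j] b[of K] by (auto simp: abs_le_iff)
  qed auto
qed simp

lemma coord_lipschitz_comp:
  assumes "L-lipschitz_on UNIV f" "coord_lipschitz N C F"
  shows "coord_lipschitz N (L * C) (\<lambda>x. f (F x))"
  unfolding coord_lipschitz_def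
proof (intro conjI allI)
  have L: "0 \<le> L" by (rule lipschitz_on_nonneg[OF assms(1)])
  show "0 \<le> L * C" using L assms(2) by (simp add: coord_lipschitz_def)
  fix x y
  have "\<bar>f (F x) - f (F y)\<bar> \<le> L * \<bar>F x - F y\<bar>"
    using lipschitz_onD[OF assms(1), of "F x" "F y"] by (simp add: dist_real_def)
  also have "\<dots> \<le> L * (C * (\<Sum>i<N. \<bar>x i - y i\<bar>))"
    by (intro mult_left_mono coord_lipschitzD assms L)
  finally show "\<bar>f (F x) - f (F y)\<bar> \<le> L * C * (\<Sum>i<N. \<bar>x i - y i\<bar>)" by simp
qed

definition scaled_excess :: "real \<Rightarrow> nat \<Rightarrow> (nat \<Rightarrow> nat) \<Rightarrow> nat \<Rightarrow> real" where
  "scaled_excess \<kappa> n \<sigma> m = real n powr (- 1/3) * (run_count n \<sigma> m - run_count n \<sigma> (n div 3)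
     + \<kappa> * (real m - real (n div 3))\<^sup>2 / real n)"

lemma EE_sum_drift_dev_le:
  assumes n: "n \<ge> 30" and ab: "a \<le> b" "b \<le> n" and b: "real n / 10 \<le> real (n - b)"
  shows "EE n (\<lambda>\<sigma>. \<Sum>i=a..<b. \<bar>drift_dev n i \<sigma>\<bar>) \<le> 140 * real (b - a) / sqrt (real n)"
proof (rule power2_le_imp_le)
  have "(EE n (\<lambda>\<sigma>. \<Sum>i=a..<b. \<bar>drift_dev n i \<sigma>\<bar>))\<^sup>2 \<le> EE n (\<lambda>\<sigma>. (\<Sum>i=a..<b. \<bar>drift_dev n i \<sigma>\<bar>)\<^sup>2)"
    by (rule EE_square)
  also have "\<dots> \<le> 19400 / real n * (real (b - a))\<^sup>2"
    by (rule EE_square_sum_drift_dev[OF assms])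
  also have "\<dots> \<le> 19600 / real n * (real (b - a))\<^sup>2"
    by (intro mult_right_mono divide_right_mono) auto
  also have "\<dots> = (140 * real (b - a) / sqrt (real n))\<^sup>2"
    by (simp add: power_divide power_mult_distrib)
  finally show "(EE n (\<lambda>\<sigma>. \<Sum>i=a..<b. \<bar>drift_dev n i \<sigma>\<bar>))\<^sup>2 \<le> (140 * real (b - a) / sqrt (real n))\<^sup>2" .
qed simp

lemma powr_sixth_tendsto_0: "(\<lambda>n. 1 / (real n powr (- 1/3) * sqrt (real n))) \<longlonglongrightarrow> 0"
proof -
  have "(\<lambda>n. real n powr (- 1/6)) \<longlonglongrightarrow> 0"
    using tendsto_neg_powr[of "-1/6" "\<lambda>n. real n" sequentially] filterlim_real_sequentially by simp
  then show ?thesis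
  proof (rule Lim_transform_eventually)
    show "eventually (\<lambda>n. real n powr (- 1/6) = 1 / (real n powr (- 1/3) * sqrt (real n))) sequentially"
      using eventually_gt_at_top[of 0]
    proof eventually_elim
      case (elim n)
      then have "real n powr (- 1/3) * sqrt (real n) = real n powr (1/6)"
        by (simp add: powr_half_sqrt[symmetric] powr_add[symmetric])
      then show ?case by (simp add: powr_minus_divide)
    qed
  qed
qed

lemma centered_runs_chain:
  assumes s: "\<sigma> permutes {1..n}" and n: "n \<ge> 3"
    and mono: "\<And>i. i < N \<Longrightarrow> mm i \<le> mm (Suc i)" and le: "\<And>i. i \<le> N \<Longrightarrow> mm i \<le> n" and j: "j \<le> N"
  shows "centered_runs n \<sigma> (mm j) - centered_runs n \<sigma> (mm 0)
    = (\<Sum>i<j. mart (innovation n) (mm i) (mm (Suc i)) \<sigma>) + (\<Sum>i=mm 0..<mm j. drift_dev n i \<sigma>) \<and> mm 0 \<le> mm j"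
  using j
proof (induction j)
  case (Suc j)
  then have IH: "centered_runs n \<sigma> (mm j) - centered_runs n \<sigma> (mm 0)
    = (\<Sum>i<j. mart (innovation n) (mm i) (mm (Suc i)) \<sigma>) + (\<Sum>i=mm 0..<mm j. drift_dev n i \<sigma>)" "mm 0 \<le> mm j" by auto
  have m: "mm j \<le> mm (Suc j)" "mm (Suc j) \<le> n" using Suc.prems mono le by auto
  have "centered_runs n \<sigma> (mm (Suc j)) - centered_runs n \<sigma> (mm j)
      = mart (innovation n) (mm j) (mm (Suc j)) \<sigma> + (\<Sum>i=mm j..<mm (Suc j). drift_dev n i \<sigma>)"
    by (rule centered_runs_diff[OF s n m])
  moreover have "(\<Sum>i=mm 0..<mm (Suc j). drift_dev n i \<sigma>) = (\<Sum>i=mm 0..<mm j. drift_dev n i \<sigma>) + (\<Sum>i=mm j..<mm (Suc j). drift_dev n i \<sigma>)"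
    by (rule sum.atLeastLessThan_concat[OF IH(2) m(1), symmetric])
  ultimately show ?case using IH m by simp
qed simp

text \<open>Over a window of order \<open>n powr (2/3)\<close> steps the deviations of the drift sum
  to O(n powr (1/6)) in mean, which vanishes after scaling by \<open>n powr (- 1/3)\<close>. What
  remains is a Lipschitz function of the block sums of the martingale and a convergent deterministic
  part.\<close>

lemma grid_convergence:
  fixes f :: "real \<Rightarrow> real" and \<kappa> :: real
  assumes \<delta>: "0 < \<delta>" and K: "0 < K" and L: "L-lipschitz_on UNIV f"
    and G: "gauss_incr M Z (2 * K) (\<beta> * sqrt \<delta>)"
  defines "d \<equiv> \<lambda>j. - (1 - \<kappa>) * (\<beta> / 2) * (grid_pt K \<delta> j)\<^sup>2"
  shows "(\<lambda>n. EE n (\<lambda>\<sigma>. f (Max ((\<lambda>j. scaled_excess \<kappa> n \<sigma> (grid_index K \<delta> n j)) ` {..2 * K}))))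
    \<longlonglongrightarrow> (\<integral>\<omega>. f (gridmax d K (\<lambda>i. if i < 2 * K then Z i \<omega> else 0)) \<partial>M)"
proof -
  define mm where "mm = grid_index K \<delta>"
  define s where "s = (\<lambda>n. real n powr (- 1/3))"
  define dn where "dn = (\<lambda>n j. s n * (run_mean n (mm n j) - run_mean n (n div 3)
       + \<kappa> * (real (mm n j) - real (n div 3))\<^sup>2 / real n))"
  define e where "e = (\<lambda>n. \<Sum>j\<le>2 * K. \<bar>dn n j - d j\<bar>)"
  define W where "W = (\<lambda>n \<sigma>. Max ((\<lambda>j. scaled_excess \<kappa> n \<sigma> (mm n j)) ` {..2 * K}))"
  have L0: "0 \<le> L" by (rule lipschitz_on_nonneg[OF L])
  have ev: "eventually (\<lambda>n. \<forall>j\<le>2 * K. real n / 10 \<le> real (n - mm n j) \<and> mm n j \<le> n) sequentially"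
    unfolding mm_def using eventually_grid_index[OF \<delta>, of K] by (rule eventually_mono) blast
  have mono: "mm n i \<le> mm n j" if "i \<le> j" for n i j
    unfolding mm_def by (rule grid_index_mono[OF \<delta> that])
  have clt: "(\<lambda>n. EE n (\<lambda>\<sigma>. f (gridmax d K (incr_vec mm n (2 * K) \<sigma>))))
      \<longlonglongrightarrow> (\<integral>\<omega>. f (gridmax d K (\<lambda>i. if i < 2 * K then Z i \<omega> else 0)) \<partial>M)"
  proof (rule grid_clt[where l="\<alpha> * \<delta>" and L="L * 2"])
    show "gauss_incr M Z (2 * K) (sqrt (80/81 * (\<alpha> * \<delta>)))"
      using G \<delta> by (subst variance_scaling) auto
    show "eventually (\<lambda>n. \<forall>j<2 * K. mm n j \<le> mm n (Suc j)) sequentially"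
      using mono by simp
    show "eventually (\<lambda>n. \<forall>j\<le>2 * K. mm n j \<le> n) sequentially"
      using ev by (rule eventually_mono) blast
    show "(\<lambda>n. real (mm n j) / real n) \<longlonglongrightarrow> 1 / 3" if "j \<le> 2 * K" for j
      unfolding mm_def by (rule grid_index_third[OF \<delta> that])
    show "coord_lipschitz (2 * K) (L * 2) (\<lambda>x. f (gridmax d K x))"
      by (rule coord_lipschitz_comp[OF L coord_lipschitz_gridmax])
    show "(\<lambda>n. real (mm n (Suc j) - mm n j) * (real n powr (- 1/3))\<^sup>2) \<longlonglongrightarrow> \<alpha> * \<delta>" if j: "j < 2 * K" for j
    proof -
      have "(\<lambda>n. (real (mm n (Suc j)) - real (n div 3)) * (real n powr (- 1/3))\<^sup>2
          - (real (mm n j) - real (n div 3)) * (real n powr (- 1/3))\<^sup>2) \<longlonglongrightarrow> \<alpha> * grid_pt K \<delta> (Suc j) - \<alpha> * grid_pt K \<delta> j"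
        unfolding mm_def using j by (intro tendsto_diff grid_index_scaled[OF \<delta>]) auto
      moreover have "\<alpha> * grid_pt K \<delta> (Suc j) - \<alpha> * grid_pt K \<delta> j = \<alpha> * \<delta>"
        by (simp add: grid_pt_def algebra_simps)
      moreover have "real (mm n (Suc j) - mm n j) * (real n powr (- 1/3))\<^sup>2
        = (real (mm n (Suc j)) - real (n div 3)) * (real n powr (- 1/3))\<^sup>2
          - (real (mm n j) - real (n div 3)) * (real n powr (- 1/3))\<^sup>2" for n
        using mono[of j "Suc j" n] by (simp add: of_nat_diff left_diff_distrib)
      ultimately show ?thesis by simp
    qed
  qed
  define tot where "tot = (\<lambda>n. real (mm n (2 * K) - mm n 0) * (s n)\<^sup>2)"
  have totlim: "tot \<longlonglongrightarrow> \<alpha> * grid_pt K \<delta> (2 * K) - \<alpha> * grid_pt K \<delta> 0"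
  proof -
    have "tot = (\<lambda>n. (real (mm n (2 * K)) - real (n div 3)) * (s n)\<^sup>2 - (real (mm n 0) - real (n div 3)) * (s n)\<^sup>2)"
      unfolding tot_def using mono[of 0 "2 * K"] by (auto simp: of_nat_diff left_diff_distrib)
    then show ?thesis
      unfolding mm_def s_def by (simp only:) (intro tendsto_diff grid_index_scaled[OF \<delta>]; simp)
  qed
  define Err where "Err = (\<lambda>n. L * (2 * (140 * (tot n * (1 / (s n * sqrt (real n))))) + e n))"
  have Errlim: "Err \<longlonglongrightarrow> 0"
  proof -
    have "e \<longlonglongrightarrow> (\<Sum>j\<le>2 * K. \<bar>d j - d j\<bar>)"
      unfolding e_def dn_def s_def mm_def d_def
      by (intro tendsto_sum tendsto_rabs tendsto_diff tendsto_const drift_scaled[OF \<delta>]) simp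
    then have elim: "e \<longlonglongrightarrow> 0" by simp
    have six: "(\<lambda>n. 1 / (s n * sqrt (real n))) \<longlonglongrightarrow> 0"
      unfolding s_def by (rule powr_sixth_tendsto_0)
    have "Err \<longlonglongrightarrow> L * (2 * (140 * ((\<alpha> * grid_pt K \<delta> (2 * K) - \<alpha> * grid_pt K \<delta> 0) * 0)) + 0)"
      unfolding Err_def by (intro tendsto_intros totlim six elim)
    then show ?thesis by simp
  qed
  have bound: "eventually (\<lambda>n. \<bar>EE n (\<lambda>\<sigma>. f (W n \<sigma>)) - EE n (\<lambda>\<sigma>. f (gridmax d K (incr_vec mm n (2 * K) \<sigma>)))\<bar> \<le> Err n) sequentially"
    using ev eventually_ge_at_top[of 30]
  proof eventually_elim
    case (elim n)
    then have n: "n \<ge> 30" "n \<ge> 3" "0 < n" and le: "\<And>j. j \<le> 2 * K \<Longrightarrow> mm n j \<le> n"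
      and w: "real n / 10 \<le> real (n - mm n (2 * K))" by auto
    define S where "S = (\<lambda>\<sigma>. \<Sum>i=mm n 0..<mm n (2 * K). \<bar>drift_dev n i \<sigma>\<bar>)"
    have s0: "0 < s n" using n by (simp add: s_def)
    have pw: "\<bar>W n \<sigma> - gridmax d K (incr_vec mm n (2 * K) \<sigma>)\<bar> \<le> 2 * (s n * S \<sigma>) + e n"
      if \<sigma>: "\<sigma> permutes {1..n}" for \<sigma>
      unfolding W_def gridmax_def
    proof (rule Max_image_diff_le)
      fix j assume j: "j \<in> {..2 * K}"
      define T where "T = (\<lambda>j. \<Sum>i=mm n 0..<mm n j. drift_dev n i \<sigma>)"
      define U where "U = (\<lambda>j. \<Sum>i<j. mart (innovation n) (mm n i) (mm n (Suc i)) \<sigma>)"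
      have ch: "centered_runs n \<sigma> (mm n j) - centered_runs n \<sigma> (mm n 0) = U j + T j" if "j \<le> 2 * K" for j
        unfolding U_def T_def
        using centered_runs_chain[OF \<sigma> n(2), of "2 * K" "mm n" j] mono le that by simp
      have inc: "(\<Sum>i<j. incr_vec mm n (2 * K) \<sigma> i) = s n * U j" if "j \<le> 2 * K" for j
        unfolding U_def sum_distrib_left using that by (intro sum.cong) (auto simp: incr_vec_def s_def)
      have T: "\<bar>T j\<bar> \<le> S \<sigma>" if "j \<le> 2 * K" for j
      proof -
        have "\<bar>T j\<bar> \<le> (\<Sum>i=mm n 0..<mm n j. \<bar>drift_dev n i \<sigma>\<bar>)" unfolding T_def by (rule sum_abs)
        also have "\<dots> \<le> S \<sigma>" unfolding S_def using mono[OF that] by (intro sum_mono2) auto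
        finally show ?thesis .
      qed
      have mK: "mm n K = n div 3" by (simp add: mm_def)
      \<comment> \<open>Grid index \<open>K\<close> is \<open>n div 3\<close>. Both counts are
        measured from the leftmost grid point, where the first block starts.\<close>
      have "scaled_excess \<kappa> n \<sigma> (mm n j) = s n * ((centered_runs n \<sigma> (mm n j) - centered_runs n \<sigma> (mm n 0)) - (centered_runs n \<sigma> (mm n K) - centered_runs n \<sigma> (mm n 0))) + dn n j"
        unfolding scaled_excess_def dn_def s_def centered_runs_def mK by (simp add: algebra_simps)
      also have "\<dots> = s n * U j - s n * U K + s n * (T j - T K) + dn n j"
        using ch[of j] ch[of K] j by (simp add: algebra_simps)
      finally have eq: "scaled_excess \<kappa> n \<sigma> (mm n j) - ((\<Sum>i<j. incr_vec mm n (2 * K) \<sigma> i) - (\<Sum>i<K. incr_vec mm n (2 * K) \<sigma> i) + d j)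
          = s n * (T j - T K) + (dn n j - d j)"
        using inc[of j] inc[of K] j by simp
      have "\<bar>s n * (T j - T K)\<bar> \<le> s n * (2 * S \<sigma>)"
        unfolding abs_mult using T[of j] T[of K] j s0 by (intro mult_mono) (auto simp: abs_le_iff)
      moreover have "\<bar>dn n j - d j\<bar> \<le> e n"
        unfolding e_def by (rule member_le_sum[OF j]) auto
      ultimately show "\<bar>scaled_excess \<kappa> n \<sigma> (mm n j) - ((\<Sum>i<j. incr_vec mm n (2 * K) \<sigma> i) - (\<Sum>i<K. incr_vec mm n (2 * K) \<sigma> i) + d j)\<bar>
          \<le> 2 * (s n * S \<sigma>) + e n"
        unfolding eq by linarith
    qed auto
    have "\<bar>EE n (\<lambda>\<sigma>. f (W n \<sigma>)) - EE n (\<lambda>\<sigma>. f (gridmax d K (incr_vec mm n (2 * K) \<sigma>)))\<bar>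
        = \<bar>EE n (\<lambda>\<sigma>. f (W n \<sigma>) - f (gridmax d K (incr_vec mm n (2 * K) \<sigma>)))\<bar>" by (simp add: EE_diff)
    also have "\<dots> \<le> EE n (\<lambda>\<sigma>. \<bar>f (W n \<sigma>) - f (gridmax d K (incr_vec mm n (2 * K) \<sigma>))\<bar>)" by (rule EE_abs)
    also have "\<dots> \<le> EE n (\<lambda>\<sigma>. L * (2 * (s n * S \<sigma>) + e n))"
    proof (rule EE_mono)
      fix \<sigma> assume \<sigma>: "\<sigma> permutes {1..n}"
      have "\<bar>f (W n \<sigma>) - f (gridmax d K (incr_vec mm n (2 * K) \<sigma>))\<bar> \<le> L * \<bar>W n \<sigma> - gridmax d K (incr_vec mm n (2 * K) \<sigma>)\<bar>"
        using lipschitz_onD[OF L, of "W n \<sigma>"] by (simp add: dist_real_def)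
      also have "\<dots> \<le> L * (2 * (s n * S \<sigma>) + e n)" by (intro mult_left_mono pw[OF \<sigma>] L0)
      finally show "\<bar>f (W n \<sigma>) - f (gridmax d K (incr_vec mm n (2 * K) \<sigma>))\<bar> \<le> L * (2 * (s n * S \<sigma>) + e n)" .
    qed
    also have "\<dots> = L * (2 * (s n * EE n S) + e n)" by (simp only: EE_cmult EE_add EE_const)
    also have "\<dots> \<le> Err n"
    proof -
      have "s n * EE n S \<le> s n * (140 * real (mm n (2 * K) - mm n 0) / sqrt (real n))"
        unfolding S_def using s0 le w mono[of 0 "2 * K" n] n by (intro mult_left_mono EE_sum_drift_dev_le) auto
      also have "\<dots> = 140 * (tot n * (1 / (s n * sqrt (real n))))"
        unfolding tot_def using s0 n by (simp add: field_simps power2_eq_square)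
      finally show ?thesis unfolding Err_def using L0 by (intro mult_left_mono) auto
    qed
    finally show ?case .
  qed
  have "(\<lambda>n. EE n (\<lambda>\<sigma>. f (W n \<sigma>)) - EE n (\<lambda>\<sigma>. f (gridmax d K (incr_vec mm n (2 * K) \<sigma>)))) \<longlonglongrightarrow> 0"
    by (rule Lim_null_comparison[OF _ Errlim]) (use bound in simp)
  from tendsto_add[OF this clt] show ?thesis
    unfolding W_def mm_def by simp
qed

section \<open>From the grid to all steps\<close>

lemma le_eps_plus_power4: 
  fixes y \<epsilon> :: real assumes "0 < \<epsilon>" shows "y \<le> \<epsilon> + y^4 / \<epsilon>^3"
proof (cases "y \<le> \<epsilon>")
  case True
  then show ?thesis using assms by (simp add: add_increasing2)
next
  case False
  then have "\<epsilon>^3 * y \<le> y^3 * y" using assms by (intro mult_right_mono power_mono) auto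
  then have "y \<le> y^4 / \<epsilon>^3" using assms by (simp add: pos_le_divide_eq power4_eq_xxxx power3_eq_cube mult_ac)
  then show ?thesis using assms by simp
qed

lemma find_block:
  fixes mm :: "nat \<Rightarrow> nat"
  assumes "mm 0 \<le> m" "m \<le> mm N" "0 < N"
  obtains j where "j < N" "mm j \<le> m" "m \<le> mm (Suc j)"
proof -
  have "\<exists>j<N. mm j \<le> m \<and> m \<le> mm (Suc j)"
    using assms
  proof (induction N)
    case (Suc N)
    show ?case
    proof (cases "mm N \<le> m")
      case True
      then show ?thesis using Suc.prems by auto
    next
      case False
      then have "0 < N" using Suc.prems(1) by (cases N) auto
      then show ?thesis using Suc.IH Suc.prems False by (auto intro: less_SucI)
    qed
  qed simp
  then show ?thesis using that by blast
qed

definition walk_max :: "nat \<Rightarrow> (nat \<Rightarrow> nat) \<Rightarrow> real" where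
  "walk_max n \<sigma> = Max (scaled_excess 0 n \<sigma> ` {0..n})"

definition grid_walk_max :: "real \<Rightarrow> nat \<Rightarrow> real \<Rightarrow> nat \<Rightarrow> (nat \<Rightarrow> nat) \<Rightarrow> real" where
  "grid_walk_max \<kappa> K \<delta> n \<sigma> = Max ((\<lambda>j. scaled_excess \<kappa> n \<sigma> (grid_index K \<delta> n j)) ` {..2 * K})"

lemma scaled_excess_third [simp]: "scaled_excess \<kappa> n \<sigma> (n div 3) = 0"
  by (simp add: scaled_excess_def)

lemma grid_walk_max_nonneg: "0 \<le> grid_walk_max \<kappa> K \<delta> n \<sigma>"
proof -
  have "scaled_excess \<kappa> n \<sigma> (grid_index K \<delta> n K) \<le> grid_walk_max \<kappa> K \<delta> n \<sigma>"
    unfolding grid_walk_max_def by (rule Max_ge, simp, rule image_eqI[of _ _ K]) auto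
  then show ?thesis by simp
qed

lemma s_identities:
  fixes n :: nat
  assumes "0 < n"
  defines "s \<equiv> real n powr (- 1/3)"
  shows "0 < s" "real n * s^3 = 1" "real n powr (2/3) = 1 / s\<^sup>2"
proof -
  show s: "0 < s" using assms by simp
  show "real n * s^3 = 1" unfolding s_def powr_inverse_third[OF assms(1)] using assms(1) by simp
  show "real n powr (2/3) = 1 / s\<^sup>2"
    using powr_two_thirds[OF assms(1)] s unfolding s_def by (simp add: field_simps)
qed

text \<open>The limiting error has four sources: steps outside the window, a threshold
  \<open>\<epsilon>\<close> for the oscillation between grid points, the expected excess over it,
  and the variation of the mean between neighbours. All but \<open>\<epsilon>\<close> vanish when
  the window grows while the mesh shrinks so fast that \<open>K * \<delta>^2\<close> tends to
  0.\<close>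

lemma window_approx:
  fixes \<delta> \<epsilon> :: real
  assumes \<delta>: "0 < \<delta>" and K: "0 < K" and \<epsilon>: "0 < \<epsilon>"
  defines "r \<equiv> \<alpha> * (real K * \<delta>)"
  shows "\<exists>E. E \<longlonglongrightarrow> 1724800 / r + \<epsilon> + 2 * real K * 4644864 * (\<alpha> * \<delta>)\<^sup>2 / \<epsilon>^3 + 2 * (\<alpha> * \<delta>) * r \<and>
    eventually (\<lambda>n. (\<forall>\<sigma>. grid_walk_max 0 K \<delta> n \<sigma> \<le> walk_max n \<sigma>) \<and>
      EE n (\<lambda>\<sigma>. walk_max n \<sigma> - grid_walk_max 0 K \<delta> n \<sigma>) \<le> E n) sequentially"
proof -
  define s where "s = (\<lambda>n. real n powr (- 1/3))"
  define \<Lambda> where "\<Lambda> = (\<lambda>n. \<alpha> * \<delta> + 2 * (s n)\<^sup>2)"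
  define \<Delta> where "\<Delta> = (\<lambda>n. r + (s n)\<^sup>2)"
  define E where "E = (\<lambda>n. 1724800 / (r - 2 * (s n)\<^sup>2) + 431223 * s n + \<epsilon> + 2 * real K * 4644864 * (\<Lambda> n)\<^sup>2 / \<epsilon>^3
     + 140 * (2 * \<Delta> n * (1 / (s n * sqrt (real n)))) + (2 * \<Lambda> n * \<Delta> n + 2 * s n * (\<Delta> n)^3 + 50 * s n))"
  have r0: "0 < r" using \<delta> K \<alpha>_pos by (simp add: r_def)
  have s0: "s \<longlonglongrightarrow> 0" unfolding s_def by (rule powr_third_tendsto_0)
  have six: "(\<lambda>n. 1 / (s n * sqrt (real n))) \<longlonglongrightarrow> 0"
    unfolding s_def by (rule powr_sixth_tendsto_0)
  have \<Lambda>l: "\<Lambda> \<longlonglongrightarrow> \<alpha> * \<delta> + 2 * 0\<^sup>2" unfolding \<Lambda>_def by (intro tendsto_intros s0)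
  have \<Delta>l: "\<Delta> \<longlonglongrightarrow> r + 0\<^sup>2" unfolding \<Delta>_def by (intro tendsto_intros s0)
  have "E \<longlonglongrightarrow> 1724800 / (r - 2 * 0\<^sup>2) + 431223 * 0 + \<epsilon> + 2 * real K * 4644864 * (\<alpha> * \<delta> + 2 * 0\<^sup>2)\<^sup>2 / \<epsilon>^3
     + 140 * (2 * (r + 0\<^sup>2) * 0) + (2 * (\<alpha> * \<delta> + 2 * 0\<^sup>2) * (r + 0\<^sup>2) + 2 * 0 * (r + 0\<^sup>2)^3 + 50 * 0)"
    unfolding E_def by (intro tendsto_intros s0 six \<Lambda>l \<Delta>l) (use r0 \<epsilon> in auto)
  then have Elim: "E \<longlonglongrightarrow> 1724800 / r + \<epsilon> + 2 * real K * 4644864 * (\<alpha> * \<delta>)\<^sup>2 / \<epsilon>^3 + 2 * (\<alpha> * \<delta>) * r" by simp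
  have "(\<lambda>n. 3 * (s n)\<^sup>2) \<longlonglongrightarrow> 3 * 0\<^sup>2" by (intro tendsto_intros s0)
  then have evr: "eventually (\<lambda>n. 3 * (s n)\<^sup>2 < r) sequentially"
    by (rule order_tendstoD(2)) (use r0 in simp)
  have "eventually (\<lambda>n. (\<forall>\<sigma>. grid_walk_max 0 K \<delta> n \<sigma> \<le> walk_max n \<sigma>) \<and>
      EE n (\<lambda>\<sigma>. walk_max n \<sigma> - grid_walk_max 0 K \<delta> n \<sigma>) \<le> E n) sequentially"
    using eventually_grid_index[OF \<delta>, of K] eventually_ge_at_top[of 30] evr
  proof eventually_elim
    case (elim n)
    define mm where "mm = grid_index K \<delta> n"
    define m0 where "m0 = n div 3"
    define x where "x = r * real n powr (2/3)"
    have n: "n \<ge> 30" "n \<ge> 3" "0 < n" using elim by auto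
    note si = s_identities[OF n(3), folded s_def]
    have sn: "0 < s n" "real n * (s n)^3 = 1" "real n powr (2/3) = 1 / (s n)\<^sup>2"
      using si by (simp_all add: s_def)
    have le: "mm j \<le> n" and w: "real n / 10 \<le> real (n - mm j)"
      and D: "\<bar>(real (mm j) - real m0) - \<alpha> * grid_pt K \<delta> j * real n powr (2/3)\<bar> \<le> 1" if "j \<le> 2 * K" for j
      using elim(1) that unfolding mm_def m0_def by auto
    have mono: "mm i \<le> mm j" if "i \<le> j" for i j
      unfolding mm_def by (rule grid_index_mono[OF \<delta> that])
    have x: "x * (s n)\<^sup>2 = r" using sn by (simp add: x_def)
    have D0: "real (mm 0) - real m0 \<le> - x + 1"
      using D[of 0] unfolding x_def r_def grid_pt_def by (simp add: abs_le_iff mult.assoc)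
    have D2: "x - 1 \<le> real (mm (2 * K)) - real m0"
      using D[of "2 * K"] unfolding x_def r_def grid_pt_def by (simp add: abs_le_iff mult.assoc)
    have Dj: "\<bar>real (mm j) - real m0\<bar> \<le> \<Delta> n / (s n)\<^sup>2" if j: "j \<le> 2 * K" for j
    proof -
      have "\<bar>real j - real K\<bar> \<le> real K" using j by (auto simp: abs_le_iff)
      then have "\<bar>grid_pt K \<delta> j\<bar> \<le> real K * \<delta>"
        unfolding grid_pt_def abs_mult using \<delta> by (intro mult_mono) auto
      then have "\<bar>\<alpha> * grid_pt K \<delta> j * real n powr (2/3)\<bar> \<le> r * real n powr (2/3)"
        unfolding abs_mult r_def using \<alpha>_pos by (intro mult_mono mult_left_mono) auto
      moreover have "\<Delta> n / (s n)\<^sup>2 = r * real n powr (2/3) + 1"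
        using sn by (simp add: \<Delta>_def add_divide_distrib)
      ultimately show ?thesis using D[OF j] by linarith
    qed
    have lenj: "real (mm (Suc j) - mm j) * (s n)\<^sup>2 \<le> \<Lambda> n" if j: "j < 2 * K" for j
    proof -
      have "\<alpha> * grid_pt K \<delta> (Suc j) * real n powr (2/3) - \<alpha> * grid_pt K \<delta> j * real n powr (2/3) = \<alpha> * \<delta> * real n powr (2/3)"
        by (simp add: grid_pt_def algebra_simps)
      then have "real (mm (Suc j)) - real (mm j) \<le> \<alpha> * \<delta> * real n powr (2/3) + 2"
        using D[of j] D[of "Suc j"] j by (simp add: abs_le_iff)
      then have "real (mm (Suc j) - mm j) \<le> \<alpha> * \<delta> * real n powr (2/3) + 2"
        using mono[of j "Suc j"] by (simp add: of_nat_diff)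
      then have "real (mm (Suc j) - mm j) * (s n)\<^sup>2 \<le> (\<alpha> * \<delta> * real n powr (2/3) + 2) * (s n)\<^sup>2"
        by (rule mult_right_mono) simp
      also have "\<dots> = \<Lambda> n" using sn by (simp add: \<Lambda>_def distrib_right)
      finally show ?thesis .
    qed
    \<comment> \<open>Slightly less than the half width \<open>x\<close> of the window: the slack of
      one step absorbs the rounding, so every \<open>m\<close> closer than \<open>R\<close> to
      \<open>n div 3\<close> lies between the outermost grid indices.\<close>
    define R where "R = nat \<lfloor>x - 1\<rfloor>"
    have x3: "3 \<le> x"
    proof -
      have "3 * (s n)\<^sup>2 \<le> x * (s n)\<^sup>2" using elim(3) unfolding x by simp
      then show ?thesis using sn(1) by simp
    qed
    have R: "R \<ge> 1" "x - 2 \<le> real R" "real R \<le> x - 1"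
    proof -
      have "0 \<le> \<lfloor>x - 1\<rfloor>" using x3 by simp
      then have r: "real R = real_of_int \<lfloor>x - 1\<rfloor>" by (simp add: R_def)
      show "x - 2 \<le> real R" "real R \<le> x - 1" unfolding r by linarith+
      then have "real 1 \<le> real R" using x3 by simp
      then show "R \<ge> 1" by (simp only: of_nat_le_iff)
    qed
    obtain T where T0: "\<And>\<sigma>. 0 \<le> T \<sigma>" and ET: "EE n T \<le> 1724800 * (real n / real R) + 431223"
      and T: "\<And>\<sigma> m. \<sigma> permutes {1..n} \<Longrightarrow> m \<le> n \<Longrightarrow> real R \<le> \<bar>real m - real (n div 3)\<bar> \<Longrightarrow>
        run_count n \<sigma> m - run_count n \<sigma> (n div 3) + (real m - real (n div 3))\<^sup>2 / (20 * real n) \<le> T \<sigma>"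
      using tail_bound[OF n(1) R(1)] by blast
    define Mx where "Mx = (\<lambda>j \<sigma>. Max ((\<lambda>m. \<bar>mart (innovation n) (mm j) m \<sigma>\<bar>) ` {mm j..mm (Suc j)}))"
    define S where "S = (\<lambda>\<sigma>. \<Sum>i=mm 0..<mm (2 * K). \<bar>drift_dev n i \<sigma>\<bar>)"
    define dr where "dr = 2 * \<Lambda> n * \<Delta> n + 2 * s n * (\<Delta> n)^3 + 50 * s n"
    have dr0: "0 \<le> dr" unfolding dr_def \<Lambda>_def \<Delta>_def using sn(1) r0 \<delta> \<alpha>_pos by simp
    have S0: "0 \<le> S \<sigma>" for \<sigma> unfolding S_def by (rule sum_nonneg) simp
    have Q0: "0 \<le> (\<Sum>j<2 * K. (s n * Mx j \<sigma>)^4 / \<epsilon>^3)" for \<sigma> using \<epsilon> by (intro sum_nonneg) simp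
    \<comment> \<open>Between neighbouring grid indices the parabola changes by a difference of
      squares, at most the mesh times the width of the window. The cubic and constant errors of
      \<open>run_mean_diff\<close> vanish after scaling.\<close>
    have drift: "s n * (run_mean n m - run_mean n (mm j)) \<le> dr"
      if j: "j < 2 * K" and m: "mm j \<le> m" "m \<le> mm (Suc j)" for j m
    proof -
      let ?a = "real m - real m0" and ?b = "real (mm j) - real m0" and ?D = "\<Delta> n / (s n)\<^sup>2"
      have mn: "m \<le> n" "mm j \<le> n" using m le[of "Suc j"] le[of j] j by auto
      have b: "\<bar>?b\<bar> \<le> ?D" using Dj[of j] j by simp
      have a: "\<bar>?a\<bar> \<le> ?D" using Dj[of j] Dj[of "Suc j"] j m by (simp add: abs_le_iff)
      have "?b\<^sup>2 - ?a\<^sup>2 = (?b - ?a) * (?b + ?a)" by (simp add: power2_eq_square algebra_simps)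
      also have "\<dots> \<le> \<bar>?b - ?a\<bar> * \<bar>?b + ?a\<bar>" unfolding abs_mult[symmetric] by (rule abs_ge_self)
      also have "\<dots> \<le> (\<Lambda> n / (s n)\<^sup>2) * (2 * ?D)"
      proof (intro mult_mono)
        have "\<bar>?b - ?a\<bar> \<le> real (mm (Suc j) - mm j)" using m by (simp add: of_nat_diff)
        also have "\<dots> \<le> \<Lambda> n / (s n)\<^sup>2" using lenj[OF j] sn(1) by (simp add: pos_le_divide_eq)
        finally show "\<bar>?b - ?a\<bar> \<le> \<Lambda> n / (s n)\<^sup>2" .
        show "\<bar>?b + ?a\<bar> \<le> 2 * ?D" using a b by (simp add: abs_le_iff)
        show "0 \<le> \<Lambda> n / (s n)\<^sup>2" unfolding \<Lambda>_def using \<delta> \<alpha>_pos by simp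
      qed simp
      finally have "(?b\<^sup>2 - ?a\<^sup>2) / real n \<le> (\<Lambda> n / (s n)\<^sup>2) * (2 * ?D) / real n"
        by (rule divide_right_mono) simp
      then have q: "?b\<^sup>2 / real n - ?a\<^sup>2 / real n \<le> (\<Lambda> n / (s n)\<^sup>2) * (2 * ?D) / real n"
        by (simp add: diff_divide_distrib)
      have "\<bar>?a\<bar>^3 / (real n)\<^sup>2 \<le> ?D^3 / (real n)\<^sup>2" "\<bar>?b\<bar>^3 / (real n)\<^sup>2 \<le> ?D^3 / (real n)\<^sup>2"
        using a b by (auto intro!: divide_right_mono power_mono)
      then have "run_mean n m - run_mean n (mm j) \<le> (\<Lambda> n / (s n)\<^sup>2) * (2 * ?D) / real n + 2 * (?D^3 / (real n)\<^sup>2) + 50"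
        using run_mean_diff(1)[OF n(1) mn(1)] run_mean_diff(1)[OF n(1) mn(2)] q
        unfolding m0_def abs_le_iff by linarith
      then have "s n * (run_mean n m - run_mean n (mm j))
          \<le> s n * ((\<Lambda> n / (s n)\<^sup>2) * (2 * ?D) / real n + 2 * (?D^3 / (real n)\<^sup>2) + 50)"
        using sn(1) by (intro mult_left_mono) auto
      also have "\<dots> = dr"
      proof -
        have nn: "real n = 1 / (s n)^3" using sn(1,2) by (simp add: field_simps)
        show ?thesis unfolding dr_def nn using sn(1)
          by (simp add: power2_eq_square power3_eq_cube field_simps)
      qed
      finally show ?thesis .
    qed
    have pw: "walk_max n \<sigma> - grid_walk_max 0 K \<delta> n \<sigma>
        \<le> s n * T \<sigma> + \<epsilon> + (\<Sum>j<2 * K. (s n * Mx j \<sigma>)^4 / \<epsilon>^3) + s n * S \<sigma> + dr" if \<sigma>: "\<sigma> permutes {1..n}" for \<sigma>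
    proof -
      have "walk_max n \<sigma> \<in> scaled_excess 0 n \<sigma> ` {0..n}" unfolding walk_max_def by (intro Max_in) auto
      then obtain m where m: "m \<le> n" "walk_max n \<sigma> = scaled_excess 0 n \<sigma> m" by auto
      show ?thesis
      proof (cases "real R \<le> \<bar>real m - real m0\<bar>")
        case True
        have "run_count n \<sigma> m - run_count n \<sigma> m0 \<le> T \<sigma>"
          using T[OF \<sigma> m(1)] True unfolding m0_def by (smt (verit) divide_nonneg_nonneg of_nat_0_le_iff zero_le_power2)
        then have "scaled_excess 0 n \<sigma> m \<le> s n * T \<sigma>"
          unfolding scaled_excess_def m0_def s_def by (simp add: mult_left_mono)
        then show ?thesis
          using m grid_walk_max_nonneg[of 0 K \<delta> n \<sigma>] Q0[of \<sigma>] dr0 \<epsilon> mult_nonneg_nonneg[OF less_imp_le[OF sn(1)] S0[of \<sigma>]]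
          by linarith
      next
        case False
        then have "real (mm 0) \<le> real m" "real m \<le> real (mm (2 * K))"
          using D0 D2 R by (auto simp: abs_le_iff not_le abs_less_iff)
        then obtain j where j: "j < 2 * K" "mm j \<le> m" "m \<le> mm (Suc j)"
          using find_block[of mm m "2 * K"] K by auto
        have "scaled_excess 0 n \<sigma> (mm j) \<le> grid_walk_max 0 K \<delta> n \<sigma>"
          unfolding grid_walk_max_def mm_def using j by (intro Max_ge) auto
        moreover have "scaled_excess 0 n \<sigma> m - scaled_excess 0 n \<sigma> (mm j) = s n * (centered_runs n \<sigma> m - centered_runs n \<sigma> (mm j)) + s n * (run_mean n m - run_mean n (mm j))"
          unfolding scaled_excess_def centered_runs_def s_def by (simp add: algebra_simps)
        moreover have "s n * (centered_runs n \<sigma> m - centered_runs n \<sigma> (mm j)) \<le> s n * Mx j \<sigma> + s n * S \<sigma>"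
        proof -
          have "centered_runs n \<sigma> m - centered_runs n \<sigma> (mm j) = mart (innovation n) (mm j) m \<sigma> + (\<Sum>i=mm j..<m. drift_dev n i \<sigma>)"
            by (rule centered_runs_diff[OF \<sigma> n(2) j(2) m(1)])
          moreover have "mart (innovation n) (mm j) m \<sigma> \<le> Mx j \<sigma>"
            unfolding Mx_def using j by (intro order.trans[OF abs_ge_self Max_ge]) auto
          moreover have "(\<Sum>i=mm j..<m. drift_dev n i \<sigma>) \<le> S \<sigma>"
          proof -
            have "(\<Sum>i=mm j..<m. drift_dev n i \<sigma>) \<le> (\<Sum>i=mm j..<m. \<bar>drift_dev n i \<sigma>\<bar>)" by (intro sum_mono) simp
            also have "\<dots> \<le> S \<sigma>"
              unfolding S_def using mono[of 0 j] mono[of "Suc j" "2 * K"] j by (intro sum_mono2) auto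
            finally show ?thesis .
          qed
          ultimately show ?thesis using sn(1) by (simp add: distrib_left[symmetric])
        qed
        \<comment> \<open>The block that contains \<open>m\<close> is random, so the maximum over
          blocks is bounded by a sum. Fourth powers are essential: \<open>2 * K\<close> blocks
          contribute a multiple of \<open>K * \<delta>^2\<close>, whereas second moments would give
          one of \<open>K * \<delta>\<close>, the half width in Brownian time, which does not tend
          to 0.\<close>
        moreover have "s n * Mx j \<sigma> \<le> \<epsilon> + (\<Sum>j<2 * K. (s n * Mx j \<sigma>)^4 / \<epsilon>^3)"
        proof -
          have "s n * Mx j \<sigma> \<le> \<epsilon> + (s n * Mx j \<sigma>)^4 / \<epsilon>^3" by (rule le_eps_plus_power4[OF \<epsilon>])
          also have "(s n * Mx j \<sigma>)^4 / \<epsilon>^3 \<le> (\<Sum>j<2 * K. (s n * Mx j \<sigma>)^4 / \<epsilon>^3)"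
            using j \<epsilon> by (intro member_le_sum) auto
          finally show ?thesis by simp
        qed
        moreover have "0 \<le> s n * T \<sigma>" using sn(1) T0 by simp
        ultimately show ?thesis unfolding m(2) using drift[OF j] by linarith
      qed
    qed
    have EM: "EE n (\<lambda>\<sigma>. (s n * Mx j \<sigma>)^4) \<le> 4644864 * (\<Lambda> n)\<^sup>2" if j: "j < 2 * K" for j
    proof -
      have "EE n (\<lambda>\<sigma>. (s n * Mx j \<sigma>)^4) = (s n)^4 * EE n (\<lambda>\<sigma>. (Mx j \<sigma>)^4)"
        by (simp only: power_mult_distrib EE_cmult)
      also have "\<dots> \<le> (s n)^4 * (3584 * 6^4 * (real (mm (Suc j) - mm j))\<^sup>2)"
        unfolding Mx_def using sn(1) n j mono[of j "Suc j"] le[of "Suc j"]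
        by (intro mult_left_mono EE_Max_abs_mart_power4 martingale_increments_innovation) auto
      also have "\<dots> = 4644864 * (real (mm (Suc j) - mm j) * (s n)\<^sup>2)\<^sup>2"
        by (simp add: power_mult_distrib)
      also have "\<dots> \<le> 4644864 * (\<Lambda> n)\<^sup>2"
        using lenj[OF j] by (intro mult_left_mono power_mono) auto
      finally show ?thesis .
    qed
    have "EE n (\<lambda>\<sigma>. walk_max n \<sigma> - grid_walk_max 0 K \<delta> n \<sigma>)
       \<le> EE n (\<lambda>\<sigma>. s n * T \<sigma> + \<epsilon> + (\<Sum>j<2 * K. (s n * Mx j \<sigma>)^4 / \<epsilon>^3) + s n * S \<sigma> + dr)"
      by (rule EE_mono) (rule pw)
    also have "\<dots> = s n * EE n T + \<epsilon> + (\<Sum>j<2 * K. EE n (\<lambda>\<sigma>. (s n * Mx j \<sigma>)^4) / \<epsilon>^3) + s n * EE n S + dr"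
      by (simp only: EE_add EE_cmult EE_const EE_sum EE_divide)
    also have "\<dots> \<le> (1724800 / (r - 2 * (s n)\<^sup>2) + 431223 * s n) + \<epsilon> + (\<Sum>j<2 * K. 4644864 * (\<Lambda> n)\<^sup>2 / \<epsilon>^3)
        + 140 * (2 * \<Delta> n * (1 / (s n * sqrt (real n)))) + dr"
    proof (intro add_mono order_refl sum_mono divide_right_mono EM)
      have "s n * EE n T \<le> s n * (1724800 * (real n / real R) + 431223)"
        using ET sn(1) by (intro mult_left_mono) auto
      also have "real n / real R \<le> real n / (x - 2)"
        using R x3 by (intro divide_left_mono) auto
      also have "s n * (1724800 * (real n / (x - 2)) + 431223) = 1724800 / (r - 2 * (s n)\<^sup>2) + 431223 * s n"
      proof -
        have "s n * (real n / (x - 2)) = (real n * (s n)^3) / ((x - 2) * (s n)\<^sup>2)"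
          using sn(1) x3 by (simp add: field_simps power2_eq_square power3_eq_cube)
        also have "\<dots> = 1 / (r - 2 * (s n)\<^sup>2)" unfolding sn(2) left_diff_distrib x ..
        finally have e: "s n * (real n / (x - 2)) = 1 / (r - 2 * (s n)\<^sup>2)" .
        have d: "s n * (1724800 * q + 431223) = 1724800 * (s n * q) + 431223 * s n" for q
          by (simp add: algebra_simps)
        show ?thesis unfolding d e by simp
      qed
      finally show "s n * EE n T \<le> 1724800 / (r - 2 * (s n)\<^sup>2) + 431223 * s n"
        using sn(1) by simp
      have tot: "real (mm (2 * K) - mm 0) \<le> 2 * (\<Delta> n / (s n)\<^sup>2)"
        using Dj[of 0] Dj[of "2 * K"] mono[of 0 "2 * K"] by (simp add: of_nat_diff abs_le_iff)
      have "s n * EE n S \<le> s n * (140 * real (mm (2 * K) - mm 0) / sqrt (real n))"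
        unfolding S_def using sn(1) n le[of "2 * K"] w[of "2 * K"] mono[of 0 "2 * K"]
        by (intro mult_left_mono EE_sum_drift_dev_le) auto
      also have "\<dots> \<le> s n * (140 * (2 * (\<Delta> n / (s n)\<^sup>2)) / sqrt (real n))"
        using tot sn(1) by (intro mult_left_mono divide_right_mono) auto
      also have "\<dots> = 140 * (2 * \<Delta> n * (1 / (s n * sqrt (real n))))"
        using sn(1) n by (simp add: field_simps power2_eq_square)
      finally show "s n * EE n S \<le> 140 * (2 * \<Delta> n * (1 / (s n * sqrt (real n))))" .
    qed (use \<epsilon> in auto)
    also have "\<dots> = E n" unfolding E_def dr_def by simp
    finally have "EE n (\<lambda>\<sigma>. walk_max n \<sigma> - grid_walk_max 0 K \<delta> n \<sigma>) \<le> E n" .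
    moreover have "grid_walk_max 0 K \<delta> n \<sigma> \<le> walk_max n \<sigma>" for \<sigma>
      unfolding grid_walk_max_def walk_max_def using le unfolding mm_def by (intro Max_mono) auto
    ultimately show ?case by blast
  qed
  then show ?thesis using Elim by blast
qed

text \<open>The constant is the same for all grids; only the point from which the bound holds
  depends on them. Hence it bounds the Brownian grid maxima uniformly. The twentieth of the parabola
  is the one kept in \<open>tail_bound\<close>.\<close>

lemma grid_walk_bound:
  assumes \<delta>: "0 < \<delta>" and K: "0 < K"
  shows "eventually (\<lambda>n. EE n (\<lambda>\<sigma>. grid_walk_max (1/20) K \<delta> n \<sigma>) \<le> 3000000) sequentially"
proof -
  define s where "s = (\<lambda>n. real n powr (- 1/3))"
  have s0: "s \<longlonglongrightarrow> 0" unfolding s_def by (rule powr_third_tendsto_0)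
  have "eventually (\<lambda>n. s n < 1 / 1000) sequentially"
    by (rule order_tendstoD(2)[OF s0]) simp
  then show ?thesis using eventually_grid_index[OF \<delta>, of K] eventually_ge_at_top[of 30]
  proof eventually_elim
    case (elim n)
    define m0 where "m0 = n div 3"
    have n: "n \<ge> 30" "n \<ge> 3" "0 < n" using elim by auto
    have sn: "0 < s n" "real n * (s n)^3 = 1" "real n powr (2/3) = 1 / (s n)\<^sup>2"
      using s_identities[OF n(3)] by (simp_all add: s_def)
    \<comment> \<open>The natural scale \<open>1 / (s n)^2 = n powr (2/3)\<close>: farther out the
      tail bound is O(n powr (1/3)), and nearer a single window of this size suffices.\<close>
    define R where "R = nat \<lceil>1 / (s n)\<^sup>2\<rceil>"
    have R: "1 / (s n)\<^sup>2 \<le> real R" "real R \<le> 1 / (s n)\<^sup>2 + 1" "R \<ge> 1"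
    proof -
      have "0 < 1 / (s n)\<^sup>2" using sn(1) by simp
      then have "0 \<le> \<lceil>1 / (s n)\<^sup>2\<rceil>" by linarith
      then have r: "real R = real_of_int \<lceil>1 / (s n)\<^sup>2\<rceil>" by (simp add: R_def)
      show "1 / (s n)\<^sup>2 \<le> real R" "real R \<le> 1 / (s n)\<^sup>2 + 1" unfolding r by linarith+
      then have "0 < real R" using \<open>0 < 1 / (s n)\<^sup>2\<close> by linarith
      then show "R \<ge> 1" by simp
    qed
    have Rs: "real R * (s n)\<^sup>2 \<le> 2"
    proof -
      have "real R * (s n)\<^sup>2 \<le> (1 / (s n)\<^sup>2 + 1) * (s n)\<^sup>2" using R by (intro mult_right_mono) auto
      also have "\<dots> = 1 + (s n)\<^sup>2" using sn(1) by (simp add: distrib_right)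
      also have "(s n)\<^sup>2 \<le> 1\<^sup>2" using sn(1) elim(1) by (intro power_mono) auto
      finally show ?thesis by simp
    qed
    obtain T where T0: "\<And>\<sigma>. 0 \<le> T \<sigma>" and ET: "EE n T \<le> 1724800 * (real n / real R) + 431223"
      and T: "\<And>\<sigma> m. \<sigma> permutes {1..n} \<Longrightarrow> m \<le> n \<Longrightarrow> real R \<le> \<bar>real m - real (n div 3)\<bar> \<Longrightarrow>
        run_count n \<sigma> m - run_count n \<sigma> (n div 3) + (real m - real (n div 3))\<^sup>2 / (20 * real n) \<le> T \<sigma>"
      using tail_bound[OF n(1) R(3)] by blast
    define m9 where "m9 = 9 * n div 10"
    define a b where "a = m0 - R" and "b = min (m0 + R) m9"
    have m09: "m0 \<le> m9" "m9 \<le> n" using n by (auto simp: m0_def m9_def)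
    have "n \<le> 10 * (n - m9)" unfolding m9_def by linarith
    then have "real n \<le> real (10 * (n - m9))" by (simp only: of_nat_le_iff)
    moreover have "real (n - m9) \<le> real (n - b)" by (simp add: b_def del: of_nat_diff)
    ultimately have w9: "real n / 10 \<le> real (n - b)" by (simp del: of_nat_diff)
    define U where "U = (\<lambda>\<sigma>. Max ((\<lambda>m. \<bar>centered_runs n \<sigma> m - centered_runs n \<sigma> m0\<bar>) ` {a..b}))"
    have U0: "0 \<le> U \<sigma>" for \<sigma>
      unfolding U_def using m09 by (intro Max_ge_iff[THEN iffD2]) (auto simp: a_def b_def intro!: bexI[of _ m0])
    have EU: "s n * EE n U \<le> 1200"
    proof (rule power2_le_imp_le)
      have "(s n * EE n U)\<^sup>2 = (s n)\<^sup>2 * (EE n U)\<^sup>2" by (simp add: power_mult_distrib)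
      also have "\<dots> \<le> (s n)\<^sup>2 * EE n (\<lambda>\<sigma>. (U \<sigma>)\<^sup>2)" by (intro mult_left_mono EE_square) simp
      also have "\<dots> \<le> (s n)\<^sup>2 * (172480 * real (b - a))"
        unfolding U_def using n m09 w9
        by (intro mult_left_mono EE_Max_centered_runs_window) (auto simp: a_def b_def)
      also have "\<dots> \<le> (s n)\<^sup>2 * (172480 * (2 * real R))"
      proof (intro mult_left_mono)
        have "b - a \<le> 2 * R" unfolding a_def b_def by linarith
        then have "real (b - a) \<le> real (2 * R)" by (simp only: of_nat_le_iff)
        then show "real (b - a) \<le> 2 * real R" by simp
      qed auto
      also have "\<dots> = 344960 * (real R * (s n)\<^sup>2)" by simp
      also have "\<dots> \<le> 344960 * 2" using Rs by (intro mult_left_mono) auto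
      finally show "(s n * EE n U)\<^sup>2 \<le> 1200\<^sup>2" by simp
    qed simp
    have pw: "grid_walk_max (1/20) K \<delta> n \<sigma> \<le> s n * T \<sigma> + s n * U \<sigma> + 16" if \<sigma>: "\<sigma> permutes {1..n}" for \<sigma>
      unfolding grid_walk_max_def
    proof (rule Max.boundedI)
      fix y assume "y \<in> (\<lambda>j. scaled_excess (1/20) n \<sigma> (grid_index K \<delta> n j)) ` {..2 * K}"
      then obtain j where j: "j \<le> 2 * K" "y = scaled_excess (1/20) n \<sigma> (grid_index K \<delta> n j)" by auto
      define m where "m = grid_index K \<delta> n j"
      define D where "D = real m - real m0"
      have m: "m \<le> n" "real n / 10 \<le> real (n - m)" using elim(2) j by (auto simp: m_def)
      have y: "y = s n * (run_count n \<sigma> m - run_count n \<sigma> m0 + D\<^sup>2 / (20 * real n))"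
        unfolding j(2) scaled_excess_def s_def D_def m_def m0_def by simp
      show "y \<le> s n * T \<sigma> + s n * U \<sigma> + 16"
      proof (cases "real R \<le> \<bar>D\<bar>")
        case True
        then have "run_count n \<sigma> m - run_count n \<sigma> m0 + D\<^sup>2 / (20 * real n) \<le> T \<sigma>"
          using T[OF \<sigma> m(1)] unfolding D_def m0_def by simp
        then have "y \<le> s n * T \<sigma>" unfolding y using sn(1) by (intro mult_left_mono) auto
        moreover have "0 \<le> s n * U \<sigma>" using sn(1) U0 by simp
        ultimately show ?thesis by linarith
      next
        case False
        then have "m \<in> {a..b}"
        proof -
          have "10 * m \<le> 9 * n" using m by (simp add: of_nat_diff)
          then have "m \<le> m9" unfolding m9_def by linarith
          moreover have "real m0 - real R \<le> real m" "real m \<le> real m0 + real R"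
            using False unfolding D_def by (auto simp: abs_le_iff not_le abs_less_iff)
          then have "real m0 \<le> real (m + R)" "real m \<le> real (m0 + R)" by simp_all
          then have "m0 \<le> m + R" "m \<le> m0 + R" by (simp_all only: of_nat_le_iff)
          ultimately show ?thesis by (auto simp: a_def b_def)
        qed
        then have "\<bar>centered_runs n \<sigma> m - centered_runs n \<sigma> m0\<bar> \<le> U \<sigma>" unfolding U_def by (intro Max_ge) auto
        moreover have "run_count n \<sigma> m - run_count n \<sigma> m0 = (centered_runs n \<sigma> m - centered_runs n \<sigma> m0) + (run_mean n m - run_mean n m0)"
          by (simp add: centered_runs_def)
        moreover have "run_mean n m - run_mean n m0 \<le> - D\<^sup>2 / (3 * real n) + 15"
          unfolding m0_def D_def by (rule run_mean_diff(2)[OF n(1) m(1)])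
        moreover have "D\<^sup>2 / (20 * real n) \<le> D\<^sup>2 / (3 * real n)"
          using n by (intro divide_left_mono) auto
        ultimately have "run_count n \<sigma> m - run_count n \<sigma> m0 + D\<^sup>2 / (20 * real n) \<le> U \<sigma> + 15" by simp
        then have "y \<le> s n * (U \<sigma> + 15)" unfolding y using sn(1) by (intro mult_left_mono) auto
        also have "\<dots> \<le> s n * U \<sigma> + 16" using elim(1) by (simp add: distrib_left)
        finally show ?thesis using mult_nonneg_nonneg[OF less_imp_le[OF sn(1)] T0[of \<sigma>]] by linarith
      qed
    qed auto
    have "EE n (\<lambda>\<sigma>. grid_walk_max (1/20) K \<delta> n \<sigma>) \<le> EE n (\<lambda>\<sigma>. s n * T \<sigma> + s n * U \<sigma> + 16)"
      by (rule EE_mono) (rule pw)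
    also have "\<dots> = s n * EE n T + s n * EE n U + 16" by (simp only: EE_add EE_cmult EE_const)
    also have "\<dots> \<le> 1725300 + 1200 + 16"
    proof (intro add_mono EU order_refl)
      have "s n * EE n T \<le> s n * (1724800 * (real n / real R) + 431223)"
        using ET sn(1) by (intro mult_left_mono) auto
      also have "\<dots> = 1724800 * (s n * (real n / real R)) + 431223 * s n" by (simp add: distrib_left)
      also have "s n * (real n / real R) \<le> 1"
      proof -
        have "s n * (real n / real R) \<le> s n * (real n / (1 / (s n)\<^sup>2))"
          using R sn(1) by (intro mult_left_mono divide_left_mono) auto
        also have "\<dots> = real n * (s n)^3" using sn(1) by (simp add: power2_eq_square power3_eq_cube)
        finally show ?thesis using sn(2) by simp
      qed
      also have "1724800 * 1 + 431223 * s n \<le> 1724800 * 1 + 431223 * (1 / 1000)"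
        using elim(1) by (intro add_mono mult_left_mono) auto
      finally show "s n * EE n T \<le> 1725300" by simp
    qed
    finally show ?case by simp
  qed
qed

section \<open>The limit of the Brownian grid maxima\<close>

text \<open>Level \<open>k\<close> consists of the multiples of \<open>1 / 2 ^ k\<close> in \<open>[- (k + 1), k + 1]\<close>.\<close>

definition level_size :: "nat \<Rightarrow> nat" where "level_size k = Suc k * 2 ^ k"

definition level_pt :: "nat \<Rightarrow> nat \<Rightarrow> real" where
  "level_pt k j = grid_pt (level_size k) (1 / 2 ^ k) j"

text \<open>For \<open>\<kappa> = 0\<close> this approximates \<open>\<beta> * V B\<close> from
  below wherever the path is bounded; a positive \<open>\<kappa>\<close> weakens the
  parabola.\<close>

definition bm_grid :: "(real \<Rightarrow> 'a \<Rightarrow> real) \<Rightarrow> real \<Rightarrow> nat \<Rightarrow> 'a \<Rightarrow> real" where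
  "bm_grid B \<kappa> k \<omega> = Max ((\<lambda>j. \<beta> * B (level_pt k j) \<omega> - (1 - \<kappa>) * (\<beta> / 2) * (level_pt k j)\<^sup>2) ` {..2 * level_size k})"

lemma level_size_pos: "0 < level_size k"
  by (simp add: level_size_def)

lemma level_pt_mid [simp]: "level_pt k (level_size k) = 0"
  by (simp add: level_pt_def grid_pt_def)

lemma level_pt_refine:
  assumes "j \<le> 2 * level_size k"
  shows "\<exists>j'\<le>2 * level_size (Suc k). level_pt (Suc k) j' = level_pt k j"
proof (intro exI conjI)
  \<comment> \<open>The index is doubled because the mesh is halved, and shifted because the next
    level starts one unit, that is \<open>2 * 2 ^ k\<close> of its own points, further left.\<close>
  show "2 * j + 2 * 2 ^ k \<le> 2 * level_size (Suc k)"
    using assms by (simp add: level_size_def algebra_simps)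
  show "level_pt (Suc k) (2 * j + 2 * 2 ^ k) = level_pt k j"
    by (simp add: level_pt_def grid_pt_def level_size_def field_simps)
qed

lemma level_pt_dense:
  assumes "\<bar>t\<bar> \<le> real k"
  shows "\<exists>j\<le>2 * level_size k. \<bar>level_pt k j - t\<bar> \<le> 1 / 2 ^ k"
proof -
  let ?K = "level_size k"
  define x where "x = t * 2 ^ k + real ?K"
  have K: "real ?K = (real k + 1) * 2 ^ k" by (simp add: level_size_def algebra_simps)
  have x: "0 \<le> x" "x \<le> 2 * real ?K"
  proof -
    have "- (real k + 1) \<le> t" "t \<le> real k + 1" using assms by auto
    then have "- (real k + 1) * 2 ^ k \<le> t * 2 ^ k" "t * 2 ^ k \<le> (real k + 1) * 2 ^ k"
      by (intro mult_right_mono; simp)+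
    then have "- real ?K \<le> t * 2 ^ k" "t * 2 ^ k \<le> real ?K"
      unfolding K by (simp_all only: mult_minus_left)
    then show "0 \<le> x" "x \<le> 2 * real ?K" unfolding x_def by simp_all
  qed
  define j where "j = nat \<lfloor>x\<rfloor>"
  have j: "real j = real_of_int \<lfloor>x\<rfloor>" using x by (simp add: j_def)
  have "real j \<le> real (2 * ?K)" unfolding j using x by (simp; linarith)
  then have "j \<le> 2 * ?K" by (simp only: of_nat_le_iff)
  moreover have "\<bar>level_pt k j - t\<bar> \<le> 1 / 2 ^ k"
  proof -
    have e: "level_pt k j - t = (real j - x) / 2 ^ k"
      unfolding level_pt_def grid_pt_def x_def by (simp add: field_simps)
    have "\<bar>real j - x\<bar> \<le> 1" unfolding j by linarith
    then show ?thesis unfolding e by (simp add: abs_divide divide_right_mono)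
  qed
  ultimately show ?thesis by blast
qed

lemma grid_pt_sum_telescope: "(\<Sum>i<j. \<beta> * (b (grid_pt K \<delta> (Suc i)) - b (grid_pt K \<delta> i))) = \<beta> * (b (grid_pt K \<delta> j) - b (grid_pt K \<delta> 0))"
  by (simp add: sum_distrib_left[symmetric] sum_lessThan_telescope[of "\<lambda>i. b (grid_pt K \<delta> i)"])

text \<open>The junk value of \<open>Sup\<close> matters because \<open>V\<close> has to be measurable also where the path is unbounded.\<close>

lemma real_Sup_unbounded: 
  fixes X :: "real set"
  assumes "\<not> bdd_above X" shows "Sup X = (LEAST z. False)"
proof -
  have "(\<lambda>z. \<forall>x\<in>X. x \<le> z) = (\<lambda>z. False)" using assms by (auto simp: bdd_above_def fun_eq_iff)
  then show ?thesis unfolding Sup_real_def by (rule arg_cong)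
qed

context
  fixes M :: "'a measure" and B :: "real \<Rightarrow> 'a \<Rightarrow> real"
  assumes BM: "two_sided_BM M B"
begin

lemma gauss_incr_grid:
  assumes \<delta>: "0 < \<delta>" and K: "0 < K"
  shows "gauss_incr M (\<lambda>j \<omega>. \<beta> * (B (grid_pt K \<delta> (Suc j)) \<omega> - B (grid_pt K \<delta> j) \<omega>)) (2 * K) (\<beta> * sqrt \<delta>)"
  unfolding gauss_incr_def
proof (intro conjI allI impI)
  show ps: "prob_space M" by (rule BM_prob_space[OF BM])
  interpret prob_space M by (rule ps)
  show "0 < \<beta> * sqrt \<delta>" using \<beta>_pos \<delta> by simp
  show "indep_vars (\<lambda>_. borel) (\<lambda>j \<omega>. \<beta> * (B (grid_pt K \<delta> (Suc j)) \<omega> - B (grid_pt K \<delta> j) \<omega>)) {..<2 * K}"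
    by (rule indep_vars_compose2[OF grid_increment_indep[OF BM \<delta> K], where Y="\<lambda>_ x. \<beta> * x"]) simp
  fix j assume j: "j < 2 * K"
  from normal_density_affine[OF grid_increment_normal[OF BM \<delta> j], where \<alpha>=\<beta> and \<beta>=0]
  show "distributed M lborel (\<lambda>\<omega>. \<beta> * (B (grid_pt K \<delta> (Suc j)) \<omega> - B (grid_pt K \<delta> j) \<omega>)) (normal_density 0 (\<beta> * sqrt \<delta>))"
    using \<beta>_pos \<delta> by simp
qed

text \<open>The increments telescope, and \<open>B 0 = 0\<close> removes the value at the
  midpoint.\<close>

lemma gridmax_eq_bm_grid:
  assumes \<omega>: "\<omega> \<in> space M"
  shows "gridmax (\<lambda>j. - (1 - \<kappa>) * (\<beta> / 2) * (grid_pt (level_size k) (1 / 2 ^ k) j)\<^sup>2) (level_size k)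
    (\<lambda>i. if i < 2 * level_size k then \<beta> * (B (grid_pt (level_size k) (1 / 2 ^ k) (Suc i)) \<omega> - B (grid_pt (level_size k) (1 / 2 ^ k) i) \<omega>) else 0)
    = bm_grid B \<kappa> k \<omega>"
  unfolding gridmax_def bm_grid_def
proof (rule arg_cong[where f=Max], rule image_cong[OF refl])
  let ?K = "level_size k"
  let ?x = "\<lambda>i. if i < 2 * ?K then \<beta> * (B (grid_pt ?K (1 / 2 ^ k) (Suc i)) \<omega> - B (grid_pt ?K (1 / 2 ^ k) i) \<omega>) else 0"
  have s: "(\<Sum>i<j. ?x i) = \<beta> * (B (level_pt k j) \<omega> - B (level_pt k 0) \<omega>)" if "j \<le> 2 * ?K" for j
  proof -
    have "(\<Sum>i<j. ?x i) = (\<Sum>i<j. \<beta> * (B (grid_pt ?K (1 / 2 ^ k) (Suc i)) \<omega> - B (grid_pt ?K (1 / 2 ^ k) i) \<omega>))"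
      using that by (intro sum.cong) auto
    then show ?thesis
      using grid_pt_sum_telescope[of "\<lambda>t. B t \<omega>" ?K "1 / 2 ^ k" j] by (simp add: level_pt_def)
  qed
  fix j assume "j \<in> {..2 * ?K}"
  then have "(\<Sum>i<j. ?x i) - (\<Sum>i<?K. ?x i) = \<beta> * B (level_pt k j) \<omega>"
    using s[of j] s[of ?K] BM_0[OF BM \<omega>] by (simp add: algebra_simps)
  moreover have "- (1 - \<kappa>) * (\<beta> / 2) * y = - ((1 - \<kappa>) * (\<beta> / 2) * y)" for y :: real
    by (simp only: mult_minus_left)
  ultimately show "(\<Sum>i<j. ?x i) - (\<Sum>i<?K. ?x i) + - (1 - \<kappa>) * (\<beta> / 2) * (grid_pt ?K (1 / 2 ^ k) j)\<^sup>2
      = \<beta> * B (level_pt k j) \<omega> - (1 - \<kappa>) * (\<beta> / 2) * (level_pt k j)\<^sup>2"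
    unfolding level_pt_def by linarith
qed

lemma grid_walk_tendsto_bm_grid:
  assumes "L-lipschitz_on UNIV f"
  shows "(\<lambda>n. EE n (\<lambda>\<sigma>. f (grid_walk_max \<kappa> (level_size k) (1 / 2 ^ k) n \<sigma>))) \<longlonglongrightarrow> (\<integral>\<omega>. f (bm_grid B \<kappa> k \<omega>) \<partial>M)"
proof -
  have eq: "(\<integral>\<omega>. f (gridmax (\<lambda>j. - (1 - \<kappa>) * (\<beta> / 2) * (grid_pt (level_size k) (1 / 2 ^ k) j)\<^sup>2) (level_size k)
    (\<lambda>i. if i < 2 * level_size k then \<beta> * (B (grid_pt (level_size k) (1 / 2 ^ k) (Suc i)) \<omega> - B (grid_pt (level_size k) (1 / 2 ^ k) i) \<omega>) else 0)) \<partial>M)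
    = (\<integral>\<omega>. f (bm_grid B \<kappa> k \<omega>) \<partial>M)"
    by (rule Bochner_Integration.integral_cong[OF refl]) (simp only: gridmax_eq_bm_grid)
  have d: "0 < (1::real) / 2 ^ k" by simp
  show ?thesis
    using grid_convergence[OF d level_size_pos[of k] assms gauss_incr_grid[OF d level_size_pos[of k]], where \<kappa>=\<kappa>]
    unfolding grid_walk_max_def eq .
qed

lemma bm_grid_measurable [measurable]: "bm_grid B \<kappa> k \<in> borel_measurable M"
  unfolding bm_grid_def using BM_measurable[OF BM] by measurable

lemma bm_grid_ge: "j \<le> 2 * level_size k \<Longrightarrow>
    \<beta> * B (level_pt k j) \<omega> - (1 - \<kappa>) * (\<beta> / 2) * (level_pt k j)\<^sup>2 \<le> bm_grid B \<kappa> k \<omega>"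
  unfolding bm_grid_def by (intro Max_ge) auto

lemma bm_grid_nonneg: "\<omega> \<in> space M \<Longrightarrow> 0 \<le> bm_grid B \<kappa> k \<omega>"
  using bm_grid_ge[of "level_size k" k \<omega> \<kappa>] BM_0[OF BM] by simp

lemma bm_grid_le_iff: "bm_grid B \<kappa> k \<omega> \<le> z \<longleftrightarrow>
    (\<forall>j\<le>2 * level_size k. \<beta> * B (level_pt k j) \<omega> - (1 - \<kappa>) * (\<beta> / 2) * (level_pt k j)\<^sup>2 \<le> z)"
  unfolding bm_grid_def by (subst Max_le_iff) auto

lemma bm_grid_Suc: "bm_grid B \<kappa> k \<omega> \<le> bm_grid B \<kappa> (Suc k) \<omega>"
  unfolding bm_grid_le_iff using level_pt_refine bm_grid_ge by metis

lemma bm_grid_mono: "i \<le> k \<Longrightarrow> bm_grid B \<kappa> i \<omega> \<le> bm_grid B \<kappa> k \<omega>"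
  by (rule lift_Suc_mono_le[of "\<lambda>k. bm_grid B \<kappa> k \<omega>"]) (rule bm_grid_Suc)

lemma bm_grid_mono_kappa: "\<kappa> \<le> \<kappa>' \<Longrightarrow> bm_grid B \<kappa> k \<omega> \<le> bm_grid B \<kappa>' k \<omega>"
proof -
  assume k: "\<kappa> \<le> \<kappa>'"
  have "(1 - \<kappa>') * (\<beta> / 2) * (level_pt k j)\<^sup>2 \<le> (1 - \<kappa>) * (\<beta> / 2) * (level_pt k j)\<^sup>2" for j
    using k \<beta>_pos by (intro mult_right_mono) auto
  then show ?thesis unfolding bm_grid_le_iff using bm_grid_ge[of _ k \<omega> \<kappa>'] by (smt (verit))
qed

text \<open>Continuity of the path and density of the grid points. Comparing upper bounds instead of
  suprema avoids presupposing that the path is bounded.\<close>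

lemma path_le_iff:
  assumes \<omega>: "\<omega> \<in> space M"
  shows "(\<forall>t. \<beta> * B t \<omega> - (1 - \<kappa>) * (\<beta> / 2) * t\<^sup>2 \<le> z) \<longleftrightarrow> (\<forall>k. bm_grid B \<kappa> k \<omega> \<le> z)"
proof (intro iffI allI)
  fix k assume "\<forall>t. \<beta> * B t \<omega> - (1 - \<kappa>) * (\<beta> / 2) * t\<^sup>2 \<le> z"
  then show "bm_grid B \<kappa> k \<omega> \<le> z" unfolding bm_grid_le_iff by blast
next
  fix t assume z: "\<forall>k. bm_grid B \<kappa> k \<omega> \<le> z"
  let ?h = "\<lambda>t. \<beta> * B t \<omega> - (1 - \<kappa>) * (\<beta> / 2) * t\<^sup>2"
  have cont: "continuous_on UNIV ?h"
    by (intro continuous_intros BM_continuous[OF BM \<omega>])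
  obtain k0 :: nat where k0: "\<bar>t\<bar> \<le> real k0" using real_arch_simple by blast
  have "\<exists>j\<le>2 * level_size k. \<bar>level_pt k j - t\<bar> \<le> 1 / 2 ^ k" if "k0 \<le> k" for k
    by (rule level_pt_dense) (use k0 that in linarith)
  then obtain j where j: "\<And>k. k0 \<le> k \<Longrightarrow> j k \<le> 2 * level_size k \<and> \<bar>level_pt k (j k) - t\<bar> \<le> 1 / 2 ^ k"
    by metis
  have lim: "(\<lambda>k. level_pt k (j k)) \<longlonglongrightarrow> t"
  proof (rule LIM_zero_cancel, rule Lim_null_comparison)
    show "(\<lambda>k. 1 / 2 ^ k :: real) \<longlonglongrightarrow> 0"
      using LIMSEQ_power_zero[of "1/2 :: real"] by (simp add: power_one_over)
    show "eventually (\<lambda>k. norm (level_pt k (j k) - t) \<le> 1 / 2 ^ k) sequentially"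
      using eventually_ge_at_top[of k0] by eventually_elim (use j in auto)
  qed
  have "(\<lambda>k. ?h (level_pt k (j k))) \<longlonglongrightarrow> ?h t"
    by (rule continuous_on_tendsto_compose[OF cont lim]) auto
  moreover have "eventually (\<lambda>k. ?h (level_pt k (j k)) \<le> z) sequentially"
    using eventually_ge_at_top[of k0]
    by eventually_elim (use z j bm_grid_ge[of _ _ \<omega> \<kappa>] in \<open>blast intro: order_trans\<close>)
  ultimately show "?h t \<le> z"
    by (rule tendsto_upperbound) simp
qed

lemma bm_grid_integrable: "integrable M (bm_grid B \<kappa> k)"
proof -
  let ?K = "level_size k"
  have "integrable M (\<lambda>\<omega>. gridmax (\<lambda>j. - (1 - \<kappa>) * (\<beta> / 2) * (grid_pt ?K (1 / 2 ^ k) j)\<^sup>2) ?K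
    (\<lambda>i. if i < 2 * ?K then \<beta> * (B (grid_pt ?K (1 / 2 ^ k) (Suc i)) \<omega> - B (grid_pt ?K (1 / 2 ^ k) i) \<omega>) else 0))"
    by (rule coord_lipschitz_integrable[OF gauss_incr_grid[OF _ level_size_pos] coord_lipschitz_gridmax]) simp
  then show ?thesis
    by (subst Bochner_Integration.integrable_cong[OF refl gridmax_eq_bm_grid[symmetric]]) auto
qed

text \<open>\<open>grid_walk_bound\<close> is passed to the limit with the identity as test
  function. The bound for the Brownian functional thus comes from the permutations.\<close>

lemma bm_grid_expectation_le: "(\<integral>\<omega>. bm_grid B (1/20) k \<omega> \<partial>M) \<le> 3000000"
proof (rule tendsto_upperbound[OF grid_walk_tendsto_bm_grid[where f="\<lambda>x. x" and L=1]])
  show "1-lipschitz_on UNIV (\<lambda>x::real. x)" by (rule lipschitz_onI) auto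
  show "eventually (\<lambda>n. EE n (\<lambda>\<sigma>. grid_walk_max (1/20) (level_size k) (1 / 2 ^ k) n \<sigma>) \<le> 3000000) sequentially"
    by (rule grid_walk_bound) (simp_all add: level_size_pos)
qed simp

text \<open>Monotone convergence: the levels increase and their expectations are bounded, so their
  supremum is integrable and finite almost everywhere. It is formed in \<open>ennreal\<close>, where
  it always exists.\<close>

lemma bm_grid_dominated:
  "\<exists>S. integrable M S \<and> (AE \<omega> in M. \<forall>k. bm_grid B (1/20) k \<omega> \<le> S \<omega>)"
proof -
  interpret prob_space M by (rule BM_prob_space[OF BM])
  define g where "g = (\<lambda>k \<omega>. ennreal (bm_grid B (1/20) k \<omega>))"
  define G where "G = (\<lambda>\<omega>. SUP k. g k \<omega>)"
  have gm[measurable]: "g k \<in> borel_measurable M" for k unfolding g_def by measurable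
  have Gm[measurable]: "G \<in> borel_measurable M" unfolding G_def by measurable
  have "incseq g" unfolding g_def by (intro incseq_SucI le_funI ennreal_leI bm_grid_Suc)
  then have "(\<integral>\<^sup>+\<omega>. G \<omega> \<partial>M) = (SUP k. \<integral>\<^sup>+\<omega>. g k \<omega> \<partial>M)"
    unfolding G_def by (rule nn_integral_monotone_convergence_SUP) measurable
  also have "\<dots> \<le> ennreal 3000000"
  proof (rule SUP_least)
    fix k
    have "(\<integral>\<^sup>+\<omega>. g k \<omega> \<partial>M) = ennreal (\<integral>\<omega>. bm_grid B (1/20) k \<omega> \<partial>M)"
      unfolding g_def by (rule nn_integral_eq_integral[OF bm_grid_integrable]) (auto intro!: AE_I2 bm_grid_nonneg)
    then show "(\<integral>\<^sup>+\<omega>. g k \<omega> \<partial>M) \<le> ennreal 3000000"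
      by (simp only:) (rule ennreal_leI[OF bm_grid_expectation_le])
  qed
  finally have fin: "(\<integral>\<^sup>+\<omega>. G \<omega> \<partial>M) < \<infinity>" by (rule order_le_less_trans) simp
  have AEfin: "AE \<omega> in M. G \<omega> \<noteq> \<infinity>"
    by (rule nn_integral_noteq_infinite) (use fin in auto)
  have "integrable M (\<lambda>\<omega>. enn2real (G \<omega>))"
  proof (rule integrableI_nonneg)
    have "(\<integral>\<^sup>+\<omega>. ennreal (enn2real (G \<omega>)) \<partial>M) \<le> (\<integral>\<^sup>+\<omega>. G \<omega> \<partial>M)"
      by (intro nn_integral_mono) (simp add: ennreal_enn2real_if)
    then show "(\<integral>\<^sup>+\<omega>. ennreal (enn2real (G \<omega>)) \<partial>M) < \<infinity>" using fin by (rule order_le_less_trans)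
  qed auto
  moreover have "AE \<omega> in M. \<forall>k. bm_grid B (1/20) k \<omega> \<le> enn2real (G \<omega>)"
    using AEfin AE_space
  proof eventually_elim
    case (elim \<omega>)
    show ?case
    proof
      fix k
      have "g k \<omega> \<le> G \<omega>" unfolding G_def by (rule SUP_upper) simp
      then have "enn2real (g k \<omega>) \<le> enn2real (G \<omega>)"
        using elim by (intro enn2real_mono) (auto simp: less_top)
      then show "bm_grid B (1/20) k \<omega> \<le> enn2real (G \<omega>)"
        using bm_grid_nonneg[OF elim(2)] by (simp add: g_def)
    qed
  qed
  ultimately show ?thesis by blast
qed

lemma V_upper_bound_iff:
  assumes \<omega>: "\<omega> \<in> space M"
  shows "(\<forall>x\<in>range (\<lambda>t. B t \<omega> - t\<^sup>2 / 2). x \<le> z) \<longleftrightarrow> (\<forall>k. bm_grid B 0 k \<omega> \<le> \<beta> * z)"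
proof -
  have "(B t \<omega> - t\<^sup>2 / 2 \<le> z) \<longleftrightarrow> (\<beta> * B t \<omega> - (1 - 0) * (\<beta> / 2) * t\<^sup>2 \<le> \<beta> * z)" for t
  proof -
    have "\<beta> * B t \<omega> - (1 - 0) * (\<beta> / 2) * t\<^sup>2 = \<beta> * (B t \<omega> - t\<^sup>2 / 2)" by (simp add: algebra_simps)
    then show ?thesis using \<beta>_pos by simp
  qed
  then show ?thesis unfolding path_le_iff[OF \<omega>, of 0 "\<beta> * z", symmetric] by auto
qed

text \<open>Under a bound the increasing maxima converge, and \<open>V_upper_bound_iff\<close>
  identifies their limit, divided by \<open>\<beta>\<close>, as the least upper bound in the
  definition of \<open>V\<close>.\<close>

lemma V_limit:
  assumes \<omega>: "\<omega> \<in> space M" and b: "\<And>k. bm_grid B 0 k \<omega> \<le> N"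
  shows "(\<lambda>k. bm_grid B 0 k \<omega>) \<longlonglongrightarrow> \<beta> * V B \<omega>" "\<And>k. bm_grid B 0 k \<omega> \<le> \<beta> * V B \<omega>"
proof -
  have "convergent (\<lambda>k. bm_grid B 0 k \<omega>)"
  proof (rule Bseq_monoseq_convergent)
    show "Bseq (\<lambda>k. bm_grid B 0 k \<omega>)"
      by (rule BseqI'[of _ N]) (use b bm_grid_nonneg[OF \<omega>] in auto)
    show "monoseq (\<lambda>k. bm_grid B 0 k \<omega>)"
      by (rule monoI1) (simp add: bm_grid_mono)
  qed
  then obtain l where l: "(\<lambda>k. bm_grid B 0 k \<omega>) \<longlonglongrightarrow> l" by (auto simp: convergent_def)
  have le: "bm_grid B 0 k \<omega> \<le> l" for k
    by (rule incseq_le[OF _ l]) (intro monoI bm_grid_mono)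
  have "V B \<omega> = l / \<beta>"
    unfolding V_def
  proof (rule cSup_eq_non_empty)
    show "range (\<lambda>t. B t \<omega> - t\<^sup>2 / 2) \<noteq> {}" by simp
    have "\<forall>x\<in>range (\<lambda>t. B t \<omega> - t\<^sup>2 / 2). x \<le> l / \<beta>"
      unfolding V_upper_bound_iff[OF \<omega>] using le \<beta>_pos by simp
    then show "x \<le> l / \<beta>" if "x \<in> range (\<lambda>t. B t \<omega> - t\<^sup>2 / 2)" for x using that by blast
    fix y assume "\<And>x. x \<in> range (\<lambda>t. B t \<omega> - t\<^sup>2 / 2) \<Longrightarrow> x \<le> y"
    then have "\<forall>k. bm_grid B 0 k \<omega> \<le> \<beta> * y" unfolding V_upper_bound_iff[OF \<omega>, symmetric] by blast
    then have "l \<le> \<beta> * y" by (intro LIMSEQ_le_const2[OF l]) auto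
    then show "l / \<beta> \<le> y" using \<beta>_pos by (simp add: pos_divide_le_eq mult.commute)
  qed
  then have "\<beta> * V B \<omega> = l" using \<beta>_pos by simp
  then show "(\<lambda>k. bm_grid B 0 k \<omega>) \<longlonglongrightarrow> \<beta> * V B \<omega>" "\<And>k. bm_grid B 0 k \<omega> \<le> \<beta> * V B \<omega>"
    using l le by simp_all
qed

text \<open>On \<open>good\<close> the function is a limit of measurable functions; elsewhere the
  supremum of an unbounded set is one fixed real number, whatever the path.\<close>

lemma V_measurable: "V B \<in> borel_measurable M"
proof -
  define good where "good = {\<omega> \<in> space M. \<exists>N::nat. \<forall>k. bm_grid B 0 k \<omega> \<le> real N}"
  have good: "good \<in> sets M" unfolding good_def by measurable
  have "V B \<omega> = (if \<omega> \<in> good then lim (\<lambda>k. bm_grid B 0 k \<omega>) / \<beta> else (LEAST z::real. False))"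
    if \<omega>: "\<omega> \<in> space M" for \<omega>
  proof (cases "\<omega> \<in> good")
    case True
    then obtain N :: nat where "\<And>k. bm_grid B 0 k \<omega> \<le> real N" by (auto simp: good_def)
    from V_limit(1)[OF \<omega> this] show ?thesis using True \<beta>_pos by (simp add: limI)
  next
    case False
    have "\<not> bdd_above (range (\<lambda>t. B t \<omega> - t\<^sup>2 / 2))"
    proof
      assume "bdd_above (range (\<lambda>t. B t \<omega> - t\<^sup>2 / 2))"
      then obtain z where "\<forall>x\<in>range (\<lambda>t. B t \<omega> - t\<^sup>2 / 2). x \<le> z" by (auto simp: bdd_above_def)
      then have z: "\<forall>k. bm_grid B 0 k \<omega> \<le> \<beta> * z" unfolding V_upper_bound_iff[OF \<omega>] .
      obtain N :: nat where "\<beta> * z \<le> real N" using real_arch_simple by blast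
      then have "\<forall>k. bm_grid B 0 k \<omega> \<le> real N" using z by (meson order_trans)
      then show False using False \<omega> by (auto simp: good_def)
    qed
    then show ?thesis using False unfolding V_def by (simp add: real_Sup_unbounded)
  qed
  moreover have "(\<lambda>\<omega>. if \<omega> \<in> good then lim (\<lambda>k. bm_grid B 0 k \<omega>) / \<beta> else (LEAST z::real. False)) \<in> borel_measurable M"
    using good by measurable
  ultimately show ?thesis by (simp cong: measurable_cong)
qed

text \<open>A function that dominates the path against the weakened parabola, with factor 19/20 = 1
  - 1/20, also dominates it against the full one.\<close>

lemma V_AE_bounds:
  "\<exists>S. integrable M S \<and> (AE \<omega> in M. (\<forall>k. bm_grid B 0 k \<omega> \<le> S \<omega>) \<and> (\<lambda>k. bm_grid B 0 k \<omega>) \<longlonglongrightarrow> \<beta> * V B \<omega>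
     \<and> 0 \<le> \<beta> * V B \<omega> \<and> \<beta> * V B \<omega> \<le> S \<omega> \<and> (\<forall>t. \<beta> * B t \<omega> - 19/20 * (\<beta> / 2) * t\<^sup>2 \<le> S \<omega>))"
proof -
  obtain S where S: "integrable M S" "AE \<omega> in M. \<forall>k. bm_grid B (1/20) k \<omega> \<le> S \<omega>"
    using bm_grid_dominated by blast
  from S(2) AE_space have "AE \<omega> in M. (\<forall>k. bm_grid B 0 k \<omega> \<le> S \<omega>) \<and> (\<lambda>k. bm_grid B 0 k \<omega>) \<longlonglongrightarrow> \<beta> * V B \<omega>
     \<and> 0 \<le> \<beta> * V B \<omega> \<and> \<beta> * V B \<omega> \<le> S \<omega> \<and> (\<forall>t. \<beta> * B t \<omega> - 19/20 * (\<beta> / 2) * t\<^sup>2 \<le> S \<omega>)"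
  proof eventually_elim
    case (elim \<omega>)
    have le: "bm_grid B 0 k \<omega> \<le> S \<omega>" for k
      using bm_grid_mono_kappa[of 0 "1/20" k \<omega>] elim(1) by (auto intro: order_trans)
    have lim: "(\<lambda>k. bm_grid B 0 k \<omega>) \<longlonglongrightarrow> \<beta> * V B \<omega>" by (rule V_limit(1)[OF elim(2) le])
    moreover have "\<beta> * V B \<omega> \<le> S \<omega>" by (rule LIMSEQ_le_const2[OF lim]) (use le in auto)
    moreover have "0 \<le> \<beta> * V B \<omega>" by (rule LIMSEQ_le_const[OF lim]) (use bm_grid_nonneg[OF elim(2)] in auto)
    moreover have "\<forall>t. \<beta> * B t \<omega> - 19/20 * (\<beta> / 2) * t\<^sup>2 \<le> S \<omega>"
      using path_le_iff[OF elim(2), of "1/20" "S \<omega>"] elim(1) by simp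
    ultimately show ?case using le by blast
  qed
  then show ?thesis using S(1) by blast
qed

lemma V_integrable: "integrable M (V B)"
proof -
  obtain S where S: "integrable M S" "AE \<omega> in M. 0 \<le> \<beta> * V B \<omega> \<and> \<beta> * V B \<omega> \<le> S \<omega>"
    using V_AE_bounds by (auto elim: eventually_mono)
  show ?thesis
  proof (rule Bochner_Integration.integrable_bound)
    show "integrable M (\<lambda>\<omega>. S \<omega> / \<beta>)" using S(1) by simp
    show "AE \<omega> in M. norm (V B \<omega>) \<le> norm (S \<omega> / \<beta>)"
      using S(2)
    proof eventually_elim
      case (elim \<omega>)
      then have "0 \<le> V B \<omega>" "V B \<omega> \<le> S \<omega> / \<beta>"
        using \<beta>_pos by (auto simp: zero_le_mult_iff pos_le_divide_eq mult.commute)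
      then show ?case unfolding real_norm_def by linarith
    qed
  qed (rule V_measurable)
qed

text \<open>A bound against the weaker parabola \<open>19/40 * t^2\<close> leaves
  \<open>- t^2 / 40\<close> to spare. Far out the function is therefore below its value 0 at time 0,
  and a maximum over a compact interval is global.\<close>

lemma V_attained:
  "AE \<omega> in M. \<exists>t. (\<forall>s. B s \<omega> - s\<^sup>2 / 2 \<le> B t \<omega> - t\<^sup>2 / 2) \<and> V B \<omega> = B t \<omega> - t\<^sup>2 / 2"
proof -
  obtain S where S: "AE \<omega> in M. \<forall>t. \<beta> * B t \<omega> - 19/20 * (\<beta> / 2) * t\<^sup>2 \<le> S \<omega>"
    using V_AE_bounds by (auto elim: eventually_mono)
  from S AE_space show ?thesis
  proof eventually_elim
    case (elim \<omega>)
    let ?h = "\<lambda>t. B t \<omega> - t\<^sup>2 / 2"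
    have cont: "continuous_on UNIV ?h" by (intro continuous_intros BM_continuous[OF BM elim(2)]) auto
    have h0: "?h 0 = 0" using BM_0[OF BM elim(2)] by simp
    define c where "c = S \<omega> / \<beta>"
    have bd: "?h t \<le> c - t\<^sup>2 / 40" for t
    proof -
      have "\<beta> * (B t \<omega> - 19/40 * t\<^sup>2) \<le> S \<omega>" using elim(1) by (simp add: algebra_simps)
      then have "B t \<omega> - 19/40 * t\<^sup>2 \<le> c" unfolding c_def using \<beta>_pos by (simp add: pos_le_divide_eq mult.commute)
      then show ?thesis by simp
    qed
    have c0: "0 \<le> c" using bd[of 0] h0 by simp
    \<comment> \<open>The summand 1 gives \<open>R \<ge> 1\<close>, hence
      \<open>R * R \<ge> R \<ge> 40 * c\<close>.\<close>
    define R where "R = 40 * c + 1"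
    have R: "1 \<le> R" "40 * c \<le> R * R"
    proof -
      show "1 \<le> R" using c0 by (simp add: R_def)
      then have "R * 1 \<le> R * R" by (intro mult_left_mono) auto
      then show "40 * c \<le> R * R" by (simp add: R_def)
    qed
    obtain t where t: "t \<in> {-R..R}" "\<And>s. s \<in> {-R..R} \<Longrightarrow> ?h s \<le> ?h t"
      using continuous_attains_sup[of "{-R..R}" ?h] R continuous_on_subset[OF cont] by (auto simp: subset_eq)
    have all: "?h s \<le> ?h t" for s
    proof (cases "s \<in> {-R..R}")
      case False
      then have "R \<le> \<bar>s\<bar>" by auto
      then have "R * R \<le> \<bar>s\<bar> * \<bar>s\<bar>" using R by (intro mult_mono) auto
      then have "40 * c \<le> s\<^sup>2" using R by (simp add: power2_eq_square)
      then have "?h s \<le> 0" using bd[of s] by simp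
      also have "0 \<le> ?h t" using t(2)[of 0] h0 R by simp
      finally show ?thesis .
    qed (rule t(2))
    have "V B \<omega> = ?h t"
      unfolding V_def by (rule cSup_eq_maximum) (use all in auto)
    then show ?case using all by blast
  qed
qed

text \<open>Dominated convergence; a Lipschitz function grows at most linearly, so an integrable
  bound for the maxima gives one for their images under \<open>f\<close>.\<close>

lemma bm_grid_tendsto_V:
  fixes f :: "real \<Rightarrow> real"
  assumes L: "L-lipschitz_on UNIV f"
  shows "(\<lambda>k. \<integral>\<omega>. f (bm_grid B 0 k \<omega>) \<partial>M) \<longlonglongrightarrow> (\<integral>\<omega>. f (\<beta> * V B \<omega>) \<partial>M)"
proof -
  interpret prob_space M by (rule BM_prob_space[OF BM])
  have fc: "continuous_on UNIV f" by (rule lipschitz_on_continuous_on[OF L])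
  have [measurable]: "f \<in> borel_measurable borel" by (rule borel_measurable_continuous_onI[OF fc])
  obtain S where S: "integrable M S" "AE \<omega> in M. (\<forall>k. bm_grid B 0 k \<omega> \<le> S \<omega>) \<and> (\<lambda>k. bm_grid B 0 k \<omega>) \<longlonglongrightarrow> \<beta> * V B \<omega>"
    using V_AE_bounds by (auto elim: eventually_mono)
  have "AE \<omega> in M. \<forall>k. bm_grid B 0 k \<omega> \<le> S \<omega>" using S(2) by (auto elim: eventually_mono)
  show ?thesis
  proof (rule integral_dominated_convergence[where w="\<lambda>\<omega>. \<bar>f 0\<bar> + L * \<bar>S \<omega>\<bar>"])
    show "(\<lambda>\<omega>. f (\<beta> * V B \<omega>)) \<in> borel_measurable M" using V_measurable by measurable
    show "(\<lambda>\<omega>. f (bm_grid B 0 k \<omega>)) \<in> borel_measurable M" for k by measurable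
    show "integrable M (\<lambda>\<omega>. \<bar>f 0\<bar> + L * \<bar>S \<omega>\<bar>)" using S(1) by simp
    show "AE \<omega> in M. (\<lambda>k. f (bm_grid B 0 k \<omega>)) \<longlonglongrightarrow> f (\<beta> * V B \<omega>)"
      using S(2)
    proof eventually_elim
      case (elim \<omega>)
      then show ?case by (intro continuous_on_tendsto_compose[OF fc]) auto
    qed
    fix k
    show "AE \<omega> in M. norm (f (bm_grid B 0 k \<omega>)) \<le> \<bar>f 0\<bar> + L * \<bar>S \<omega>\<bar>"
      using S(2) AE_space
    proof eventually_elim
      case (elim \<omega>)
      have "\<bar>f (bm_grid B 0 k \<omega>) - f 0\<bar> \<le> L * \<bar>bm_grid B 0 k \<omega>\<bar>"
        using lipschitz_onD[OF L, of "bm_grid B 0 k \<omega>" 0] by (simp add: dist_real_def)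
      also have "\<dots> \<le> L * \<bar>S \<omega>\<bar>"
      proof (rule mult_left_mono)
        have "bm_grid B 0 k \<omega> \<le> S \<omega>" using elim(1) by blast
        then show "\<bar>bm_grid B 0 k \<omega>\<bar> \<le> \<bar>S \<omega>\<bar>" using bm_grid_nonneg[OF elim(2), of 0 k] by simp
      qed (rule lipschitz_on_nonneg[OF L])
      finally show ?case by simp
    qed
  qed
qed

end

section \<open>Transfer to the run counts\<close>

lemma nat_floor_third: "nat \<lfloor>real n / 3\<rfloor> = n div 3"
  using floor_divide_of_nat_eq[of n 3, where ?'a=real] by simp

lemma X1_max_eq_walk_max:
  assumes "\<sigma> permutes {1..n}" "1 \<le> n"
  shows "real n powr (- 1/3) * real_of_int (X1_max n \<sigma> - X1 n \<sigma> (nat \<lfloor>real n / 3\<rfloor>)) = walk_max n \<sigma>"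
proof -
  let ?s = "real n powr (- 1/3)"
  let ?g = "\<lambda>z :: int. ?s * (real_of_int z - run_count n \<sigma> (n div 3))"
  have X: "real_of_int (X1 n \<sigma> m) = run_count n \<sigma> m" for m
    using X1_eq_runs[OF assms] by (simp add: run_count_def)
  have "mono ?g" by (intro monoI mult_left_mono) auto
  then have "?g (X1_max n \<sigma>) = Max (?g ` (X1 n \<sigma> ` {0..n}))"
    unfolding X1_max_def by (intro mono_Max_commute) auto
  also have "\<dots> = walk_max n \<sigma>"
    unfolding walk_max_def image_image scaled_excess_def X by simp
  finally show ?thesis by (simp add: nat_floor_third X)
qed

lemma cts_step_lipschitz:
  assumes "a < b" shows "(1 / (b - a))-lipschitz_on UNIV (cts_step a b)"
proof (rule lipschitz_onI)
  have c: "cts_step a b x = max 0 (min 1 ((b - x) / (b - a)))" for x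
    using assms by (auto simp: cts_step_def max_def min_def field_simps)
  fix x y
  have "\<bar>(b - x) / (b - a) - (b - y) / (b - a)\<bar> = \<bar>x - y\<bar> / (b - a)"
    using assms by (simp add: diff_divide_distrib[symmetric] abs_divide abs_minus_commute)
  then show "dist (cts_step a b x) (cts_step a b y) \<le> 1 / (b - a) * dist x y"
    unfolding c dist_real_def by (auto simp: max_def min_def)
qed (use assms in simp)

context
  fixes M :: "'a measure" and B :: "real \<Rightarrow> 'a \<Rightarrow> real"
  assumes BM: "two_sided_BM M B"
begin

text \<open>Two limits in order: a level \<open>k\<close> is fixed at which both the error of
  \<open>window_approx\<close> and the distance of the grid maximum from
  \<open>\<beta> * V B\<close> are small, and then \<open>n\<close> tends to infinity on that
  grid.\<close>

lemma walk_max_tendsto: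
  fixes f :: "real \<Rightarrow> real"
  assumes L: "L-lipschitz_on UNIV f"
  shows "(\<lambda>n. EE n (\<lambda>\<sigma>. f (walk_max n \<sigma>))) \<longlonglongrightarrow> (\<integral>\<omega>. f (\<beta> * V B \<omega>) \<partial>M)"
proof (rule LIMSEQ_I)
  fix \<eta> :: real assume \<eta>: "0 < \<eta>"
  have L0: "0 \<le> L" by (rule lipschitz_on_nonneg[OF L])
  define \<epsilon> where "\<epsilon> = \<eta> / (4 * (L + 1))"
  have \<epsilon>: "0 < \<epsilon>" "L * \<epsilon> < \<eta> / 2"
  proof -
    show e: "0 < \<epsilon>" using \<eta> L0 by (simp add: \<epsilon>_def)
    have "L * \<epsilon> \<le> (L + 1) * \<epsilon>" using e by (intro mult_right_mono) auto
    also have "\<dots> = \<eta> / 4" using L0 by (simp add: \<epsilon>_def field_simps)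
    finally show "L * \<epsilon> < \<eta> / 2" using \<eta> by simp
  qed
  let ?K = "\<lambda>k. level_size k" and ?d = "\<lambda>k :: nat. 1 / 2 ^ k :: real"
  \<comment> \<open>The limiting error of \<open>window_approx\<close> at level \<open>k\<close>. In
    Brownian time the half width is \<open>k + 1\<close> and the mesh \<open>2^-k\<close>, so the
    oscillation and drift terms are constants times \<open>(k + 1) / 2^k\<close>.\<close>
  define c where "c = (\<lambda>k. 1724800 / (\<alpha> * (real (?K k) * ?d k)) + \<epsilon> + 2 * real (?K k) * 4644864 * (\<alpha> * ?d k)\<^sup>2 / \<epsilon>^3
      + 2 * (\<alpha> * ?d k) * (\<alpha> * (real (?K k) * ?d k)))"
  have Kd: "real (?K k) * ?d k = real (Suc k)" for k unfolding level_size_def by (simp only: of_nat_mult of_nat_power) simp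
  have half: "(\<lambda>k. real (Suc k) * ?d k) \<longlonglongrightarrow> 0"
  proof -
    have "(\<lambda>k. real (Suc k) * (1/2) ^ k) \<longlonglongrightarrow> 0"
      using summable_LIMSEQ_zero[OF geometric_deriv_sums[of "1/2 :: real", THEN sums_summable]] by simp
    then show ?thesis by (simp add: power_one_over)
  qed
  have c_eq: "c = (\<lambda>k. (1724800 / \<alpha>) * (1 / real (Suc k)) + \<epsilon> + (2 * 4644864 * \<alpha>\<^sup>2 / \<epsilon>^3) * (real (Suc k) * ?d k)
      + (2 * \<alpha>\<^sup>2) * (real (Suc k) * ?d k))"
  proof
    fix k
    have "2 * real (?K k) * 4644864 * (\<alpha> * ?d k)\<^sup>2 / \<epsilon>^3 = (2 * 4644864 * \<alpha>\<^sup>2 / \<epsilon>^3) * ((real (?K k) * ?d k) * ?d k)"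
      by (simp add: power2_eq_square mult_ac)
    then show "c k = (1724800 / \<alpha>) * (1 / real (Suc k)) + \<epsilon> + (2 * 4644864 * \<alpha>\<^sup>2 / \<epsilon>^3) * (real (Suc k) * ?d k)
      + (2 * \<alpha>\<^sup>2) * (real (Suc k) * ?d k)"
      unfolding c_def Kd by (simp add: power2_eq_square)
  qed
  have "c \<longlonglongrightarrow> (1724800 / \<alpha>) * 0 + \<epsilon> + (2 * 4644864 * \<alpha>\<^sup>2 / \<epsilon>^3) * 0 + (2 * \<alpha>\<^sup>2) * 0"
    unfolding c_eq by (intro tendsto_intros half LIMSEQ_Suc[OF lim_const_over_n])
  then have "(\<lambda>k. L * c k) \<longlonglongrightarrow> L * \<epsilon>" by (intro tendsto_mult_left) simp
  then have 1: "eventually (\<lambda>k. L * c k < \<eta> / 2) sequentially"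
    by (rule order_tendstoD(2)) (rule \<epsilon>(2))
  have 2: "eventually (\<lambda>k. \<bar>(\<integral>\<omega>. f (bm_grid B 0 k \<omega>) \<partial>M) - (\<integral>\<omega>. f (\<beta> * V B \<omega>) \<partial>M)\<bar> < \<eta> / 4) sequentially"
    using tendstoD[OF bm_grid_tendsto_V[OF BM L], of "\<eta> / 4"] \<eta> by (simp add: dist_real_def)
  obtain k where k: "L * c k < \<eta> / 2" "\<bar>(\<integral>\<omega>. f (bm_grid B 0 k \<omega>) \<partial>M) - (\<integral>\<omega>. f (\<beta> * V B \<omega>) \<partial>M)\<bar> < \<eta> / 4"
    using eventually_happens'[OF _ eventually_conj[OF 1 2]] by auto
  have dk: "0 < ?d k" by simp
  obtain E where E: "E \<longlonglongrightarrow> c k" "eventually (\<lambda>n. (\<forall>\<sigma>. grid_walk_max 0 (?K k) (?d k) n \<sigma> \<le> walk_max n \<sigma>) \<and>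
      EE n (\<lambda>\<sigma>. walk_max n \<sigma> - grid_walk_max 0 (?K k) (?d k) n \<sigma>) \<le> E n) sequentially"
    using window_approx[OF dk level_size_pos[of k] \<epsilon>(1)] unfolding c_def by blast
  have "(\<lambda>n. L * E n) \<longlonglongrightarrow> L * c k" by (intro tendsto_mult_left E)
  then have 3: "eventually (\<lambda>n. L * E n < \<eta> / 2) sequentially"
    by (rule order_tendstoD(2)) (rule k(1))
  have 4: "eventually (\<lambda>n. \<bar>EE n (\<lambda>\<sigma>. f (grid_walk_max 0 (?K k) (?d k) n \<sigma>)) - (\<integral>\<omega>. f (bm_grid B 0 k \<omega>) \<partial>M)\<bar> < \<eta> / 4) sequentially"
    using tendstoD[OF grid_walk_tendsto_bm_grid[OF BM L, of 0 k], of "\<eta> / 4"] \<eta> by (simp add: dist_real_def)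
  have "eventually (\<lambda>n. norm (EE n (\<lambda>\<sigma>. f (walk_max n \<sigma>)) - (\<integral>\<omega>. f (\<beta> * V B \<omega>) \<partial>M)) < \<eta>) sequentially"
    using E(2) 3 4
  proof eventually_elim
    case (elim n)
    let ?G = "grid_walk_max 0 (?K k) (?d k) n"
    have "\<bar>EE n (\<lambda>\<sigma>. f (walk_max n \<sigma>)) - EE n (\<lambda>\<sigma>. f (?G \<sigma>))\<bar> = \<bar>EE n (\<lambda>\<sigma>. f (walk_max n \<sigma>) - f (?G \<sigma>))\<bar>"
      by (simp add: EE_diff)
    also have "\<dots> \<le> EE n (\<lambda>\<sigma>. \<bar>f (walk_max n \<sigma>) - f (?G \<sigma>)\<bar>)" by (rule EE_abs)
    also have "\<dots> \<le> EE n (\<lambda>\<sigma>. L * (walk_max n \<sigma> - ?G \<sigma>))"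
    proof (rule EE_mono)
      fix \<sigma>
      have "?G \<sigma> \<le> walk_max n \<sigma>" using elim(1) by blast
      then show "\<bar>f (walk_max n \<sigma>) - f (?G \<sigma>)\<bar> \<le> L * (walk_max n \<sigma> - ?G \<sigma>)"
        using lipschitz_onD[OF L, of "walk_max n \<sigma>" "?G \<sigma>"] by (simp add: dist_real_def)
    qed
    also have "\<dots> = L * EE n (\<lambda>\<sigma>. walk_max n \<sigma> - ?G \<sigma>)" by (rule EE_cmult)
    also have "\<dots> \<le> L * E n" using elim(1) L0 by (intro mult_left_mono) auto
    finally have "\<bar>EE n (\<lambda>\<sigma>. f (walk_max n \<sigma>)) - EE n (\<lambda>\<sigma>. f (?G \<sigma>))\<bar> < \<eta> / 2" using elim(2) by linarith
    then show ?case unfolding real_norm_def using elim(3) k(2) by linarith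
  qed
  then show "\<exists>no. \<forall>n\<ge>no. norm (EE n (\<lambda>\<sigma>. f (walk_max n \<sigma>)) - (\<integral>\<omega>. f (\<beta> * V B \<omega>) \<partial>M)) < \<eta>"
    by (simp add: eventually_sequentially)
qed

text \<open>Continuous ramps from 1 to 0 determine convergence in distribution, and they are
  Lipschitz.\<close>

lemma walk_max_weak_conv:
  "weak_conv_m
     (\<lambda>n. distr (measure_pmf (uniform_perm n)) borel
        (\<lambda>\<sigma>. real n powr (- 1/3) * real_of_int (X1_max n \<sigma> - X1 n \<sigma> (nat \<lfloor>real n / 3\<rfloor>))))
     (distr M borel (\<lambda>\<omega>. \<beta> * V B \<omega>))"
proof -
  interpret prob_space M by (rule BM_prob_space[OF BM])
  let ?W = "\<lambda>n \<sigma>. real n powr (- 1/3) * real_of_int (X1_max n \<sigma> - X1 n \<sigma> (nat \<lfloor>real n / 3\<rfloor>))"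
  let ?D = "\<lambda>n. distr (measure_pmf (uniform_perm n)) borel (?W n)"
  have Vm: "(\<lambda>\<omega>. \<beta> * V B \<omega>) \<in> borel_measurable M" using V_measurable[OF BM] by measurable
  have D: "real_distribution (?D n)" for n
    unfolding real_distribution_def real_distribution_axioms_def
    by (auto intro!: prob_space.prob_space_distr measure_pmf.prob_space_axioms)
  have D': "real_distribution (distr M borel (\<lambda>\<omega>. \<beta> * V B \<omega>))"
    unfolding real_distribution_def real_distribution_axioms_def
    using prob_space_distr[OF Vm] by auto
  show ?thesis
  proof (rule integral_cts_step_conv_imp_weak_conv[OF D D'])
    fix x y :: real assume xy: "x < y"
    note L = cts_step_lipschitz[OF xy]
    have cm: "cts_step x y \<in> borel_measurable borel"
      by (intro borel_measurable_continuous_onI lipschitz_on_continuous_on[OF L])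
    have "(\<integral>z. cts_step x y z \<partial>?D n) = EE n (\<lambda>\<sigma>. cts_step x y (?W n \<sigma>))" for n
      by (subst integral_distr[OF _ cm]) (auto simp: expectation_uniform_perm)
    moreover have "EE n (\<lambda>\<sigma>. cts_step x y (?W n \<sigma>)) = EE n (\<lambda>\<sigma>. cts_step x y (walk_max n \<sigma>))" if "1 \<le> n" for n
      by (rule EE_cong) (simp only: X1_max_eq_walk_max[OF _ that])
    ultimately have "eventually (\<lambda>n. EE n (\<lambda>\<sigma>. cts_step x y (walk_max n \<sigma>)) = (\<integral>z. cts_step x y z \<partial>?D n)) sequentially"
      by (intro eventually_sequentiallyI[of 1]) simp
    with walk_max_tendsto[OF L]
    have "(\<lambda>n. \<integral>z. cts_step x y z \<partial>?D n) \<longlonglongrightarrow> (\<integral>\<omega>. cts_step x y (\<beta> * V B \<omega>) \<partial>M)"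
      by (rule Lim_transform_eventually)
    then show "(\<lambda>n. \<integral>z. cts_step x y z \<partial>?D n) \<longlonglongrightarrow> (\<integral>z. cts_step x y z \<partial>distr M borel (\<lambda>\<omega>. \<beta> * V B \<omega>))"
      by (subst integral_distr[OF Vm cm])
  qed
qed

text \<open>The identity is Lipschitz, so \<open>walk_max_tendsto\<close> also gives the limit of
  the means.\<close>

lemma expectation_X1_max_asymptotics:
  "(\<lambda>n. measure_pmf.expectation (uniform_perm n) (\<lambda>\<sigma>. real_of_int (X1_max n \<sigma>))
      - (measure_pmf.expectation (uniform_perm n) (\<lambda>\<sigma>. real_of_int (X1 n \<sigma> (nat \<lfloor>real n / 3\<rfloor>)))
         + \<beta> * (\<integral>\<omega>. V B \<omega> \<partial>M) * real n powr (1/3)))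
   \<in> o(\<lambda>n. real n powr (1/3))"
proof (rule smalloI_tendsto)
  show "eventually (\<lambda>n. real n powr (1/3) \<noteq> 0) sequentially"
    using eventually_gt_at_top[of 0] by eventually_elim simp
  have "1-lipschitz_on UNIV (\<lambda>x::real. x)" by (rule lipschitz_onI) auto
  from walk_max_tendsto[OF this] have "(\<lambda>n. EE n (walk_max n)) \<longlonglongrightarrow> \<beta> * (\<integral>\<omega>. V B \<omega> \<partial>M)" by simp
  then have "(\<lambda>n. EE n (walk_max n) - \<beta> * (\<integral>\<omega>. V B \<omega> \<partial>M)) \<longlonglongrightarrow> 0" by (rule LIM_zero)
  then show "(\<lambda>n. (measure_pmf.expectation (uniform_perm n) (\<lambda>\<sigma>. real_of_int (X1_max n \<sigma>))
      - (measure_pmf.expectation (uniform_perm n) (\<lambda>\<sigma>. real_of_int (X1 n \<sigma> (nat \<lfloor>real n / 3\<rfloor>)))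
         + \<beta> * (\<integral>\<omega>. V B \<omega> \<partial>M) * real n powr (1/3))) / real n powr (1/3)) \<longlonglongrightarrow> 0"
  proof (rule Lim_transform_eventually)
    show "eventually (\<lambda>n. EE n (walk_max n) - \<beta> * (\<integral>\<omega>. V B \<omega> \<partial>M)
       = (measure_pmf.expectation (uniform_perm n) (\<lambda>\<sigma>. real_of_int (X1_max n \<sigma>))
      - (measure_pmf.expectation (uniform_perm n) (\<lambda>\<sigma>. real_of_int (X1 n \<sigma> (nat \<lfloor>real n / 3\<rfloor>)))
         + \<beta> * (\<integral>\<omega>. V B \<omega> \<partial>M) * real n powr (1/3))) / real n powr (1/3)) sequentially"
      using eventually_ge_at_top[of 1]
    proof eventually_elim
      case (elim n)
      let ?a = "EE n (\<lambda>\<sigma>. real_of_int (X1_max n \<sigma>))" and ?b = "EE n (\<lambda>\<sigma>. real_of_int (X1 n \<sigma> (nat \<lfloor>real n / 3\<rfloor>)))"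
      have p: "0 < real n powr (1/3)" "real n powr (- 1/3) = 1 / real n powr (1/3)"
        using elim by (auto simp: powr_minus_divide)
      have "EE n (walk_max n) = EE n (\<lambda>\<sigma>. real n powr (- 1/3) * real_of_int (X1_max n \<sigma> - X1 n \<sigma> (nat \<lfloor>real n / 3\<rfloor>)))"
        by (rule EE_cong) (simp only: X1_max_eq_walk_max[OF _ elim])
      also have "\<dots> = (?a - ?b) / real n powr (1/3)"
        unfolding EE_cmult p(2) by (simp add: EE_diff)
      finally show ?case
        unfolding expectation_uniform_perm using p(1) by (simp add: field_simps)
    qed
  qed
qed

end

text \<open>The exact mean \<open>run_mean n (n div 3)\<close> differs from
  \<open>4 / 27 * n\<close> by at most 7.\<close>

lemma expectation_X1_third:
  "(\<lambda>n. measure_pmf.expectation (uniform_perm n) (\<lambda>\<sigma>. real_of_int (X1 n \<sigma> (nat \<lfloor>real n / 3\<rfloor>))) - 4 / 27 * real n)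
    \<in> o(\<lambda>n. real n powr (1/3))"
proof (rule smalloI_tendsto)
  show "eventually (\<lambda>n. real n powr (1/3) \<noteq> 0) sequentially"
    using eventually_gt_at_top[of 0] by eventually_elim simp
  have lim: "(\<lambda>n. 7 * real n powr (- 1/3)) \<longlonglongrightarrow> 0"
    using tendsto_mult_left[OF powr_third_tendsto_0, of 7] by simp
  show "(\<lambda>n. (measure_pmf.expectation (uniform_perm n) (\<lambda>\<sigma>. real_of_int (X1 n \<sigma> (nat \<lfloor>real n / 3\<rfloor>))) - 4 / 27 * real n)
      / real n powr (1/3)) \<longlonglongrightarrow> 0"
  proof (rule Lim_null_comparison[OF _ lim])
    show "eventually (\<lambda>n. norm ((measure_pmf.expectation (uniform_perm n) (\<lambda>\<sigma>. real_of_int (X1 n \<sigma> (nat \<lfloor>real n / 3\<rfloor>))) - 4 / 27 * real n)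
      / real n powr (1/3)) \<le> 7 * real n powr (- 1/3)) sequentially"
      using eventually_ge_at_top[of 30]
    proof eventually_elim
      case (elim n)
      have "EE n (\<lambda>\<sigma>. real_of_int (X1 n \<sigma> (nat \<lfloor>real n / 3\<rfloor>))) = EE n (\<lambda>\<sigma>. run_count n \<sigma> (n div 3))"
        unfolding nat_floor_third using elim by (intro EE_cong) (simp add: X1_eq_runs run_count_def)
      also have "\<dots> = run_mean n (n div 3)" using elim by (intro EE_run_count) auto
      finally have e: "EE n (\<lambda>\<sigma>. real_of_int (X1 n \<sigma> (nat \<lfloor>real n / 3\<rfloor>))) = run_mean n (n div 3)" .
      have "\<bar>run_mean n (n div 3) - 4 / 27 * real n\<bar> / real n powr (1/3) \<le> 7 / real n powr (1/3)"
        using run_mean_diff(3)[OF elim order_refl] by (intro divide_right_mono) auto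
      then show ?case
        unfolding expectation_uniform_perm e using elim by (simp add: powr_minus_divide abs_divide)
    qed
  qed
qed

theorem theorem7p5:
  fixes M :: "'a measure" and B :: "real \<Rightarrow> 'a \<Rightarrow> real"
  assumes "two_sided_BM M B"
  shows
    "(AE \<omega> in M. \<exists>t. (\<forall>s. B s \<omega> - s\<^sup>2 / 2 \<le> B t \<omega> - t\<^sup>2 / 2) \<and> V B \<omega> = B t \<omega> - t\<^sup>2 / 2) \<and>
     integrable M (V B) \<and>
     \<beta> = 4 / 27 * 150 powr (1/3) \<and>
     weak_conv_m
       (\<lambda>n. distr (measure_pmf (uniform_perm n)) borel
          (\<lambda>\<sigma>. real n powr (- 1/3) * real_of_int (X1_max n \<sigma> - X1 n \<sigma> (nat \<lfloor>real n / 3\<rfloor>))))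
       (distr M borel (\<lambda>\<omega>. \<beta> * V B \<omega>)) \<and>
     (\<lambda>n. measure_pmf.expectation (uniform_perm n) (\<lambda>\<sigma>. real_of_int (X1_max n \<sigma>))
          - (measure_pmf.expectation (uniform_perm n) (\<lambda>\<sigma>. real_of_int (X1 n \<sigma> (nat \<lfloor>real n / 3\<rfloor>)))
             + \<beta> * (\<integral>\<omega>. V B \<omega> \<partial>M) * real n powr (1/3)))
       \<in> o(\<lambda>n. real n powr (1/3)) \<and>
     (\<lambda>n. measure_pmf.expectation (uniform_perm n) (\<lambda>\<sigma>. real_of_int (X1_max n \<sigma>))
          - (4 / 27 * real n + \<beta> * (\<integral>\<omega>. V B \<omega> \<partial>M) * real n powr (1/3)))
       \<in> o(\<lambda>n. real n powr (1/3))"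
proof (intro conjI)
  show "(\<lambda>n. measure_pmf.expectation (uniform_perm n) (\<lambda>\<sigma>. real_of_int (X1_max n \<sigma>))
          - (4 / 27 * real n + \<beta> * (\<integral>\<omega>. V B \<omega> \<partial>M) * real n powr (1/3)))
       \<in> o(\<lambda>n. real n powr (1/3))"
    using sum_in_smallo(1)[OF expectation_X1_max_asymptotics[OF assms] expectation_X1_third]
    by (simp add: algebra_simps)
qed (rule V_attained[OF assms] V_integrable[OF assms] \<beta>_alt walk_max_weak_conv[OF assms]
    expectation_X1_max_asymptotics[OF assms])+

end
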